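(* Let $K$ be a field of characteristic zero and $n\ge1$. (1) Let $\mathcal O\in K^n/\mathbb Z^n$. Every module $M\in\mathrm{GW}(\mathbb I_n,\mathcal O)$ is a unique direct sum of absolutely prime generalized weight $\mathbb I_n$-modules, and this direct sum is $M=\bigoplus_{\mathcal D_{\mathcal O}\subseteq\mathbb D_{\mathcal O}}M_{\mathcal D_{\mathcal O}}$ where $M_{\mathcal D_{\mathcal O}}\in\mathrm{GW}(\mathbb I_n,\mathcal D_{\mathcal O})$. (2) Every generalized weight $\mathbb I_n$-module is a unique sum of absolutely prime (generalized weight) $\mathbb I_n$-modules.
   Context: A nonzero module $M$ over a ring $R$ is absolutely prime if $\mathfrak p=\mathrm{ann}_R(M)$ is a prime ideal of $R$ and $\mathrm{ann}_R(N)=\mathfrak p$ for all nonzero subfactors $N=M_2/M_1$ of $M$ ($M_1\subset M_2\subseteq M$ submodules). $\otimes=\otimes_K$. $P_n=K[x_1,\dots,x_n]$. $\mathbb I_n$ is the $K$-subalgebra of $\mathrm{End}_K(P_n)$ generated by the multiplications by $x_i$, the partial derivatives $\partial_i$, and the integrations $\int_i$ ($K$-linear, $x^\alpha\mapsto x_ix^\alpha/(\alpha_i+1)$), $i=1,\dots,n$; $\mathbb I_n=\mathbb I_1(1)\otimes\cdots\otimes\mathbb I_1(n)$ with $\mathbb I_1(i)=K\langle x_i,\partial_i,\int_i\rangle\simeq\mathbb I_1$. $H_i=\partial_ix_i$ and $D_n=K[H_1,\dots,H_n]\subset\mathbb I_n$ is a polynomial algebra. For $\lambda\in K^n$, $\mathfrak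 m_\lambda=(H_1-\lambda_1,\dots,H_n-\lambda_n)\subset D_n$. For a left $\mathbb I_n$-module $M$, $M^\lambda=\{v:\mathfrak m_\lambda^iv=0\text{ for some }i\}$; $M$ is generalized weight if $M=\bigoplus_{\lambda\in K^n}M^\lambda$, and $\mathrm{Supp}(M)=\{\lambda:M^\lambda\neq0\}$. $\mathbb Z^n$ acts on $K^n$ by translations; an orbit $\mathcal O=\lambda+\mathbb Z^n$ is a product $\mathcal O_1\times\cdots\times\mathcal O_n$ with $\mathcal O_i\in K/\mathbb Z$. $\mathrm{GW}(\mathbb I_n,\mathcal O)$ is the full subcategory of $\mathbb I_n$-modules that are generalized weight with $\mathrm{Supp}(M)\subseteq\mathcal O$. $\mathbb D_{\mathcal O}=\{i:\mathcal O_i=\mathbb Z\}$. $\mathbb I_1$ (with $x,\partial,\int,H$) has a unique proper nonzero ideal $F$, spanned by $\int^s\partial^t-\int^{s+1}\partial^{t+1}$ ($s,t\geq0$); $B_1=\mathbb I_1/F$ is the skew Laurent polynomial algebra $K[H][\partial^{\pm1}]$ with $\partial H=(H+1)\partial$, $\int\mapsto\partial^{-1}$. For $\lambda\in K$, $M(1,\lambda)=B_1/B_1(H-\lambda)$. Choose $\lambda_{\mathcal O_i}\in\mathcal O_i$ (with $\lambda_{\mathbb Z}=0$). For a subset $\mathcal D_{\mathcal O}\subseteq\mathbb D_{\mathcal O}$ let $M(\mathcal D_{\mathcal O})=\bigotimes_{i=1}^nM_i$ with $M_i=K[x_i]$ if $i\in\mathcal D_{\mathcal O}$ and $M_i=M(1,\lambda_{\mathcal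 O_i})$ otherwise; it is a simple weight $\mathbb I_n$-module. $\mathrm{GW}(\mathbb I_n,\mathcal D_{\mathcal O})$ is the full subcategory of $\mathrm{GW}(\mathbb I_n,\mathcal O)$ generated by $M(\mathcal D_{\mathcal O})$, i.e. consisting of the modules all of whose simple subquotients are isomorphic to $M(\mathcal D_{\mathcal O})$.
   Formalization: "Unique" is taken among direct sums of absolutely prime generalized weight modules with pairwise distinct annihilators (summands from different orbits may merge in (2)); without this it fails, as K[x]⊕K[x] is absolutely prime and also splits. *)

theory Defs
  imports
    "HOL-Library.Poly_Mapping"
    "HOL-Algebra.QuotRing"
    "HOL-Algebra.Ideal_Product"
    "HOL-Algebra.Generated_Rings"
    "HOL-Algebra.Module"
begin

section \<open>Left modules over a not necessarily commutative ring\<close>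

text \<open>
  The library locale \<open>module\<close> requires a commutative ring of scalars. The record type
  \<open>module\<close> is reused here; as in the library, its fields \<open>mult\<close> and \<open>one\<close> carry no meaning for
  a module. The library locale \<open>submodule\<close> does not depend on commutativity and is used as it is.
\<close>

locale left_module = R?: ring R + M?: abelian_group M
  for R :: "('r, 'x) ring_scheme" (structure) and M :: "('r, 'm) module" (structure) +
  assumes smult_closed:
      "\<lbrakk>a \<in> carrier R; x \<in> carrier M\<rbrakk> \<Longrightarrow> a \<odot>\<^bsub>M\<^esub> x \<in> carrier M"
    and smult_l_distr:
      "\<lbrakk>a \<in> carrier R; b \<in> carrier R; x \<in> carrier M\<rbrakk> \<Longrightarrow>
        (a \<oplus> b) \<odot>\<^bsub>M\<^esub> x = a \<odot>\<^bsub>M\<^esub> x \<oplus>\<^bsub>M\<^esub> b \<odot>\<^bsub>M\<^esub> x"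
    and smult_r_distr:
      "\<lbrakk>a \<in> carrier R; x \<in> carrier M; y \<in> carrier M\<rbrakk> \<Longrightarrow>
        a \<odot>\<^bsub>M\<^esub> (x \<oplus>\<^bsub>M\<^esub> y) = a \<odot>\<^bsub>M\<^esub> x \<oplus>\<^bsub>M\<^esub> a \<odot>\<^bsub>M\<^esub> y"
    and smult_assoc1:
      "\<lbrakk>a \<in> carrier R; b \<in> carrier R; x \<in> carrier M\<rbrakk> \<Longrightarrow>
        (a \<otimes> b) \<odot>\<^bsub>M\<^esub> x = a \<odot>\<^bsub>M\<^esub> (b \<odot>\<^bsub>M\<^esub> x)"
    and smult_one: "x \<in> carrier M \<Longrightarrow> \<one> \<odot>\<^bsub>M\<^esub> x = x"

abbreviation sub_module :: "('r, 'm) module \<Rightarrow> 'm set \<Rightarrow> ('r, 'm) module" where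
  "sub_module M N \<equiv> M\<lparr>carrier := N\<rparr>"

definition quot_module :: "('r, 'm) module \<Rightarrow> 'm set \<Rightarrow> ('r, 'm set) module" where
  "quot_module M N =
    \<lparr>carrier = a_rcosets\<^bsub>M\<^esub> N, mult = undefined, one = undefined, zero = N,
     add = set_add M, smult = (\<lambda>a X. \<Union>x\<in>X. N +>\<^bsub>M\<^esub> (a \<odot>\<^bsub>M\<^esub> x))\<rparr>"

definition module_isomorphic ::
  "('r, 'x) ring_scheme \<Rightarrow> ('r, 'm) module \<Rightarrow> ('r, 'n) module \<Rightarrow> bool" where
  "module_isomorphic R M N \<longleftrightarrow>
    (\<exists>f. bij_betw f (carrier M) (carrier N) \<and>
         (\<forall>x\<in>carrier M. \<forall>y\<in>carrier M. f (x \<oplus>\<^bsub>M\<^esub> y) = f x \<oplus>\<^bsub>N\<^esub> f y) \<and>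
         (\<forall>a\<in>carrier R. \<forall>x\<in>carrier M. f (a \<odot>\<^bsub>M\<^esub> x) = a \<odot>\<^bsub>N\<^esub> f x))"

definition simple_module :: "('r, 'x) ring_scheme \<Rightarrow> ('r, 'm) module \<Rightarrow> bool" where
  "simple_module R M \<longleftrightarrow>
    left_module R M \<and> carrier M \<noteq> {\<zero>\<^bsub>M\<^esub>} \<and>
    (\<forall>N. submodule N R M \<longrightarrow> N = {\<zero>\<^bsub>M\<^esub>} \<or> N = carrier M)"

definition ann :: "('r, 'x) ring_scheme \<Rightarrow> ('r, 'm) module \<Rightarrow> 'r set" where
  "ann R M = {a \<in> carrier R. \<forall>x\<in>carrier M. a \<odot>\<^bsub>M\<^esub> x = \<zero>\<^bsub>M\<^esub>}"

text \<open>
  The usual notion for noncommutative rings, in terms of products of two-sided ideals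
  (the library's \<open>primeideal\<close> is the elementwise notion for commutative rings).
\<close>

definition prime_ideal :: "('r, 'x) ring_scheme \<Rightarrow> 'r set \<Rightarrow> bool" where
  "prime_ideal R P \<longleftrightarrow>
    ideal P R \<and> P \<noteq> carrier R \<and>
    (\<forall>I J. ideal I R \<longrightarrow> ideal J R \<longrightarrow> I \<cdot>\<^bsub>R\<^esub> J \<subseteq> P \<longrightarrow> I \<subseteq> P \<or> J \<subseteq> P)"

definition absolutely_prime :: "('r, 'x) ring_scheme \<Rightarrow> ('r, 'm) module \<Rightarrow> bool" where
  "absolutely_prime R M \<longleftrightarrow>
    left_module R M \<and> carrier M \<noteq> {\<zero>\<^bsub>M\<^esub>} \<and> prime_ideal R (ann R M) \<and>
    (\<forall>M1 M2. submodule M1 R M \<longrightarrow> submodule M2 R M \<longrightarrow> M1 \<subset> M2 \<longrightarrow>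
       ann R (quot_module (sub_module M M2) M1) = ann R M)"

definition internal_direct_sum ::
  "('r, 'm) module \<Rightarrow> 'i set \<Rightarrow> ('i \<Rightarrow> 'm set) \<Rightarrow> bool" where
  "internal_direct_sum M I A \<longleftrightarrow>
    (\<forall>i\<in>I. subgroup (A i) (add_monoid M)) \<and>
    (\<forall>m\<in>carrier M. \<exists>!f. f \<in> (\<Pi>\<^sub>E i\<in>I. A i) \<and> finite {i \<in> I. f i \<noteq> \<zero>\<^bsub>M\<^esub>} \<and>
       m = (\<Oplus>\<^bsub>M\<^esub>i\<in>{i \<in> I. f i \<noteq> \<zero>\<^bsub>M\<^esub>}. f i))"

definition transport_module :: "('m \<Rightarrow> 'p) \<Rightarrow> ('r, 'm) module \<Rightarrow> ('r, 'p) module" where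
  "transport_module f M =
    \<lparr>carrier = f ` carrier M, mult = undefined, one = undefined, zero = f \<zero>\<^bsub>M\<^esub>,
     add = (\<lambda>x y. f (inv_into (carrier M) f x \<oplus>\<^bsub>M\<^esub> inv_into (carrier M) f y)),
     smult = (\<lambda>a x. f (a \<odot>\<^bsub>M\<^esub> inv_into (carrier M) f x))\<rparr>"


section \<open>The algebra of polynomial integro-differential operators\<close>

text \<open>
  The finite type \<open>'n\<close> indexes the variables, so \<open>n = CARD('n) \<ge> 1\<close>, and the type \<open>'k\<close> is the
  field \<open>K\<close>. A polynomial is a finitely supported map from exponent vectors to coefficients.
\<close>

type_synonym ('k, 'n) pol = "('n \<Rightarrow>\<^sub>0 nat) \<Rightarrow>\<^sub>0 'k"
type_synonym ('k, 'n) endo = "('k, 'n) pol \<Rightarrow> ('k, 'n) pol"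

definition pscale :: "'k::field_char_0 \<Rightarrow> ('a \<Rightarrow>\<^sub>0 'k) \<Rightarrow> 'a \<Rightarrow>\<^sub>0 'k" where
  "pscale c p = Poly_Mapping.map ((*) c) p"

definition End_P :: "('k::field_char_0, 'n) endo ring" where
  "End_P = \<lparr>carrier = {f. Vector_Spaces.linear pscale pscale f}, mult = (\<circ>), one = id,
            zero = (\<lambda>p. 0), add = (\<lambda>f g p. f p + g p)\<rparr>"

definition op_X :: "'n \<Rightarrow> ('k::field_char_0, 'n) endo" where
  "op_X i p = Poly_Mapping.single (Poly_Mapping.single i 1) 1 * p"

definition op_D :: "'n \<Rightarrow> ('k::field_char_0, 'n) endo" where
  "op_D i p = (\<Sum>\<alpha>\<in>Poly_Mapping.keys p.
     Poly_Mapping.single (\<alpha> - Poly_Mapping.single i 1)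
       (of_nat (Poly_Mapping.lookup \<alpha> i) * Poly_Mapping.lookup p \<alpha>))"

definition op_J :: "'n \<Rightarrow> ('k::field_char_0, 'n) endo" where
  "op_J i p = (\<Sum>\<alpha>\<in>Poly_Mapping.keys p.
     Poly_Mapping.single (\<alpha> + Poly_Mapping.single i 1)
       (Poly_Mapping.lookup p \<alpha> / of_nat (Poly_Mapping.lookup \<alpha> i + 1)))"

definition op_H :: "'n \<Rightarrow> ('k::field_char_0, 'n) endo" where
  "op_H i = op_D i \<circ> op_X i"

definition gen_algebra :: "('k::field_char_0, 'n) endo set \<Rightarrow> ('k, 'n) endo ring" where
  "gen_algebra G = End_P\<lparr>carrier := generate_ring End_P (Set.range pscale \<union> G)\<rparr>"

definition I_n :: "('k::field_char_0, 'n) endo ring" where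
  "I_n = gen_algebra (Set.range op_X \<union> Set.range op_D \<union> Set.range op_J)"

definition I_1 :: "'n \<Rightarrow> ('k::field_char_0, 'n) endo ring" where
  "I_1 i = gen_algebra {op_X i, op_D i, op_J i}"

definition D_n :: "('k::field_char_0, 'n) endo ring" where
  "D_n = gen_algebra (Set.range op_H)"


section \<open>Generalized weight modules\<close>

definition H_minus :: "'n \<Rightarrow> 'k \<Rightarrow> ('k::field_char_0, 'n) endo" where
  "H_minus i c p = op_H i p - pscale c p"

definition max_ideal :: "('n \<Rightarrow> 'k::field_char_0) \<Rightarrow> ('k, 'n) endo set" where
  "max_ideal lam = Idl\<^bsub>D_n\<^esub> (Set.range (\<lambda>i. H_minus i (lam i)))"

definition ideal_power :: "('r, 'x) ring_scheme \<Rightarrow> 'r set \<Rightarrow> nat \<Rightarrow> 'r set" where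
  "ideal_power R I k = ((\<lambda>J. J \<cdot>\<^bsub>R\<^esub> I) ^^ k) (carrier R)"

definition weight_component ::
  "(('k::field_char_0, 'n) endo, 'm) module \<Rightarrow> ('n \<Rightarrow> 'k) \<Rightarrow> 'm set" where
  "weight_component M lam =
    {v \<in> carrier M. \<exists>k. \<forall>a\<in>ideal_power D_n (max_ideal lam) k. a \<odot>\<^bsub>M\<^esub> v = \<zero>\<^bsub>M\<^esub>}"

definition generalized_weight :: "(('k::field_char_0, 'n) endo, 'm) module \<Rightarrow> bool" where
  "generalized_weight M \<longleftrightarrow>
    left_module I_n M \<and> internal_direct_sum M UNIV (weight_component M)"

definition Supp :: "(('k::field_char_0, 'n) endo, 'm) module \<Rightarrow> ('n \<Rightarrow> 'k) set" where
  "Supp M = {lam. weight_component M lam \<noteq> {\<zero>\<^bsub>M\<^esub>}}"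

definition Z_orbit :: "('n \<Rightarrow> 'k::field_char_0) \<Rightarrow> ('n \<Rightarrow> 'k) set" where
  "Z_orbit lam = {\<mu>. \<exists>z :: 'n \<Rightarrow> int. \<forall>i. \<mu> i = lam i + of_int (z i)}"

definition Z_orbits :: "('n \<Rightarrow> 'k::field_char_0) set set" where
  "Z_orbits = Set.range Z_orbit"

definition Z_cosets :: "'k::field_char_0 set set" where
  "Z_cosets = Set.range (\<lambda>c. {c + of_int z | z. True})"

definition orbit_factor :: "('n \<Rightarrow> 'k::field_char_0) set \<Rightarrow> 'n \<Rightarrow> 'k set" where
  "orbit_factor Orb i = (\<lambda>\<mu>. \<mu> i) ` Orb"

definition D_set :: "('n \<Rightarrow> 'k::field_char_0) set \<Rightarrow> 'n set" where
  "D_set Orb = {i. orbit_factor Orb i = \<int>}"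

definition GW ::
  "('n \<Rightarrow> 'k::field_char_0) set \<Rightarrow> (('k, 'n) endo, 'm) module \<Rightarrow> bool" where
  "GW Orb M \<longleftrightarrow> generalized_weight M \<and> Supp M \<subseteq> Orb"


section \<open>The simple modules\<close>

definition poly_module :: "'n \<Rightarrow> (('k::field_char_0, 'n) endo, ('k, 'n) pol) module" where
  "poly_module i =
    \<lparr>carrier = {p. \<forall>\<alpha>\<in>Poly_Mapping.keys p. Poly_Mapping.keys \<alpha> \<subseteq> {i}},
     mult = undefined, one = undefined, zero = 0, add = (+), smult = (\<lambda>a p. a p)\<rparr>"

definition matrix_unit :: "'n \<Rightarrow> nat \<Rightarrow> nat \<Rightarrow> ('k::field_char_0, 'n) endo" where
  "matrix_unit i s t p =
    (op_J i ^^ s) ((op_D i ^^ t) p) - (op_J i ^^ (s + 1)) ((op_D i ^^ (t + 1)) p)"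

definition F_ideal :: "'n \<Rightarrow> ('k::field_char_0, 'n) endo set" where
  "F_ideal i =
    {(\<lambda>p. \<Sum>(s, t)\<in>A. pscale (c s t) (matrix_unit i s t p)) | A c. finite A}"

definition B_1 :: "'n \<Rightarrow> ('k::field_char_0, 'n) endo set ring" where
  "B_1 i = I_1 i Quot F_ideal i"

definition regular_module :: "'r ring \<Rightarrow> ('r, 'r) module" where
  "regular_module R = \<lparr>carrier = carrier R, mult = undefined, one = undefined,
     zero = \<zero>\<^bsub>R\<^esub>, add = add R, smult = mult R\<rparr>"

definition restrict_scalars :: "('r \<Rightarrow> 's) \<Rightarrow> ('s, 'm) module \<Rightarrow> ('r, 'm) module" where
  "restrict_scalars h M = \<lparr>carrier = carrier M, mult = undefined, one = undefined,
     zero = \<zero>\<^bsub>M\<^esub>, add = add M, smult = (\<lambda>a x. h a \<odot>\<^bsub>M\<^esub> x)\<rparr>"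

definition M_1 ::
  "'n \<Rightarrow> 'k \<Rightarrow> (('k::field_char_0, 'n) endo, ('k, 'n) endo set set) module" where
  "M_1 i c =
    restrict_scalars (\<lambda>a. F_ideal i +>\<^bsub>I_1 i\<^esub> a)
      (quot_module (regular_module (B_1 i))
        {b \<otimes>\<^bsub>B_1 i\<^esub> (F_ideal i +>\<^bsub>I_1 i\<^esub> H_minus i c) | b. b \<in> carrier (B_1 i)})"

subsection \<open>Tensor products over the field\<close>

text \<open>
  For a family of left modules over the algebras \<open>I_1 i\<close>, the tensor product over \<open>K\<close> is the free
  vector space on the tuples modulo the multilinear relations. In a factor, \<open>c \<in> K\<close> acts through
  the scalar operator \<open>pscale c \<in> I_1 i\<close>.
\<close>

definition free_module ::
  "('n \<Rightarrow> (('k::field_char_0, 'n) endo, 'y) module) \<Rightarrow> ('k, ('n \<Rightarrow> 'y) \<Rightarrow>\<^sub>0 'k) module" where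
  "free_module Ms =
    \<lparr>carrier = {f. \<forall>v\<in>Poly_Mapping.keys f. \<forall>i. v i \<in> carrier (Ms i)},
     mult = undefined, one = undefined, zero = 0, add = (+), smult = pscale\<rparr>"

inductive_set multilinear_relations ::
  "('n \<Rightarrow> (('k::field_char_0, 'n) endo, 'y) module) \<Rightarrow> (('n \<Rightarrow> 'y) \<Rightarrow>\<^sub>0 'k) set"
  for Ms where
    zero: "0 \<in> multilinear_relations Ms"
  | plus: "\<lbrakk>f \<in> multilinear_relations Ms; g \<in> multilinear_relations Ms\<rbrakk> \<Longrightarrow>
      f + g \<in> multilinear_relations Ms"
  | additive: "\<lbrakk>\<forall>j. v j \<in> carrier (Ms j); x \<in> carrier (Ms i); y \<in> carrier (Ms i)\<rbrakk> \<Longrightarrow>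
      Poly_Mapping.single (v(i := x \<oplus>\<^bsub>Ms i\<^esub> y)) c
        - Poly_Mapping.single (v(i := x)) c - Poly_Mapping.single (v(i := y)) c
      \<in> multilinear_relations Ms"
  | scalar: "\<lbrakk>\<forall>j. v j \<in> carrier (Ms j); x \<in> carrier (Ms i)\<rbrakk> \<Longrightarrow>
      Poly_Mapping.single (v(i := pscale b \<odot>\<^bsub>Ms i\<^esub> x)) c - Poly_Mapping.single (v(i := x)) (c * b)
      \<in> multilinear_relations Ms"

definition tensor_space ::
  "('n \<Rightarrow> (('k::field_char_0, 'n) endo, 'y) module) \<Rightarrow>
    ('k, (('n \<Rightarrow> 'y) \<Rightarrow>\<^sub>0 'k) set) module" where
  "tensor_space Ms = quot_module (free_module Ms) (multilinear_relations Ms)"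

definition pure_tensor ::
  "('n \<Rightarrow> (('k::field_char_0, 'n) endo, 'y) module) \<Rightarrow> ('n \<Rightarrow> 'y) \<Rightarrow>
    (('n \<Rightarrow> 'y) \<Rightarrow>\<^sub>0 'k) set" where
  "pure_tensor Ms v = multilinear_relations Ms +>\<^bsub>free_module Ms\<^esub> Poly_Mapping.single v 1"

definition tensor_with_action ::
  "('n \<Rightarrow> (('k::field_char_0, 'n) endo, 'y) module) \<Rightarrow>
    (('k, 'n) endo \<Rightarrow> (('n \<Rightarrow> 'y) \<Rightarrow>\<^sub>0 'k) set \<Rightarrow> (('n \<Rightarrow> 'y) \<Rightarrow>\<^sub>0 'k) set) \<Rightarrow>
    (('k, 'n) endo, (('n \<Rightarrow> 'y) \<Rightarrow>\<^sub>0 'k) set) module" where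
  "tensor_with_action Ms \<rho> =
    \<lparr>carrier = carrier (tensor_space Ms), mult = undefined, one = undefined,
     zero = \<zero>\<^bsub>tensor_space Ms\<^esub>, add = add (tensor_space Ms), smult = \<rho>\<rparr>"

definition is_tensor_action ::
  "('n \<Rightarrow> (('k::field_char_0, 'n) endo, 'y) module) \<Rightarrow>
    (('k, 'n) endo \<Rightarrow> (('n \<Rightarrow> 'y) \<Rightarrow>\<^sub>0 'k) set \<Rightarrow> (('n \<Rightarrow> 'y) \<Rightarrow>\<^sub>0 'k) set) \<Rightarrow> bool" where
  "is_tensor_action Ms \<rho> \<longleftrightarrow>
    left_module I_n (tensor_with_action Ms \<rho>) \<and>
    (\<forall>i. \<forall>a\<in>carrier (I_1 i). \<forall>v. (\<forall>j. v j \<in> carrier (Ms j)) \<longrightarrow>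
       \<rho> a (pure_tensor Ms v) = pure_tensor Ms (v(i := a \<odot>\<^bsub>Ms i\<^esub> v i)))"

text \<open>
  Since \<open>I_n\<close> is the tensor product of its subalgebras \<open>I_1 i\<close>, there is an action of \<open>I_n\<close> on the
  tensor product in which \<open>I_1 i\<close> acts on the factor \<open>i\<close>. It is unique on the carriers because
  the \<open>I_1 i\<close> generate \<open>I_n\<close>, so the choice below is immaterial.
\<close>

definition tensor_module ::
  "('n \<Rightarrow> (('k::field_char_0, 'n) endo, 'y) module) \<Rightarrow>
    (('k, 'n) endo, (('n \<Rightarrow> 'y) \<Rightarrow>\<^sub>0 'k) set) module" where
  "tensor_module Ms = tensor_with_action Ms (SOME \<rho>. is_tensor_action Ms \<rho>)"

subsection \<open>The modules attached to a set of indices\<close>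

text \<open>
  The two kinds of factors live on different types; \<open>Inl\<close> and \<open>Inr\<close> embed them into a common one.
  The function \<open>rep\<close> chooses a representative of each element of \<open>K/Z\<close>.
\<close>

definition factor ::
  "('k set \<Rightarrow> 'k) \<Rightarrow> ('n \<Rightarrow> 'k) set \<Rightarrow> 'n set \<Rightarrow> 'n \<Rightarrow>
    (('k::field_char_0, 'n) endo, ('k, 'n) pol + ('k, 'n) endo set set) module" where
  "factor rep Orb D i =
    (if i \<in> D then transport_module Inl (poly_module i)
     else transport_module Inr (M_1 i (rep (orbit_factor Orb i))))"

definition M_simple ::
  "('k set \<Rightarrow> 'k) \<Rightarrow> ('n \<Rightarrow> 'k) set \<Rightarrow> 'n set \<Rightarrow>
    (('k::field_char_0, 'n) endo,
     (('n \<Rightarrow> ('k, 'n) pol + ('k, 'n) endo set set) \<Rightarrow>\<^sub>0 'k) set) module" where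
  "M_simple rep Orb D = tensor_module (factor rep Orb D)"

definition GW_D ::
  "('k set \<Rightarrow> 'k) \<Rightarrow> ('n \<Rightarrow> 'k) set \<Rightarrow> 'n set \<Rightarrow>
    (('k::field_char_0, 'n) endo, 'm) module \<Rightarrow> bool" where
  "GW_D rep Orb D M \<longleftrightarrow>
    GW Orb M \<and>
    (\<forall>M1 M2. submodule M1 I_n M \<longrightarrow> submodule M2 I_n M \<longrightarrow> M1 \<subseteq> M2 \<longrightarrow>
       simple_module I_n (quot_module (sub_module M M2) M1) \<longrightarrow>
       module_isomorphic I_n (quot_module (sub_module M M2) M1) (M_simple rep Orb D))"


section \<open>Decompositions into absolutely prime modules\<close>

text \<open>
  Summands with equal annihilators could be merged or, if decomposable, split, so uniqueness only
  makes sense for decompositions whose summands have pairwise distinct annihilators. As absolutely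
  prime modules are nonzero, the summands of a direct sum are distinct and form a set.
\<close>

definition abs_prime_decomposition ::
  "(('k::field_char_0, 'n) endo, 'm) module \<Rightarrow> 'm set set \<Rightarrow> bool" where
  "abs_prime_decomposition M S \<longleftrightarrow>
    (\<forall>N\<in>S. submodule N I_n M \<and> absolutely_prime I_n (sub_module M N) \<and>
            generalized_weight (sub_module M N)) \<and>
    internal_direct_sum M S (\<lambda>N. N) \<and>
    inj_on (\<lambda>N. ann I_n (sub_module M N)) S"

end

theory Submission
  imports Defs "HOL-Computational_Algebra.Polynomial"
begin

text \<open>
  Write \<open>J\<close> for the integration, \<open>\<partial>\<close> for the derivation, so that \<open>\<partial> J = 1\<close>. If \<open>H = \<partial> x\<close> acts locally
  finitely, every vector is uniquely the sum of a vector killed by a power of \<open>\<partial>\<close> and a vector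
  infinitely divisible by \<open>J\<close>. Doing this for all variables splits a generalized weight module
  into \<open>2^n\<close> submodules \<open>part D\<close>, one for each set \<open>D\<close> of variables whose derivation is locally nilpotent.

  A nonzero module of type \<open>D\<close> contains a joint eigenvector of the \<open>H\<^sub>i\<close>, and the vectors obtained
  from it by powers of the \<open>J\<^sub>i\<close> and \<open>\<partial>\<^sub>i\<close> have distinct weights, so they are linearly independent. In this
  chain an operator acts by coefficients that are polynomial in the weight, and a polynomial
  vanishing on a coset of a lattice vanishes. Hence the annihilator depends only on \<open>D\<close>, which makes
  the parts absolutely prime with distinct annihilators; conversely the annihilator of a
  generalized weight module that is absolutely prime determines its type, whence the uniqueness.
  A simple module of type \<open>D\<close> has the chain of an eigenvector as a basis, and so does the tensor product
  \<open>M_simple\<close>.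
\<close>

section \<open>Left modules\<close>

text \<open>The splitting comes from the idempotent \<open>e = 1 - J \<partial>\<close>: since
  \<open>e x = 0\<close>, one has \<open>e (H - c) = (1 - c) e\<close>, and moving
  \<open>\<partial>^k\<close> past \<open>H - c\<close> shifts \<open>c\<close> by \<open>k\<close>.
  So if a product of factors \<open>H - c\<close> kills \<open>m\<close>, then
  \<open>e \<partial>^k m = 0\<close> for all large \<open>k\<close>, and
  \<open>\<partial>^k m\<close> is infinitely divisible. For the annihilators the obstacle is that
  modules of one type may have disjoint weights. Operators are therefore written as words, whose
  coefficients make sense for every weight, and each module is compared with
  \<open>K[x_1, ..., x_n]\<close>. In the variables outside \<open>D\<close> the polynomials behave
  like a chain only far from exponent zero, which is why annihilation is required only eventually.
  Type and finiteness under \<open>H\<close> pass to subfactors, so one computation of the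
  annihilator gives absolute primeness. For the tensor product an action of the whole algebra has to
  exist. It is not built from the factors: tensors are mapped to a given simple module and its
  action is carried back, so existence of the action and the isomorphism come from one map.\<close>

context left_module
begin

declare smult_closed [simp, intro] smult_one [simp]

lemma smult_r_null [simp]:
  assumes "a \<in> carrier R"
  shows "a \<odot>\<^bsub>M\<^esub> \<zero>\<^bsub>M\<^esub> = \<zero>\<^bsub>M\<^esub>"
proof -
  have "a \<odot>\<^bsub>M\<^esub> \<zero>\<^bsub>M\<^esub> \<oplus>\<^bsub>M\<^esub> a \<odot>\<^bsub>M\<^esub> \<zero>\<^bsub>M\<^esub> = a \<odot>\<^bsub>M\<^esub> \<zero>\<^bsub>M\<^esub>"
    using smult_r_distr[OF assms, of "\<zero>\<^bsub>M\<^esub>" "\<zero>\<^bsub>M\<^esub>"] by simp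
  then show ?thesis using assms by (metis M.add.l_cancel_one' M.zero_closed smult_closed)
qed

lemma smult_l_null [simp]:
  assumes "x \<in> carrier M"
  shows "\<zero>\<^bsub>R\<^esub> \<odot>\<^bsub>M\<^esub> x = \<zero>\<^bsub>M\<^esub>"
proof -
  have "\<zero>\<^bsub>R\<^esub> \<odot>\<^bsub>M\<^esub> x \<oplus>\<^bsub>M\<^esub> \<zero>\<^bsub>R\<^esub> \<odot>\<^bsub>M\<^esub> x = \<zero>\<^bsub>R\<^esub> \<odot>\<^bsub>M\<^esub> x"
    using smult_l_distr[OF _ _ assms, of "\<zero>\<^bsub>R\<^esub>" "\<zero>\<^bsub>R\<^esub>"] by simp
  then show ?thesis using assms by (metis M.add.l_cancel_one' R.zero_closed smult_closed)
qed

lemma smult_l_minus: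
  assumes "a \<in> carrier R" "x \<in> carrier M"
  shows "(\<ominus>\<^bsub>R\<^esub> a) \<odot>\<^bsub>M\<^esub> x = \<ominus>\<^bsub>M\<^esub> (a \<odot>\<^bsub>M\<^esub> x)"
proof -
  have "(\<ominus>\<^bsub>R\<^esub> a) \<odot>\<^bsub>M\<^esub> x \<oplus>\<^bsub>M\<^esub> a \<odot>\<^bsub>M\<^esub> x = \<zero>\<^bsub>M\<^esub>"
    using assms by (simp add: smult_l_distr [symmetric] R.l_neg)
  then show ?thesis using assms by (simp add: M.minus_equality)
qed

lemma smult_r_minus:
  assumes "a \<in> carrier R" "x \<in> carrier M"
  shows "a \<odot>\<^bsub>M\<^esub> (\<ominus>\<^bsub>M\<^esub> x) = \<ominus>\<^bsub>M\<^esub> (a \<odot>\<^bsub>M\<^esub> x)"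
proof -
  have "a \<odot>\<^bsub>M\<^esub> (\<ominus>\<^bsub>M\<^esub> x) \<oplus>\<^bsub>M\<^esub> a \<odot>\<^bsub>M\<^esub> x = \<zero>\<^bsub>M\<^esub>"
    using assms by (simp add: smult_r_distr [symmetric] M.l_neg)
  then show ?thesis using assms by (simp add: M.minus_equality)
qed

lemma smult_r_diff:
  assumes "a \<in> carrier R" "x \<in> carrier M" "y \<in> carrier M"
  shows "a \<odot>\<^bsub>M\<^esub> (x \<ominus>\<^bsub>M\<^esub> y) = a \<odot>\<^bsub>M\<^esub> x \<ominus>\<^bsub>M\<^esub> a \<odot>\<^bsub>M\<^esub> y"
  using assms by (simp add: a_minus_def smult_r_distr smult_r_minus)

lemma submodule_closed:
  assumes "submodule N R M"
  shows submodule_subset: "N \<subseteq> carrier M"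
    and submodule_zero: "\<zero>\<^bsub>M\<^esub> \<in> N"
    and submodule_add: "\<And>x y. \<lbrakk>x \<in> N; y \<in> N\<rbrakk> \<Longrightarrow> x \<oplus>\<^bsub>M\<^esub> y \<in> N"
    and submodule_neg: "\<And>x. x \<in> N \<Longrightarrow> \<ominus>\<^bsub>M\<^esub> x \<in> N"
    and submodule_diff: "\<And>x y. \<lbrakk>x \<in> N; y \<in> N\<rbrakk> \<Longrightarrow> x \<ominus>\<^bsub>M\<^esub> y \<in> N"
    and submodule_smult: "\<And>a x. \<lbrakk>a \<in> carrier R; x \<in> N\<rbrakk> \<Longrightarrow> a \<odot>\<^bsub>M\<^esub> x \<in> N"
proof -
  interpret N: submodule N R M by fact
  show *: "N \<subseteq> carrier M" "\<zero>\<^bsub>M\<^esub> \<in> N"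
    "\<And>x y. \<lbrakk>x \<in> N; y \<in> N\<rbrakk> \<Longrightarrow> x \<oplus>\<^bsub>M\<^esub> y \<in> N"
    "\<And>x. x \<in> N \<Longrightarrow> \<ominus>\<^bsub>M\<^esub> x \<in> N"
    "\<And>a x. \<lbrakk>a \<in> carrier R; x \<in> N\<rbrakk> \<Longrightarrow> a \<odot>\<^bsub>M\<^esub> x \<in> N"
    using N.subset N.one_closed N.m_closed N.m_inv_closed N.smult_closed
    by (auto simp: a_inv_def)
  show "\<And>x y. \<lbrakk>x \<in> N; y \<in> N\<rbrakk> \<Longrightarrow> x \<ominus>\<^bsub>M\<^esub> y \<in> N"
    unfolding a_minus_def using * by blast
qed

text \<open>Negatives are the multiples by \<open>\<ominus> \<one>\<close>, so closure under the
  scalars provides them.\<close>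

lemma submoduleI:
  assumes "N \<subseteq> carrier M" "\<zero>\<^bsub>M\<^esub> \<in> N"
    and "\<And>x y. \<lbrakk>x \<in> N; y \<in> N\<rbrakk> \<Longrightarrow> x \<oplus>\<^bsub>M\<^esub> y \<in> N"
    and sm: "\<And>a x. \<lbrakk>a \<in> carrier R; x \<in> N\<rbrakk> \<Longrightarrow> a \<odot>\<^bsub>M\<^esub> x \<in> N"
  shows "submodule N R M"
proof -
  have "\<ominus>\<^bsub>M\<^esub> x \<in> N" if "x \<in> N" for x
    using sm[of "\<ominus>\<^bsub>R\<^esub> \<one>\<^bsub>R\<^esub>" x] that assms(1) by (auto simp: smult_l_minus)
  then show ?thesis
    using assms unfolding submodule_def submodule_axioms_def
    by (auto intro!: subgroup.intro simp: a_inv_def)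
qed

lemma submodule_zero_ideal: "submodule {\<zero>\<^bsub>M\<^esub>} R M"
  by (rule submoduleI) auto

lemma abelian_group_sub_module:
  assumes "submodule N R M"
  shows "abelian_group (sub_module M N)"
proof -
  note N = submodule_closed[OF assms]
  have car: "x \<in> carrier M" if "x \<in> N" for x using that N(1) by auto
  show ?thesis
  proof (rule abelian_groupI)
    fix x assume "x \<in> carrier (sub_module M N)"
    then show "\<exists>y\<in>carrier (sub_module M N). y \<oplus>\<^bsub>sub_module M N\<^esub> x = \<zero>\<^bsub>sub_module M N\<^esub>"
      using N(4) car by (auto intro!: bexI[of _ "\<ominus>\<^bsub>M\<^esub> x"] simp: M.l_neg)
  qed (use N car in \<open>auto simp: M.a_ac\<close>)
qed

lemma left_module_sub_module:
  assumes "submodule N R M"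
  shows "left_module R (sub_module M N)"
proof -
  note N = submodule_closed[OF assms]
  have car: "x \<in> carrier M" if "x \<in> N" for x using that N(1) by auto
  interpret S: abelian_group "sub_module M N" by (rule abelian_group_sub_module[OF assms])
  show ?thesis
    by unfold_locales
      (use N car in \<open>auto simp: smult_l_distr smult_r_distr smult_assoc1\<close>)
qed

lemma finsum_sub_module:
  assumes "submodule N R M" "f \<in> A \<rightarrow> N"
  shows "finsum (sub_module M N) f A = finsum M f A"
proof (cases "finite A")
  case True
  interpret S: abelian_group "sub_module M N" by (rule abelian_group_sub_module[OF assms(1)])
  show ?thesis using True assms(2)
  proof (induction A rule: finite_induct)
    case empty
    then show ?case by (simp add: S.finsum_empty)
  next
    case (insert x F)
    have "f \<in> F \<rightarrow> carrier M" "f x \<in> carrier M"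
      using insert.prems submodule_subset[OF assms(1)] by auto
    moreover have "f \<in> F \<rightarrow> carrier (sub_module M N)" "f x \<in> carrier (sub_module M N)"
      using insert.prems by auto
    ultimately show ?case using insert
      by (simp add: S.finsum_insert)
  qed
next
  case False
  interpret S: abelian_group "sub_module M N" by (rule abelian_group_sub_module[OF assms(1)])
  show ?thesis using False by (simp add: M.finsum_infinite S.finsum_infinite)
qed

text \<open>Lets a chain \<open>M1 \<subseteq> M2 \<subseteq> M\<close> be read as a submodule of
  the module \<open>M2\<close>, which is how subfactors are formed.\<close>

lemma submodule_sub_module_iff:
  assumes "submodule N R M"
  shows "submodule N' R (sub_module M N) \<longleftrightarrow> submodule N' R M \<and> N' \<subseteq> N"
proof -
  interpret S: left_module R "sub_module M N" by (rule left_module_sub_module[OF assms])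
  show ?thesis
  proof
    assume "submodule N' R (sub_module M N)"
    note N' = S.submodule_closed[OF this]
    show "submodule N' R M \<and> N' \<subseteq> N"
      using N' submodule_subset[OF assms] by (auto intro!: submoduleI)
  next
    assume a: "submodule N' R M \<and> N' \<subseteq> N"
    then have "submodule N' R M" by simp
    note N' = submodule_closed[OF this]
    show "submodule N' R (sub_module M N)"
      using N' a by (auto intro!: S.submoduleI)
  qed
qed

lemma submodule_abelian_subgroup:
  assumes "submodule N R M"
  shows "abelian_subgroup N M"
proof (rule abelian_subgroupI3)
  show "additive_subgroup N M"
    using assms by (simp add: submodule_def additive_subgroup_def)
qed (rule M.abelian_group_axioms)

end

section \<open>Cosets and quotient modules\<close>

context abelian_subgroup
begin

lemma coset_eq_iff:
  assumes "x \<in> carrier G" "y \<in> carrier G"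
  shows "H +> x = H +> y \<longleftrightarrow> x \<ominus> y \<in> H"
proof -
  have "x \<ominus> y \<in> H \<longleftrightarrow> x \<in> H +> y"
    using assms by (simp add: a_rcos_module a_minus_def)
  then show ?thesis
    by (metis a_rcos_self a_repr_independence' assms)
qed

lemma coset_eq_self_iff:
  assumes "x \<in> carrier G"
  shows "H +> x = H \<longleftrightarrow> x \<in> H"
  by (metis a_rcos_const a_rcos_self assms)

lemma coset_in_rcosets: "x \<in> carrier G \<Longrightarrow> H +> x \<in> a_rcosets H"
  by (simp add: a_rcosetsI a_subset)

lemma rcosetsE:
  assumes "X \<in> a_rcosets H"
  obtains x where "x \<in> carrier G" "X = H +> x"
  using assms by (auto simp: A_RCOSETS_def')

text \<open>Any record \<open>Q\<close> with these three fields is allowed, because the same cosets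
  occur with different scalar actions: in quotient modules and in tensor products.\<close>

lemma abelian_group_rcosets:
  assumes "carrier Q = a_rcosets H" "add Q = set_add G" "zero Q = H"
  shows "abelian_group Q"
proof (rule abelian_groupI)
  fix X Y assume "X \<in> carrier Q" "Y \<in> carrier Q"
  then obtain x y where "x \<in> carrier G" "X = H +> x" "y \<in> carrier G" "Y = H +> y"
    unfolding assms by (metis rcosetsE)
  then show "X \<oplus>\<^bsub>Q\<^esub> Y \<in> carrier Q" "X \<oplus>\<^bsub>Q\<^esub> Y = Y \<oplus>\<^bsub>Q\<^esub> X"
    by (simp_all add: assms a_rcos_sum coset_in_rcosets a_comm)
next
  show "\<zero>\<^bsub>Q\<^esub> \<in> carrier Q"
    using coset_in_rcosets[of "\<zero>"] a_rcos_const[of "\<zero>"] by (simp add: assms)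
next
  fix X assume "X \<in> carrier Q"
  then obtain x where x: "x \<in> carrier G" "X = H +> x"
    unfolding assms by (metis rcosetsE)
  have H0: "H = H +> \<zero>" using a_rcos_const[of "\<zero>"] by simp
  have "H <+> (H +> x) = H +> x" using x by (subst (1) H0) (simp add: a_rcos_sum)
  then show "\<zero>\<^bsub>Q\<^esub> \<oplus>\<^bsub>Q\<^esub> X = X" using x by (simp add: assms)
  have "(H +> (\<ominus> x)) <+> (H +> x) = H" using x H0
    by (simp add: a_rcos_sum l_neg)
  then show "\<exists>Y\<in>carrier Q. Y \<oplus>\<^bsub>Q\<^esub> X = \<zero>\<^bsub>Q\<^esub>"
    using x by (auto simp: assms coset_in_rcosets intro!: bexI[of _ "H +> (\<ominus> x)"])
next
  fix X Y Z assume "X \<in> carrier Q" "Y \<in> carrier Q" "Z \<in> carrier Q"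
  then obtain x y z where "x \<in> carrier G" "X = H +> x" "y \<in> carrier G" "Y = H +> y"
     "z \<in> carrier G" "Z = H +> z"
    unfolding assms by (metis rcosetsE)
  then show "X \<oplus>\<^bsub>Q\<^esub> Y \<oplus>\<^bsub>Q\<^esub> Z = X \<oplus>\<^bsub>Q\<^esub> (Y \<oplus>\<^bsub>Q\<^esub> Z)"
    by (simp add: assms a_rcos_sum a_assoc)
qed

end

lemma quot_module_simps [simp]:
  "carrier (quot_module M N) = a_rcosets\<^bsub>M\<^esub> N"
  "zero (quot_module M N) = N"
  "add (quot_module M N) = set_add M"
  by (simp_all add: quot_module_def)

context left_module
begin

text \<open>The action on a coset is defined as a union over its representatives. Two
  representatives differ by an element of \<open>N\<close>, and \<open>a\<close> maps this
  difference into \<open>N\<close>, so all members of the union are the same coset.\<close>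

lemma smult_quot_module:
  assumes "submodule N R M" "a \<in> carrier R" "x \<in> carrier M"
  shows "a \<odot>\<^bsub>quot_module M N\<^esub> (N +>\<^bsub>M\<^esub> x) = N +>\<^bsub>M\<^esub> (a \<odot>\<^bsub>M\<^esub> x)"
proof -
  interpret N: abelian_subgroup N M by (rule submodule_abelian_subgroup[OF assms(1)])
  have "N +>\<^bsub>M\<^esub> (a \<odot>\<^bsub>M\<^esub> y) = N +>\<^bsub>M\<^esub> (a \<odot>\<^bsub>M\<^esub> x)" if y: "y \<in> N +>\<^bsub>M\<^esub> x" for y
  proof -
    have yc: "y \<in> carrier M" using y N.a_elemrcos_carrier assms(3) by blast
    have "y \<ominus>\<^bsub>M\<^esub> x \<in> N"
      using y yc assms(3) by (simp add: N.a_rcos_module a_minus_def)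
    then have "a \<odot>\<^bsub>M\<^esub> (y \<ominus>\<^bsub>M\<^esub> x) \<in> N" by (rule submodule_smult[OF assms(1,2)])
    then show ?thesis using yc assms by (simp add: N.coset_eq_iff smult_r_diff)
  qed
  moreover have "x \<in> N +>\<^bsub>M\<^esub> x" using assms(3) by (rule N.a_rcos_self)
  ultimately have "(\<Union>y\<in>N +>\<^bsub>M\<^esub> x. N +>\<^bsub>M\<^esub> (a \<odot>\<^bsub>M\<^esub> y)) = N +>\<^bsub>M\<^esub> (a \<odot>\<^bsub>M\<^esub> x)"
    by blast
  then show ?thesis by (simp add: quot_module_def)
qed

lemma left_module_quot_module:
  assumes "submodule N R M"
  shows "left_module R (quot_module M N)"
proof -
  interpret N: abelian_subgroup N M by (rule submodule_abelian_subgroup[OF assms])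
  interpret Q: abelian_group "quot_module M N"
    by (rule N.abelian_group_rcosets) simp_all
  note sm = smult_quot_module[OF assms]
  show ?thesis
  proof (unfold_locales, goal_cases)
    case (1 a X)
    then obtain x where "x \<in> carrier M" "X = N +>\<^bsub>M\<^esub> x" by (auto elim: N.rcosetsE)
    then show ?case using 1 by (simp add: sm N.coset_in_rcosets)
  next
    case (2 a b X)
    then obtain x where "x \<in> carrier M" "X = N +>\<^bsub>M\<^esub> x" by (auto elim: N.rcosetsE)
    then show ?case using 2 by (simp add: sm N.a_rcos_sum smult_l_distr)
  next
    case (3 a X Y)
    then obtain x y where "x \<in> carrier M" "X = N +>\<^bsub>M\<^esub> x" "y \<in> carrier M" "Y = N +>\<^bsub>M\<^esub> y"
      by (auto elim!: N.rcosetsE)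
    then show ?case using 3 by (simp add: sm N.a_rcos_sum smult_r_distr)
  next
    case (4 a b X)
    then obtain x where "x \<in> carrier M" "X = N +>\<^bsub>M\<^esub> x" by (auto elim: N.rcosetsE)
    then show ?case using 4 by (simp add: sm smult_assoc1)
  next
    case (5 X)
    then obtain x where "x \<in> carrier M" "X = N +>\<^bsub>M\<^esub> x" by (auto elim: N.rcosetsE)
    then show ?case by (simp add: sm)
  qed
qed

section \<open>Annihilators and absolute primeness\<close>

lemma ann_quot_module:
  assumes "submodule N R M"
  shows "ann R (quot_module M N) = {a \<in> carrier R. \<forall>x\<in>carrier M. a \<odot>\<^bsub>M\<^esub> x \<in> N}"
proof -
  interpret N: abelian_subgroup N M by (rule submodule_abelian_subgroup[OF assms])
  have *: "(\<forall>X\<in>carrier (quot_module M N). a \<odot>\<^bsub>quot_module M N\<^esub> X = N)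
      \<longleftrightarrow> (\<forall>x\<in>carrier M. a \<odot>\<^bsub>M\<^esub> x \<in> N)" if "a \<in> carrier R" for a
  proof
    assume l: "\<forall>X\<in>carrier (quot_module M N). a \<odot>\<^bsub>quot_module M N\<^esub> X = N"
    show "\<forall>x\<in>carrier M. a \<odot>\<^bsub>M\<^esub> x \<in> N"
    proof
      fix x assume x: "x \<in> carrier M"
      have "a \<odot>\<^bsub>quot_module M N\<^esub> (N +>\<^bsub>M\<^esub> x) = N"
        by (rule l[rule_format]) (simp add: N.coset_in_rcosets x)
      then show "a \<odot>\<^bsub>M\<^esub> x \<in> N"
        using x that by (simp add: smult_quot_module[OF assms] N.coset_eq_self_iff)
    qed
  next
    assume r: "\<forall>x\<in>carrier M. a \<odot>\<^bsub>M\<^esub> x \<in> N"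
    show "\<forall>X\<in>carrier (quot_module M N). a \<odot>\<^bsub>quot_module M N\<^esub> X = N"
    proof
      fix X assume "X \<in> carrier (quot_module M N)"
      then obtain x where x: "x \<in> carrier M" "X = N +>\<^bsub>M\<^esub> x" by (auto elim: N.rcosetsE)
      have "a \<odot>\<^bsub>M\<^esub> x \<in> N" using r x(1) by blast
      then show "a \<odot>\<^bsub>quot_module M N\<^esub> X = N"
        unfolding x(2) using x(1) that
        by (simp add: smult_quot_module[OF assms] N.coset_eq_self_iff)
    qed
  qed
  show ?thesis unfolding ann_def quot_module_simps(2)
    by (rule Collect_cong, rule conj_cong[OF refl], rule *)
qed

lemma ideal_ann: "ideal (ann R M) R"
proof (rule idealI)
  show "ring R" by (rule R.ring_axioms)
  show "subgroup (ann R M) (add_monoid R)"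
    by (rule subgroup.intro) (auto simp: ann_def smult_l_distr smult_l_minus a_inv_def[symmetric])
qed (auto simp: ann_def smult_assoc1)

text \<open>
  If all nonzero submodules have the annihilator \<open>P\<close> and \<open>I J \<subseteq> P\<close> with \<open>j m \<noteq> 0\<close> for some
  \<open>j \<in> J\<close>, then \<open>I\<close> annihilates the nonzero submodule \<open>J m\<close>.
\<close>

lemma prime_ideal_ann:
  assumes "carrier M \<noteq> {\<zero>\<^bsub>M\<^esub>}"
    and eq: "\<And>N. \<lbrakk>submodule N R M; N \<noteq> {\<zero>\<^bsub>M\<^esub>}\<rbrakk> \<Longrightarrow> ann R (sub_module M N) = ann R M"
  shows "prime_ideal R (ann R M)"
  unfolding prime_ideal_def
proof (intro conjI allI impI)
  show "ideal (ann R M) R" by (rule ideal_ann)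
  have "\<one>\<^bsub>R\<^esub> \<notin> ann R M" using assms(1) by (auto simp: ann_def)
  then show "ann R M \<noteq> carrier R" by auto
  fix I J assume I: "ideal I R" and J: "ideal J R" and IJ: "I \<cdot>\<^bsub>R\<^esub> J \<subseteq> ann R M"
  interpret J: ideal J R by (rule J)
  interpret I: ideal I R by (rule I)
  show "I \<subseteq> ann R M \<or> J \<subseteq> ann R M"
  proof (rule disjCI)
    assume "\<not> J \<subseteq> ann R M"
    then obtain j m where jm: "j \<in> J" "m \<in> carrier M" "j \<odot>\<^bsub>M\<^esub> m \<noteq> \<zero>\<^bsub>M\<^esub>"
      by (auto simp: ann_def J.a_Hcarr)
    define N where "N = (\<lambda>b. b \<odot>\<^bsub>M\<^esub> m) ` J"
    have "submodule N R M"
    proof (rule submoduleI)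
      show "N \<subseteq> carrier M" using jm by (auto simp: N_def J.a_Hcarr)
      show "\<zero>\<^bsub>M\<^esub> \<in> N" unfolding N_def
        by (rule image_eqI[of _ _ "\<zero>\<^bsub>R\<^esub>"]) (use jm in auto)
      show "x \<oplus>\<^bsub>M\<^esub> y \<in> N" if xy: "x \<in> N" "y \<in> N" for x y
      proof -
        obtain b c where bc: "b \<in> J" "c \<in> J" "x = b \<odot>\<^bsub>M\<^esub> m" "y = c \<odot>\<^bsub>M\<^esub> m"
          using xy by (auto simp: N_def)
        then show ?thesis unfolding N_def
          by (intro image_eqI[of _ _ "b \<oplus>\<^bsub>R\<^esub> c"]) (auto simp: smult_l_distr J.a_Hcarr jm)
      qed
      show "a \<odot>\<^bsub>M\<^esub> x \<in> N" if ax: "a \<in> carrier R" "x \<in> N" for a x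
      proof -
        obtain b where b: "b \<in> J" "x = b \<odot>\<^bsub>M\<^esub> m" using ax by (auto simp: N_def)
        then show ?thesis unfolding N_def using ax(1)
          by (intro image_eqI[of _ _ "a \<otimes>\<^bsub>R\<^esub> b"]) (auto simp: smult_assoc1 J.a_Hcarr jm J.I_l_closed)
      qed
    qed
    moreover have "N \<noteq> {\<zero>\<^bsub>M\<^esub>}" using jm by (auto simp: N_def)
    ultimately have "ann R (sub_module M N) = ann R M" by (rule eq)
    moreover have "I \<subseteq> ann R (sub_module M N)"
    proof
      fix i assume i: "i \<in> I"
      have "i \<odot>\<^bsub>M\<^esub> (b \<odot>\<^bsub>M\<^esub> m) = \<zero>\<^bsub>M\<^esub>" if "b \<in> J" for b
      proof -
        have "i \<otimes>\<^bsub>R\<^esub> b \<in> ann R M" using IJ ideal_prod.prod[OF i that] by auto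
        then show ?thesis using i that jm
          by (auto simp: ann_def smult_assoc1[symmetric] I.a_Hcarr J.a_Hcarr)
      qed
      then show "i \<in> ann R (sub_module M N)" using i by (auto simp: ann_def N_def I.a_Hcarr)
    qed
    ultimately show "I \<subseteq> ann R M" by simp
  qed
qed

lemma ann_quot_zero: "ann R (quot_module M {\<zero>\<^bsub>M\<^esub>}) = ann R M"
  unfolding ann_quot_module[OF submodule_zero_ideal] by (simp add: ann_def)

text \<open>Primeness of the annihilator is contained in the condition on subfactors: the choice
  \<open>M1 = {\<zero>}\<close> shows that every nonzero submodule has the annihilator of
  \<open>M\<close>, and \<open>prime_ideal_ann\<close> applies.\<close>

lemma absolutely_primeI:
  assumes "carrier M \<noteq> {\<zero>\<^bsub>M\<^esub>}"
    and eq: "\<And>M1 M2. \<lbrakk>submodule M1 R M; submodule M2 R M; M1 \<subset> M2\<rbrakk>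
      \<Longrightarrow> ann R (quot_module (sub_module M M2) M1) = ann R M"
  shows "absolutely_prime R M"
  unfolding absolutely_prime_def
proof (intro conjI allI impI)
  show "left_module R M" by (rule left_module_axioms)
  show "prime_ideal R (ann R M)"
  proof (rule prime_ideal_ann)
    fix N assume N: "submodule N R M" "N \<noteq> {\<zero>\<^bsub>M\<^esub>}"
    interpret S: left_module R "sub_module M N" by (rule left_module_sub_module[OF N(1)])
    have "{\<zero>\<^bsub>M\<^esub>} \<subset> N" using N submodule_zero[OF N(1)] by auto
    from eq[OF submodule_zero_ideal N(1) this]
    show "ann R (sub_module M N) = ann R M" using S.ann_quot_zero by simp
  qed (rule assms(1))
qed (use assms in auto)

text \<open>A submodule is the subfactor \<open>N / 0\<close>. This is the form in which absolute
  primeness enters the uniqueness proof.\<close>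

lemma absolutely_prime_ann_submodule:
  assumes "absolutely_prime R M" "submodule N R M" "N \<noteq> {\<zero>\<^bsub>M\<^esub>}"
  shows "ann R (sub_module M N) = ann R M"
proof -
  interpret S: left_module R "sub_module M N" by (rule left_module_sub_module[OF assms(2)])
  have "{\<zero>\<^bsub>M\<^esub>} \<subset> N" using assms submodule_zero[OF assms(2)] by auto
  then have "ann R (quot_module (sub_module M N) {\<zero>\<^bsub>M\<^esub>}) = ann R M"
    using assms submodule_zero_ideal by (auto simp: absolutely_prime_def)
  then show ?thesis using S.ann_quot_zero by simp
qed

end

section \<open>Direct sums\<close>

context left_module
begin

lemma internal_direct_sum_decompose:
  assumes "internal_direct_sum M I A" "m \<in> carrier M"
  obtains J f where "finite J" "J \<subseteq> I" "\<And>i. i \<in> I \<Longrightarrow> f i \<in> A i"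
    "m = finsum M f J"
proof -
  obtain f where "f \<in> (\<Pi>\<^sub>E i\<in>I. A i)" "finite {i \<in> I. f i \<noteq> \<zero>\<^bsub>M\<^esub>}"
    "m = (\<Oplus>\<^bsub>M\<^esub>i\<in>{i \<in> I. f i \<noteq> \<zero>\<^bsub>M\<^esub>}. f i)"
    using assms unfolding internal_direct_sum_def by blast
  then show ?thesis
    by (intro that[of "{i \<in> I. f i \<noteq> \<zero>\<^bsub>M\<^esub>}" f]) (auto simp: PiE_iff)
qed

text \<open>The maps \<open>p i\<close> are the projections onto the summands.\<close>

lemma internal_direct_sumI:
  assumes sub: "\<And>i. i \<in> I \<Longrightarrow> subgroup (A i) (add_monoid M)"
    and ex: "\<And>m. m \<in> carrier M \<Longrightarrow> \<exists>J f. finite J \<and> J \<subseteq> I \<and> (\<forall>i\<in>J. f i \<in> A i) \<and> m = finsum M f J"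
    and p: "\<And>i. i \<in> I \<Longrightarrow> p i \<in> hom (add_monoid M) (add_monoid M)"
    and p1: "\<And>i x. \<lbrakk>i \<in> I; x \<in> A i\<rbrakk> \<Longrightarrow> p i x = x"
    and p0: "\<And>i j x. \<lbrakk>i \<in> I; j \<in> I; i \<noteq> j; x \<in> A i\<rbrakk> \<Longrightarrow> p j x = \<zero>\<^bsub>M\<^esub>"
  shows "internal_direct_sum M I A"
proof -
  have A: "A i \<subseteq> carrier M" "\<zero>\<^bsub>M\<^esub> \<in> A i" if "i \<in> I" for i
    using subgroup.subset[OF sub[OF that]] subgroup.one_closed[OF sub[OF that]] by auto
  have pz: "p i \<zero>\<^bsub>M\<^esub> = \<zero>\<^bsub>M\<^esub>" if "i \<in> I" for i
    using p1[OF that A(2)[OF that]] .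
  \<comment> \<open>\<open>p j\<close> reads off the \<open>j\<close>-th summand of any finite sum
    of elements of the \<open>A i\<close>; existence and uniqueness of the family both use
    it.\<close>
  have psum: "p j (finsum M f J) = (if j \<in> J then f j else \<zero>\<^bsub>M\<^esub>)"
    if "finite J" "J \<subseteq> I" "\<And>i. i \<in> J \<Longrightarrow> f i \<in> A i" "j \<in> I" for J f j
    using that(1-3)
  proof (induction J rule: finite_induct)
    case empty
    then show ?case using pz[OF that(4)] by simp
  next
    case (insert x F)
    have "f \<in> F \<rightarrow> carrier M" "f x \<in> carrier M"
      using insert.prems A by blast+
    then have "p j (finsum M f (insert x F)) = p j (f x) \<oplus>\<^bsub>M\<^esub> p j (finsum M f F)"
      using insert.hyps p[OF that(4)] by (simp add: hom_def)
    moreover have "p j (finsum M f F) = (if j \<in> F then f j else \<zero>\<^bsub>M\<^esub>)"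
      using insert by auto
    moreover have "p j (f x) = (if x = j then f x else \<zero>\<^bsub>M\<^esub>)"
      using p1[of x "f x"] p0[of x j "f x"] insert.prems that(4) by auto
    moreover have "j \<in> F \<Longrightarrow> f j \<in> carrier M" using \<open>f \<in> F \<rightarrow> carrier M\<close> by auto
    ultimately show ?case using insert.hyps \<open>f x \<in> carrier M\<close> by auto
  qed
  show ?thesis unfolding internal_direct_sum_def
  proof (intro conjI ballI)
    fix m assume m: "m \<in> carrier M"
    obtain J f where J: "finite J" "J \<subseteq> I" "\<forall>i\<in>J. f i \<in> A i" "m = finsum M f J"
      using ex[OF m] by blast
    have pm: "p j m = (if j \<in> J then f j else \<zero>\<^bsub>M\<^esub>)" if "j \<in> I" for j
      using psum[of J f j] J that by simp
    define g where "g = (\<lambda>i\<in>I. p i m)"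
    have gJ: "{i \<in> I. g i \<noteq> \<zero>\<^bsub>M\<^esub>} = {i \<in> J. f i \<noteq> \<zero>\<^bsub>M\<^esub>}"
      using J(2) pm by (fastforce simp: g_def split: if_splits)
    \<comment> \<open>The definition sums over the exact support, so the zero summands of
      \<open>f\<close> have to be dropped.\<close>
    have "m = finsum M f {i \<in> J. f i \<noteq> \<zero>\<^bsub>M\<^esub>}"
      unfolding J(4)
      by (rule M.add.finprod_mono_neutral_cong_right) (use J A in auto)
    also have "\<dots> = finsum M g {i \<in> J. f i \<noteq> \<zero>\<^bsub>M\<^esub>}"
    proof (rule M.finsum_cong')
      show gf: "g \<in> {i \<in> J. f i \<noteq> \<zero>\<^bsub>M\<^esub>} \<rightarrow> carrier M"
      proof
        fix i assume "i \<in> {i \<in> J. f i \<noteq> \<zero>\<^bsub>M\<^esub>}"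
        then have i: "i \<in> J" "i \<in> I" using J(2) by auto
        then have "g i = f i" using pm[of i] by (simp add: g_def)
        then show "g i \<in> carrier M" using J(3) A(1)[OF i(2)] i(1) by auto
      qed
      fix i assume "i \<in> {i \<in> J. f i \<noteq> \<zero>\<^bsub>M\<^esub>}"
      then have i: "i \<in> J" "i \<in> I" using J(2) by auto
      then show "f i = g i" using pm[of i] by (simp add: g_def)
    qed simp
    finally have m_eq: "m = finsum M g {i \<in> I. g i \<noteq> \<zero>\<^bsub>M\<^esub>}" unfolding gJ .
    show "\<exists>!f. f \<in> (\<Pi>\<^sub>E i\<in>I. A i) \<and> finite {i \<in> I. f i \<noteq> \<zero>\<^bsub>M\<^esub>} \<and>
       m = (\<Oplus>\<^bsub>M\<^esub>i\<in>{i \<in> I. f i \<noteq> \<zero>\<^bsub>M\<^esub>}. f i)"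
    proof (rule ex1I[of _ g])
      show "g \<in> (\<Pi>\<^sub>E i\<in>I. A i) \<and> finite {i \<in> I. g i \<noteq> \<zero>\<^bsub>M\<^esub>} \<and>
         m = (\<Oplus>\<^bsub>M\<^esub>i\<in>{i \<in> I. g i \<noteq> \<zero>\<^bsub>M\<^esub>}. g i)"
      proof (intro conjI)
        have "p i m \<in> A i" if "i \<in> I" for i
          using pm[OF that] J(3) A(2)[OF that] by simp
        then show "g \<in> (\<Pi>\<^sub>E i\<in>I. A i)" by (simp add: g_def)
        show "finite {i \<in> I. g i \<noteq> \<zero>\<^bsub>M\<^esub>}" unfolding gJ using J(1) by simp
      qed (rule m_eq)
    next
      fix h assume h: "h \<in> (\<Pi>\<^sub>E i\<in>I. A i) \<and> finite {i \<in> I. h i \<noteq> \<zero>\<^bsub>M\<^esub>} \<and>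
         m = (\<Oplus>\<^bsub>M\<^esub>i\<in>{i \<in> I. h i \<noteq> \<zero>\<^bsub>M\<^esub>}. h i)"
      show "h = g"
      proof (rule extensionalityI[of _ I])
        show "h \<in> extensional I" "g \<in> extensional I" using h by (auto simp: PiE_iff g_def)
        fix j assume j: "j \<in> I"
        have "p j (finsum M h {i \<in> I. h i \<noteq> \<zero>\<^bsub>M\<^esub>}) = h j"
          by (subst psum) (use h j in \<open>auto simp: PiE_iff\<close>)
        moreover have "finsum M h {i \<in> I. h i \<noteq> \<zero>\<^bsub>M\<^esub>} = m" using h by simp
        ultimately show "h j = g j" using j by (simp add: g_def)
      qed
    qed
  qed (rule sub)
qed

end

section \<open>Operators on polynomials\<close>

lemma lookup_pscale [simp]: "Poly_Mapping.lookup (pscale c p) x = c * Poly_Mapping.lookup p x"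
  by (simp add: pscale_def Poly_Mapping.map.rep_eq when_def)

lemma pscale_single [simp]: "pscale c (Poly_Mapping.single x b) = Poly_Mapping.single x (c * b)"
  by (rule poly_mapping_eqI) (simp add: lookup_single when_def)

lemma vector_space_pscale: "vector_space (pscale :: 'k::field_char_0 \<Rightarrow> ('a \<Rightarrow>\<^sub>0 'k) \<Rightarrow> _)"
  by unfold_locales (auto intro!: poly_mapping_eqI simp: lookup_add algebra_simps)

interpretation pscale: vector_space "pscale :: 'k::field_char_0 \<Rightarrow> ('a \<Rightarrow>\<^sub>0 'k) \<Rightarrow> _"
  by (rule vector_space_pscale)

text \<open>One key is removed at a time. The side condition \<open>x \<notin> keys p\<close> makes
  the keys of the sum a disjoint union, so that a condition on all keys is inherited by
  \<open>p\<close>.\<close>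

lemma poly_mapping_add_induct [case_names zero add]:
  fixes p :: "'a \<Rightarrow>\<^sub>0 'b::ab_group_add"
  assumes "P 0"
    and "\<And>x c p. \<lbrakk>x \<notin> Poly_Mapping.keys p; c \<noteq> 0; P p\<rbrakk> \<Longrightarrow> P (Poly_Mapping.single x c + p)"
  shows "P p"
proof (induction "card (Poly_Mapping.keys p)" arbitrary: p)
  case 0
  then have "p = 0" by simp
  then show ?case using assms(1) by simp
next
  case (Suc n)
  then obtain x where x: "x \<in> Poly_Mapping.keys p" by fastforce
  define q where "q = p - Poly_Mapping.single x (Poly_Mapping.lookup p x)"
  have k: "Poly_Mapping.keys q = Poly_Mapping.keys p - {x}"
    by (auto simp: q_def in_keys_iff lookup_minus lookup_single when_def split: if_splits)
  then have "P q" using Suc x by (intro Suc.hyps(1)) simp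
  then have "P (Poly_Mapping.single x (Poly_Mapping.lookup p x) + q)"
    using k x by (intro assms(2)) (auto simp: in_keys_iff)
  then show ?case by (simp add: q_def)
qed

lemma in_End_P_iff:
  "f \<in> carrier End_P \<longleftrightarrow>
    (\<forall>p q. f (p + q) = f p + f q) \<and> (\<forall>c p. f (pscale c p) = pscale c (f p))"
  by (auto simp: End_P_def Vector_Spaces.linear_iff vector_space_pscale)

lemma End_P_simps [simp]:
  "f \<otimes>\<^bsub>End_P\<^esub> g = f \<circ> g" "\<one>\<^bsub>End_P\<^esub> = id" "\<zero>\<^bsub>End_P\<^esub> = (\<lambda>p. 0)" "f \<oplus>\<^bsub>End_P\<^esub> g = (\<lambda>p. f p + g p)"
  by (simp_all add: End_P_def)

lemma End_P_add: "f \<in> carrier End_P \<Longrightarrow> f (p + q) = f p + f q"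
  and End_P_pscale: "f \<in> carrier End_P \<Longrightarrow> f (pscale c p) = pscale c (f p)"
  by (auto simp: in_End_P_iff)

lemma End_P_zero: "f \<in> carrier End_P \<Longrightarrow> f 0 = 0"
  using End_P_pscale[of f 0 0] by simp

text \<open>The monomials span, so an identity between operators reduces to a computation with
  exponents and one coefficient.\<close>

lemma End_P_eqI:
  assumes f: "f \<in> carrier End_P" and g: "g \<in> carrier End_P"
    and eq: "\<And>\<alpha>. f (Poly_Mapping.single \<alpha> 1) = g (Poly_Mapping.single \<alpha> 1)"
  shows "f = g"
proof
  fix p
  show "f p = g p"
  proof (induction p rule: poly_mapping_add_induct)
    case (add x c p)
    have "f (Poly_Mapping.single x c) = g (Poly_Mapping.single x c)"
      using End_P_pscale[OF f, of c "Poly_Mapping.single x 1"]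
        End_P_pscale[OF g, of c "Poly_Mapping.single x 1"] eq[of x] by simp
    then show ?case using add by (simp add: End_P_add[OF f] End_P_add[OF g])
  qed (use End_P_zero f g in metis)
qed

lemma ring_End_P: "ring (End_P :: ('k::field_char_0, 'n) endo ring)"
proof (rule ringI)
  show "abelian_group (End_P :: ('k, 'n) endo ring)"
  proof (rule abelian_groupI)
    fix f :: "('k, 'n) endo" assume f: "f \<in> carrier End_P"
    have "(\<lambda>p. - f p) \<in> carrier End_P"
      using f by (auto simp: in_End_P_iff pscale.scale_minus_right)
    then show "\<exists>g\<in>carrier End_P. g \<oplus>\<^bsub>End_P\<^esub> f = \<zero>\<^bsub>End_P\<^esub>"
      by (rule bexI[rotated]) simp
  qed (auto simp: in_End_P_iff algebra_simps pscale.scale_right_distrib)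
  show "Group.monoid (End_P :: ('k, 'n) endo ring)"
    by (rule Group.monoidI) (auto simp: in_End_P_iff)
qed (auto simp: in_End_P_iff)

interpretation End_P: ring "End_P :: ('k::field_char_0, 'n) endo ring" by (rule ring_End_P)

lemma End_P_a_inv:
  assumes "f \<in> carrier End_P"
  shows "\<ominus>\<^bsub>End_P\<^esub> f = (\<lambda>p. - f p)"
proof (rule End_P.minus_equality)
  show "(\<lambda>p. - f p) \<oplus>\<^bsub>End_P\<^esub> f = \<zero>\<^bsub>End_P\<^esub>" by simp
  show "f \<in> carrier End_P" by fact
  show "(\<lambda>p. - f p) \<in> carrier End_P"
    using assms by (auto simp: in_End_P_iff pscale.scale_minus_right)
qed

lemma pscale_in_End_P [simp]: "pscale c \<in> carrier End_P"
  by (auto simp: in_End_P_iff pscale.scale_right_distrib mult.commute)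

section \<open>Algebras of endomorphisms generated by a set\<close>

lemma gen_algebra_simps [simp]:
  "f \<otimes>\<^bsub>gen_algebra G\<^esub> g = f \<circ> g" "\<one>\<^bsub>gen_algebra G\<^esub> = id" "\<zero>\<^bsub>gen_algebra G\<^esub> = (\<lambda>p. 0)"
  "f \<oplus>\<^bsub>gen_algebra G\<^esub> g = (\<lambda>p. f p + g p)"
  by (simp_all add: gen_algebra_def End_P_def)

context
  fixes G :: "('k::field_char_0, 'n) endo set"
  assumes G: "G \<subseteq> carrier End_P"
begin

lemma gens_subset: "Set.range pscale \<union> G \<subseteq> carrier End_P"
  using G by auto

lemma gen_algebra_subset_End_P: "carrier (gen_algebra G) \<subseteq> carrier End_P"
  using End_P.generate_ring_incl[OF gens_subset] by (simp add: gen_algebra_def)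

lemma ring_gen_algebra: "ring (gen_algebra G)"
  unfolding gen_algebra_def by (rule End_P.generate_ring_is_ring[OF gens_subset])

lemma gen_algebra_closed:
  shows gen_algebra_gen: "g \<in> G \<Longrightarrow> g \<in> carrier (gen_algebra G)"
    and gen_algebra_pscale: "pscale c \<in> carrier (gen_algebra G)"
    and gen_algebra_comp: "\<lbrakk>f \<in> carrier (gen_algebra G); g \<in> carrier (gen_algebra G)\<rbrakk>
      \<Longrightarrow> f \<circ> g \<in> carrier (gen_algebra G)"
    and gen_algebra_add: "\<lbrakk>f \<in> carrier (gen_algebra G); g \<in> carrier (gen_algebra G)\<rbrakk>
      \<Longrightarrow> (\<lambda>p. f p + g p) \<in> carrier (gen_algebra G)"
    and gen_algebra_id: "id \<in> carrier (gen_algebra G)"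
    and gen_algebra_zero: "(\<lambda>p. 0) \<in> carrier (gen_algebra G)"
proof -
  interpret A: ring "gen_algebra G" by (rule ring_gen_algebra)
  show "g \<in> G \<Longrightarrow> g \<in> carrier (gen_algebra G)" "pscale c \<in> carrier (gen_algebra G)"
    by (auto simp: gen_algebra_def intro: generate_ring.incl)
  show "\<lbrakk>f \<in> carrier (gen_algebra G); g \<in> carrier (gen_algebra G)\<rbrakk>
      \<Longrightarrow> f \<circ> g \<in> carrier (gen_algebra G)"
    using A.m_closed by simp
  show "\<lbrakk>f \<in> carrier (gen_algebra G); g \<in> carrier (gen_algebra G)\<rbrakk>
      \<Longrightarrow> (\<lambda>p. f p + g p) \<in> carrier (gen_algebra G)"
    using A.a_closed by simp
  show "id \<in> carrier (gen_algebra G)" "(\<lambda>p. 0) \<in> carrier (gen_algebra G)"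
    using A.one_closed A.zero_closed by simp_all
qed

lemma gen_algebra_diff:
  assumes "f \<in> carrier (gen_algebra G)" "g \<in> carrier (gen_algebra G)"
  shows "(\<lambda>p. f p - g p) \<in> carrier (gen_algebra G)"
  using gen_algebra_add[OF assms(1) gen_algebra_comp[OF gen_algebra_pscale[of "-1"] assms(2)]]
  by simp

lemma gen_algebra_funpow:
  "f \<in> carrier (gen_algebra G) \<Longrightarrow> f ^^ k \<in> carrier (gen_algebra G)"
  by (induction k) (auto intro: gen_algebra_comp simp: gen_algebra_id)

text \<open>The cases of the unit and of negatives in the generated ring are absorbed by the scalar
  operators: \<open>id = pscale 1\<close>, and a negative is a product with
  \<open>pscale (-1)\<close>.\<close>

lemma gen_algebra_induct [consumes 1, case_names pscale gen add comp]:
  assumes "a \<in> carrier (gen_algebra G)"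
    and ps: "\<And>c. P (pscale c)"
    and "\<And>g. g \<in> G \<Longrightarrow> P g"
    and "\<And>f g. \<lbrakk>f \<in> carrier (gen_algebra G); g \<in> carrier (gen_algebra G); P f; P g\<rbrakk>
      \<Longrightarrow> P (\<lambda>p. f p + g p)"
    and comp: "\<And>f g. \<lbrakk>f \<in> carrier (gen_algebra G); g \<in> carrier (gen_algebra G); P f; P g\<rbrakk>
      \<Longrightarrow> P (f \<circ> g)"
  shows "P a"
proof -
  have mem: "b \<in> carrier (gen_algebra G)" if "b \<in> generate_ring End_P (Set.range pscale \<union> G)" for b
    using that by (simp add: gen_algebra_def)
  have "a \<in> generate_ring End_P (Set.range pscale \<union> G)"
    using assms(1) by (simp add: gen_algebra_def)
  then show ?thesis
  proof (induction rule: generate_ring.induct)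
    case one
    have "pscale 1 = (id :: ('k, 'n) endo)" by auto
    then have "P id" using ps[of 1] by metis
    then show ?case unfolding End_P_simps .
  next
    case (a_inv h)
    have "h \<in> carrier End_P" using mem[OF a_inv(1)] gen_algebra_subset_End_P by auto
    then have "\<ominus>\<^bsub>End_P\<^esub> h = pscale (-1) \<circ> h" by (auto simp: End_P_a_inv)
    moreover have "P (pscale (-1) \<circ> h)"
      by (rule comp[OF gen_algebra_pscale mem[OF a_inv(1)] ps a_inv(2)])
    ultimately show ?case by (simp only:)
  next
    case (eng_mult f h)
    show ?case unfolding End_P_simps
      by (rule comp[OF mem[OF eng_mult(1)] mem[OF eng_mult(2)] eng_mult(3,4)])
  qed (use assms(2-) mem in auto)
qed

end

subsection \<open>Relations between the generators\<close>

lemma op_X_single: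
  "op_X i (Poly_Mapping.single \<alpha> c) = Poly_Mapping.single (\<alpha> + Poly_Mapping.single i 1) c"
  by (simp add: op_X_def mult_single add.commute)

lemma op_D_single:
  "op_D i (Poly_Mapping.single \<alpha> c) =
    Poly_Mapping.single (\<alpha> - Poly_Mapping.single i 1) (of_nat (Poly_Mapping.lookup \<alpha> i) * c)"
  by (simp add: op_D_def)

lemma op_J_single:
  "op_J i (Poly_Mapping.single \<alpha> c) =
    Poly_Mapping.single (\<alpha> + Poly_Mapping.single i 1) (c / of_nat (Poly_Mapping.lookup \<alpha> i + 1))"
  by (simp add: op_J_def)

lemma keys_pscale: "c \<noteq> 0 \<Longrightarrow> Poly_Mapping.keys (pscale c p) = Poly_Mapping.keys p"
  by (auto simp: in_keys_iff)

lemma op_X_in_End_P: "(op_X i :: ('k::field_char_0, 'n) endo) \<in> carrier End_P"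
proof -
  have "pscale c p = Poly_Mapping.single 0 c * p" for c :: 'k and p :: "('k, 'n) pol"
    by (simp add: pscale_def Poly_Mapping.mult_map_scale_conv_mult)
  then show ?thesis by (auto simp: in_End_P_iff op_X_def algebra_simps)
qed

lemma op_D_in_End_P: "(op_D i :: ('k::field_char_0, 'n) endo) \<in> carrier End_P"
proof -
  have "op_D i (p + q) = op_D i p + op_D i q" for p q :: "('k, 'n) pol"
    unfolding op_D_def
    by (rule setsum_keys_plus_distrib) (simp_all add: single_add algebra_simps)
  moreover have "op_D i (pscale c p) = pscale c (op_D i p)" for c and p :: "('k, 'n) pol"
    by (cases "c = 0")
      (simp_all add: op_D_def keys_pscale pscale.scale_sum_right mult.left_commute)
  ultimately show ?thesis by (simp add: in_End_P_iff)
qed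

lemma op_J_in_End_P: "(op_J i :: ('k::field_char_0, 'n) endo) \<in> carrier End_P"
proof -
  have "op_J i (p + q) = op_J i p + op_J i q" for p q :: "('k, 'n) pol"
    unfolding op_J_def
    by (rule setsum_keys_plus_distrib) (simp_all add: single_add add_divide_distrib)
  moreover have "op_J i (pscale c p) = pscale c (op_J i p)" for c and p :: "('k, 'n) pol"
    by (cases "c = 0") (simp_all add: op_J_def keys_pscale pscale.scale_sum_right)
  ultimately show ?thesis by (simp add: in_End_P_iff)
qed

lemmas op_in_End_P = op_X_in_End_P op_D_in_End_P op_J_in_End_P

lemma op_H_in_End_P: "op_H i \<in> carrier End_P"
  using End_P.m_closed[OF op_D_in_End_P op_X_in_End_P] by (simp add: op_H_def)

lemma comp_in_End_P: "\<lbrakk>f \<in> carrier End_P; g \<in> carrier End_P\<rbrakk> \<Longrightarrow> f \<circ> g \<in> carrier End_P"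
  using End_P.m_closed by simp

lemma add_in_End_P: "\<lbrakk>f \<in> carrier End_P; g \<in> carrier End_P\<rbrakk> \<Longrightarrow> (\<lambda>p. f p + g p) \<in> carrier End_P"
  using End_P.a_closed by simp

lemma id_in_End_P: "id \<in> carrier End_P"
  using End_P.one_closed by simp

text \<open>Subtraction of exponents truncates at zero, so lowering and raising cancel only where
  \<open>x_i\<close> occurs.\<close>

lemma exp_diff_add:
  "Poly_Mapping.lookup \<alpha> i \<noteq> 0 \<Longrightarrow>
    \<alpha> - Poly_Mapping.single i (1::nat) + Poly_Mapping.single i 1 = \<alpha>"
  by (rule poly_mapping_eqI) (auto simp: lookup_add lookup_minus lookup_single when_def)

lemma op_D_J: "op_D i \<circ> op_J i = (id :: ('k::field_char_0, 'n) endo)"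
proof (rule End_P_eqI)
  fix \<alpha> :: "'n \<Rightarrow>\<^sub>0 nat"
  \<comment> \<open>Characteristic zero enters here: integration divides by this number.\<close>
  have "(1 + of_nat (Poly_Mapping.lookup \<alpha> i) :: 'k) \<noteq> 0"
    by (metis of_nat_Suc of_nat_neq_0)
  then show "(op_D i \<circ> op_J i) (Poly_Mapping.single \<alpha> 1 :: ('k, 'n) pol) = id (Poly_Mapping.single \<alpha> 1)"
    by (simp add: op_D_single op_J_single lookup_add add.commute)
qed (intro comp_in_End_P op_in_End_P id_in_End_P)+

lemma op_D_X: "op_D i \<circ> op_X i = (\<lambda>p :: ('k::field_char_0, 'n) pol. p + op_X i (op_D i p))"
proof (rule End_P_eqI)
  fix \<alpha> :: "'n \<Rightarrow>\<^sub>0 nat"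
  show "(op_D i \<circ> op_X i) (Poly_Mapping.single \<alpha> 1 :: ('k, 'n) pol)
      = Poly_Mapping.single \<alpha> 1 + op_X i (op_D i (Poly_Mapping.single \<alpha> 1))"
    \<comment> \<open>If \<open>x_i\<close> does not occur in the monomial,
      \<open>\<partial>_i\<close> kills it and the second summand vanishes; otherwise lowering and
      raising the exponent cancel.\<close>
    using exp_diff_add[of \<alpha> i]
    by (cases "Poly_Mapping.lookup \<alpha> i = 0")
      (simp_all add: op_D_single op_X_single lookup_add single_add[symmetric] End_P_zero[OF op_X_in_End_P])
  show "(\<lambda>p. p + op_X i (op_D i p)) \<in> carrier (End_P :: ('k, 'n) endo ring)"
    using add_in_End_P[OF id_in_End_P comp_in_End_P[OF op_X_in_End_P op_D_in_End_P]] by simp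
qed (intro comp_in_End_P op_in_End_P)

text \<open>\<open>J \<partial>\<close> fixes every multiple of \<open>x_i\<close>. With
  \<open>H = \<partial> x\<close> this says \<open>x = J H\<close>, so the action of
  \<open>x\<close> is determined by those of \<open>J\<close> and \<open>H\<close>.\<close>

lemma op_J_D_X: "op_J i \<circ> (op_D i \<circ> op_X i) = (op_X i :: ('k::field_char_0, 'n) endo)"
proof (rule End_P_eqI)
  fix \<alpha> :: "'n \<Rightarrow>\<^sub>0 nat"
  have "(1 + of_nat (Poly_Mapping.lookup \<alpha> i) :: 'k) \<noteq> 0"
    by (metis of_nat_Suc of_nat_neq_0)
  then show "(op_J i \<circ> (op_D i \<circ> op_X i)) (Poly_Mapping.single \<alpha> 1 :: ('k, 'n) pol)
      = op_X i (Poly_Mapping.single \<alpha> 1)"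
    by (simp add: op_D_single op_X_single op_J_single lookup_add add.commute)
qed (intro comp_in_End_P op_in_End_P)+

lemma op_commute:
  fixes f g :: "('k::field_char_0, 'n) endo"
  assumes "i \<noteq> j" "f \<in> {op_X i, op_D i, op_J i}" "g \<in> {op_X j, op_D j, op_J j}"
  shows "f \<circ> g = g \<circ> f"
proof (rule End_P_eqI)
  fix \<alpha> :: "'n \<Rightarrow>\<^sub>0 nat"
  let ?e = "\<lambda>i. Poly_Mapping.single i (1::nat)"
  have "\<alpha> + ?e i - ?e j = \<alpha> - ?e j + ?e i" "\<alpha> + ?e j - ?e i = \<alpha> - ?e i + ?e j"
    "\<alpha> - ?e i - ?e j = \<alpha> - ?e j - ?e i"
    using assms(1)
    by (auto intro!: poly_mapping_eqI simp: lookup_add lookup_minus lookup_single when_def)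
  then show "(f \<circ> g) (Poly_Mapping.single \<alpha> 1) = (g \<circ> f) (Poly_Mapping.single \<alpha> 1)"
    using assms
    by (auto simp: op_X_single op_D_single op_J_single lookup_add lookup_minus lookup_single
        add.commute add.left_commute mult.commute)
qed (use assms in \<open>auto intro!: comp_in_End_P op_in_End_P\<close>)

subsection \<open>The algebras \<open>I_n\<close>, \<open>I_1\<close> and \<open>D_n\<close>\<close>

lemma I_n_gens: "Set.range op_X \<union> Set.range op_D \<union> Set.range op_J \<subseteq> carrier End_P"
  by (auto intro: op_in_End_P)

lemma I_1_gens: "{op_X i, op_D i, op_J i} \<subseteq> carrier End_P"
  by (auto intro: op_in_End_P)

lemma D_n_gens: "Set.range op_H \<subseteq> carrier End_P"
  by (auto intro: op_H_in_End_P)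

lemma ring_I_n: "ring I_n" unfolding I_n_def by (rule ring_gen_algebra[OF I_n_gens])
lemma ring_I_1: "ring (I_1 i)" unfolding I_1_def by (rule ring_gen_algebra[OF I_1_gens])
lemma ring_D_n: "ring D_n" unfolding D_n_def by (rule ring_gen_algebra[OF D_n_gens])

lemma I_n_simps [simp]:
  "f \<otimes>\<^bsub>I_n\<^esub> g = f \<circ> g" "\<one>\<^bsub>I_n\<^esub> = id" "\<zero>\<^bsub>I_n\<^esub> = (\<lambda>p. 0)" "f \<oplus>\<^bsub>I_n\<^esub> g = (\<lambda>p. f p + g p)"
  by (simp_all add: I_n_def)

lemma I_1_simps [simp]:
  "f \<otimes>\<^bsub>I_1 i\<^esub> g = f \<circ> g" "\<one>\<^bsub>I_1 i\<^esub> = id" "\<zero>\<^bsub>I_1 i\<^esub> = (\<lambda>p. 0)" "f \<oplus>\<^bsub>I_1 i\<^esub> g = (\<lambda>p. f p + g p)"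
  by (simp_all add: I_1_def)

lemma D_n_simps [simp]:
  "f \<otimes>\<^bsub>D_n\<^esub> g = f \<circ> g" "\<one>\<^bsub>D_n\<^esub> = id" "\<zero>\<^bsub>D_n\<^esub> = (\<lambda>p. 0)" "f \<oplus>\<^bsub>D_n\<^esub> g = (\<lambda>p. f p + g p)"
  by (simp_all add: D_n_def)

lemmas I_n_comp [intro, simp] = gen_algebra_comp[OF I_n_gens, folded I_n_def]
lemmas I_n_add [intro, simp] = gen_algebra_add[OF I_n_gens, folded I_n_def]
lemmas I_n_diff [intro, simp] = gen_algebra_diff[OF I_n_gens, folded I_n_def]
lemmas I_n_funpow [intro, simp] = gen_algebra_funpow[OF I_n_gens, folded I_n_def]
lemmas I_n_pscale [intro, simp] = gen_algebra_pscale[OF I_n_gens, folded I_n_def]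
lemmas I_n_id [intro, simp] = gen_algebra_id[OF I_n_gens, folded I_n_def]
lemmas I_n_zero [intro, simp] = gen_algebra_zero[OF I_n_gens, folded I_n_def]
lemmas I_n_subset_End_P = gen_algebra_subset_End_P[OF I_n_gens, folded I_n_def]
lemmas I_n_induct = gen_algebra_induct[OF I_n_gens, folded I_n_def, consumes 1, case_names pscale gen add comp]

lemmas I_1_comp [intro, simp] = gen_algebra_comp[OF I_1_gens, folded I_1_def]
lemmas I_1_add [intro, simp] = gen_algebra_add[OF I_1_gens, folded I_1_def]
lemmas I_1_diff [intro, simp] = gen_algebra_diff[OF I_1_gens, folded I_1_def]
lemmas I_1_funpow [intro, simp] = gen_algebra_funpow[OF I_1_gens, folded I_1_def]
lemmas I_1_pscale [intro, simp] = gen_algebra_pscale[OF I_1_gens, folded I_1_def]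
lemmas I_1_id [intro, simp] = gen_algebra_id[OF I_1_gens, folded I_1_def]
lemmas I_1_zero [intro, simp] = gen_algebra_zero[OF I_1_gens, folded I_1_def]
lemmas I_1_subset_End_P = gen_algebra_subset_End_P[OF I_1_gens, folded I_1_def]
lemmas I_1_induct = gen_algebra_induct[OF I_1_gens, folded I_1_def, consumes 1, case_names pscale gen add comp]

lemma I_n_op [intro, simp]:
  "op_X i \<in> carrier I_n" "op_D i \<in> carrier I_n" "op_J i \<in> carrier I_n"
  unfolding I_n_def by (rule gen_algebra_gen[OF I_n_gens], blast)+

lemma I_1_op [intro, simp]:
  "op_X i \<in> carrier (I_1 i)" "op_D i \<in> carrier (I_1 i)" "op_J i \<in> carrier (I_1 i)"
  unfolding I_1_def by (rule gen_algebra_gen[OF I_1_gens], blast)+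

lemma op_H_I_1 [intro, simp]: "op_H i \<in> carrier (I_1 i)" by (simp add: op_H_def)
lemma op_H_I_n [intro, simp]: "op_H i \<in> carrier I_n" by (simp add: op_H_def)

lemma H_minus_I_1 [intro, simp]: "H_minus i c \<in> carrier (I_1 i)"
  using I_1_diff[OF op_H_I_1 I_1_pscale] by (simp add: H_minus_def[abs_def])

lemma H_minus_I_n [intro, simp]: "H_minus i c \<in> carrier I_n"
  using I_n_diff[OF op_H_I_n I_n_pscale] by (simp add: H_minus_def[abs_def])

lemma I_1_subset_I_n: "a \<in> carrier (I_1 i) \<Longrightarrow> a \<in> carrier I_n"
proof (induction rule: I_1_induct)
  case (comp f g)
  show ?case by (rule I_n_comp[OF comp(3,4)])
qed auto

lemma D_n_subset_I_n: "a \<in> carrier D_n \<Longrightarrow> a \<in> carrier I_n"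
  unfolding D_n_def
proof (induction rule: gen_algebra_induct[OF D_n_gens, consumes 1, case_names pscale gen add comp])
  case (comp f g)
  show ?case by (rule I_n_comp[OF comp(3,4)])
qed auto

lemma H_minus_D_n: "H_minus i c \<in> carrier D_n"
proof -
  have "op_H i \<in> carrier D_n" unfolding D_n_def by (rule gen_algebra_gen[OF D_n_gens]) auto
  then have "(\<lambda>p. op_H i p - pscale c p) \<in> carrier D_n"
    unfolding D_n_def by (intro gen_algebra_diff gen_algebra_pscale D_n_gens)
  then show ?thesis by (simp add: H_minus_def[abs_def])
qed

lemma I_n_pscale_commute: "a \<in> carrier I_n \<Longrightarrow> a \<circ> pscale c = pscale c \<circ> a"
  using I_n_subset_End_P by (auto simp: End_P_pscale fun_eq_iff)

text \<open>The operators that commute with a fixed one contain the scalars and are closed under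
  sums and products. The claim therefore passes from the generators to the algebra, for
  \<open>b\<close> with a generator on the left and then for \<open>a\<close>.\<close>

lemma I_1_commute:
  assumes "i \<noteq> j" "a \<in> carrier (I_1 i)" "b \<in> carrier (I_1 j)"
  shows "a \<circ> b = b \<circ> a"
proof -
  have gens: "g \<circ> b = b \<circ> g" if g: "g \<in> {op_X i, op_D i, op_J i}" for g
    using assms(3)
  proof (induction rule: I_1_induct)
    case (pscale c)
    have "g \<in> carrier I_n" using g by auto
    then show ?case by (rule I_n_pscale_commute)
  next
    case (gen h)
    then show ?case using op_commute[OF assms(1) g] by blast
  next
    case (add f h)
    have "g \<in> carrier End_P" using g by (auto intro: op_in_End_P)
    then show ?case using add by (auto simp: fun_eq_iff End_P_add)
  next
    case (comp f h)
    then show ?case unfolding fun_eq_iff comp_apply by metis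
  qed
  have "b \<in> carrier End_P" by (rule subsetD[OF I_1_subset_End_P assms(3)])
  note bl = End_P_add[OF this]
  have bI: "b \<in> carrier I_n" using assms(3) by (rule I_1_subset_I_n)
  show ?thesis using assms(2)
  proof (induction rule: I_1_induct)
    case (pscale c)
    show ?case by (rule I_n_pscale_commute[OF bI, symmetric])
  next
    case (gen g)
    then show ?case by (rule gens)
  next
    case (add f h)
    then show ?case by (auto simp: fun_eq_iff bl)
  next
    case (comp f h)
    then show ?case unfolding fun_eq_iff comp_apply by metis
  qed
qed

section \<open>Modules over \<open>I_n\<close>\<close>

locale I_module = left_module "I_n :: ('k::field_char_0, 'n::finite) endo ring" M
  for M :: "(('k::field_char_0, 'n::finite) endo, 'm) module" (structure)
begin

lemma act_comp:
  "\<lbrakk>a \<in> carrier I_n; b \<in> carrier I_n; x \<in> carrier M\<rbrakk> \<Longrightarrow>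
    (a \<circ> b) \<odot> x = a \<odot> (b \<odot> x)"
  using smult_assoc1[of a b x] by simp

lemma act_add:
  "\<lbrakk>a \<in> carrier I_n; b \<in> carrier I_n; x \<in> carrier M\<rbrakk> \<Longrightarrow>
    (\<lambda>p. a p + b p) \<odot> x = a \<odot> x \<oplus> b \<odot> x"
  using smult_l_distr[of a b x] by simp

lemma act_id [simp]: "x \<in> carrier M \<Longrightarrow> id \<odot> x = x"
  using smult_one[of x] by simp

lemma act_ident [simp]: "x \<in> carrier M \<Longrightarrow> (\<lambda>p. p) \<odot> x = x"
  using act_id[of x] by (simp only: id_def)

lemma act_zero [simp]: "x \<in> carrier M \<Longrightarrow> (\<lambda>p. 0) \<odot> x = \<zero>"
  using smult_l_null[of x] by simp

lemma act_pscale_1 [simp]: "x \<in> carrier M \<Longrightarrow> pscale 1 \<odot> x = x"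
proof -
  have "pscale 1 = (id :: ('k, 'n) endo)" by auto
  then show "x \<in> carrier M \<Longrightarrow> pscale 1 \<odot> x = x" by (simp only: act_id)
qed

lemma act_pscale_0 [simp]: "x \<in> carrier M \<Longrightarrow> pscale 0 \<odot> x = \<zero>"
proof -
  have "pscale 0 = (\<lambda>p. 0 :: ('k, 'n) pol)" by auto
  then show "x \<in> carrier M \<Longrightarrow> pscale 0 \<odot> x = \<zero>" by (simp only: act_zero)
qed

lemma act_pscale_add:
  assumes "x \<in> carrier M"
  shows "pscale (b + c) \<odot> x = pscale b \<odot> x \<oplus> pscale c \<odot> x"
proof -
  have "pscale (b + c) = (\<lambda>p :: ('k, 'n) pol. pscale b p + pscale c p)"
    by (auto simp: pscale.scale_left_distrib)
  then show ?thesis using act_add[OF _ _ assms] by (simp only: I_n_pscale)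
qed

lemma act_pscale_mult:
  assumes "x \<in> carrier M"
  shows "pscale (b * c) \<odot> x = pscale b \<odot> (pscale c \<odot> x)"
proof -
  have "pscale (b * c) = (pscale b \<circ> pscale c :: ('k, 'n) endo)" by auto
  then show ?thesis using act_comp[OF _ _ assms] by (simp only: I_n_pscale)
qed

lemma act_pscale_minus_1: "x \<in> carrier M \<Longrightarrow> pscale (-1) \<odot> x = \<ominus> x"
  using act_pscale_add[of x "-1" 1] by (metis M.minus_equality act_pscale_0 act_pscale_1
      add.left_inverse I_n_pscale smult_closed)

lemma act_pscale_eq_0_iff:
  assumes "x \<in> carrier M"
  shows "pscale c \<odot> x = \<zero> \<longleftrightarrow> c = 0 \<or> x = \<zero>"
proof -
  have "x = \<zero>" if "pscale c \<odot> x = \<zero>" "c \<noteq> 0"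
    using act_pscale_mult[OF assms, of "inverse c" c] that assms by simp
  then show ?thesis using assms by auto
qed

lemma act_commute:
  assumes "a \<circ> b = b \<circ> a" "a \<in> carrier I_n" "b \<in> carrier I_n" "x \<in> carrier M"
  shows "a \<odot> (b \<odot> x) = b \<odot> (a \<odot> x)"
  using act_comp[OF assms(2,3,4)] act_comp[OF assms(3,2,4)] assms(1) by simp

lemma act_pscale_commute:
  "\<lbrakk>a \<in> carrier I_n; x \<in> carrier M\<rbrakk> \<Longrightarrow>
    a \<odot> (pscale c \<odot> x) = pscale c \<odot> (a \<odot> x)"
  by (rule act_commute[OF I_n_pscale_commute]) auto

lemma act_I_1_commute:
  assumes "i \<noteq> j" "a \<in> carrier (I_1 i)" "b \<in> carrier (I_1 j)" "x \<in> carrier M"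
  shows "a \<odot> (b \<odot> x) = b \<odot> (a \<odot> x)"
  by (rule act_commute[OF I_1_commute[OF assms(1-3)]])
    (use assms in \<open>auto intro: I_1_subset_I_n\<close>)

lemma act_funpow_Suc:
  assumes "a \<in> carrier I_n" "x \<in> carrier M"
  shows "(a ^^ Suc k) \<odot> x = a \<odot> ((a ^^ k) \<odot> x)"
    and "(a ^^ Suc k) \<odot> x = (a ^^ k) \<odot> (a \<odot> x)"
proof -
  show "(a ^^ Suc k) \<odot> x = a \<odot> ((a ^^ k) \<odot> x)"
    unfolding funpow.simps by (rule act_comp[OF assms(1) I_n_funpow[OF assms(1)] assms(2)])
  show "(a ^^ Suc k) \<odot> x = (a ^^ k) \<odot> (a \<odot> x)"
    unfolding funpow_Suc_right by (rule act_comp[OF I_n_funpow[OF assms(1)] assms(1) assms(2)])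
qed

lemma act_funpow_commute:
  assumes "a \<in> carrier I_n" "x \<in> carrier M"
  shows "a \<odot> ((a ^^ k) \<odot> x) = (a ^^ k) \<odot> (a \<odot> x)"
  using act_funpow_Suc[OF assms, of k] by (rule trans[OF sym])

lemma act_funpow_0 [simp]: "x \<in> carrier M \<Longrightarrow> (a ^^ 0) \<odot> x = x"
  unfolding funpow.simps by simp

lemma act_funpow_add:
  assumes "a \<in> carrier I_n" "x \<in> carrier M"
  shows "(a ^^ (j + k)) \<odot> x = (a ^^ j) \<odot> ((a ^^ k) \<odot> x)"
  unfolding funpow_add by (rule act_comp) (use assms in auto)

lemma D_J_act [simp]: "x \<in> carrier M \<Longrightarrow> op_D i \<odot> (op_J i \<odot> x) = x"
  using act_comp[of "op_D i" "op_J i" x] by (simp add: op_D_J)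

lemma D_X_act:
  assumes "x \<in> carrier M"
  shows "op_D i \<odot> (op_X i \<odot> x) = x \<oplus> op_X i \<odot> (op_D i \<odot> x)"
proof -
  have "op_D i \<odot> (op_X i \<odot> x) = (op_D i \<circ> op_X i) \<odot> x"
    using assms by (simp only: act_comp I_n_op)
  also have "(op_D i \<circ> op_X i) = (\<lambda>p. id p + (op_X i \<circ> op_D i) p)"
    by (simp add: op_D_X)
  also have "\<dots> \<odot> x = id \<odot> x \<oplus> (op_X i \<circ> op_D i) \<odot> x"
    by (rule act_add[OF I_n_id I_n_comp[OF I_n_op(1) I_n_op(2)] assms])
  finally show ?thesis using assms by (simp only: act_comp I_n_op act_id)
qed

lemma J_D_X_act:
  assumes "x \<in> carrier M"
  shows "op_J i \<odot> (op_D i \<odot> (op_X i \<odot> x)) = op_X i \<odot> x"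
proof -
  have "op_J i \<odot> (op_D i \<odot> (op_X i \<odot> x)) = (op_J i \<circ> (op_D i \<circ> op_X i)) \<odot> x"
    using assms by (simp only: act_comp I_n_op I_n_comp smult_closed)
  then show ?thesis by (simp only: op_J_D_X)
qed

lemma H_act: "x \<in> carrier M \<Longrightarrow> op_H i \<odot> x = op_D i \<odot> (op_X i \<odot> x)"
  unfolding op_H_def by (simp only: act_comp I_n_op)

lemma X_eq_J_H: "x \<in> carrier M \<Longrightarrow> op_X i \<odot> x = op_J i \<odot> (op_H i \<odot> x)"
  by (simp add: H_act J_D_X_act)

text \<open>On eigenvectors this means that \<open>\<partial>\<close> lowers the eigenvalue of
  \<open>H\<close> by one; \<open>H_J_act\<close> is the counterpart by which \<open>J\<close>
  raises it.\<close>

lemma D_H_act: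
  assumes "x \<in> carrier M"
  shows "op_D i \<odot> (op_H i \<odot> x) = op_H i \<odot> (op_D i \<odot> x) \<oplus> op_D i \<odot> x"
  using assms by (simp add: H_act D_X_act smult_r_distr M.a_comm)

lemma H_J_act:
  assumes "x \<in> carrier M"
  shows "op_H i \<odot> (op_J i \<odot> x) = op_J i \<odot> (op_H i \<odot> x) \<oplus> op_J i \<odot> x"
  using assms D_X_act[of "op_J i \<odot> x" i]
  by (simp add: X_eq_J_H[symmetric]) (simp add: H_act M.a_comm)

text \<open>A factor \<open>J\<close> can be pulled to the left through \<open>x\<close> at the
  price of an extra summand. This keeps divisibility by powers of \<open>J\<close> stable under
  \<open>x\<close>.\<close>

lemma X_J_act:
  assumes "x \<in> carrier M"
  shows "op_X i \<odot> (op_J i \<odot> x) = op_J i \<odot> (op_X i \<odot> x \<oplus> op_J i \<odot> x)"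
  using assms by (simp add: X_eq_J_H[of "op_J i \<odot> x"] H_J_act X_eq_J_H[of x])

lemma H_minus_act:
  assumes "x \<in> carrier M"
  shows "H_minus i c \<odot> x = op_H i \<odot> x \<ominus> pscale c \<odot> x"
proof -
  have *: "H_minus i c = (\<lambda>p. op_H i p + (pscale (-1) \<circ> pscale c) p)"
    by (auto simp: H_minus_def)
  have "H_minus i c \<odot> x = op_H i \<odot> x \<oplus> (pscale (-1) \<circ> pscale c) \<odot> x"
    unfolding * by (rule act_add[OF op_H_I_n I_n_comp[OF I_n_pscale I_n_pscale] assms])
  also have "(pscale (-1) \<circ> pscale c) \<odot> x = \<ominus> (pscale c \<odot> x)"
    using assms by (simp only: act_comp I_n_pscale act_pscale_minus_1 smult_closed)
  finally show ?thesis by (simp only: a_minus_def)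
qed

lemma H_minus_eq_0_iff:
  assumes "x \<in> carrier M"
  shows "H_minus i c \<odot> x = \<zero> \<longleftrightarrow> op_H i \<odot> x = pscale c \<odot> x"
  using assms by (simp add: H_minus_act M.minus_eq)
    (metis I_n_pscale M.add.inv_closed M.minus_equality M.minus_minus M.r_neg op_H_I_n smult_closed)

lemma funpow_D_J_act [simp]:
  assumes "x \<in> carrier M"
  shows "(op_D i ^^ k) \<odot> ((op_J i ^^ k) \<odot> x) = x"
  using assms
proof (induction k)
  case (Suc k)
  then show ?case
    by (simp only: act_funpow_Suc(2)[of "op_D i"] act_funpow_Suc(1)[of "op_J i"] I_n_op I_n_funpow
        smult_closed D_J_act)
qed simp

lemma submodule_generatorsI:
  assumes "N \<subseteq> carrier M" "\<zero> \<in> N"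
    and add: "\<And>x y. \<lbrakk>x \<in> N; y \<in> N\<rbrakk> \<Longrightarrow> x \<oplus> y \<in> N"
    and ps: "\<And>c x. x \<in> N \<Longrightarrow> pscale c \<odot> x \<in> N"
    and gen: "\<And>g i x. \<lbrakk>g \<in> {op_X i, op_D i, op_J i}; x \<in> N\<rbrakk> \<Longrightarrow> g \<odot> x \<in> N"
  shows "submodule N I_n M"
proof (rule submoduleI)
  have "\<forall>x\<in>N. a \<odot> x \<in> N" if "a \<in> carrier I_n" for a
    using that
  proof (induction rule: I_n_induct)
    case (gen g)
    then obtain i where "g \<in> {op_X i, op_D i, op_J i}" by auto
    then show ?case using assms(5) by blast
  next
    case (add f g)
    then show ?case using assms(1) assms(3) by (auto simp: act_add)
  next
    case (comp f g)
    show ?case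
    proof
      fix x assume "x \<in> N"
      then show "(f \<circ> g) \<odot> x \<in> N"
        using comp act_comp[OF comp(1,2), of x] assms(1) by auto
    qed
  qed (use ps in auto)
  then show "\<And>a x. \<lbrakk>a \<in> carrier I_n; x \<in> N\<rbrakk> \<Longrightarrow> a \<odot> x \<in> N" by blast
qed (use assms in auto)

subsection \<open>The locally nilpotent and the divisible part for one variable\<close>

definition nil :: "'n \<Rightarrow> 'm set" where
  "nil i = {m \<in> carrier M. \<exists>k. (op_D i ^^ k) \<odot> m = \<zero>}"

text \<open>The largest submodule on which \<open>J \<partial> = 1\<close>, so that
  \<open>\<partial>\<close> and \<open>J\<close> are inverse to each other there. Its counterpart
  \<open>nil i\<close> is the torsion with respect to the powers of
  \<open>\<partial>\<close>.\<close>

definition dvs :: "'n \<Rightarrow> 'm set" where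
  "dvs i = {m \<in> carrier M. \<forall>k. \<exists>x\<in>carrier M. m = (op_J i ^^ k) \<odot> x}"

lemma nil_mono:
  assumes "m \<in> carrier M" "(op_D i ^^ k) \<odot> m = \<zero>" "k \<le> l"
  shows "(op_D i ^^ l) \<odot> m = \<zero>"
  using act_funpow_add[of "op_D i" m "l - k" k] assms by simp

text \<open>By \<open>\<partial> x = 1 + x \<partial>\<close>, one application of \<open>x\<close>
  raises the nilpotency index by at most one.\<close>

lemma nil_X:
  assumes "m \<in> carrier M" "(op_D i ^^ k) \<odot> m = \<zero>"
  shows "(op_D i ^^ Suc k) \<odot> (op_X i \<odot> m) = \<zero>"
  using assms
proof (induction k arbitrary: m)
  case 0
  then show ?case by simp
next
  case (Suc k)
  have "(op_D i ^^ k) \<odot> (op_D i \<odot> m) = \<zero>"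
    using Suc.prems act_funpow_Suc(2)[of "op_D i" m k] by (simp only: I_n_op)
  then have "(op_D i ^^ Suc k) \<odot> (op_X i \<odot> (op_D i \<odot> m)) = \<zero>"
    using Suc.prems(1) by (intro Suc.IH) auto
  moreover have "(op_D i ^^ Suc (Suc k)) \<odot> (op_X i \<odot> m)
      = (op_D i ^^ Suc k) \<odot> (m \<oplus> op_X i \<odot> (op_D i \<odot> m))"
    using act_funpow_Suc(2)[of "op_D i" "op_X i \<odot> m" "Suc k"] Suc.prems(1)
    by (simp only: I_n_op smult_closed D_X_act)
  ultimately show ?case
    using Suc.prems by (simp only: smult_r_distr I_n_op I_n_funpow smult_closed M.l_zero M.zero_closed)
qed

lemma submodule_nil: "submodule (nil i) I_n M"
proof (rule submodule_generatorsI)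
  show "nil i \<subseteq> carrier M" by (auto simp: nil_def)
  show "\<zero> \<in> nil i" by (auto simp: nil_def)
  show "pscale c \<odot> x \<in> nil i" if x: "x \<in> nil i" for c x
  proof -
    obtain k where "x \<in> carrier M" "(op_D i ^^ k) \<odot> x = \<zero>" using x by (auto simp: nil_def)
    then have "(op_D i ^^ k) \<odot> (pscale c \<odot> x) = \<zero>" by (simp add: act_pscale_commute)
    then show ?thesis using \<open>x \<in> carrier M\<close> by (auto simp: nil_def)
  qed
  show "x \<oplus> y \<in> nil i" if xy: "x \<in> nil i" "y \<in> nil i" for x y
  proof -
    obtain k l where kl: "(op_D i ^^ k) \<odot> x = \<zero>" "(op_D i ^^ l) \<odot> y = \<zero>"
      and c: "x \<in> carrier M" "y \<in> carrier M"
      using xy by (auto simp: nil_def)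
    have "(op_D i ^^ (max k l)) \<odot> (x \<oplus> y) = \<zero>"
      using nil_mono[OF c(1) kl(1), of "max k l"] nil_mono[OF c(2) kl(2), of "max k l"] c
      by (simp add: smult_r_distr)
    then show ?thesis using c by (auto simp: nil_def)
  qed
  show "g \<odot> x \<in> nil i" if g: "g \<in> {op_X j, op_D j, op_J j}" and x: "x \<in> nil i" for g j x
  proof -
    have gI: "g \<in> carrier (I_1 j)" using g by auto
    have xc: "x \<in> carrier M" using x by (simp add: nil_def)
    then have gx: "g \<odot> x \<in> carrier M" using I_1_subset_I_n[OF gI] by simp
    obtain k where k: "(op_D i ^^ k) \<odot> x = \<zero>" using x by (auto simp: nil_def)
    show ?thesis
    proof (cases "j = i")
      case False
      have "(op_D i ^^ k) \<odot> (g \<odot> x) = g \<odot> ((op_D i ^^ k) \<odot> x)"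
        by (rule act_I_1_commute) (use False gI xc in auto)
      then show ?thesis using k gx I_1_subset_I_n[OF gI] by (auto simp: nil_def)
    next
      case True
      \<comment> \<open>In its own variable \<open>J\<close> raises the exponent by one,
        \<open>\<partial>\<close> does not raise it, and \<open>x\<close> is covered by
        \<open>nil_X\<close>.\<close>
      have "(op_D i ^^ Suc k) \<odot> (op_J i \<odot> x) = \<zero>"
        using k xc by (simp only: act_funpow_Suc(2) I_n_op smult_closed D_J_act)
      moreover have "(op_D i ^^ k) \<odot> (op_D i \<odot> x) = \<zero>"
        using nil_mono[OF xc k, of "Suc k"] xc
        by (simp only: act_funpow_Suc(2)[symmetric] I_n_op)
      moreover note nil_X[OF xc k]
      ultimately have "\<exists>l. (op_D i ^^ l) \<odot> (g \<odot> x) = \<zero>"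
        using g unfolding True by blast
      then show ?thesis using gx by (simp add: nil_def)
    qed
  qed
qed

text \<open>Induction on \<open>k\<close> along \<open>x J = J (x + J)\<close>: each factor
  \<open>J\<close> moves in front of \<open>x\<close>, and the extra summand \<open>J J^k x\<close>
  is again a multiple of \<open>J^k\<close>.\<close>

lemma dvs_X:
  assumes "x \<in> carrier M"
  shows "\<exists>y\<in>carrier M. op_X i \<odot> ((op_J i ^^ k) \<odot> x) = (op_J i ^^ k) \<odot> y"
proof (induction k)
  case 0
  then show ?case using assms by (auto intro!: bexI[of _ "op_X i \<odot> x"])
next
  case (Suc k)
  then obtain y where y: "y \<in> carrier M"
    "op_X i \<odot> ((op_J i ^^ k) \<odot> x) = (op_J i ^^ k) \<odot> y" by auto
  let ?J = "(op_J i ^^ k) \<odot> x"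
  have J: "?J \<in> carrier M" using assms by simp
  have "op_X i \<odot> ((op_J i ^^ Suc k) \<odot> x) = op_X i \<odot> (op_J i \<odot> ?J)"
    using assms by (simp only: act_funpow_Suc(1) I_n_op)
  also have "\<dots> = op_J i \<odot> (op_X i \<odot> ?J \<oplus> op_J i \<odot> ?J)"
    by (rule X_J_act[OF J])
  also have "op_J i \<odot> ?J = (op_J i ^^ k) \<odot> (op_J i \<odot> x)"
    by (rule act_funpow_commute) (use assms in auto)
  also have "op_X i \<odot> ?J \<oplus> \<dots> = (op_J i ^^ k) \<odot> (y \<oplus> op_J i \<odot> x)"
    using y assms by (simp add: smult_r_distr)
  also have "op_J i \<odot> \<dots> = (op_J i ^^ Suc k) \<odot> (y \<oplus> op_J i \<odot> x)"
    using y assms by (simp only: act_funpow_Suc(1) I_n_op smult_closed M.a_closed)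
  finally show ?case by (rule bexI) (use y assms in simp)
qed

lemma submodule_dvs: "submodule (dvs i) I_n M"
proof (rule submodule_generatorsI)
  show "dvs i \<subseteq> carrier M" by (auto simp: dvs_def)
  show "\<zero> \<in> dvs i" by (auto simp: dvs_def intro!: bexI[of _ "\<zero>"])
  show "pscale c \<odot> x \<in> dvs i" if x: "x \<in> dvs i" for c x
    unfolding dvs_def mem_Collect_eq
  proof (intro conjI allI)
    show "pscale c \<odot> x \<in> carrier M" using x by (simp add: dvs_def)
    fix k
    obtain y where "y \<in> carrier M" "x = (op_J i ^^ k) \<odot> y" using x by (auto simp: dvs_def)
    then show "\<exists>y\<in>carrier M. pscale c \<odot> x = (op_J i ^^ k) \<odot> y"
      by (auto intro!: bexI[of _ "pscale c \<odot> y"] simp: act_pscale_commute)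
  qed
  show "x \<oplus> y \<in> dvs i" if xy: "x \<in> dvs i" "y \<in> dvs i" for x y
    unfolding dvs_def mem_Collect_eq
  proof (intro conjI allI)
    show "x \<oplus> y \<in> carrier M" using xy by (simp add: dvs_def)
    fix k
    obtain x' y' where "x' \<in> carrier M" "x = (op_J i ^^ k) \<odot> x'"
      "y' \<in> carrier M" "y = (op_J i ^^ k) \<odot> y'"
      using xy unfolding dvs_def by blast
    then show "\<exists>z\<in>carrier M. x \<oplus> y = (op_J i ^^ k) \<odot> z"
      by (intro bexI[of _ "x' \<oplus> y'"]) (simp_all add: smult_r_distr)
  qed
  show "g \<odot> x \<in> dvs i" if g: "g \<in> {op_X j, op_D j, op_J j}" and x: "x \<in> dvs i" for g j x
    unfolding dvs_def mem_Collect_eq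
  proof (intro conjI allI)
    have gI: "g \<in> carrier (I_1 j)" using g by auto
    note gn = I_1_subset_I_n[OF gI]
    have xc: "x \<in> carrier M" using x by (simp add: dvs_def)
    then show gx: "g \<odot> x \<in> carrier M" using gn by simp
    fix k
    obtain y where y: "y \<in> carrier M" "x = (op_J i ^^ k) \<odot> y" using x by (auto simp: dvs_def)
    show "\<exists>y\<in>carrier M. g \<odot> x = (op_J i ^^ k) \<odot> y"
    proof (cases "j = i")
      case False
      have "g \<odot> ((op_J i ^^ k) \<odot> y) = (op_J i ^^ k) \<odot> (g \<odot> y)"
        by (rule act_I_1_commute) (use False gI y in auto)
      then show ?thesis using y gn by (auto intro!: bexI[of _ "g \<odot> y"])
    next
      case True
      have "op_J i \<odot> x = (op_J i ^^ k) \<odot> (op_J i \<odot> y)"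
        unfolding y(2) by (rule act_funpow_commute) (use y in auto)
      then have J: ?thesis if "g = op_J i" using that y(1) by (auto intro!: bexI[of _ "op_J i \<odot> y"])
      \<comment> \<open>\<open>\<partial>\<close> uses up one factor \<open>J\<close>, so
        divisibility is taken one power higher.\<close>
      obtain z where z: "z \<in> carrier M" "x = (op_J i ^^ Suc k) \<odot> z"
        using x unfolding dvs_def by blast
      have "op_D i \<odot> x = (op_J i ^^ k) \<odot> z"
        unfolding z(2) using z(1) by (simp only: act_funpow_Suc(1) I_n_op I_n_funpow smult_closed D_J_act)
      then have D: ?thesis if "g = op_D i" using that z(1) by auto
      have X: ?thesis if "g = op_X i" using that dvs_X[OF y(1), of i k] y(2) by auto
      show ?thesis using g True J D X by auto
    qed
  qed
qed

lemma dvs_eq: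
  assumes "x \<in> dvs i"
  shows "(op_J i ^^ k) \<odot> ((op_D i ^^ k) \<odot> x) = x"
proof -
  obtain y where "y \<in> carrier M" "x = (op_J i ^^ k) \<odot> y"
    using assms by (auto simp: dvs_def)
  then show ?thesis by simp
qed

lemma dvs_J_D:
  assumes "x \<in> dvs i"
  shows "op_J i \<odot> (op_D i \<odot> x) = x"
proof -
  obtain y where y: "y \<in> carrier M" "x = (op_J i ^^ Suc 0) \<odot> y"
    using assms unfolding dvs_def by blast
  then have "x = op_J i \<odot> y" by (simp only: act_funpow_Suc(1) I_n_op act_funpow_0)
  then show ?thesis using y(1) by simp
qed

text \<open>The witness for \<open>k\<close> is \<open>\<partial>^k x\<close>: in
  \<open>J^k \<partial>^k x\<close> the hypothesis cancels the innermost pair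
  \<open>J \<partial>\<close>, and this repeats down to \<open>x\<close>.\<close>

lemma dvsI:
  assumes "x \<in> carrier M" "\<And>k. op_J i \<odot> (op_D i \<odot> ((op_D i ^^ k) \<odot> x)) = (op_D i ^^ k) \<odot> x"
  shows "x \<in> dvs i"
proof -
  have "x = (op_J i ^^ k) \<odot> ((op_D i ^^ k) \<odot> x)" for k
  proof (induction k)
    case (Suc k)
    have "(op_J i ^^ Suc k) \<odot> ((op_D i ^^ Suc k) \<odot> x)
        = (op_J i ^^ k) \<odot> (op_J i \<odot> (op_D i \<odot> ((op_D i ^^ k) \<odot> x)))"
      using assms(1) by (simp only: act_funpow_Suc(2)[of "op_J i"] act_funpow_Suc(1)[of "op_D i"]
          I_n_op I_n_funpow smult_closed)
    also have "\<dots> = (op_J i ^^ k) \<odot> ((op_D i ^^ k) \<odot> x)" by (simp only: assms(2))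
    finally show ?case using Suc by (rule trans[OF _ sym, rotated])
  qed (use assms in simp)
  then show ?thesis using assms(1) by (auto simp: dvs_def intro!: bexI[of _ "(op_D i ^^ _) \<odot> x"])
qed

lemma nil_dvs_zero:
  assumes "x \<in> nil i" "x \<in> dvs i"
  shows "x = \<zero>"
proof -
  obtain k where "(op_D i ^^ k) \<odot> x = \<zero>" using assms by (auto simp: nil_def)
  then show ?thesis using dvs_eq[OF assms(2), of k] by simp
qed

subsection \<open>Locally \<open>H\<close>-finite elements\<close>

text \<open>A list with repetitions stands for a monic polynomial in \<open>H_i\<close> that splits
  over the field; the fold applies it to \<open>m\<close>.\<close>

definition H_prod :: "'n \<Rightarrow> 'k list \<Rightarrow> 'm \<Rightarrow> 'm" where
  "H_prod i cs m = foldr (\<lambda>c x. H_minus i c \<odot> x) cs m"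

lemma H_prod_simps [simp]:
  "H_prod i [] m = m" "H_prod i (c # cs) m = H_minus i c \<odot> H_prod i cs m"
  by (simp_all add: H_prod_def)

lemma H_prod_closed [simp, intro]: "m \<in> carrier M \<Longrightarrow> H_prod i cs m \<in> carrier M"
  by (induction cs) auto

lemma D_H_minus:
  assumes "x \<in> carrier M"
  shows "op_D i \<odot> (H_minus i c \<odot> x) = H_minus i (c - 1) \<odot> (op_D i \<odot> x)"
proof -
  let ?d = "op_D i \<odot> x"
  have d: "?d \<in> carrier M" using assms by simp
  have "op_D i \<odot> (H_minus i c \<odot> x)
      = (op_H i \<odot> ?d \<oplus> ?d) \<ominus> pscale c \<odot> ?d"
    using assms by (simp add: H_minus_act smult_r_diff D_H_act act_pscale_commute)
  moreover have "pscale c \<odot> ?d = pscale (c - 1) \<odot> ?d \<oplus> ?d"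
    using act_pscale_add[OF d, of "c - 1" 1] d by simp
  moreover have "(a \<oplus> ?d) \<ominus> (b \<oplus> ?d) = a \<ominus> b"
    if "a \<in> carrier M" "b \<in> carrier M" for a b
    using that d by (simp add: M.minus_eq M.minus_add M.a_ac M.r_neg1 M.r_neg2 M.r_neg)
  ultimately show ?thesis using d by (simp add: H_minus_act)
qed

lemma funpow_D_H_minus:
  assumes "x \<in> carrier M"
  shows "(op_D i ^^ k) \<odot> (H_minus i c \<odot> x) = H_minus i (c - of_nat k) \<odot> ((op_D i ^^ k) \<odot> x)"
proof (induction k)
  case 0
  then show ?case using assms by simp
next
  case (Suc k)
  have "(op_D i ^^ Suc k) \<odot> (H_minus i c \<odot> x)
      = op_D i \<odot> (H_minus i (c - of_nat k) \<odot> ((op_D i ^^ k) \<odot> x))"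
    using assms Suc by (simp only: act_funpow_Suc(1) I_n_op H_minus_I_n smult_closed)
  also have "\<dots> = H_minus i (c - of_nat k - 1) \<odot> (op_D i \<odot> ((op_D i ^^ k) \<odot> x))"
    by (rule D_H_minus) (use assms in auto)
  finally show ?case using assms
    by (simp only: act_funpow_Suc(1) I_n_op) (simp add: algebra_simps)
qed

text \<open>\<open>1 - J D\<close> is the matrix unit of index \<open>(0, 0)\<close>; it satisfies \<open>e H = e\<close>.\<close>

definition e00 :: "'n \<Rightarrow> 'm \<Rightarrow> 'm" where
  "e00 i m = m \<ominus> op_J i \<odot> (op_D i \<odot> m)"

lemma e00_closed [simp, intro]: "m \<in> carrier M \<Longrightarrow> e00 i m \<in> carrier M"
  by (simp add: e00_def)

lemma e00_eq_0_iff: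
  "m \<in> carrier M \<Longrightarrow> e00 i m = \<zero> \<longleftrightarrow> op_J i \<odot> (op_D i \<odot> m) = m"
  by (auto simp: e00_def M.minus_eq M.r_neg)
    (metis I_n_op(2,3) M.add.inv_closed M.minus_equality M.minus_minus smult_closed)

lemma e00_H_minus:
  assumes "x \<in> carrier M"
  shows "e00 i (H_minus i c \<odot> x) = pscale (1 - c) \<odot> e00 i x"
proof -
  let ?y = "op_X i \<odot> (op_D i \<odot> x)"
  let ?j = "op_J i \<odot> (op_D i \<odot> x)"
  let ?s = "pscale c \<odot> x" and ?t = "pscale c \<odot> ?j"
  have c: "?y \<in> carrier M" "?j \<in> carrier M" "?s \<in> carrier M" "?t \<in> carrier M" using assms by auto
  \<comment> \<open>Here \<open>e x = 0\<close> enters, in the form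
    \<open>J \<partial> x = x\<close>. As \<open>H = 1 + x \<partial>\<close>, it is the reason for
    \<open>e H = e\<close>.\<close>
  have y: "op_J i \<odot> (op_D i \<odot> ?y) = ?y" using assms by (simp add: J_D_X_act)
  have "e00 i (H_minus i c \<odot> x)
      = ((x \<oplus> ?y) \<ominus> ?s) \<ominus> ((?j \<oplus> ?y) \<ominus> ?t)"
    using assms c y unfolding e00_def
    by (simp add: H_minus_act H_act D_X_act smult_r_diff smult_r_distr act_pscale_commute)
  also have "\<dots> = (x \<ominus> ?j) \<ominus> (?s \<ominus> ?t)"
    using assms c by (simp add: M.minus_eq M.minus_add M.a_ac M.r_neg1 M.r_neg2)
  also have "?s \<ominus> ?t = pscale c \<odot> e00 i x"
    using assms by (simp add: e00_def smult_r_diff)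
  also have "x \<ominus> ?j = e00 i x" by (simp add: e00_def)
  also have "e00 i x \<ominus> pscale c \<odot> e00 i x = pscale (1 - c) \<odot> e00 i x"
    using act_pscale_add[of "e00 i x" 1 "- c"] act_pscale_mult[of "e00 i x" "-1" c] assms
    by (simp add: M.minus_eq act_pscale_minus_1)
  finally show ?thesis .
qed

text \<open>Moving \<open>\<partial>^k\<close> past \<open>H - c\<close> turns it into
  \<open>H - (c - k)\<close>, and \<open>e\<close> replaces this factor by the scalar
  \<open>1 + k - c\<close>. The whole product becomes a scalar, which is nonzero when no root equals
  \<open>1 + k\<close>.\<close>

lemma e00_D_H_prod:
  assumes "m \<in> carrier M" "H_prod i cs m = \<zero>" "1 + of_nat k \<notin> set cs"
  shows "e00 i ((op_D i ^^ k) \<odot> m) = \<zero>"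
proof -
  have "e00 i ((op_D i ^^ k) \<odot> H_prod i cs m)
      = pscale (prod_list (map (\<lambda>c. 1 + of_nat k - c) cs)) \<odot> e00 i ((op_D i ^^ k) \<odot> m)"
    using assms(1)
  proof (induction cs)
    case (Cons c cs)
    then show ?case
      by (simp add: funpow_D_H_minus e00_H_minus act_pscale_mult diff_diff_eq2)
  qed simp
  moreover have "prod_list (map (\<lambda>c. 1 + of_nat k - c) cs) \<noteq> 0"
    using assms(3) by (auto simp: prod_list_zero_iff)
  moreover have "e00 i ((op_D i ^^ k) \<odot> H_prod i cs m) = \<zero>"
    unfolding assms(2) by (simp add: e00_def M.minus_eq)
  ultimately show ?thesis
    using act_pscale_eq_0_iff[of "e00 i ((op_D i ^^ k) \<odot> m)"] assms(1) by auto
qed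

text \<open>Beyond all roots, \<open>e\<close> kills every further derivative of \<open>m\<close>,
  so \<open>w = \<partial>^k m\<close> is infinitely divisible. The vector \<open>v = J^k w\<close>
  has the same image under \<open>\<partial>^k\<close> as \<open>m\<close>, hence the difference is
  nilpotent.\<close>

lemma nil_dvs_decompose:
  assumes "m \<in> carrier M" "H_prod i cs m = \<zero>"
  obtains v where "v \<in> dvs i" "m \<ominus> v \<in> nil i"
proof -
  \<comment> \<open>In characteristic zero the numbers \<open>1 + k\<close> are distinct, so a
    finite list of roots contains only finitely many of them.\<close>
  have "finite {k :: nat. 1 + of_nat k \<in> set cs}"
    by (rule finite_imageD[of "\<lambda>k. 1 + of_nat k"])
      (auto intro: finite_subset[of _ "set cs"] simp: inj_on_def)
  then obtain k where k: "\<And>l. l \<ge> k \<Longrightarrow> 1 + of_nat l \<notin> set cs"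
    unfolding finite_nat_set_iff_bounded by (metis leD mem_Collect_eq)
  define w where "w = (op_D i ^^ k) \<odot> m"
  have w: "w \<in> carrier M" using assms(1) by (simp add: w_def)
  have "w \<in> dvs i"
  proof (rule dvsI[OF w])
    fix l
    have "(op_D i ^^ l) \<odot> w = (op_D i ^^ (l + k)) \<odot> m"
      using assms(1) by (simp add: w_def act_funpow_add)
    moreover have "e00 i ((op_D i ^^ (l + k)) \<odot> m) = \<zero>"
      by (rule e00_D_H_prod[OF assms k]) simp
    ultimately show "op_J i \<odot> (op_D i \<odot> ((op_D i ^^ l) \<odot> w)) = (op_D i ^^ l) \<odot> w"
      using assms(1) by (simp add: e00_eq_0_iff)
  qed
  then have "(op_J i ^^ k) \<odot> w \<in> dvs i" by (intro submodule_smult[OF submodule_dvs]) auto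
  moreover have "(op_D i ^^ k) \<odot> (m \<ominus> (op_J i ^^ k) \<odot> w) = \<zero>"
    using w assms(1) by (simp add: smult_r_distr smult_r_minus w_def M.minus_eq M.r_neg)
  then have "m \<ominus> (op_J i ^^ k) \<odot> w \<in> nil i"
    using w assms(1) by (auto simp: nil_def)
  ultimately show ?thesis by (rule that)
qed

end

subsection \<open>Subquotients\<close>

text \<open>
  In the paper's terms: over \<open>I_1 i\<close>, such a module is a sum of copies of \<open>K[x\<^sub>i]\<close> for \<open>i \<in> D\<close>, and a
  module over \<open>B_1 i\<close> for \<open>i \<notin> D\<close>.
\<close>

definition of_type :: "(('k::field_char_0, 'n) endo, 'm) module \<Rightarrow> 'n set \<Rightarrow> bool" where
  "of_type M D \<longleftrightarrow> (\<forall>m\<in>carrier M. \<forall>i.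
    (i \<in> D \<longrightarrow> (\<exists>k. (op_D i ^^ k) \<odot>\<^bsub>M\<^esub> m = \<zero>\<^bsub>M\<^esub>)) \<and>
    (i \<notin> D \<longrightarrow> op_J i \<odot>\<^bsub>M\<^esub> (op_D i \<odot>\<^bsub>M\<^esub> m) = m))"

text \<open>\<open>C i\<close> records where the eigenvalues of \<open>H_i\<close> may lie. The fold
  is the body of \<open>H_prod\<close>, written out so that the notion is available for modules of
  any element type, in particular for quotients.\<close>

definition H_finite :: "(('k::field_char_0, 'n) endo, 'm) module \<Rightarrow> ('n \<Rightarrow> 'k set) \<Rightarrow> bool" where
  "H_finite M C \<longleftrightarrow> (\<forall>m\<in>carrier M. \<forall>i. \<exists>cs. set cs \<subseteq> C i \<and>
    foldr (\<lambda>c x. H_minus i c \<odot>\<^bsub>M\<^esub> x) cs m = \<zero>\<^bsub>M\<^esub>)"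

context I_module
begin

lemma I_module_sub_module: "submodule N I_n M \<Longrightarrow> I_module (sub_module M N)"
  by (simp add: I_module_def left_module_sub_module)

lemma I_module_quot_module: "submodule N I_n M \<Longrightarrow> I_module (quot_module M N)"
  by (simp add: I_module_def left_module_quot_module)

lemma of_type_sub_module: "\<lbrakk>of_type M D; submodule N I_n M\<rbrakk> \<Longrightarrow> of_type (sub_module M N) D"
  using submodule_subset by (fastforce simp: of_type_def)

text \<open>Together with the statements on submodules and on \<open>H_finite\<close>, this carries
  the hypotheses of the annihilator computation over to every subfactor.\<close>

lemma of_type_quot_module:
  assumes "of_type M D" "submodule N I_n M"
  shows "of_type (quot_module M N) D"
  unfolding of_type_def
proof (intro ballI allI conjI impI)
  interpret N: abelian_subgroup N M by (rule submodule_abelian_subgroup[OF assms(2)])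
  fix X i assume "X \<in> carrier (quot_module M N)"
  then obtain m where m: "m \<in> carrier M" "X = N +> m" by (auto elim: N.rcosetsE)
  {
    assume "i \<in> D"
    then obtain k where k: "(op_D i ^^ k) \<odot> m = \<zero>" using assms(1) m by (auto simp: of_type_def)
    have "(op_D i ^^ k) \<odot>\<^bsub>quot_module M N\<^esub> X = N"
      unfolding m(2) by (subst smult_quot_module[OF assms(2)]) (use m k N.a_rcos_const in auto)
    then show "\<exists>k. (op_D i ^^ k) \<odot>\<^bsub>quot_module M N\<^esub> X = \<zero>\<^bsub>quot_module M N\<^esub>" by auto
  }
  {
    assume "i \<notin> D"
    then have "op_J i \<odot> (op_D i \<odot> m) = m" using assms(1) m by (auto simp: of_type_def)
    then show "op_J i \<odot>\<^bsub>quot_module M N\<^esub> (op_D i \<odot>\<^bsub>quot_module M N\<^esub> X) = X"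
      using m by (simp add: smult_quot_module[OF assms(2)])
  }
qed

lemma H_finite_sub_module: "\<lbrakk>H_finite M C; submodule N I_n M\<rbrakk> \<Longrightarrow> H_finite (sub_module M N) C"
  using submodule_subset by (fastforce simp: H_finite_def)

lemma H_finite_quot_module:
  assumes "H_finite M C" "submodule N I_n M"
  shows "H_finite (quot_module M N) C"
  unfolding H_finite_def
proof (intro ballI allI)
  interpret N: abelian_subgroup N M by (rule submodule_abelian_subgroup[OF assms(2)])
  fix X i assume "X \<in> carrier (quot_module M N)"
  then obtain m where m: "m \<in> carrier M" "X = N +> m" by (auto elim: N.rcosetsE)
  obtain cs where cs: "set cs \<subseteq> C i" "H_prod i cs m = \<zero>"
    using assms(1) m(1) unfolding H_finite_def H_prod_def by blast
  have "foldr (\<lambda>c x. H_minus i c \<odot>\<^bsub>quot_module M N\<^esub> x) ds X = N +> H_prod i ds m" for ds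
    using m by (induction ds) (simp_all add: smult_quot_module[OF assms(2)])
  then show "\<exists>cs. set cs \<subseteq> C i \<and>
      foldr (\<lambda>c x. H_minus i c \<odot>\<^bsub>quot_module M N\<^esub> x) cs X = \<zero>\<^bsub>quot_module M N\<^esub>"
    using cs N.a_rcos_const[of "\<zero>"] by (auto intro!: exI[of _ cs])
qed

lemma H_finiteE:
  assumes "H_finite M C" "m \<in> carrier M"
  obtains cs where "set cs \<subseteq> C i" "H_prod i cs m = \<zero>"
  using assms unfolding H_finite_def H_prod_def by blast

lemma of_type_nil: "\<lbrakk>of_type M D; i \<in> D; m \<in> carrier M\<rbrakk> \<Longrightarrow> m \<in> nil i"
  by (auto simp: of_type_def nil_def)

lemma of_type_dvs: "\<lbrakk>of_type M D; i \<notin> D; m \<in> carrier M\<rbrakk> \<Longrightarrow> m \<in> dvs i"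
  by (rule dvsI) (auto simp: of_type_def)

end

subsection \<open>The decomposition of an \<open>H\<close>-finite module\<close>

lemma (in abelian_group) diff_eq_zero_iff:
  assumes "a \<in> carrier G" "b \<in> carrier G"
  shows "a \<ominus> b = \<zero> \<longleftrightarrow> a = b"
proof
  assume "a \<ominus> b = \<zero>"
  then have "\<ominus> (\<ominus> b) = a" using assms by (intro minus_equality) (auto simp: minus_eq)
  then show "a = b" using assms by simp
qed (use assms in \<open>simp add: minus_eq r_neg\<close>)

lemma (in abelian_group) finsum_hom:
  assumes p: "p \<in> hom (add_monoid G) (add_monoid G)" "p \<zero> = \<zero>" and f: "f \<in> A \<rightarrow> carrier G"
  shows "p (finsum G f A) = finsum G (\<lambda>x. p (f x)) A"
proof (cases "finite A")
  case True
  then show ?thesis using f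
  proof (induction A rule: finite_induct)
    case empty
    then show ?case using p by simp
  next
    case (insert x F)
    then have c: "f \<in> F \<rightarrow> carrier G" "f x \<in> carrier G" by auto
    then have "(\<lambda>x. p (f x)) \<in> F \<rightarrow> carrier G" "p (f x) \<in> carrier G"
      using p by (auto simp: hom_def)
    then show ?case using c insert p by (simp add: hom_def)
  qed
qed (use p in \<open>simp add: finsum_infinite\<close>)

text \<open>A fixed enumeration of the variables, along which projections and operators belonging to
  the single variables are composed.\<close>

definition idx :: "'n::finite list" where
  "idx = (SOME xs. set xs = UNIV \<and> distinct xs)"

lemma idx: "set idx = (UNIV :: 'n::finite set)" "distinct (idx :: 'n list)"
proof -
  have "\<exists>xs :: 'n list. set xs = UNIV \<and> distinct xs"
    using finite_distinct_list[OF finite_UNIV] by auto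
  then have "set (idx :: 'n list) = UNIV \<and> distinct (idx :: 'n list)"
    unfolding idx_def by (rule someI_ex)
  then show "set idx = (UNIV :: 'n::finite set)" "distinct (idx :: 'n list)" by auto
qed

locale H_module = I_module M
  for M :: "(('k::field_char_0, 'n::finite) endo, 'm) module" (structure) +
  fixes C :: "'n \<Rightarrow> 'k set"
  assumes H_finite: "H_finite M C"
begin

definition proj :: "'n \<Rightarrow> 'm \<Rightarrow> 'm" where
  "proj i m = (THE v. v \<in> dvs i \<and> m \<ominus> v \<in> nil i)"

text \<open>Two candidates differ by an element of \<open>nil i\<close> and of \<open>dvs i\<close>,
  which is zero. Linearity of \<open>proj i\<close> over the algebra follows from this
  characterisation, since both sets are submodules.\<close>

lemma proj_eqI:
  assumes "m \<in> carrier M" "v \<in> dvs i" "m \<ominus> v \<in> nil i"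
  shows "proj i m = v"
  unfolding proj_def
proof (rule the_equality)
  fix w assume w: "w \<in> dvs i \<and> m \<ominus> w \<in> nil i"
  have c: "v \<in> carrier M" "w \<in> carrier M" using assms w by (auto simp: dvs_def)
  have "(m \<ominus> v) \<ominus> (m \<ominus> w) \<in> nil i"
    by (rule submodule_diff[OF submodule_nil]) (use assms(3) w in auto)
  moreover have "(m \<ominus> v) \<ominus> (m \<ominus> w) = w \<ominus> v"
    using c assms(1) by (simp add: M.minus_eq M.minus_add M.a_ac M.r_neg1 M.r_neg2)
  moreover have "w \<ominus> v \<in> dvs i"
    by (rule submodule_diff[OF submodule_dvs]) (use assms(2) w in auto)
  ultimately have "w \<ominus> v = \<zero>" using nil_dvs_zero by metis
  then show "w = v" using c by (simp add: M.diff_eq_zero_iff)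
qed (use assms in auto)

lemma proj_dvs: "m \<in> carrier M \<Longrightarrow> proj i m \<in> dvs i"
  and proj_nil: "m \<in> carrier M \<Longrightarrow> m \<ominus> proj i m \<in> nil i"
proof -
  assume m: "m \<in> carrier M"
  obtain cs where "H_prod i cs m = \<zero>" by (rule H_finiteE[OF H_finite m])
  then obtain v where "v \<in> dvs i" "m \<ominus> v \<in> nil i" by (rule nil_dvs_decompose[OF m])
  then show "proj i m \<in> dvs i" "m \<ominus> proj i m \<in> nil i"
    using proj_eqI[OF m] by auto
qed

lemma proj_closed [simp, intro]: "m \<in> carrier M \<Longrightarrow> proj i m \<in> carrier M"
  using proj_dvs[of m i] by (simp add: dvs_def)

lemma proj_add:
  assumes "x \<in> carrier M" "y \<in> carrier M"
  shows "proj i (x \<oplus> y) = proj i x \<oplus> proj i y"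
proof (rule proj_eqI)
  show "proj i x \<oplus> proj i y \<in> dvs i"
    using assms by (intro submodule_add[OF submodule_dvs] proj_dvs)
  have "(x \<ominus> proj i x) \<oplus> (y \<ominus> proj i y) \<in> nil i"
    using assms by (intro submodule_add[OF submodule_nil] proj_nil)
  then show "x \<oplus> y \<ominus> (proj i x \<oplus> proj i y) \<in> nil i"
    using assms by (simp add: M.minus_eq M.minus_add M.a_ac)
qed (use assms in simp)

lemma proj_act:
  assumes "a \<in> carrier I_n" "x \<in> carrier M"
  shows "proj i (a \<odot> x) = a \<odot> proj i x"
proof (rule proj_eqI)
  show "a \<odot> proj i x \<in> dvs i"
    using assms by (intro submodule_smult[OF submodule_dvs] proj_dvs)
  have "a \<odot> (x \<ominus> proj i x) \<in> nil i"
    using assms by (intro submodule_smult[OF submodule_nil] proj_nil)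
  then show "a \<odot> x \<ominus> a \<odot> proj i x \<in> nil i"
    using assms by (simp add: smult_r_diff)
qed (use assms in simp)

lemma proj_on_dvs: "x \<in> dvs i \<Longrightarrow> proj i x = x"
  using submodule_zero[OF submodule_nil] by (intro proj_eqI) (auto simp: dvs_def M.minus_eq M.r_neg)

lemma proj_on_nil:
  assumes "x \<in> nil i"
  shows "proj i x = \<zero>"
proof (rule proj_eqI)
  show x: "x \<in> carrier M" using assms by (simp add: nil_def)
  then have "x \<ominus> \<zero> = x" by (simp add: M.minus_eq)
  then show "x \<ominus> \<zero> \<in> nil i" using assms by simp
qed (rule submodule_zero[OF submodule_dvs])

definition proj_type :: "'n set \<Rightarrow> 'n \<Rightarrow> 'm \<Rightarrow> 'm" where
  "proj_type D i m = (if i \<in> D then m \<ominus> proj i m else proj i m)"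

lemma proj_type_closed [simp, intro]: "m \<in> carrier M \<Longrightarrow> proj_type D i m \<in> carrier M"
  by (simp add: proj_type_def)

lemma proj_type_add:
  "\<lbrakk>x \<in> carrier M; y \<in> carrier M\<rbrakk> \<Longrightarrow>
    proj_type D i (x \<oplus> y) = proj_type D i x \<oplus> proj_type D i y"
  by (simp add: proj_type_def proj_add M.minus_eq M.minus_add M.a_ac)

lemma proj_type_act:
  "\<lbrakk>a \<in> carrier I_n; x \<in> carrier M\<rbrakk> \<Longrightarrow> proj_type D i (a \<odot> x) = a \<odot> proj_type D i x"
  by (simp add: proj_type_def proj_act smult_r_diff)

definition cond :: "'n set \<Rightarrow> 'n \<Rightarrow> 'm set" where
  "cond D i = (if i \<in> D then nil i else dvs i)"

lemma submodule_cond: "submodule (cond D i) I_n M"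
  by (simp add: cond_def submodule_nil submodule_dvs)

lemma proj_type_in_cond: "m \<in> carrier M \<Longrightarrow> proj_type D i m \<in> cond D i"
  by (simp add: proj_type_def cond_def proj_dvs proj_nil)

lemma proj_type_on_cond:
  assumes "x \<in> cond E i"
  shows "proj_type D i x = (if i \<in> D \<longleftrightarrow> i \<in> E then x else \<zero>)"
  using assms submodule_subset[OF submodule_cond[of E i]]
  by (auto simp: proj_type_def cond_def proj_on_nil proj_on_dvs M.minus_eq M.r_neg split: if_splits)

text \<open>The conditions are expressed by the action of \<open>\<partial>\<close> and
  \<open>J\<close>, and the projection commutes with the action; so projecting for one variable does
  not spoil what was achieved for another.\<close>

lemma proj_type_preserves_cond:
  assumes "x \<in> cond E j"
  shows "proj_type D i x \<in> cond E j"
proof -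
  have xc: "x \<in> carrier M" using assms submodule_subset[OF submodule_cond] by auto
  have z: "proj_type D i \<zero> = \<zero>"
    using proj_type_act[of "\<lambda>p. 0" "\<zero>" D i] by simp
  show ?thesis
  proof (cases "j \<in> E")
    case True
    then obtain k where "(op_D j ^^ k) \<odot> x = \<zero>" using assms by (auto simp: cond_def nil_def)
    then have "(op_D j ^^ k) \<odot> proj_type D i x = \<zero>"
      using xc z by (simp add: proj_type_act[symmetric])
    then show ?thesis using True xc by (auto simp: cond_def nil_def)
  next
    case False
    have "\<exists>y\<in>carrier M. proj_type D i x = (op_J j ^^ k) \<odot> y" for k
    proof -
      obtain y where "y \<in> carrier M" "x = (op_J j ^^ k) \<odot> y"
        using assms False by (auto simp: cond_def dvs_def)
      then show ?thesis by (intro bexI[of _ "proj_type D i y"]) (simp_all add: proj_type_act)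
    qed
    then show ?thesis using False xc by (simp add: cond_def dvs_def)
  qed
qed

definition comp :: "'n list \<Rightarrow> 'n set \<Rightarrow> 'm \<Rightarrow> 'm" where
  "comp xs D m = foldr (proj_type D) xs m"

lemma comp_simps [simp]: "comp [] D m = m" "comp (i # xs) D m = proj_type D i (comp xs D m)"
  by (simp_all add: comp_def)

lemma comp_closed [simp, intro]: "m \<in> carrier M \<Longrightarrow> comp xs D m \<in> carrier M"
  by (induction xs) auto

lemma comp_add:
  "\<lbrakk>x \<in> carrier M; y \<in> carrier M\<rbrakk> \<Longrightarrow> comp xs D (x \<oplus> y) = comp xs D x \<oplus> comp xs D y"
  by (induction xs) (simp_all add: proj_type_add)

lemma comp_act:
  "\<lbrakk>a \<in> carrier I_n; x \<in> carrier M\<rbrakk> \<Longrightarrow> comp xs D (a \<odot> x) = a \<odot> comp xs D x"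
  by (induction xs) (simp_all add: proj_type_act)

lemma comp_zero [simp]: "comp xs D \<zero> = \<zero>"
  using comp_act[of "\<lambda>p. 0" "\<zero>" xs D] by simp

lemma comp_hom: "comp xs D \<in> hom (add_monoid M) (add_monoid M)"
  by (auto simp: hom_def comp_add)

lemma comp_in_cond: "\<lbrakk>m \<in> carrier M; i \<in> set xs\<rbrakk> \<Longrightarrow> comp xs D m \<in> cond D i"
  by (induction xs) (auto intro: proj_type_in_cond proj_type_preserves_cond)

text \<open>The expansion of the product over \<open>i\<close> of \<open>(1 - p_i) + p_i\<close>,
  each factor being the identity: the subsets of \<open>xs\<close> correspond to the choices of one
  summand per factor.\<close>

lemma comp_sum:
  assumes "distinct xs" "m \<in> carrier M"
  shows "finsum M (\<lambda>D. comp xs D m) (Pow (set xs)) = m"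
  using assms
proof (induction xs)
  case (Cons i xs)
  let ?P = "Pow (set xs)"
  have fin: "finite ?P" by simp
  have dis: "?P \<inter> insert i ` ?P = {}" using Cons.prems by auto
  have inj: "inj_on (insert i) ?P" using Cons.prems by (auto simp: inj_on_def)
  have eq: "comp xs (insert i D) m = comp xs D m" for D
  proof -
    have "comp ys (insert i D) m = comp ys D m" if "i \<notin> set ys" for ys
      using that by (induction ys) (auto simp: proj_type_def)
    then show ?thesis using Cons.prems by simp
  qed
  have "finsum M (\<lambda>D. comp (i # xs) D m) (Pow (set (i # xs)))
      = finsum M (\<lambda>D. comp (i # xs) D m) (?P \<union> insert i ` ?P)"
    by (simp only: list.set Pow_insert)
  also have "\<dots> = finsum M (\<lambda>D. comp (i # xs) D m) ?P \<oplus> finsum M (\<lambda>D. comp (i # xs) D m) (insert i ` ?P)"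
    using Cons.prems dis by (intro M.finsum_Un_disjoint) auto
  also have "finsum M (\<lambda>D. comp (i # xs) D m) (insert i ` ?P)
      = finsum M (\<lambda>D. comp (i # xs) (insert i D) m) ?P"
    using Cons.prems by (intro M.finsum_reindex inj) auto
  also have "finsum M (\<lambda>D. comp (i # xs) D m) ?P \<oplus> \<dots>
      = finsum M (\<lambda>D. comp (i # xs) D m \<oplus> comp (i # xs) (insert i D) m) ?P"
    using Cons.prems by (intro M.finsum_addf[symmetric]) auto
  also have "\<dots> = finsum M (\<lambda>D. comp xs D m) ?P"
  proof (rule M.finsum_cong')
    fix D assume "D \<in> ?P"
    then have "i \<notin> D" using Cons.prems by auto
    then show "comp (i # xs) D m \<oplus> comp (i # xs) (insert i D) m = comp xs D m"
      using Cons.prems by (simp add: eq proj_type_def M.minus_eq M.a_ac M.r_neg1 M.r_neg2 M.r_neg)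
  qed (use Cons.prems in auto)
  also have "\<dots> = m" using Cons by simp
  finally show ?case .
qed simp

section \<open>The parts of an H-finite module\<close>

definition part :: "'n set \<Rightarrow> 'm set" where
  "part D = (\<Inter>i. cond D i)"

lemma submodule_part: "submodule (part D) I_n M"
proof (rule submoduleI)
  note c = submodule_closed[OF submodule_cond]
  show "part D \<subseteq> carrier M" using c(1) by (force simp: part_def)
  show "\<zero> \<in> part D" using c(2) by (auto simp: part_def)
  show "\<And>x y. \<lbrakk>x \<in> part D; y \<in> part D\<rbrakk> \<Longrightarrow> x \<oplus> y \<in> part D"
    using c(3) by (auto simp: part_def)
  show "\<And>a x. \<lbrakk>a \<in> carrier I_n; x \<in> part D\<rbrakk> \<Longrightarrow> a \<odot> x \<in> part D"
    using c(6) by (auto simp: part_def)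
qed

lemma of_type_part: "of_type (sub_module M (part D)) D"
  unfolding of_type_def
proof (intro ballI allI)
  fix m i assume "m \<in> carrier (sub_module M (part D))"
  then have "m \<in> cond D i" by (simp add: part_def)
  then show "(i \<in> D \<longrightarrow> (\<exists>k. (op_D i ^^ k) \<odot>\<^bsub>sub_module M (part D)\<^esub> m = \<zero>\<^bsub>sub_module M (part D)\<^esub>)) \<and>
    (i \<notin> D \<longrightarrow> op_J i \<odot>\<^bsub>sub_module M (part D)\<^esub> (op_D i \<odot>\<^bsub>sub_module M (part D)\<^esub> m) = m)"
    by (auto simp: cond_def nil_def dvs_J_D)
qed

lemma comp_in_part: "m \<in> carrier M \<Longrightarrow> comp idx D m \<in> part D"
  using comp_in_cond[of m _ idx D] by (auto simp: part_def idx)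

lemma comp_on_part: "m \<in> part D \<Longrightarrow> comp xs D m = m"
  by (induction xs) (simp_all add: part_def proj_type_on_cond[of m D])

text \<open>At a variable \<open>i\<close> on which \<open>D\<close> and \<open>E\<close> disagree,
  the result is nilpotent as well as infinitely divisible.\<close>

lemma comp_on_other_part:
  assumes "m \<in> part E" "D \<noteq> E"
  shows "comp idx D m = \<zero>"
proof -
  obtain i where i: "(i \<in> D) \<noteq> (i \<in> E)" using assms(2) by auto
  have "comp idx D m \<in> cond D i" using comp_in_part[of m D] submodule_subset[OF submodule_part] assms(1)
    by (auto simp: part_def)
  moreover have "comp xs D m \<in> cond E i" for xs
    using assms(1) by (induction xs) (auto simp: part_def intro: proj_type_preserves_cond)
  ultimately show ?thesis
    using i nil_dvs_zero by (auto simp: cond_def split: if_splits)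
qed

lemma part_Int:
  assumes "m \<in> part D" "m \<in> part E" "D \<noteq> E"
  shows "m = \<zero>"
  using comp_on_part[OF assms(1), of idx] comp_on_other_part[OF assms(2,3)] by simp

text \<open>The index family may be any one that contains all nonzero parts. It is taken as the
  subsets of \<open>D_set\<close>, as a singleton, or as empty, depending on what is known about the
  module.\<close>

lemma parts_decompose:
  assumes "m \<in> carrier M" "\<And>D. D \<notin> \<D> \<Longrightarrow> part D = {\<zero>}"
  shows "m = finsum M (\<lambda>D. comp idx D m) \<D>"
proof -
  have "m = finsum M (\<lambda>D. comp idx D m) UNIV"
    using comp_sum[OF idx(2) assms(1)] by (simp add: idx(1))
  also have "\<dots> = finsum M (\<lambda>D. comp idx D m) \<D>"
    by (rule M.add.finprod_mono_neutral_cong_right) (use comp_in_part assms in auto)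
  finally show ?thesis .
qed

lemma direct_sum_parts:
  assumes "\<And>D. D \<notin> \<D> \<Longrightarrow> part D = {\<zero>}"
  shows "internal_direct_sum M \<D> part"
proof (rule internal_direct_sumI[where p = "comp idx"])
  fix m assume m: "m \<in> carrier M"
  show "\<exists>J f. finite J \<and> J \<subseteq> \<D> \<and> (\<forall>i\<in>J. f i \<in> part i) \<and> m = finsum M f J"
    using parts_decompose[OF m assms] comp_in_part[OF m]
    by (intro exI[of _ \<D>] exI[of _ "\<lambda>D. comp idx D m"]) (auto intro: finite_subset[OF subset_UNIV])
qed (use submodule_part comp_hom comp_on_part comp_on_other_part in \<open>auto simp: submodule_def\<close>)

definition parts :: "'m set set" where
  "parts = {part D | D. part D \<noteq> {\<zero>}}"

text \<open>The same sum indexed by the submodules themselves, as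
  \<open>abs_prime_decomposition\<close> demands. Nonzero parts of different types are different
  sets, because they meet in zero only.\<close>

lemma direct_sum_parts_set: "internal_direct_sum M parts (\<lambda>N. N)"
proof -
  define \<D> where "\<D> = {D. part D \<noteq> {\<zero>}}"
  have inj: "inj_on part \<D>"
  proof (rule inj_onI, rule ccontr)
    fix D E assume "D \<in> \<D>" "E \<in> \<D>" "part D = part E" "D \<noteq> E"
    then have "part D \<subseteq> {\<zero>}" using part_Int[of _ D E] by auto
    then show False using \<open>D \<in> \<D>\<close> submodule_zero[OF submodule_part, of D] by (auto simp: \<D>_def)
  qed
  have parts: "parts = part ` \<D>" by (auto simp: parts_def \<D>_def)
  let ?p = "\<lambda>N. comp idx (the_inv_into \<D> part N)"
  show ?thesis
  proof (rule internal_direct_sumI[where p = ?p])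
    fix m assume m: "m \<in> carrier M"
    have "m = finsum M (\<lambda>D. comp idx D m) \<D>"
      by (rule parts_decompose[OF m]) (auto simp: \<D>_def)
    also have "\<dots> = finsum M (\<lambda>D. ?p (part D) m) \<D>"
      using m inj by (intro M.finsum_cong') (auto simp: the_inv_into_f_f)
    also have "\<dots> = finsum M (\<lambda>N. ?p N m) (part ` \<D>)"
      using m by (intro M.finsum_reindex[symmetric] inj) auto
    finally have "m = finsum M (\<lambda>N. ?p N m) parts" unfolding parts .
    moreover have "finite parts" unfolding parts by (auto intro: finite_subset[OF subset_UNIV])
    moreover have "\<forall>N\<in>parts. ?p N m \<in> N"
      unfolding parts using comp_in_part[OF m] inj by (auto simp: the_inv_into_f_f)
    ultimately show "\<exists>J f. finite J \<and> J \<subseteq> parts \<and> (\<forall>i\<in>J. f i \<in> i) \<and> m = finsum M f J"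
      by (intro exI[of _ parts] exI[of _ "\<lambda>N. ?p N m"]) auto
  next
    fix N x assume "N \<in> parts" "x \<in> N"
    then show "?p N x = x" unfolding parts using inj comp_on_part by (auto simp: the_inv_into_f_f)
  next
    fix N N' x assume a: "N \<in> parts" "N' \<in> parts" "N \<noteq> N'" "x \<in> N"
    then obtain D E where DE: "D \<in> \<D>" "N = part D" "E \<in> \<D>" "N' = part E" unfolding parts by auto
    then have "E \<noteq> D" using a(3) by auto
    then have "comp idx E x = \<zero>" using a(4) DE(2) by (intro comp_on_other_part[of x D E]) auto
    then show "?p N' x = \<zero>" using DE inj by (simp add: the_inv_into_f_f)
  next
    fix N assume "N \<in> parts"
    then show "subgroup N (add_monoid M)" using submodule_part by (auto simp: parts_def submodule_def)
  qed (rule comp_hom)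
qed

end

subsection \<open>Generalized weight modules\<close>

lemma H_minus_max_ideal: "H_minus i (lam i) \<in> max_ideal lam"
  by (auto simp: max_ideal_def genideal_def)

lemma max_ideal_subset: "max_ideal lam \<subseteq> carrier D_n"
proof -
  have "ideal (carrier D_n) D_n" by (rule ring.oneideal[OF ring_D_n])
  moreover have "Set.range (\<lambda>i. H_minus i (lam i)) \<subseteq> carrier D_n"
    by (rule image_subsetI) (rule H_minus_D_n)
  ultimately show ?thesis unfolding max_ideal_def genideal_def by (intro Inter_lower CollectI conjI)
qed

lemma ideal_power_Suc: "ideal_power R I (Suc k) = ideal_power R I k \<cdot>\<^bsub>R\<^esub> I"
  by (simp add: ideal_power_def)

lemma ideal_power_subset: "ideal_power D_n (max_ideal lam) k \<subseteq> carrier D_n"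
proof (induction k)
  case (Suc k)
  have "a \<in> carrier D_n" if "a \<in> ideal_power D_n (max_ideal lam) k \<cdot>\<^bsub>D_n\<^esub> max_ideal lam" for a
    using that
  proof (induction rule: ideal_prod.induct)
    case (prod a b)
    then have "a \<in> carrier D_n" "b \<in> carrier D_n" using Suc max_ideal_subset by auto
    then show ?case by (rule monoid.m_closed[OF ring.is_monoid[OF ring_D_n]])
  next
    case (sum a b)
    show ?case by (rule ring.ring_simprules(1)[OF ring_D_n sum(3,4)])
  qed
  then show ?case unfolding ideal_power_Suc by (rule subsetI)
qed (simp add: ideal_power_def)

text \<open>Through this membership, a vector of a weight component is killed by a power of each
  single \<open>H_i - lam i\<close>.\<close>

lemma funpow_H_minus_ideal_power: "(H_minus i (lam i) ^^ k) \<in> ideal_power D_n (max_ideal lam) k"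
proof (induction k)
  case 0
  have "\<one>\<^bsub>D_n\<^esub> \<in> carrier D_n" by (rule monoid.one_closed[OF ring.is_monoid[OF ring_D_n]])
  then show ?case unfolding ideal_power_def funpow.simps D_n_simps id_apply .
next
  case (Suc k)
  have "(H_minus i (lam i) ^^ k) \<otimes>\<^bsub>D_n\<^esub> H_minus i (lam i)
      \<in> ideal_power D_n (max_ideal lam) k \<cdot>\<^bsub>D_n\<^esub> max_ideal lam"
    by (rule ideal_prod.prod[OF Suc H_minus_max_ideal])
  then show ?case unfolding D_n_simps funpow_Suc_right ideal_power_Suc .
qed

context I_module
begin

lemma weight_component_H_prod:
  assumes "v \<in> weight_component M lam"
  obtains k where "\<And>i. H_prod i (replicate k (lam i)) v = \<zero>"
proof -
  from assms obtain k where v: "v \<in> carrier M"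
    and k: "\<And>a. a \<in> ideal_power D_n (max_ideal lam) k \<Longrightarrow> a \<odot> v = \<zero>"
    by (auto simp: weight_component_def)
  have "(H_minus i c ^^ k) \<odot> v = H_prod i (replicate k c) v" for i c k
  proof (induction k)
    case (Suc k)
    then show ?case using v by (simp only: act_funpow_Suc(1) H_minus_I_n replicate.simps H_prod_simps)
  qed (use v in simp)
  then have "H_prod i (replicate k (lam i)) v = \<zero>" for i
    using k[OF funpow_H_minus_ideal_power] by metis
  then show ?thesis by (rule that)
qed

lemma H_prod_append: "H_prod i (cs @ ds) m = H_prod i cs (H_prod i ds m)"
  by (induction cs) auto

lemma H_minus_commute:
  assumes "x \<in> carrier M"
  shows "H_minus i b \<odot> (H_minus j c \<odot> x) = H_minus j c \<odot> (H_minus i b \<odot> x)"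
proof (cases "i = j")
  case True
  have "H_minus j b \<circ> H_minus j c = H_minus j c \<circ> H_minus j b"
  proof
    fix p
    have d: "op_H j (p - q) = op_H j p - op_H j q" for p q :: "('k, 'n) pol"
      using End_P_add[OF op_H_in_End_P, of j "p - q" q] by (simp add: algebra_simps)
    show "(H_minus j b \<circ> H_minus j c) p = (H_minus j c \<circ> H_minus j b) p"
      by (simp add: H_minus_def d End_P_pscale[OF op_H_in_End_P] pscale.scale_right_diff_distrib
          mult.commute)
  qed
  then show ?thesis unfolding True by (rule act_commute) (use assms in auto)
qed (use assms in \<open>auto intro: act_I_1_commute\<close>)

lemma H_prod_H_minus_commute:
  "x \<in> carrier M \<Longrightarrow> H_prod i cs (H_minus j c \<odot> x) = H_minus j c \<odot> H_prod i cs x"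
  by (induction cs) (simp_all add: H_minus_commute[of _ i _ j])

lemma H_prod_commute:
  "x \<in> carrier M \<Longrightarrow> H_prod i cs (H_prod j ds x) = H_prod j ds (H_prod i cs x)"
  by (induction ds) (simp_all add: H_prod_H_minus_commute)

lemma H_prod_add:
  "\<lbrakk>x \<in> carrier M; y \<in> carrier M\<rbrakk> \<Longrightarrow> H_prod i cs (x \<oplus> y) = H_prod i cs x \<oplus> H_prod i cs y"
  by (induction cs) (simp_all add: smult_r_distr)

lemma H_prod_zero [simp]: "H_prod i cs \<zero> = \<zero>"
  by (induction cs) simp_all

text \<open>A vector is a finite sum of generalized weight vectors, each killed by a power of
  \<open>H_i - lam i\<close>. The factors commute, so the concatenated lists kill the sum.\<close>

lemma generalized_weight_H_finite:
  assumes gw: "generalized_weight M" and C: "\<And>lam i. lam \<in> Supp M \<Longrightarrow> lam i \<in> C i"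
  shows "H_finite M C"
  unfolding H_finite_def
proof (intro ballI allI)
  fix m i assume "m \<in> carrier M"
  then obtain J f where J: "finite J" "\<And>lam. f lam \<in> weight_component M lam" "m = finsum M f J"
    using gw internal_direct_sum_decompose[of UNIV "weight_component M" m]
    by (auto simp: generalized_weight_def)
  have "\<exists>cs. set cs \<subseteq> C i \<and> H_prod i cs (finsum M f J) = \<zero>"
    using J(1)
  proof (induction J rule: finite_induct)
    case empty
    then show ?case by (auto intro!: exI[of _ "[]"])
  next
    case (insert lam F)
    then obtain cs where cs: "set cs \<subseteq> C i" "H_prod i cs (finsum M f F) = \<zero>" by auto
    obtain ds where ds: "set ds \<subseteq> C i" "H_prod i ds (f lam) = \<zero>"
    \<comment> \<open>Only weights of the support may contribute roots; for any other weight the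
      component is zero and the empty list serves.\<close>
    proof (cases "lam \<in> Supp M")
      case True
      obtain k where "H_prod i (replicate k (lam i)) (f lam) = \<zero>"
        using weight_component_H_prod[OF J(2)] by metis
      then show ?thesis using that[of "replicate k (lam i)"] C[OF True, of i]
        by (cases "k = 0") auto
    next
      case False
      then have "f lam = \<zero>" using J(2)[of lam] by (auto simp: Supp_def)
      then show ?thesis using that[of "[]"] by simp
    qed
    have c: "f \<in> F \<rightarrow> carrier M" "f lam \<in> carrier M" using J(2) by (auto simp: weight_component_def)
    then have "H_prod i (cs @ ds) (finsum M f (insert lam F)) = \<zero>"
      using insert.hyps ds(2) cs(2)
      by (simp add: H_prod_append H_prod_add H_prod_commute[of "finsum M f F" i cs i ds])
    then show ?case using cs ds by (intro exI[of _ "cs @ ds"]) auto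
  qed
  then show "\<exists>cs. set cs \<subseteq> C i \<and> foldr (\<lambda>c x. H_minus i c \<odot> x) cs m = \<zero>"
    using J(3) by (simp add: H_prod_def)
qed

end

context H_module
begin

text \<open>The projection onto the part commutes with \<open>D_n\<close>, so it maps weight
  components into themselves. Applied to the weight decomposition of a vector of the part, it yields
  a decomposition of the same vector.\<close>

lemma generalized_weight_part:
  assumes gw: "generalized_weight M"
  shows "generalized_weight (sub_module M (part D))"
proof -
  let ?N = "part D" and ?S = "sub_module M (part D)"
  note N = submodule_closed[OF submodule_part[of D]]
  have wc: "weight_component ?S lam = weight_component M lam \<inter> ?N" for lam
    using N(1) by (auto simp: weight_component_def)
  have ids: "internal_direct_sum M UNIV (weight_component M)"
    using gw by (simp add: generalized_weight_def)
  have car: "weight_component M lam \<subseteq> carrier M" for lam by (auto simp: weight_component_def)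
  have comp_wc: "comp idx D x \<in> weight_component M lam" if "x \<in> weight_component M lam" for x lam
  proof -
    obtain k where k: "x \<in> carrier M" "\<forall>a\<in>ideal_power D_n (max_ideal lam) k. a \<odot> x = \<zero>"
      using \<open>x \<in> _\<close> by (auto simp: weight_component_def)
    have "a \<odot> comp idx D x = \<zero>" if a: "a \<in> ideal_power D_n (max_ideal lam) k" for a
    proof -
      have "a \<in> carrier I_n" using a ideal_power_subset D_n_subset_I_n by blast
      then show ?thesis using k a by (simp add: comp_act[symmetric])
    qed
    then show ?thesis using k(1) by (auto simp: weight_component_def)
  qed
  have "internal_direct_sum ?S UNIV (weight_component ?S)"
    unfolding internal_direct_sum_def
  proof (intro conjI ballI)
    fix lam :: "'n \<Rightarrow> 'k"
    have "subgroup (weight_component M lam) (add_monoid M)"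
      using ids by (simp add: internal_direct_sum_def)
    then interpret W: subgroup "weight_component M lam" "add_monoid M" .
    interpret S: abelian_group ?S by (rule abelian_group_sub_module[OF submodule_part])
    have minv: "\<ominus>\<^bsub>?S\<^esub> x = \<ominus> x" if "x \<in> ?N" for x
      by (rule S.minus_equality) (use that N in \<open>auto simp: M.l_neg subset_iff\<close>)
    show "subgroup (weight_component ?S lam) (add_monoid ?S)"
    proof (rule subgroup.intro)
      fix x assume "x \<in> weight_component ?S lam"
      then have x: "x \<in> weight_component M lam" "x \<in> ?N" by (auto simp: wc)
      have "inv\<^bsub>add_monoid ?S\<^esub> x = \<ominus> x" using minv[OF x(2)] by (simp add: a_inv_def)
      then show "inv\<^bsub>add_monoid ?S\<^esub> x \<in> weight_component ?S lam"
        using W.m_inv_closed[OF x(1)] N(4)[OF x(2)] by (simp add: wc a_inv_def)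
    qed (use W.m_closed W.one_closed N in \<open>auto simp: wc\<close>)
  next
    fix m assume "m \<in> carrier ?S"
    then have m: "m \<in> ?N" "m \<in> carrier M" using N(1) by auto
    let ?Q = "\<lambda>M f. f \<in> (\<Pi>\<^sub>E lam\<in>UNIV. weight_component M lam) \<and>
      finite {lam \<in> UNIV. f lam \<noteq> \<zero>\<^bsub>M\<^esub>} \<and> m = (\<Oplus>\<^bsub>M\<^esub>lam\<in>{lam \<in> UNIV. f lam \<noteq> \<zero>\<^bsub>M\<^esub>}. f lam)"
    have ex1: "\<exists>!f. ?Q M f" using ids m(2) by (simp add: internal_direct_sum_def)
    then obtain f where f: "?Q M f" by blast
    define g where "g lam = comp idx D (f lam)" for lam
    have fw: "f lam \<in> weight_component M lam" for lam using f by (auto simp: PiE_iff)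
    have fc: "f lam \<in> carrier M" for lam using fw car by auto
    have sub: "{lam \<in> UNIV. g lam \<noteq> \<zero>} \<subseteq> {lam \<in> UNIV. f lam \<noteq> \<zero>}" by (auto simp: g_def)
    have "m = comp idx D m" using comp_on_part[OF m(1)] by simp
    also have "\<dots> = comp idx D (\<Oplus>lam\<in>{lam \<in> UNIV. f lam \<noteq> \<zero>}. f lam)"
      using f by simp
    also have "\<dots> = (\<Oplus>lam\<in>{lam \<in> UNIV. f lam \<noteq> \<zero>}. g lam)"
      unfolding g_def by (rule M.finsum_hom[OF comp_hom]) (use fc in auto)
    also have "\<dots> = (\<Oplus>lam\<in>{lam \<in> UNIV. g lam \<noteq> \<zero>}. g lam)"
      by (rule M.add.finprod_mono_neutral_cong_right) (use f sub fc in \<open>auto simp: g_def\<close>)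
    finally have "m = (\<Oplus>lam\<in>{lam \<in> UNIV. g lam \<noteq> \<zero>}. g lam)" .
    moreover have "finite {lam \<in> UNIV. g lam \<noteq> \<zero>}" using f sub finite_subset by blast
    moreover have "g \<in> (\<Pi>\<^sub>E lam\<in>UNIV. weight_component M lam)" using comp_wc[OF fw] by (auto simp: g_def)
    ultimately have "?Q M g" by blast
    \<comment> \<open>By uniqueness the projected family is the original one, so the weight
      components of an element of the part lie in the part.\<close>
    with ex1 f have fg: "f = g" by blast
    have "g lam \<in> ?N" for lam unfolding g_def by (rule comp_in_part[OF fc])
    then have fN: "f lam \<in> ?N" for lam unfolding fg .
    \<comment> \<open>A decomposition inside the part is a decomposition in \<open>M\<close> with
      all members in the part; uniqueness is inherited in this way.\<close>
    have eq: "?Q ?S h \<longleftrightarrow> ?Q M h \<and> (\<forall>lam. h lam \<in> ?N)" for h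
    proof -
      have "(\<Oplus>\<^bsub>?S\<^esub>lam\<in>{lam \<in> UNIV. h lam \<noteq> \<zero>}. h lam) = (\<Oplus>lam\<in>{lam \<in> UNIV. h lam \<noteq> \<zero>}. h lam)"
        if "\<forall>lam. h lam \<in> ?N"
        by (rule finsum_sub_module[OF submodule_part]) (use that in auto)
      then show ?thesis by (auto simp: PiE_iff wc)
    qed
    show "\<exists>!f. ?Q ?S f" unfolding eq using ex1 f fN by blast
  qed
  then show ?thesis
    using left_module_sub_module[OF submodule_part] by (simp add: generalized_weight_def)
qed

end

section \<open>Chains of weight vectors\<close>

definition pop :: "'n list \<Rightarrow> ('n \<Rightarrow> ('k::field_char_0, 'n) endo) \<Rightarrow> ('k, 'n) endo" where
  "pop xs a = foldr (\<lambda>i f. a i \<circ> f) xs id"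

lemma pop_simps: "pop [] a = id" "pop (i # xs) a = a i \<circ> pop xs a"
  by (simp_all add: pop_def)

lemma pop_I_n: "(\<And>i. i \<in> set xs \<Longrightarrow> a i \<in> carrier I_n) \<Longrightarrow> pop xs a \<in> carrier I_n"
  by (induction xs) (auto simp only: pop_simps I_n_id I_n_comp list.set insert_iff)

lemma pop_cong: "(\<And>i. i \<in> set xs \<Longrightarrow> a i = b i) \<Longrightarrow> pop xs a = pop xs b"
  by (induction xs) (auto simp: pop_simps)

text \<open>Integer powers of \<open>J\<close> with \<open>\<partial>\<close> in the role of its
  inverse. The rule \<open>\<partial> J^s = J^(s-1)\<close> holds for all \<open>s\<close>, while
  \<open>J J^s = J^(s+1)\<close> for negative \<open>s\<close> depends on
  \<open>J \<partial> = 1\<close>.\<close>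

definition Jpow :: "'n \<Rightarrow> int \<Rightarrow> ('k::field_char_0, 'n) endo" where
  "Jpow i s = (if s \<ge> 0 then op_J i ^^ nat s else op_D i ^^ nat (- s))"

lemma Jpow_I_1 [simp, intro]: "Jpow i s \<in> carrier (I_1 i)"
  by (simp add: Jpow_def)

lemma Jpow_I_n [simp, intro]: "Jpow i s \<in> carrier I_n"
  by (rule I_1_subset_I_n[OF Jpow_I_1])

context I_module
begin

text \<open>\<open>\<partial>_i\<close> is then bijective with inverse \<open>J_i\<close>. This
  fails for polynomials, where \<open>\<partial>_i\<close> kills the constants.\<close>

definition full :: "'n \<Rightarrow> bool" where
  "full i \<longleftrightarrow> (\<forall>m\<in>carrier M. op_J i \<odot> (op_D i \<odot> m) = m)"

lemma pop_act_Cons: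
  assumes "\<And>j. a j \<in> carrier (I_1 j)" "m \<in> carrier M"
  shows "pop (i # xs) a \<odot> m = a i \<odot> (pop xs a \<odot> m)"
  unfolding pop_simps
  by (rule act_comp[OF I_1_subset_I_n[OF assms(1)] pop_I_n[OF I_1_subset_I_n[OF assms(1)]] assms(2)])

lemma pop_act_Nil: "m \<in> carrier M \<Longrightarrow> pop [] a \<odot> m = m"
  unfolding pop_simps by simp

lemma pop_act_closed:
  assumes "\<And>j. a j \<in> carrier (I_1 j)" "m \<in> carrier M"
  shows "pop xs a \<odot> m \<in> carrier M"
  by (rule smult_closed[OF pop_I_n[OF I_1_subset_I_n[OF assms(1)]] assms(2)])

lemma pop_act_commute:
  assumes "\<And>j. a j \<in> carrier (I_1 j)" "m \<in> carrier M" "b \<in> carrier (I_1 i)" "i \<notin> set xs"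
  shows "b \<odot> (pop xs a \<odot> m) = pop xs a \<odot> (b \<odot> m)"
  using assms(4)
proof (induction xs)
  case (Cons j xs)
  have bm: "b \<odot> m \<in> carrier M" using I_1_subset_I_n[OF assms(3)] assms(2) by simp
  have "b \<odot> (a j \<odot> (pop xs a \<odot> m)) = a j \<odot> (b \<odot> (pop xs a \<odot> m))"
    by (rule act_I_1_commute[of i j]) (use Cons.prems assms pop_act_closed in auto)
  then show ?case
    using Cons by (simp add: pop_act_Cons[OF assms(1,2)] pop_act_Cons[OF assms(1) bm])
qed (use assms I_1_subset_I_n[OF assms(3)] in \<open>simp add: pop_act_Nil\<close>)

text \<open>Factors that belong to different variables commute, so any of them can be moved to the
  front.\<close>

lemma pop_act_split:
  assumes "\<And>j. a j \<in> carrier (I_1 j)" "m \<in> carrier M" "distinct xs" "i \<in> set xs"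
  shows "pop xs a \<odot> m = a i \<odot> (pop (remove1 i xs) a \<odot> m)"
  using assms(3,4)
proof (induction xs)
  case (Cons j xs)
  show ?case
  proof (cases "i = j")
    case False
    have "a j \<odot> (a i \<odot> (pop (remove1 i xs) a \<odot> m))
        = a i \<odot> (a j \<odot> (pop (remove1 i xs) a \<odot> m))"
      by (rule act_I_1_commute[of j i]) (use False assms pop_act_closed in auto)
    then show ?thesis using Cons False by (simp add: pop_act_Cons[OF assms(1,2)])
  qed (simp add: pop_act_Cons[OF assms(1,2)])
qed simp

lemma pop_act_update:
  assumes "\<And>j. a j \<in> carrier (I_1 j)" "m \<in> carrier M" "distinct xs" "i \<in> set xs"
    "b \<in> carrier (I_1 i)"
  shows "pop xs (a(i := b)) \<odot> m = b \<odot> (pop (remove1 i xs) a \<odot> m)"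
proof -
  have "pop xs (a(i := b)) \<odot> m = (a(i := b)) i \<odot> (pop (remove1 i xs) (a(i := b)) \<odot> m)"
    by (rule pop_act_split) (use assms in auto)
  moreover have "pop (remove1 i xs) (a(i := b)) = pop (remove1 i xs) a"
    using assms(3) by (intro pop_cong) auto
  ultimately show ?thesis by simp
qed

lemma Jpow_0_act: "m \<in> carrier M \<Longrightarrow> Jpow i 0 \<odot> m = m"
  unfolding Jpow_def by simp

lemma D_Jpow:
  assumes "r \<in> carrier M"
  shows "op_D i \<odot> (Jpow i s \<odot> r) = Jpow i (s - 1) \<odot> r"
proof (cases "s > 0")
  case True
  then have "(Jpow i s :: ('k, 'n) endo) = op_J i ^^ Suc (nat (s - 1))" "(Jpow i (s - 1) :: ('k, 'n) endo) = op_J i ^^ nat (s - 1)"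
    by (simp_all add: Jpow_def Suc_nat_eq_nat_zadd1 del: funpow.simps)
  then show ?thesis using assms by (simp only: act_funpow_Suc(1) I_n_op I_n_funpow smult_closed D_J_act)
next
  case False
  then have "(Jpow i s :: ('k, 'n) endo) = op_D i ^^ nat (- s)" "(Jpow i (s - 1) :: ('k, 'n) endo) = op_D i ^^ Suc (nat (- s))"
    by (auto simp: Jpow_def Suc_nat_eq_nat_zadd1 simp del: funpow.simps)
  then show ?thesis using assms by (simp only: act_funpow_Suc(1) I_n_op)
qed

lemma J_Jpow:
  assumes "r \<in> carrier M" "s \<ge> 0 \<or> full i"
  shows "op_J i \<odot> (Jpow i s \<odot> r) = Jpow i (s + 1) \<odot> r"
proof (cases "s \<ge> 0")
  case True
  then have "nat (s + 1) = Suc (nat s)" by linarith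
  with True have "(Jpow i s :: ('k, 'n) endo) = op_J i ^^ nat s" "(Jpow i (s + 1) :: ('k, 'n) endo) = op_J i ^^ Suc (nat s)"
    by (simp_all add: Jpow_def del: funpow.simps)
  then show ?thesis using assms by (simp only: act_funpow_Suc(1) I_n_op)
next
  case False
  then have "op_J i \<odot> (op_D i \<odot> (Jpow i (s + 1) \<odot> r)) = Jpow i (s + 1) \<odot> r"
    using assms by (simp add: full_def)
  then show ?thesis using assms(1) by (simp add: D_Jpow)
qed

lemma H_Jpow:
  assumes "r \<in> carrier M" "op_H i \<odot> r = pscale c \<odot> r"
  shows "op_H i \<odot> (Jpow i s \<odot> r) = pscale (c + of_int s) \<odot> (Jpow i s \<odot> r)"
proof -
  have J: "op_H i \<odot> ((op_J i ^^ k) \<odot> r) = pscale (c + of_nat k) \<odot> ((op_J i ^^ k) \<odot> r)" for k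
  proof (induction k)
    case (Suc k)
    let ?y = "(op_J i ^^ k) \<odot> r"
    have y: "?y \<in> carrier M" using assms by simp
    have "op_H i \<odot> (op_J i \<odot> ?y) = op_J i \<odot> (pscale (c + of_nat k) \<odot> ?y) \<oplus> op_J i \<odot> ?y"
      using y Suc by (simp add: H_J_act)
    also have "\<dots> = pscale (c + of_nat k) \<odot> (op_J i \<odot> ?y) \<oplus> pscale 1 \<odot> (op_J i \<odot> ?y)"
      using y by (simp add: act_pscale_commute)
    also have "\<dots> = pscale (c + of_nat k + 1) \<odot> (op_J i \<odot> ?y)"
      by (rule act_pscale_add[symmetric]) (use y in simp)
    finally have "op_H i \<odot> ((op_J i ^^ Suc k) \<odot> r)
        = pscale (c + of_nat k + 1) \<odot> ((op_J i ^^ Suc k) \<odot> r)"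
      using assms(1) by (simp only: act_funpow_Suc(1) I_n_op)
    moreover have "c + of_nat k + 1 = c + of_nat (Suc k)" by simp
    ultimately show ?case by (simp only:)
  qed (use assms in simp)
  have D: "op_H i \<odot> ((op_D i ^^ k) \<odot> r) = pscale (c - of_nat k) \<odot> ((op_D i ^^ k) \<odot> r)" for k
  proof -
    have "H_minus i c \<odot> r = \<zero>" using assms by (simp add: H_minus_eq_0_iff)
    then have "H_minus i (c - of_nat k) \<odot> ((op_D i ^^ k) \<odot> r) = \<zero>"
      using funpow_D_H_minus[OF assms(1), of k i c] by simp
    then show ?thesis using assms by (simp add: H_minus_eq_0_iff)
  qed
  show ?thesis
  proof (cases "s \<ge> 0")
    case True
    then have "(of_int s :: 'k) = of_nat (nat s)" by (metis int_nat_eq of_int_of_nat_eq)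
    then show ?thesis using True J[of "nat s"] by (simp add: Jpow_def)
  next
    case False
    then have "(of_int s :: 'k) = - of_nat (nat (- s))"
      by (metis add.inverse_inverse int_nat_eq le_minus_iff linorder_le_cases neg_0_le_iff_le of_int_minus of_int_of_nat_eq)
    then show ?thesis using False D[of "nat (- s)"] by (simp add: Jpow_def)
  qed
qed

definition chain :: "'m \<Rightarrow> ('n \<Rightarrow> int) \<Rightarrow> 'm" where
  "chain v \<gamma> = pop idx (\<lambda>i. Jpow i (\<gamma> i)) \<odot> v"

text \<open>For \<open>i \<in> D\<close> the vector is the bottom of its chain, and
  \<open>H = 1 + x \<partial>\<close> forces the eigenvalue \<open>1\<close> there. The constant
  polynomial \<open>1\<close> is the model.\<close>

definition base :: "'n set \<Rightarrow> ('n \<Rightarrow> 'k) \<Rightarrow> 'm \<Rightarrow> bool" where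
  "base D lam v \<longleftrightarrow> v \<in> carrier M \<and> (\<forall>i. op_H i \<odot> v = pscale (lam i) \<odot> v) \<and>
    (\<forall>i\<in>D. op_D i \<odot> v = \<zero> \<and> lam i = 1)"

lemma chain_closed [simp, intro]: "v \<in> carrier M \<Longrightarrow> chain v \<gamma> \<in> carrier M"
  unfolding chain_def by (rule pop_act_closed) auto

lemma chain_zero:
  assumes "v \<in> carrier M"
  shows "chain v (\<lambda>i. 0) = v"
proof -
  have "pop xs (\<lambda>i. Jpow i 0) \<odot> v = v" for xs
  proof (induction xs)
    case (Cons i xs)
    have "pop (i # xs) (\<lambda>i. Jpow i 0) \<odot> v = Jpow i 0 \<odot> (pop xs (\<lambda>i. Jpow i 0) \<odot> v)"
      by (rule pop_act_Cons) (use assms in auto)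
    then show ?case unfolding Cons by (simp only: Jpow_0_act[OF assms])
  qed (simp add: pop_act_Nil assms)
  then show ?thesis by (simp add: chain_def)
qed

text \<open>Isolates one variable: \<open>r\<close> collects the operators of all others, does not
  depend on \<open>s\<close>, and is killed by every operator of \<open>I_1 i\<close> that kills
  \<open>v\<close>. Statements on chains thereby reduce to one variable.\<close>

lemma chain_split:
  assumes "v \<in> carrier M"
  obtains r where "r \<in> carrier M" "\<And>s. chain v (\<gamma>(i := s)) = Jpow i s \<odot> r"
    "\<And>b. b \<in> carrier (I_1 i) \<Longrightarrow> b \<odot> v = \<zero> \<Longrightarrow> b \<odot> r = \<zero>"
proof
  let ?a = "\<lambda>j. Jpow j (\<gamma> j) :: ('k, 'n) endo"
  let ?r = "pop (remove1 i idx) ?a \<odot> v"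
  show "?r \<in> carrier M" by (rule pop_act_closed) (use assms in auto)
  show "chain v (\<gamma>(i := s)) = Jpow i s \<odot> ?r" for s
  proof -
    have eq: "(\<lambda>j. Jpow j ((\<gamma>(i := s)) j)) = ?a(i := Jpow i s)" by auto
    show ?thesis unfolding chain_def eq
      by (rule pop_act_update) (use assms in \<open>auto simp: idx\<close>)
  qed
  fix b assume b: "b \<in> carrier (I_1 i)" "b \<odot> v = \<zero>"
  have "b \<odot> ?r = pop (remove1 i idx) ?a \<odot> (b \<odot> v)"
    by (rule pop_act_commute) (use assms b in \<open>auto simp: set_remove1_eq[OF idx(2)]\<close>)
  then show "b \<odot> ?r = \<zero>" using b pop_I_n[of "remove1 i idx" ?a] by simp
qed

lemma chain_D:
  assumes "v \<in> carrier M"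
  shows "op_D i \<odot> chain v \<gamma> = chain v (\<gamma>(i := \<gamma> i - 1))"
proof -
  obtain r where r: "r \<in> carrier M" "\<And>s. chain v (\<gamma>(i := s)) = Jpow i s \<odot> r"
    using chain_split[OF assms] by metis
  have "chain v \<gamma> = Jpow i (\<gamma> i) \<odot> r" using r(2)[of "\<gamma> i"] by (simp only: fun_upd_triv)
  then show ?thesis by (simp only: r(2) D_Jpow[OF r(1)])
qed

lemma chain_J:
  assumes "v \<in> carrier M" "\<gamma> i \<ge> 0 \<or> full i"
  shows "op_J i \<odot> chain v \<gamma> = chain v (\<gamma>(i := \<gamma> i + 1))"
proof -
  obtain r where r: "r \<in> carrier M" "\<And>s. chain v (\<gamma>(i := s)) = Jpow i s \<odot> r"
    using chain_split[OF assms(1)] by metis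
  have "chain v \<gamma> = Jpow i (\<gamma> i) \<odot> r" using r(2)[of "\<gamma> i"] by (simp only: fun_upd_triv)
  then show ?thesis by (simp only: r(2) J_Jpow[OF r(1) assms(2)])
qed

lemma chain_H:
  assumes "base D lam v"
  shows "op_H i \<odot> chain v \<gamma> = pscale (lam i + of_int (\<gamma> i)) \<odot> chain v \<gamma>"
proof -
  have v: "v \<in> carrier M" "H_minus i (lam i) \<odot> v = \<zero>"
    using assms by (auto simp: base_def H_minus_eq_0_iff)
  obtain r where r: "r \<in> carrier M" "\<And>s. chain v (\<gamma>(i := s)) = Jpow i s \<odot> r"
    "\<And>b. b \<in> carrier (I_1 i) \<Longrightarrow> b \<odot> v = \<zero> \<Longrightarrow> b \<odot> r = \<zero>"
    using chain_split[OF v(1)] by metis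
  have "op_H i \<odot> r = pscale (lam i) \<odot> r"
    using r(1) r(3)[OF _ v(2)] by (simp add: H_minus_eq_0_iff)
  note H = H_Jpow[OF r(1) this]
  have "chain v \<gamma> = Jpow i (\<gamma> i) \<odot> r" using r(2)[of "\<gamma> i"] by (simp only: fun_upd_triv)
  then show ?thesis by (simp only: H)
qed

lemma chain_X:
  assumes "base D lam v" "\<gamma> i \<ge> 0 \<or> full i"
  shows "op_X i \<odot> chain v \<gamma> = pscale (lam i + of_int (\<gamma> i)) \<odot> chain v (\<gamma>(i := \<gamma> i + 1))"
proof -
  have v: "v \<in> carrier M" using assms by (simp add: base_def)
  have "op_X i \<odot> chain v \<gamma> = op_J i \<odot> (pscale (lam i + of_int (\<gamma> i)) \<odot> chain v \<gamma>)"
    using v by (simp only: X_eq_J_H chain_closed chain_H[OF assms(1)])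
  also have "\<dots> = pscale (lam i + of_int (\<gamma> i)) \<odot> (op_J i \<odot> chain v \<gamma>)"
    by (rule act_pscale_commute) (use v in auto)
  finally show ?thesis unfolding chain_J[where \<gamma> = \<gamma> and i = i, OF v assms(2)] .
qed

lemma chain_D_zero:
  assumes "base D lam v" "i \<in> D" "\<gamma> i = 0"
  shows "op_D i \<odot> chain v \<gamma> = \<zero>"
proof -
  have v: "v \<in> carrier M" "op_D i \<odot> v = \<zero>"
    using assms by (auto simp: base_def)
  obtain r where r: "r \<in> carrier M" "\<And>s. chain v (\<gamma>(i := s)) = Jpow i s \<odot> r"
    "\<And>b. b \<in> carrier (I_1 i) \<Longrightarrow> b \<odot> v = \<zero> \<Longrightarrow> b \<odot> r = \<zero>"
    using chain_split[OF v(1)] by metis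
  have "chain v \<gamma> = Jpow i (\<gamma> i) \<odot> r" using r(2)[of "\<gamma> i"] by (simp only: fun_upd_triv)
  then have "chain v \<gamma> = r" unfolding assms(3) by (simp only: Jpow_0_act[OF r(1)])
  then show ?thesis using r(3)[OF _ v(2)] by simp
qed

text \<open>A power of \<open>J\<close> has the same power of \<open>\<partial>\<close> as left
  inverse. For negative exponents the roles are exchanged, which works on infinitely divisible
  vectors.\<close>

lemma Jpow_nonzero:
  assumes "r \<in> carrier M" "r \<noteq> \<zero>" "s \<ge> 0 \<or> full i"
  shows "Jpow i s \<odot> r \<noteq> \<zero>"
proof (cases "s \<ge> 0")
  case True
  show ?thesis
  proof
    assume "Jpow i s \<odot> r = \<zero>"
    then have "(op_D i ^^ nat s) \<odot> ((op_J i ^^ nat s) \<odot> r) = \<zero>"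
      using True by (simp add: Jpow_def del: funpow_D_J_act)
    then show False using assms by simp
  qed
next
  case False
  then have full: "full i" using assms by simp
  have "r \<in> dvs i" by (rule dvsI) (use full assms in \<open>auto simp: full_def\<close>)
  then have "(op_J i ^^ nat (-s)) \<odot> ((op_D i ^^ nat (-s)) \<odot> r) = r" by (rule dvs_eq)
  then show ?thesis using False assms(2) by (auto simp: Jpow_def)
qed

lemma chain_nonzero:
  assumes "v \<in> carrier M" "v \<noteq> \<zero>" "\<And>i. \<gamma> i \<ge> 0 \<or> full i"
  shows "chain v \<gamma> \<noteq> \<zero>"
proof -
  have "pop xs (\<lambda>i. Jpow i (\<gamma> i)) \<odot> v \<noteq> \<zero>" for xs
  proof (induction xs)
    case (Cons i xs)
    have c: "pop xs (\<lambda>i. Jpow i (\<gamma> i)) \<odot> v \<in> carrier M"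
      by (rule pop_act_closed) (use assms in auto)
    show ?case
      using Jpow_nonzero[OF c Cons assms(3)] pop_act_Cons[of "\<lambda>i. Jpow i (\<gamma> i)" v i xs] assms(1) by simp
  qed (simp add: pop_act_Nil assms)
  then show ?thesis by (simp add: chain_def)
qed

subsection \<open>Linear combinations\<close>

definition lincomb :: "('x \<Rightarrow> 'm) \<Rightarrow> ('x \<Rightarrow>\<^sub>0 'k) \<Rightarrow> 'm" where
  "lincomb \<phi> p = finsum M (\<lambda>x. pscale (Poly_Mapping.lookup p x) \<odot> \<phi> x) (Poly_Mapping.keys p)"

context
  fixes \<phi> :: "'x \<Rightarrow> 'm"
  assumes \<phi>: "\<And>x. \<phi> x \<in> carrier M"
begin

lemma lincomb_closed [simp, intro]: "lincomb \<phi> p \<in> carrier M"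
  unfolding lincomb_def using \<phi> by (intro M.finsum_closed) auto

lemma lincomb_superset:
  assumes "finite A" "Poly_Mapping.keys p \<subseteq> A"
  shows "lincomb \<phi> p = finsum M (\<lambda>x. pscale (Poly_Mapping.lookup p x) \<odot> \<phi> x) A"
  unfolding lincomb_def using assms \<phi>
  by (intro M.add.finprod_mono_neutral_cong_left) (auto simp: in_keys_iff)

lemma lincomb_add: "lincomb \<phi> (p + q) = lincomb \<phi> p \<oplus> lincomb \<phi> q"
proof -
  let ?A = "Poly_Mapping.keys p \<union> Poly_Mapping.keys q"
  have k: "Poly_Mapping.keys (p + q) \<subseteq> ?A" by (rule keys_add)
  have "lincomb \<phi> (p + q) = finsum M (\<lambda>x. pscale (Poly_Mapping.lookup (p + q) x) \<odot> \<phi> x) ?A"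
    by (rule lincomb_superset) (use k in auto)
  also have "\<dots> = finsum M (\<lambda>x. pscale (Poly_Mapping.lookup p x) \<odot> \<phi> x \<oplus>
      pscale (Poly_Mapping.lookup q x) \<odot> \<phi> x) ?A"
    using \<phi> by (intro M.finsum_cong') (auto simp: lookup_add act_pscale_add)
  also have "\<dots> = finsum M (\<lambda>x. pscale (Poly_Mapping.lookup p x) \<odot> \<phi> x) ?A \<oplus>
      finsum M (\<lambda>x. pscale (Poly_Mapping.lookup q x) \<odot> \<phi> x) ?A"
    using \<phi> by (intro M.finsum_addf) auto
  also have "\<dots> = lincomb \<phi> p \<oplus> lincomb \<phi> q"
    using lincomb_superset[of ?A p] lincomb_superset[of ?A q] by simp
  finally show ?thesis .
qed

lemma lincomb_zero [simp]: "lincomb \<phi> 0 = \<zero>"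
  by (simp add: lincomb_def)

lemma lincomb_single [simp]: "lincomb \<phi> (Poly_Mapping.single x c) = pscale c \<odot> \<phi> x"
proof -
  have "lincomb \<phi> (Poly_Mapping.single x c)
      = finsum M (\<lambda>y. pscale (Poly_Mapping.lookup (Poly_Mapping.single x c) y) \<odot> \<phi> y) {x}"
    by (rule lincomb_superset) auto
  then show ?thesis using \<phi> by (simp add: M.finsum_insert)
qed

lemma lincomb_uminus: "lincomb \<phi> (- p) = \<ominus> lincomb \<phi> p"
proof -
  have "lincomb \<phi> (- p) \<oplus> lincomb \<phi> p = \<zero>"
    using lincomb_add[of "- p" p] by simp
  then show ?thesis by (simp add: M.minus_equality)
qed

lemma lincomb_diff: "lincomb \<phi> (p - q) = lincomb \<phi> p \<ominus> lincomb \<phi> q"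
  using lincomb_add[of p "- q"] by (simp add: lincomb_uminus M.minus_eq)

lemma lincomb_eigen:
  assumes "a \<in> carrier I_n" "\<And>x. x \<in> Poly_Mapping.keys p \<Longrightarrow> a \<odot> \<phi> x = pscale (\<kappa> x) \<odot> \<phi> x"
  obtains q where "\<And>x. Poly_Mapping.lookup q x = \<kappa> x * Poly_Mapping.lookup p x"
    "a \<odot> lincomb \<phi> p = lincomb \<phi> q"
proof -
  have "\<exists>q. (\<forall>x. Poly_Mapping.lookup q x = \<kappa> x * Poly_Mapping.lookup p x) \<and>
    a \<odot> lincomb \<phi> p = lincomb \<phi> q"
    using assms(2)
  proof (induction p rule: poly_mapping_add_induct)
    case zero
    then show ?case using assms(1) by (auto intro!: exI[of _ 0])
  next
    case (add x c p)
    have k: "Poly_Mapping.keys (Poly_Mapping.single x c + p) = insert x (Poly_Mapping.keys p)"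
      using add.hyps by (auto simp: in_keys_iff lookup_add lookup_single when_def split: if_splits)
    obtain q where q: "\<And>y. Poly_Mapping.lookup q y = \<kappa> y * Poly_Mapping.lookup p y"
      "a \<odot> lincomb \<phi> p = lincomb \<phi> q"
      using add k by auto
    have "a \<odot> (pscale c \<odot> \<phi> x) = pscale c \<odot> (a \<odot> \<phi> x)"
      by (rule act_pscale_commute[OF assms(1) \<phi>])
    also have "\<dots> = pscale (c * \<kappa> x) \<odot> \<phi> x"
      using add.prems[of x] k by (simp add: act_pscale_mult[OF \<phi>])
    finally have "a \<odot> (pscale c \<odot> \<phi> x) = pscale (\<kappa> x * c) \<odot> \<phi> x"
      by (simp only: mult.commute)
    then have "a \<odot> lincomb \<phi> (Poly_Mapping.single x c + p)
        = pscale (\<kappa> x * c) \<odot> \<phi> x \<oplus> lincomb \<phi> q"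
      using q(2) assms(1) \<phi> by (simp add: lincomb_add smult_r_distr)
    also have "\<dots> = lincomb \<phi> (Poly_Mapping.single x (\<kappa> x * c) + q)"
      by (simp add: lincomb_add)
    finally show ?case
      by (intro exI[of _ "Poly_Mapping.single x (\<kappa> x * c) + q"])
        (auto simp: lookup_add lookup_single when_def q(1) algebra_simps)
  qed
  then show ?thesis using that by blast
qed

text \<open>Eigenvectors with distinct joint eigenvalues: if \<open>wt x\<close> and
  \<open>wt y\<close> differ at \<open>i\<close>, applying \<open>H_i - wt y i\<close> removes the
  key \<open>y\<close> from the relation and keeps \<open>x\<close>, so a shorter nontrivial
  relation arises.\<close>

lemma lincomb_weight_independent:
  assumes wt: "\<And>x i. x \<in> Poly_Mapping.keys p \<Longrightarrow> op_H i \<odot> \<phi> x = pscale (wt x i) \<odot> \<phi> x"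
    and inj: "inj_on wt (Poly_Mapping.keys p)"
    and nz: "\<And>x. x \<in> Poly_Mapping.keys p \<Longrightarrow> \<phi> x \<noteq> \<zero>"
    and zero: "lincomb \<phi> p = \<zero>"
  shows "p = 0"
  using assms
proof (induction "card (Poly_Mapping.keys p)" arbitrary: p rule: less_induct)
  case less
  show ?case
  proof (rule ccontr)
    assume "p \<noteq> 0"
    then obtain x where x: "x \<in> Poly_Mapping.keys p" by fastforce
    show False
    proof (cases "Poly_Mapping.keys p = {x}")
      case True
      then have "lincomb \<phi> p = pscale (Poly_Mapping.lookup p x) \<odot> \<phi> x"
        using \<phi> by (simp add: lincomb_def M.finsum_insert)
      then have "pscale (Poly_Mapping.lookup p x) \<odot> \<phi> x = \<zero>" using less.prems(4) by simp
      then have "Poly_Mapping.lookup p x = 0 \<or> \<phi> x = \<zero>" by (simp only: act_pscale_eq_0_iff[OF \<phi>])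
      then show False using less.prems(3)[OF x] x by (simp add: in_keys_iff)
    next
      case False
      then obtain y where y: "y \<in> Poly_Mapping.keys p" "y \<noteq> x" using x by auto
      then have "wt y \<noteq> wt x" using less.prems(2) x by (auto simp: inj_on_def)
      then obtain i where i: "wt y i \<noteq> wt x i" by auto
      have H: "H_minus i (wt y i) \<odot> \<phi> z = pscale (wt z i - wt y i) \<odot> \<phi> z"
        if "z \<in> Poly_Mapping.keys p" for z
        using less.prems(1)[OF that] \<phi>[of z] act_pscale_add[OF \<phi>, of "wt z i - wt y i" "wt y i" z]
        by (simp add: H_minus_act M.minus_eq M.a_assoc M.r_neg)
      obtain q where q: "\<And>z. Poly_Mapping.lookup q z = (wt z i - wt y i) * Poly_Mapping.lookup p z"
        "H_minus i (wt y i) \<odot> lincomb \<phi> p = lincomb \<phi> q"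
        using lincomb_eigen[of "H_minus i (wt y i)" p "\<lambda>z. wt z i - wt y i"] H by auto
      have sub: "Poly_Mapping.keys q \<subseteq> Poly_Mapping.keys p" "y \<notin> Poly_Mapping.keys q"
        "x \<in> Poly_Mapping.keys q"
        using i x by (auto simp: in_keys_iff q(1))
      then have "card (Poly_Mapping.keys q) < card (Poly_Mapping.keys p)"
        using y by (intro psubset_card_mono) auto
      moreover have "lincomb \<phi> q = \<zero>" using q(2) less.prems(4) by simp
      ultimately have "q = 0"
        using less.prems(1-3) sub(1) by (intro less.hyps) (auto intro: inj_on_subset)
      then show False using sub(3) by simp
    qed
  qed
qed

end

text \<open>The weights \<open>lam + \<gamma>\<close> are distinct in characteristic zero, and the
  vectors are nonzero at the positions allowed by the hypothesis on the keys.\<close>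

lemma chain_independent:
  assumes b: "base D lam v" and nz: "v \<noteq> \<zero>" and full: "\<And>i. i \<notin> D \<Longrightarrow> full i"
    and keys: "\<And>\<gamma> i. \<lbrakk>\<gamma> \<in> Poly_Mapping.keys p; i \<in> D\<rbrakk> \<Longrightarrow> \<gamma> i \<ge> 0"
    and zero: "lincomb (chain v) p = \<zero>"
  shows "p = 0"
proof -
  have v: "v \<in> carrier M" using b by (simp add: base_def)
  show ?thesis
  proof (rule lincomb_weight_independent[where \<phi> = "chain v" and wt = "\<lambda>\<gamma> i. lam i + of_int (\<gamma> i)"])
    show "inj_on (\<lambda>\<gamma> i. lam i + of_int (\<gamma> i)) (Poly_Mapping.keys p)"
      by (rule inj_onI) (auto simp: fun_eq_iff)
    show "\<And>\<gamma>. \<gamma> \<in> Poly_Mapping.keys p \<Longrightarrow> chain v \<gamma> \<noteq> \<zero>"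
      using keys full by (intro chain_nonzero v nz) auto
  qed (use v zero in \<open>auto intro: chain_H[OF b]\<close>)
qed

subsection \<open>Existence of eigenvectors\<close>

text \<open>The conditions are reached one variable at a time. An operator of \<open>I_1 i\<close>
  makes the vector good at \<open>i\<close> and keeps it good at the other variables, because it
  commutes with the operators that test goodness there.\<close>

lemma exists_base:
  assumes ty: "of_type M D" and hf: "H_finite M C" and nz: "carrier M \<noteq> {\<zero>}"
  obtains lam v where "base D lam v" "v \<noteq> \<zero>" "\<And>i. i \<notin> D \<Longrightarrow> lam i \<in> C i"
proof -
  define good where "good i v \<longleftrightarrow>
    (if i \<in> D then op_D i \<odot> v = \<zero> else \<exists>c\<in>C i. H_minus i c \<odot> v = \<zero>)" for i v
  \<comment> \<open>Goodness at \<open>i\<close> is annihilation by one operator of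
    \<open>I_1 i\<close>; this form allows the commutation argument.\<close>
  have goodE: "\<exists>b. b \<in> carrier (I_1 i) \<and> b \<odot> v = \<zero> \<and>
      (\<forall>w. b \<odot> w = \<zero> \<longrightarrow> good i w)" if g: "good i v" for i v
  proof (cases "i \<in> D")
    case True
    then show ?thesis using g by (intro exI[of _ "op_D i"]) (auto simp: good_def)
  next
    case False
    then obtain c where "c \<in> C i" "H_minus i c \<odot> v = \<zero>" using g by (auto simp: good_def)
    then show ?thesis using False by (intro exI[of _ "H_minus i c"]) (auto simp: good_def)
  qed
  have step: "\<exists>a\<in>carrier (I_1 i). a \<odot> v \<noteq> \<zero> \<and> good i (a \<odot> v)"
    if v: "v \<in> carrier M" "v \<noteq> \<zero>" for i v
  proof (cases "i \<in> D")
    case True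
    then obtain k where k: "(op_D i ^^ k) \<odot> v = \<zero>" using ty v by (auto simp: of_type_def)
    \<comment> \<open>The last nonzero power \<open>\<partial>^(l-1) v\<close> is killed by
      \<open>\<partial>\<close>.\<close>
    define l where "l = (LEAST k. (op_D i ^^ k) \<odot> v = \<zero>)"
    have l: "(op_D i ^^ l) \<odot> v = \<zero>" unfolding l_def using k by (rule LeastI)
    have "l \<noteq> 0" using l v by (intro notI) simp
    then obtain m where m: "l = Suc m" using not0_implies_Suc by blast
    have "(op_D i ^^ m) \<odot> v \<noteq> \<zero>"
      using not_less_Least[of m "\<lambda>k. (op_D i ^^ k) \<odot> v = \<zero>"] m by (simp add: l_def)
    moreover have "op_D i \<odot> ((op_D i ^^ m) \<odot> v) = \<zero>"
      using l v unfolding m by (simp only: act_funpow_Suc(1) I_n_op)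
    ultimately show ?thesis using True
      by (intro bexI[of _ "op_D i ^^ m"]) (auto simp: good_def)
  next
    case False
    obtain cs where "set cs \<subseteq> C i" "H_prod i cs v = \<zero>" using H_finiteE[OF hf v(1)] by metis
    \<comment> \<open>The factors \<open>H - c\<close> are applied one after the other; the last
      nonzero partial product is an eigenvector.\<close>
    then have "\<exists>a\<in>carrier (I_1 i). \<exists>c\<in>C i. a \<odot> v \<noteq> \<zero> \<and> H_minus i c \<odot> (a \<odot> v) = \<zero>"
    proof (induction cs)
      case Nil
      then show ?case using v by simp
    next
      case (Cons c cs)
      have "\<exists>a\<in>carrier (I_1 i). H_prod i cs v = a \<odot> v"
      proof (induction cs)
        case Nil
        then show ?case using v by (auto intro!: bexI[of _ id])
      next
        case (Cons d cs)
        then obtain a where a: "a \<in> carrier (I_1 i)" "H_prod i cs v = a \<odot> v" by auto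
        have "H_prod i (d # cs) v = (H_minus i d \<circ> a) \<odot> v"
          using a act_comp[OF H_minus_I_n I_1_subset_I_n[OF a(1)] v(1), of i d] by simp
        then show ?case by (rule bexI[where x = "H_minus i d \<circ> a"]) (rule I_1_comp[OF H_minus_I_1 a(1)])
      qed
      then obtain a where a: "a \<in> carrier (I_1 i)" "H_prod i cs v = a \<odot> v" by blast
      show ?case
      proof (cases "H_prod i cs v = \<zero>")
        case True
        then show ?thesis using Cons by simp
      next
        case False
        then show ?thesis using Cons.prems a by (intro bexI[of _ a] bexI[of _ c]) simp_all
      qed
    qed
    then show ?thesis using False by (auto simp: good_def)
  qed
  have "\<exists>v\<in>carrier M. v \<noteq> \<zero> \<and> (\<forall>i\<in>set xs. good i v)" if "distinct xs" for xs
    using that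
  proof (induction xs)
    case Nil
    then show ?case using nz M.zero_closed by auto
  next
    case (Cons i xs)
    then obtain v where v: "v \<in> carrier M" "v \<noteq> \<zero>" "\<forall>i\<in>set xs. good i v" by auto
    obtain a where a: "a \<in> carrier (I_1 i)" "a \<odot> v \<noteq> \<zero>" "good i (a \<odot> v)"
      using step[OF v(1,2)] by blast
    have "good j (a \<odot> v)" if j: "j \<in> set xs" for j
    proof -
      obtain b where b: "b \<in> carrier (I_1 j)" "b \<odot> v = \<zero>" "\<forall>w. b \<odot> w = \<zero> \<longrightarrow> good j w"
        using goodE[of j v] v(3) j by blast
      have "i \<noteq> j" using Cons.prems j by auto
      then have "b \<odot> (a \<odot> v) = a \<odot> (b \<odot> v)"
        by (intro act_I_1_commute[of j i]) (use a b v in auto)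
      then show ?thesis using b a I_1_subset_I_n[OF a(1)] by simp
    qed
    then show ?case using a v I_1_subset_I_n[OF a(1)] by (intro bexI[of _ "a \<odot> v"]) auto
  qed
  from this[OF idx(2)] obtain v where v: "v \<in> carrier M" "v \<noteq> \<zero>" "\<And>i. good i v"
    by (auto simp: idx)
  have "\<exists>c. (i \<in> D \<longrightarrow> c = 1) \<and> (i \<notin> D \<longrightarrow> c \<in> C i) \<and> op_H i \<odot> v = pscale c \<odot> v" for i
  proof (cases "i \<in> D")
    case True
    then have "op_D i \<odot> v = \<zero>" using v(3)[of i] by (simp add: good_def)
    then show ?thesis using True v(1) by (simp add: H_act D_X_act)
  next
    case False
    then obtain c where "c \<in> C i" "H_minus i c \<odot> v = \<zero>" using v(3)[of i] by (auto simp: good_def)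
    then show ?thesis using False v(1) by (auto simp: H_minus_eq_0_iff)
  qed
  then obtain lam where lam: "\<And>i. (i \<in> D \<longrightarrow> lam i = 1) \<and> (i \<notin> D \<longrightarrow> lam i \<in> C i) \<and>
      op_H i \<odot> v = pscale (lam i) \<odot> v"
    by metis
  have "base D lam v"
    unfolding base_def using v(1) lam v(3) by (auto simp: good_def split: if_splits)
  then show ?thesis using that v(2) lam by blast
qed

end

subsection \<open>Words in the generators\<close>

text \<open>A word determines a shift and a coefficient without reference to a module. This
  syntactic form makes it possible to compare the action of one operator on different
  modules.\<close>

datatype 'n gen = GX 'n | GD 'n | GJ 'n

fun gen_op :: "'n gen \<Rightarrow> ('k::field_char_0, 'n) endo" where
  "gen_op (GX i) = op_X i"
| "gen_op (GD i) = op_D i"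
| "gen_op (GJ i) = op_J i"

fun gen_shift :: "'n gen \<Rightarrow> 'n \<Rightarrow> int" where
  "gen_shift (GX i) j = (if j = i then 1 else 0)"
| "gen_shift (GD i) j = (if j = i then -1 else 0)"
| "gen_shift (GJ i) j = (if j = i then 1 else 0)"

fun word_op :: "'n gen list \<Rightarrow> ('k::field_char_0, 'n) endo" where
  "word_op [] = id"
| "word_op (g # w) = gen_op g \<circ> word_op w"

fun word_shift :: "'n gen list \<Rightarrow> 'n \<Rightarrow> int" where
  "word_shift [] j = 0"
| "word_shift (g # w) j = gen_shift g j + word_shift w j"

text \<open>
  A generator multiplies the vector of position \<open>\<gamma>\<close> and weight \<open>\<mu>\<close> of a chain by \<open>gen_coeff\<close>;
  positions only matter for the variables in \<open>D\<close>, where the chain stops at \<open>0\<close>.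
\<close>

fun gen_coeff :: "'n set \<Rightarrow> 'n gen \<Rightarrow> ('n \<Rightarrow> int) \<Rightarrow> ('n \<Rightarrow> 'k) \<Rightarrow> 'k::field_char_0" where
  "gen_coeff D (GX i) \<gamma> \<mu> = \<mu> i"
| "gen_coeff D (GD i) \<gamma> \<mu> = (if i \<in> D \<and> \<gamma> i = 0 then 0 else 1)"
| "gen_coeff D (GJ i) \<gamma> \<mu> = 1"

text \<open>Each letter is evaluated at the place to which the rest of the word has already moved.
  Along a chain \<open>\<mu>\<close> equals \<open>lam + \<gamma>\<close>, but the two are separate
  arguments: the density argument varies \<open>\<mu>\<close> while \<open>\<gamma>\<close> stays
  fixed.\<close>

fun word_coeff :: "'n set \<Rightarrow> 'n gen list \<Rightarrow> ('n \<Rightarrow> int) \<Rightarrow> ('n \<Rightarrow> 'k) \<Rightarrow> 'k::field_char_0" where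
  "word_coeff D [] \<gamma> \<mu> = 1"
| "word_coeff D (g # w) \<gamma> \<mu> =
    gen_coeff D g (\<lambda>i. \<gamma> i + word_shift w i) (\<lambda>i. \<mu> i + of_int (word_shift w i)) * word_coeff D w \<gamma> \<mu>"

lemma gen_op_I_n [simp]: "gen_op g \<in> carrier I_n"
  by (cases g) auto

lemma word_op_I_n [simp]: "word_op w \<in> carrier I_n"
proof (induction w)
  case (Cons g w)
  show ?case unfolding word_op.simps by (rule I_n_comp[OF gen_op_I_n Cons])
next
  case Nil
  show ?case unfolding word_op.simps by (rule I_n_id)
qed

lemma word_shift_bound: "\<bar>word_shift w i\<bar> \<le> int (length w)"
proof (induction w)
  case (Cons g w)
  then show ?case by (cases g) auto
qed simp

text \<open>A word that would step below zero in a variable of \<open>D\<close> applies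
  \<open>\<partial>\<close> at position \<open>0\<close> on its way, which contributes the factor
  \<open>0\<close>.\<close>

lemma word_coeff_nonneg:
  assumes "i \<in> D" "\<gamma> i \<ge> 0" "word_coeff D w \<gamma> \<mu> \<noteq> 0"
  shows "\<gamma> i + word_shift w i \<ge> 0"
  using assms(3)
proof (induction w)
  case (Cons g w)
  then have "\<gamma> i + word_shift w i \<ge> 0" by simp
  then show ?case using Cons.prems assms(1) by (cases g) (auto split: if_splits)
qed (use assms in simp)

lemma word_coeff_cong:
  assumes "\<And>i. i \<in> D \<Longrightarrow> \<gamma> i = \<delta> i"
  shows "word_coeff D w \<gamma> \<mu> = word_coeff D w \<delta> \<mu>"
proof (induction w)
  case (Cons g w)
  then show ?case using assms by (cases g) auto
qed simp

text \<open>Only the letters \<open>GX\<close> contribute factors that depend on the weight, and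
  these are at most linear in one coordinate.\<close>

lemma word_coeff_poly: "\<exists>q. \<forall>t. word_coeff D w \<gamma> (\<mu>(i := t)) = poly q t"
proof (induction w)
  case Nil
  show ?case by (rule exI[of _ 1]) simp
next
  case (Cons g w)
  then obtain q where q: "\<And>t. word_coeff D w \<gamma> (\<mu>(i := t)) = poly q t" by blast
  have "\<exists>r. \<forall>t. gen_coeff D g (\<lambda>j. \<gamma> j + word_shift w j)
      (\<lambda>j. (\<mu>(i := t)) j + of_int (word_shift w j)) = poly r t"
  proof (cases g)
    case (GX j)
    then show ?thesis
      by (intro exI[of _ "if j = i then [:of_int (word_shift w j), 1:] else [:\<mu> j + of_int (word_shift w j):]"])
        (simp add: add.commute)
  next
    case (GD j)
    then show ?thesis by (auto intro: exI[of _ 0] exI[of _ 1])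
  next
    case (GJ j)
    then show ?thesis by (auto intro: exI[of _ 1])
  qed
  then obtain r where r: "\<And>t. gen_coeff D g (\<lambda>j. \<gamma> j + word_shift w j)
      (\<lambda>j. (\<mu>(i := t)) j + of_int (word_shift w j)) = poly r t" by auto
  show ?case unfolding word_coeff.simps r q by (rule exI[of _ "r * q"]) simp
qed

section \<open>Operators as linear combinations of words, and their coordinates\<close>

definition words_op :: "('k \<times> 'n gen list) list \<Rightarrow> ('k::field_char_0, 'n) endo" where
  "words_op ws = (\<lambda>p. \<Sum>(c, w)\<leftarrow>ws. pscale c (word_op w p))"

lemma words_op_Cons: "words_op ((c, w) # ws) = (\<lambda>p. (pscale c \<circ> word_op w) p + words_op ws p)"
  by (simp add: words_op_def)

lemma words_op_append: "words_op (us @ vs) = (\<lambda>p. words_op us p + words_op vs p)"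
  by (simp add: words_op_def)

lemma words_op_I_n: "words_op ws \<in> carrier I_n"
proof (induction ws)
  case Nil
  then show ?case by (simp add: words_op_def)
next
  case (Cons x ws)
  obtain c w where x: "x = (c, w)" by (cases x)
  show ?case unfolding x words_op_Cons
    by (rule I_n_add[OF I_n_comp[OF I_n_pscale word_op_I_n] Cons])
qed

lemma I_n_words:
  fixes a :: "('k::field_char_0, 'n) endo"
  assumes "a \<in> carrier I_n"
  obtains ws where "a = words_op ws"
proof -
  define W where "W = Set.range (words_op :: _ \<Rightarrow> ('k, 'n) endo)"
  have W_sub: "b \<in> carrier End_P" if "b \<in> W" for b
    using that words_op_I_n I_n_subset_End_P by (auto simp: W_def)
  have add: "(\<lambda>p. f p + g p) \<in> W" if "f \<in> W" "g \<in> W" for f g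
    using that words_op_append[symmetric] by (auto simp: W_def)
  have ps: "pscale c \<circ> f \<in> W" if "f \<in> W" for c f
  proof -
    obtain ws where f: "f = words_op ws" using \<open>f \<in> W\<close> by (auto simp: W_def)
    have "pscale c \<circ> words_op ws = words_op (map (\<lambda>(d, w). (c * d, w)) ws)"
      by (induction ws) (auto simp: words_op_def fun_eq_iff pscale.scale_right_distrib)
    then show ?thesis unfolding f W_def by auto
  qed
  have gen: "gen_op g \<circ> f \<in> W" if "f \<in> W" for g f
  proof -
    obtain ws where f: "f = words_op ws" using \<open>f \<in> W\<close> by (auto simp: W_def)
    have e: "gen_op g \<in> carrier (End_P :: ('k, 'n) endo ring)" using I_n_subset_End_P by auto
    have "gen_op g \<circ> words_op ws = words_op (map (\<lambda>(d, w). (d, g # w)) ws)"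
      by (induction ws)
        (auto simp: words_op_def fun_eq_iff End_P_add[OF e] End_P_pscale[OF e] End_P_zero[OF e])
    then show ?thesis unfolding f W_def by auto
  qed
  have word: "word_op w \<circ> f \<in> W" if f: "f \<in> W" for w f
  proof (induction w)
    case Nil
    then show ?case using f by (simp only: word_op.simps id_comp)
  next
    case (Cons g w)
    show ?case unfolding word_op.simps comp_assoc by (rule gen[OF Cons])
  qed
  have words: "words_op ws \<circ> f \<in> W" if f: "f \<in> W" for ws f
  proof (induction ws)
    case Nil
    have "words_op [] \<circ> f = words_op []" by (simp add: words_op_def comp_def)
    then show ?case by (simp only: W_def rangeI)
  next
    case (Cons x ws)
    obtain c w where x: "x = (c, w)" by (cases x)
    have "words_op (x # ws) \<circ> f = (\<lambda>p. (pscale c \<circ> (word_op w \<circ> f)) p + (words_op ws \<circ> f) p)"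
      by (auto simp: x words_op_Cons)
    also have "\<dots> \<in> W" by (rule add[OF ps[OF word[OF f]] Cons])
    finally show ?case .
  qed
  have id: "id \<in> W"
    unfolding W_def by (rule image_eqI[of _ _ "[(1, [])]"]) (auto simp: words_op_def)
  from assms have "a \<in> W"
  proof (induction rule: I_n_induct)
    case (pscale c)
    show ?case using ps[OF id, of c] by (simp only: comp_id)
  next
    case (gen g)
    then obtain h where "g = gen_op h" by (auto intro: gen_op.simps[symmetric])
    then show ?case using \<open>\<And>g f. f \<in> W \<Longrightarrow> gen_op g \<circ> f \<in> W\<close>[OF id, of h] by (simp only: comp_id)
  next
    case (add f g)
    show ?case by (rule \<open>\<And>f g. \<lbrakk>f \<in> W; g \<in> W\<rbrakk> \<Longrightarrow> (\<lambda>p. f p + g p) \<in> W\<close>[OF add(3,4)])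
  next
    case (comp f g)
    then obtain ws where "f = words_op ws" by (auto simp: W_def)
    then show ?case using words[OF comp(4)] by (simp only:)
  qed
  then show ?thesis using that by (auto simp: W_def)
qed

text \<open>The coordinates of \<open>words_op ws\<close> applied to the vector of position \<open>\<gamma>\<close> and weight \<open>\<mu>\<close>.\<close>

definition words_coord ::
  "'n set \<Rightarrow> ('k \<times> 'n gen list) list \<Rightarrow> ('n \<Rightarrow> int) \<Rightarrow> ('n \<Rightarrow> 'k) \<Rightarrow> ('n \<Rightarrow> int) \<Rightarrow>\<^sub>0 'k::field_char_0" where
  "words_coord D ws \<gamma> \<mu> =
    (\<Sum>(c, w)\<leftarrow>ws. Poly_Mapping.single (\<lambda>i. \<gamma> i + word_shift w i) (c * word_coeff D w \<gamma> \<mu>))"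

lemma words_coord_Cons: "words_coord D ((c, w) # ws) \<gamma> \<mu> =
    Poly_Mapping.single (\<lambda>i. \<gamma> i + word_shift w i) (c * word_coeff D w \<gamma> \<mu>) + words_coord D ws \<gamma> \<mu>"
  by (simp add: words_coord_def)

lemma words_coord_nonneg:
  assumes "\<delta> \<in> Poly_Mapping.keys (words_coord D ws \<gamma> \<mu>)" "i \<in> D" "\<gamma> i \<ge> 0"
  shows "\<delta> i \<ge> 0"
  using assms(1)
proof (induction ws)
  case Nil
  then show ?case by (simp add: words_coord_def)
next
  case (Cons x ws)
  obtain c w where x: "x = (c, w)" by (cases x)
  have "\<delta> \<in> Poly_Mapping.keys (Poly_Mapping.single (\<lambda>i. \<gamma> i + word_shift w i) (c * word_coeff D w \<gamma> \<mu>))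
      \<or> \<delta> \<in> Poly_Mapping.keys (words_coord D ws \<gamma> \<mu>)"
    using subsetD[OF keys_add Cons.prems[unfolded x words_coord_Cons]] by (simp only: Un_iff)
  then show ?case
    using Cons.IH word_coeff_nonneg[where D = D and w = w and \<mu> = \<mu> and \<gamma> = \<gamma> and i = i, OF assms(2,3)]
    by (auto split: if_splits)
qed

lemma words_coord_poly:
  "\<exists>q. \<forall>t. Poly_Mapping.lookup (words_coord D ws \<gamma> (\<mu>(i := t))) \<delta> = poly q t"
proof (induction ws)
  case Nil
  show ?case by (rule exI[of _ 0]) (simp add: words_coord_def)
next
  case (Cons x ws)
  obtain c w where x: "x = (c, w)" by (cases x)
  obtain q where "\<And>t. Poly_Mapping.lookup (words_coord D ws \<gamma> (\<mu>(i := t))) \<delta> = poly q t"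
    using Cons by blast
  moreover obtain r where "\<And>t. word_coeff D w \<gamma> (\<mu>(i := t)) = poly r t"
    using word_coeff_poly[of D w \<gamma> \<mu> i] by blast
  ultimately show ?case
    unfolding x words_coord_Cons
    by (intro exI[of _ "(if (\<lambda>i. \<gamma> i + word_shift w i) = \<delta> then smult c r else 0) + q"])
      (auto simp: lookup_add lookup_single when_def)
qed

text \<open>Outside \<open>D\<close> the position only labels the target and does not affect the
  coefficient. Coordinates are therefore compared at the same relative shift
  \<open>z\<close>.\<close>

lemma words_coord_cong:
  assumes "\<And>i. i \<in> D \<Longrightarrow> \<gamma> i = \<delta> i"
  shows "Poly_Mapping.lookup (words_coord D ws \<gamma> \<mu>) (\<lambda>i. \<gamma> i + z i)
    = Poly_Mapping.lookup (words_coord D ws \<delta> \<mu>) (\<lambda>i. \<delta> i + z i)"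
proof (induction ws)
  case Nil
  then show ?case by (simp add: words_coord_def)
next
  case (Cons x ws)
  obtain c w where x: "x = (c, w)" by (cases x)
  have "(\<lambda>i. \<gamma> i + word_shift w i) = (\<lambda>i. \<gamma> i + z i) \<longleftrightarrow>
      (\<lambda>i. \<delta> i + word_shift w i) = (\<lambda>i. \<delta> i + z i)"
    by (auto simp: fun_eq_iff)
  then show ?case
    using Cons word_coeff_cong[where D = D and w = w and \<mu> = \<mu>, OF assms]
    unfolding x words_coord_Cons by (simp add: lookup_add lookup_single when_def)
qed

context I_module
begin

lemma chain_gen:
  assumes b: "base D lam v" and nn: "\<And>i. i \<in> D \<Longrightarrow> \<gamma> i \<ge> 0" and f: "\<And>i. i \<notin> D \<Longrightarrow> \<gamma> i \<ge> 0 \<or> full i"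
  shows "gen_op g \<odot> chain v \<gamma> =
    pscale (gen_coeff D g \<gamma> (\<lambda>i. lam i + of_int (\<gamma> i))) \<odot> chain v (\<lambda>i. \<gamma> i + gen_shift g i)"
proof -
  have v: "v \<in> carrier M" using b by (simp add: base_def)
  have up: "\<gamma> i \<ge> 0 \<or> full i" for i using nn f by blast
  show ?thesis
  proof (cases g)
    case (GX i)
    have "\<gamma>(i := \<gamma> i + 1) = (\<lambda>j. \<gamma> j + gen_shift g j)" using GX by auto
    then show ?thesis using chain_X[where \<gamma> = \<gamma> and i = i, OF b up] GX by simp
  next
    case (GD i)
    have e: "\<gamma>(i := \<gamma> i - 1) = (\<lambda>j. \<gamma> j + gen_shift g j)" using GD by auto
    show ?thesis
    proof (cases "i \<in> D \<and> \<gamma> i = 0")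
      case True
      then show ?thesis using GD chain_D_zero[OF b, where i = i and \<gamma> = \<gamma>] v by simp
    next
      case False
      then have "gen_coeff D g \<gamma> (\<lambda>i. lam i + of_int (\<gamma> i)) = (1 :: 'k)" using GD by auto
      then show ?thesis using GD chain_D[OF v, where i = i and \<gamma> = \<gamma>] v unfolding e by simp
    qed
  next
    case (GJ i)
    have "\<gamma>(i := \<gamma> i + 1) = (\<lambda>j. \<gamma> j + gen_shift g j)" using GJ by auto
    then show ?thesis using chain_J[where \<gamma> = \<gamma> and i = i, OF v up] GJ v by simp
  qed
qed

text \<open>Outside \<open>D\<close> there are two ways to avoid trouble at zero: either
  \<open>J \<partial> = 1\<close> holds in this variable, or the start is at least
  \<open>length w\<close> away from zero. The second alternative serves the polynomials.\<close>

lemma chain_word: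
  assumes b: "base D lam v" and nn: "\<And>i. i \<in> D \<Longrightarrow> \<gamma> i \<ge> 0"
    and f: "\<And>i. i \<notin> D \<Longrightarrow> \<gamma> i \<ge> int (length w) \<or> full i"
  shows "word_op w \<odot> chain v \<gamma> =
    pscale (word_coeff D w \<gamma> (\<lambda>i. lam i + of_int (\<gamma> i))) \<odot> chain v (\<lambda>i. \<gamma> i + word_shift w i)"
  using f
proof (induction w)
  case Nil
  have "v \<in> carrier M" using b by (simp add: base_def)
  then show ?case by simp
next
  case (Cons g w)
  let ?\<mu> = "\<lambda>i. lam i + of_int (\<gamma> i) :: 'k" and ?\<delta> = "\<lambda>i. \<gamma> i + word_shift w i"
  let ?c = "word_coeff D w \<gamma> ?\<mu>"
  have v: "v \<in> carrier M" using b by (simp add: base_def)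
  have IH: "word_op w \<odot> chain v \<gamma> = pscale ?c \<odot> chain v ?\<delta>"
    using Cons.prems by (intro Cons.IH) force
  have "word_op (g # w) \<odot> chain v \<gamma> = gen_op g \<odot> (word_op w \<odot> chain v \<gamma>)"
    unfolding word_op.simps by (rule act_comp[OF gen_op_I_n word_op_I_n chain_closed[OF v]])
  also have "\<dots> = pscale ?c \<odot> (gen_op g \<odot> chain v ?\<delta>)"
    unfolding IH by (rule act_pscale_commute[OF gen_op_I_n chain_closed[OF v]])
  also have "\<dots> = pscale (word_coeff D (g # w) \<gamma> ?\<mu>) \<odot> chain v (\<lambda>i. \<gamma> i + word_shift (g # w) i)"
  \<comment> \<open>With coefficient \<open>0\<close> the position reached may be negative in
    \<open>D\<close>, where \<open>chain_gen\<close> does not apply; both sides vanish.\<close>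
  proof (cases "?c = 0")
    case True
    then show ?thesis using v by simp
  next
    case False
    have "gen_op g \<odot> chain v ?\<delta> =
      pscale (gen_coeff D g ?\<delta> (\<lambda>i. lam i + of_int (?\<delta> i))) \<odot> chain v (\<lambda>i. ?\<delta> i + gen_shift g i)"
    proof (rule chain_gen[OF b])
      show "\<And>i. i \<in> D \<Longrightarrow> 0 \<le> ?\<delta> i" using word_coeff_nonneg[where \<gamma> = \<gamma> and w = w, OF _ nn False] by blast
      fix i assume "i \<notin> D"
      then show "0 \<le> ?\<delta> i \<or> full i" using Cons.prems[of i] word_shift_bound[of w i] by auto
    qed
    moreover have "(\<lambda>i. ?\<delta> i + gen_shift g i) = (\<lambda>i. \<gamma> i + word_shift (g # w) i)"
      by (auto simp: fun_eq_iff)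
    ultimately show ?thesis
      using v by (simp add: act_pscale_mult[symmetric] mult.commute add.assoc)
  qed
  finally show ?case .
qed

lemma chain_words:
  assumes b: "base D lam v" and nn: "\<And>i. i \<in> D \<Longrightarrow> \<gamma> i \<ge> 0"
    and f: "\<And>i c w. \<lbrakk>i \<notin> D; (c, w) \<in> set ws\<rbrakk> \<Longrightarrow> \<gamma> i \<ge> int (length w) \<or> full i"
  shows "words_op ws \<odot> chain v \<gamma> = lincomb (chain v) (words_coord D ws \<gamma> (\<lambda>i. lam i + of_int (\<gamma> i)))"
  using f
proof (induction ws)
  case Nil
  have "v \<in> carrier M" using b by (simp add: base_def)
  then show ?case by (simp add: words_op_def words_coord_def)
next
  case (Cons x ws)
  obtain c w where x: "x = (c, w)" by (cases x)
  let ?\<mu> = "\<lambda>i. lam i + of_int (\<gamma> i) :: 'k"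
  have v: "v \<in> carrier M" using b by (simp add: base_def)
  have w: "word_op w \<odot> chain v \<gamma> =
    pscale (word_coeff D w \<gamma> ?\<mu>) \<odot> chain v (\<lambda>i. \<gamma> i + word_shift w i)"
    by (rule chain_word[OF b nn]) (use Cons.prems x in auto)
  have "words_op (x # ws) \<odot> chain v \<gamma> =
      (pscale c \<circ> word_op w) \<odot> chain v \<gamma> \<oplus> words_op ws \<odot> chain v \<gamma>"
    unfolding x words_op_Cons
    by (rule act_add[OF I_n_comp[OF I_n_pscale word_op_I_n] words_op_I_n chain_closed[OF v]])
  also have "(pscale c \<circ> word_op w) \<odot> chain v \<gamma> = pscale c \<odot> (word_op w \<odot> chain v \<gamma>)"
    by (rule act_comp[OF I_n_pscale word_op_I_n chain_closed[OF v]])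
  also have "\<dots> = pscale (c * word_coeff D w \<gamma> ?\<mu>) \<odot> chain v (\<lambda>i. \<gamma> i + word_shift w i)"
    unfolding w by (rule act_pscale_mult[symmetric]) (use v in auto)
  also have "words_op ws \<odot> chain v \<gamma> = lincomb (chain v) (words_coord D ws \<gamma> ?\<mu>)"
    using Cons.prems by (intro Cons.IH) auto
  finally show ?case
    unfolding x words_coord_Cons using v by (simp add: lincomb_add)
qed

end

subsection \<open>The annihilators\<close>

text \<open>The Zariski density of the lattice \<open>lam + \<int>\<^sup>A\<close>, used one coordinate at a time.\<close>

lemma vanish_on_lattice:
  fixes F :: "('n \<Rightarrow> 'k::field_char_0) \<Rightarrow> 'k"
  assumes "finite A"
    and poly: "\<And>i \<mu>. \<exists>q. \<forall>t. F (\<mu>(i := t)) = poly q t"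
    and zero: "\<And>\<mu>. \<lbrakk>\<And>i. i \<in> A \<Longrightarrow> \<exists>s. \<mu> i = lam i + of_int s; \<And>i. i \<notin> A \<Longrightarrow> \<mu> i = \<nu> i\<rbrakk> \<Longrightarrow> F \<mu> = 0"
  shows "F \<nu> = 0"
  using assms(1) zero
proof (induction A arbitrary: \<nu> rule: finite_induct)
  case empty
  then show ?case by simp
next
  case (insert i A)
  \<comment> \<open>On the line through \<open>\<nu>\<close> in direction \<open>i\<close>,
    \<open>F\<close> is a polynomial in one variable. It vanishes at the infinitely many points
    \<open>lam i + s\<close>, hence everywhere on the line.\<close>
  obtain q where q: "\<And>t. F (\<nu>(i := t)) = poly q t" using poly by metis
  have "poly q (lam i + of_int s) = 0" for s
  proof -
    have "F (\<nu>(i := lam i + of_int s)) = 0"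
    proof (rule insert.IH)
      fix \<mu> assume m: "\<And>j. j \<in> A \<Longrightarrow> \<exists>s. \<mu> j = lam j + of_int s"
        "\<And>j. j \<notin> A \<Longrightarrow> \<mu> j = (\<nu>(i := lam i + of_int s)) j"
      show "F \<mu> = 0"
      proof (rule insert.prems)
        fix j assume "j \<in> insert i A"
        then show "\<exists>s. \<mu> j = lam j + of_int s" using m insert.hyps(2) by (cases "j = i") auto
      next
        fix j assume "j \<notin> insert i A"
        then show "\<mu> j = \<nu> j" using m(2)[of j] by auto
      qed
    qed
    then show ?thesis using q by simp
  qed
  then have "Set.range (\<lambda>s. lam i + of_int s) \<subseteq> {t. poly q t = 0}" by auto
  moreover have "infinite (Set.range (\<lambda>s :: int. lam i + of_int s :: 'k))"
  proof -
    have "inj (\<lambda>s :: int. lam i + of_int s :: 'k)" by (auto simp: inj_on_def)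
    then show ?thesis using infinite_UNIV_int by (metis finite_imageD)
  qed
  ultimately have "infinite {t. poly q t = 0}" using finite_subset by blast
  then have "q = 0" using poly_roots_finite by blast
  then show ?case using q[of "\<nu> i"] by simp
qed

text \<open>All of \<open>K[x\<^sub>1, \<dots>, x\<^sub>n]\<close>; the operations of \<open>poly_module i\<close> do not depend on \<open>i\<close>.\<close>

definition pol_module :: "(('k::field_char_0, 'n) endo, ('k, 'n) pol) module" where
  "pol_module = sub_module (poly_module undefined) UNIV"

lemma pol_module_simps [simp]:
  "carrier pol_module = UNIV" "zero pol_module = 0" "add pol_module = (+)" "a \<odot>\<^bsub>pol_module\<^esub> p = a p"
  by (simp_all add: pol_module_def poly_module_def)

interpretation pol: I_module "pol_module :: (('k::field_char_0, 'n::finite) endo, ('k, 'n) pol) module"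
proof (unfold I_module_def, intro left_module.intro)
  show "ring (I_n :: ('k, 'n) endo ring)" by (rule ring_I_n)
  show "abelian_group (pol_module :: (('k, 'n) endo, ('k, 'n) pol) module)"
  proof (rule abelian_groupI)
    fix x :: "('k, 'n) pol"
    show "\<exists>y\<in>carrier pol_module. y \<oplus>\<^bsub>pol_module\<^esub> x = \<zero>\<^bsub>pol_module\<^esub>"
      by (rule bexI[of _ "- x"]) auto
  qed (auto simp: algebra_simps)
  show "left_module_axioms (I_n :: ('k, 'n) endo ring) pol_module"
    by unfold_locales (simp_all add: End_P_add[OF subsetD[OF I_n_subset_End_P]])
qed

text \<open>Valid for every \<open>D\<close>, since \<open>1\<close> is killed by all
  \<open>\<partial>_i\<close>. Thus the polynomials can be compared with modules of every type,
  although they are themselves locally nilpotent in all variables.\<close>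

lemma pol_base: "pol.base D (\<lambda>i. 1) (1 :: ('k::field_char_0, 'n::finite) pol)"
proof -
  have D: "op_D i (1 :: ('k, 'n) pol) = 0" for i
    using op_D_single[of i 0 "1 :: 'k"] by simp
  moreover have "op_H i (1 :: ('k, 'n) pol) = 1" for i
    using fun_cong[OF op_D_X, of i "1 :: ('k, 'n) pol"] D[of i] End_P_zero[OF op_X_in_End_P, of i]
    by (simp add: op_H_def)
  ultimately show ?thesis by (simp add: pol.base_def)
qed

lemma pop_J_single:
  assumes "distinct xs" "c \<noteq> 0"
  shows "\<exists>d. d \<noteq> 0 \<and> pop xs (\<lambda>i. op_J i ^^ n i) (Poly_Mapping.single \<alpha> c :: ('k::field_char_0, 'n) pol)
    = Poly_Mapping.single (\<alpha> + (\<Sum>i\<in>set xs. Poly_Mapping.single i (n i))) d"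
  using assms(1)
proof (induction xs)
  case Nil
  show ?case by (rule exI[of _ c]) (simp add: pop_simps assms(2))
next
  case (Cons i xs)
  have J: "\<exists>e. e \<noteq> 0 \<and> (op_J i ^^ k) (Poly_Mapping.single \<beta> d :: ('k, 'n) pol)
      = Poly_Mapping.single (\<beta> + Poly_Mapping.single i k) e" if "d \<noteq> 0" for k \<beta> d
  proof (induction k)
    case 0
    then show ?case using that by auto
  next
    case (Suc k)
    then obtain e where e: "e \<noteq> 0" "(op_J i ^^ k) (Poly_Mapping.single \<beta> d :: ('k, 'n) pol)
      = Poly_Mapping.single (\<beta> + Poly_Mapping.single i k) e" by blast
    let ?m = "Poly_Mapping.lookup (\<beta> + Poly_Mapping.single i k) i + 1"
    have "(op_J i ^^ Suc k) (Poly_Mapping.single \<beta> d :: ('k, 'n) pol)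
        = Poly_Mapping.single (\<beta> + Poly_Mapping.single i k + Poly_Mapping.single i 1) (e / of_nat ?m)"
      unfolding funpow.simps comp_apply e(2) by (rule op_J_single)
    also have "\<beta> + Poly_Mapping.single i k + Poly_Mapping.single i 1 = \<beta> + Poly_Mapping.single i (Suc k)"
      by (simp add: add.assoc single_add[symmetric])
    finally have "(op_J i ^^ Suc k) (Poly_Mapping.single \<beta> d :: ('k, 'n) pol)
        = Poly_Mapping.single (\<beta> + Poly_Mapping.single i (Suc k)) (e / of_nat ?m)" .
    moreover have "e / of_nat ?m \<noteq> 0" using e(1) by (simp del: of_nat_add of_nat_Suc)
    ultimately show ?case by blast
  qed
  obtain d where d: "d \<noteq> 0" "pop xs (\<lambda>i. op_J i ^^ n i) (Poly_Mapping.single \<alpha> c :: ('k, 'n) pol)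
    = Poly_Mapping.single (\<alpha> + (\<Sum>i\<in>set xs. Poly_Mapping.single i (n i))) d"
    using Cons by auto
  obtain e where "e \<noteq> 0" "(op_J i ^^ n i)
      (Poly_Mapping.single (\<alpha> + (\<Sum>i\<in>set xs. Poly_Mapping.single i (n i))) d :: ('k, 'n) pol)
    = Poly_Mapping.single (\<alpha> + (\<Sum>i\<in>set xs. Poly_Mapping.single i (n i)) + Poly_Mapping.single i (n i)) e"
    using J[OF d(1)] by blast
  moreover have "\<alpha> + (\<Sum>i\<in>set xs. Poly_Mapping.single i (n i)) + Poly_Mapping.single i (n i)
      = \<alpha> + (\<Sum>i\<in>set (i # xs). Poly_Mapping.single i (n i))"
    using Cons.prems by (simp add: ac_simps)
  ultimately show ?case unfolding pop_simps comp_apply d(2) by metis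
qed

lemma exponent_sum: "\<alpha> = (\<Sum>i\<in>UNIV. Poly_Mapping.single (i::'n::finite) (Poly_Mapping.lookup \<alpha> i))"
  by (rule poly_mapping_eqI) (simp add: lookup_sum lookup_single when_def)

text \<open>Up to nonzero scalars, the monomials are the chain of the constant polynomial
  \<open>1\<close>.\<close>

lemma pol_chain:
  obtains d where "d \<noteq> 0"
    "pol.chain 1 (\<lambda>i. int (Poly_Mapping.lookup \<alpha> i)) = (Poly_Mapping.single \<alpha> d :: ('k::field_char_0, 'n::finite) pol)"
proof -
  have "(\<lambda>i. Jpow i (int (Poly_Mapping.lookup \<alpha> i))) =
      (\<lambda>i. op_J i ^^ Poly_Mapping.lookup \<alpha> i :: ('k, 'n) endo)"
    by (auto simp: Jpow_def)
  then show ?thesis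
    using pop_J_single[OF idx(2), of 1 "Poly_Mapping.lookup \<alpha>" 0] exponent_sum[of \<alpha>] that
    by (auto simp: pol.chain_def idx(1))
qed

text \<open>
  The operators that kill all polynomials sufficiently divisible by the \<open>x\<^sub>i\<close> with \<open>i \<notin> D\<close>. They annihilate
  every module of type \<open>D\<close>, because there \<open>J\<^sub>i\<close> is surjective for these \<open>i\<close>. Conversely, away from the
  walls \<open>\<gamma> i = 0\<close> an operator acts on polynomials by the same coefficients as on a chain.
\<close>

definition eventual_ann :: "'n set \<Rightarrow> ('k::field_char_0, 'n::finite) endo set" where
  "eventual_ann D = {a \<in> carrier I_n. \<exists>k. a \<circ> pop idx (\<lambda>i. op_J i ^^ (if i \<in> D then 0 else k)) = (\<lambda>p. 0)}"

context I_module
begin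

text \<open>The right-hand side does not mention \<open>M\<close>, so all nonzero H-finite modules
  of type \<open>D\<close> share one annihilator.\<close>

lemma ann_eq_eventual_ann:
  assumes ty: "of_type M D" and hf: "H_finite M C" and nz: "carrier M \<noteq> {\<zero>}"
  shows "ann I_n M = eventual_ann D"
proof (intro equalityI subsetI)
  fix a :: "('k, 'n) endo" assume "a \<in> eventual_ann D"
  then obtain k where a: "a \<in> carrier I_n"
    and k: "a \<circ> pop idx (\<lambda>i. op_J i ^^ (if i \<in> D then 0 else k)) = (\<lambda>p. 0)"
    by (auto simp: eventual_ann_def)
  let ?a = "\<lambda>i. op_J i ^^ (if i \<in> D then 0 else k) :: ('k, 'n) endo"
  have ac: "?a j \<in> carrier (I_1 j)" for j by (rule I_1_funpow[OF I_1_op(3)])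
  \<comment> \<open>For \<open>i \<notin> D\<close> every vector is divisible by
    \<open>J_i^k\<close>, and for \<open>i \<in> D\<close> the exponent is \<open>0\<close>. The
    product of the powers of \<open>J\<close> is therefore onto, and \<open>a\<close> vanishes on
    its image.\<close>
  have surj: "\<exists>y\<in>carrier M. x = pop xs ?a \<odot> y" if "x \<in> carrier M" for x xs
    using that
  proof (induction xs arbitrary: x)
    case Nil
    then show ?case by (auto simp: pop_act_Nil)
  next
    case (Cons i xs)
    have "\<exists>y\<in>carrier M. x = ?a i \<odot> y"
    proof (cases "i \<in> D")
      case True
      then show ?thesis using Cons.prems by (intro bexI[of _ x]) (simp_all del: funpow.simps)
    next
      case False
      then have "x \<in> dvs i" using of_type_dvs[OF ty] Cons.prems by simp
      then show ?thesis using False unfolding dvs_def by simp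
    qed
    then obtain y where y: "y \<in> carrier M" "x = ?a i \<odot> y" by blast
    obtain z where z: "z \<in> carrier M" "y = pop xs ?a \<odot> z" using Cons.IH[OF y(1)] by blast
    have "x = pop (i # xs) ?a \<odot> z"
      unfolding y(2) z(2) by (rule pop_act_Cons[OF ac z(1), symmetric])
    then show ?case using z(1) by blast
  qed
  have "a \<odot> x = \<zero>" if x: "x \<in> carrier M" for x
  proof -
    obtain y where y: "y \<in> carrier M" "x = pop idx ?a \<odot> y" using surj[OF x] by blast
    have "a \<odot> x = (a \<circ> pop idx ?a) \<odot> y"
      unfolding y(2) by (rule act_comp[symmetric, OF a pop_I_n[OF I_1_subset_I_n[OF ac]] y(1)])
    then show ?thesis unfolding k using y(1) by simp
  qed
  then show "a \<in> ann I_n M" using a by (simp add: ann_def)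
next
  fix a :: "('k, 'n) endo" assume "a \<in> ann I_n M"
  then have a: "a \<in> carrier I_n" "\<And>x. x \<in> carrier M \<Longrightarrow> a \<odot> x = \<zero>" by (auto simp: ann_def)
  obtain ws where ws: "a = words_op ws" by (rule I_n_words[OF a(1)])
  obtain lam v where b: "base D lam v" and v: "v \<noteq> \<zero>" using exists_base[OF ty hf nz] by metis
  have vc: "v \<in> carrier M" and lam: "\<And>i. i \<in> D \<Longrightarrow> lam i = 1" using b by (auto simp: base_def)
  have full: "full i" if "i \<notin> D" for i using ty that by (auto simp: full_def of_type_def)
  \<comment> \<open>\<open>a\<close> kills the chain of \<open>v\<close>, whose vectors at
    admissible positions are independent, so the coordinates of \<open>a\<close> along the chain
    vanish.\<close>
  have coord_M: "words_coord D ws \<gamma> (\<lambda>i. lam i + of_int (\<gamma> i)) = 0" if nn: "\<And>i. i \<in> D \<Longrightarrow> \<gamma> i \<ge> 0" for \<gamma>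
  proof (rule chain_independent[OF b v full])
    show "0 \<le> \<delta> i" if "\<delta> \<in> Poly_Mapping.keys (words_coord D ws \<gamma> (\<lambda>i. lam i + of_int (\<gamma> i)))" "i \<in> D" for \<delta> i
      by (rule words_coord_nonneg[OF that nn[OF that(2)]])
    have "words_op ws \<odot> chain v \<gamma> = lincomb (chain v) (words_coord D ws \<gamma> (\<lambda>i. lam i + of_int (\<gamma> i)))"
      by (rule chain_words[OF b nn]) (use full in auto)
    then show "lincomb (chain v) (words_coord D ws \<gamma> (\<lambda>i. lam i + of_int (\<gamma> i))) = \<zero>"
      using a(2)[OF chain_closed[OF vc]] unfolding ws by simp
  qed
  \<comment> \<open>The same coordinates at the weights \<open>1 + \<gamma>\<close> of the
    monomials. In the variables of \<open>D\<close> the weights agree already because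
    \<open>lam i = 1\<close>; in the others, vanishing on the coset of \<open>lam i\<close> extends
    to all weights.\<close>
  have coord_P: "words_coord D ws \<gamma> (\<lambda>i. 1 + of_int (\<gamma> i)) = 0" if nn: "\<And>i. i \<in> D \<Longrightarrow> \<gamma> i \<ge> 0" for \<gamma>
  proof (rule poly_mapping_eqI)
    fix \<delta>
    define z where "z i = \<delta> i - \<gamma> i" for i
    have \<delta>: "\<delta> = (\<lambda>i. \<gamma> i + z i)" by (simp add: z_def)
    have "Poly_Mapping.lookup (words_coord D ws \<gamma> (\<lambda>i. 1 + of_int (\<gamma> i))) \<delta> = 0"
    proof (rule vanish_on_lattice[where F = "\<lambda>\<mu>. Poly_Mapping.lookup (words_coord D ws \<gamma> \<mu>) \<delta>"
          and A = "- D" and lam = lam])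
      show "finite (- D)" by simp
      show "\<And>i \<mu>. \<exists>q. \<forall>t. Poly_Mapping.lookup (words_coord D ws \<gamma> (\<mu>(i := t))) \<delta> = poly q t"
        by (rule words_coord_poly)
      fix \<mu> assume m: "\<And>i. i \<in> - D \<Longrightarrow> \<exists>s. \<mu> i = lam i + of_int s"
        "\<And>i. i \<notin> - D \<Longrightarrow> \<mu> i = 1 + of_int (\<gamma> i)"
      \<comment> \<open>Outside \<open>D\<close> the position may be changed so as to match the
        weight \<open>\<mu>\<close>; the coordinates depend only on the relative shift
        \<open>z\<close>.\<close>
      have "\<exists>s. \<mu> i = lam i + of_int s \<and> (i \<in> D \<longrightarrow> s = \<gamma> i)" for i
        using m[of i] lam[of i] by (cases "i \<in> D") auto
      then obtain \<gamma>' where g: "\<And>i. \<mu> i = lam i + of_int (\<gamma>' i)" "\<And>i. i \<in> D \<Longrightarrow> \<gamma>' i = \<gamma> i"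
        by metis
      have "(\<lambda>i. lam i + of_int (\<gamma>' i)) = \<mu>" using g(1) by auto
      moreover have "words_coord D ws \<gamma>' (\<lambda>i. lam i + of_int (\<gamma>' i)) = 0"
        by (rule coord_M) (simp add: g(2) nn)
      ultimately have "words_coord D ws \<gamma>' \<mu> = 0" by simp
      then show "Poly_Mapping.lookup (words_coord D ws \<gamma> \<mu>) \<delta> = 0"
        using words_coord_cong[of D \<gamma>' \<gamma> ws \<mu> z] g(2) unfolding \<delta> by simp
    qed
    then show "Poly_Mapping.lookup (words_coord D ws \<gamma> (\<lambda>i. 1 + of_int (\<gamma> i))) \<delta>
        = Poly_Mapping.lookup 0 \<delta>" by simp
  qed
  \<comment> \<open>The sum of all word lengths bounds each of them. Starting from exponents at
    least \<open>k\<close> outside \<open>D\<close>, no word reaches a negative exponent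
    there.\<close>
  define k where "k = sum_list (map (length \<circ> snd) ws)"
  have k: "length w \<le> k" if "(c, w) \<in> set ws" for c w
    unfolding k_def using that by (intro member_le_sum_list) force+
  let ?p = "pop idx (\<lambda>i. op_J i ^^ (if i \<in> D then 0 else k)) :: ('k, 'n) endo"
  have aE: "a \<in> carrier End_P" using a(1) I_n_subset_End_P by auto
  have pI: "?p \<in> carrier I_n" by (rule pop_I_n) (rule I_n_funpow[OF I_n_op(3)])
  have "a \<circ> ?p = (\<lambda>p. 0)"
  proof (rule End_P_eqI)
    show "a \<circ> ?p \<in> carrier End_P" using I_n_comp[OF a(1) pI] I_n_subset_End_P by auto
    show "(\<lambda>p. 0) \<in> carrier End_P" using I_n_zero I_n_subset_End_P by auto
    fix \<alpha>
    define \<beta> where "\<beta> = \<alpha> + (\<Sum>i\<in>set idx. Poly_Mapping.single i (if i \<in> D then 0 else k))"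
    obtain d where d: "?p (Poly_Mapping.single \<alpha> 1) = Poly_Mapping.single \<beta> d"
      using pop_J_single[OF idx(2), of 1 "\<lambda>i. if i \<in> D then 0 else k" \<alpha>] unfolding \<beta>_def by auto
    have \<beta>: "Poly_Mapping.lookup \<beta> i \<ge> k" if "i \<notin> D" for i
      using that by (simp add: \<beta>_def lookup_add lookup_sum idx(1) lookup_single when_def)
    obtain e where e: "e \<noteq> 0"
      "pol.chain 1 (\<lambda>i. int (Poly_Mapping.lookup \<beta> i)) = (Poly_Mapping.single \<beta> e :: ('k, 'n) pol)"
      by (rule pol_chain)
    have "words_op ws \<odot>\<^bsub>pol_module\<^esub> pol.chain 1 (\<lambda>i. int (Poly_Mapping.lookup \<beta> i))
        = pol.lincomb (pol.chain (1 :: ('k, 'n) pol))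
            (words_coord D ws (\<lambda>i. int (Poly_Mapping.lookup \<beta> i))
              (\<lambda>i. 1 + of_int (int (Poly_Mapping.lookup \<beta> i))))"
    proof (rule pol.chain_words[OF pol_base])
      fix i c w assume "i \<notin> D" "(c, w) \<in> set ws"
      then have "length w \<le> Poly_Mapping.lookup \<beta> i" using k[of c w] \<beta>[of i] by linarith
      then show "int (length w) \<le> int (Poly_Mapping.lookup \<beta> i) \<or> Q" for Q by simp
    qed simp
    also have "\<dots> = 0"
      by (subst coord_P) (simp_all add: pol.lincomb_zero)
    finally have "a (Poly_Mapping.single \<beta> e) = 0" unfolding e(2) ws by simp
    moreover have "Poly_Mapping.single \<beta> d = pscale (d / e) (Poly_Mapping.single \<beta> e)"
      using e(1) by simp
    ultimately show "(a \<circ> ?p) (Poly_Mapping.single \<alpha> 1) = 0"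
      unfolding comp_apply d by (simp only: End_P_pscale[OF aE] pscale.scale_zero_right)
  qed
  then show "a \<in> eventual_ann D" using a(1) by (auto simp: eventual_ann_def)
qed

lemma absolutely_prime_of_type:
  assumes ty: "of_type M D" and hf: "H_finite M C" and nz: "carrier M \<noteq> {\<zero>}"
  shows "absolutely_prime I_n M"
proof (rule absolutely_primeI[OF nz])
  fix M1 M2 assume M: "submodule M1 I_n M" "submodule M2 I_n M" "M1 \<subset> M2"
  interpret S: I_module "sub_module M M2" by (rule I_module_sub_module[OF M(2)])
  have M1: "submodule M1 I_n (sub_module M M2)"
    using M by (auto simp: submodule_sub_module_iff[OF M(2)])
  interpret Q: I_module "quot_module (sub_module M M2) M1" by (rule S.I_module_quot_module[OF M1])
  interpret N: abelian_subgroup M1 "sub_module M M2" by (rule S.submodule_abelian_subgroup[OF M1])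
  obtain x where x: "x \<in> M2" "x \<notin> M1" using M(3) by auto
  have "M1 +>\<^bsub>sub_module M M2\<^esub> x \<noteq> M1" using N.coset_eq_self_iff[of x] x by simp
  then have nz': "carrier (quot_module (sub_module M M2) M1) \<noteq> {\<zero>\<^bsub>quot_module (sub_module M M2) M1\<^esub>}"
    using N.coset_in_rcosets[of x] x by auto
  have "ann I_n (quot_module (sub_module M M2) M1) = eventual_ann D"
    by (rule Q.ann_eq_eventual_ann[OF S.of_type_quot_module[OF of_type_sub_module[OF ty M(2)] M1]
      S.H_finite_quot_module[OF H_finite_sub_module[OF hf M(2)] M1] nz'])
  then show "ann I_n (quot_module (sub_module M M2) M1) = ann I_n M"
    by (rule trans[OF _ ann_eq_eventual_ann[OF ty hf nz, symmetric]])
qed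

end

section \<open>Decomposition into absolutely prime modules\<close>

context I_module
begin

text \<open>The operator \<open>1 - J \<partial>\<close> tests the type at \<open>i\<close>. If it
  killed a module with \<open>i \<in> D\<close>, every vector would be both nilpotent and infinitely
  divisible, hence zero.\<close>

lemma type_via_ann:
  assumes ty: "of_type M D" and nz: "carrier M \<noteq> {\<zero>}"
  shows "(\<lambda>p. p - op_J i (op_D i p)) \<in> ann I_n M \<longleftrightarrow> i \<notin> D"
proof -
  let ?e = "\<lambda>p :: ('k, 'n) pol. p - op_J i (op_D i p)"
  have e: "?e = (\<lambda>p. id p + (pscale (-1) \<circ> (op_J i \<circ> op_D i)) p)" by auto
  have eI: "?e \<in> carrier I_n"
    unfolding e by (rule I_n_add[OF I_n_id I_n_comp[OF I_n_pscale I_n_comp[OF I_n_op(3) I_n_op(2)]]])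
  have act: "?e \<odot> m = e00 i m" if m: "m \<in> carrier M" for m
  proof -
    have "?e \<odot> m = id \<odot> m \<oplus> (pscale (-1) \<circ> (op_J i \<circ> op_D i)) \<odot> m"
      unfolding e by (rule act_add[OF I_n_id I_n_comp[OF I_n_pscale I_n_comp[OF I_n_op(3) I_n_op(2)]] m])
    also have "(pscale (-1) \<circ> (op_J i \<circ> op_D i)) \<odot> m = \<ominus> (op_J i \<odot> (op_D i \<odot> m))"
      using m by (simp only: act_comp I_n_pscale I_n_comp I_n_op act_pscale_minus_1 smult_closed)
    finally show ?thesis using m by (simp only: act_id e00_def M.minus_eq)
  qed
  show ?thesis
  proof
    assume "?e \<in> ann I_n M"
    then have "?e \<odot> m = \<zero>" if "m \<in> carrier M" for m
      using that by (simp add: ann_def)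
    then have "e00 i m = \<zero>" if "m \<in> carrier M" for m
      using that act[OF that] by metis
    then have JD: "op_J i \<odot> (op_D i \<odot> m) = m" if "m \<in> carrier M" for m
      using that by (simp only: e00_eq_0_iff[symmetric])
    show "i \<notin> D"
    proof
      assume i: "i \<in> D"
      have "m = \<zero>" if m: "m \<in> carrier M" for m
        by (rule nil_dvs_zero[OF of_type_nil[OF ty i m] dvsI[OF m JD]]) (use m in simp)
      then show False using nz by auto
    qed
  next
    assume "i \<notin> D"
    then have "e00 i m = \<zero>" if "m \<in> carrier M" for m
      using that ty by (simp add: e00_eq_0_iff of_type_def)
    then show "?e \<in> ann I_n M" using eI act by (simp add: ann_def)
  qed
qed

lemma type_unique_of_ann:
  assumes "of_type M D" "carrier M \<noteq> {\<zero>}" "I_module N" "of_type N E" "carrier N \<noteq> {\<zero>\<^bsub>N\<^esub>}"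
    and "ann I_n M = ann I_n N"
  shows "D = E"
proof -
  interpret N: I_module N by fact
  show ?thesis using type_via_ann[OF assms(1,2)] N.type_via_ann[OF assms(4,5)] assms(6) by auto
qed

end

context H_module
begin

lemma part_closed: "part D \<subseteq> carrier M"
  by (rule submodule_subset[OF submodule_part])

lemma absolutely_prime_part:
  assumes "part D \<noteq> {\<zero>}"
  shows "absolutely_prime I_n (sub_module M (part D))"
proof -
  interpret S: I_module "sub_module M (part D)" by (rule I_module_sub_module[OF submodule_part])
  show ?thesis
    by (rule S.absolutely_prime_of_type[OF of_type_part H_finite_sub_module[OF H_finite submodule_part]])
      (use assms in simp)
qed

lemma abs_prime_decomposition_parts:
  assumes "generalized_weight M"
  shows "abs_prime_decomposition M parts"
  unfolding abs_prime_decomposition_def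
proof (intro conjI ballI)
  fix N assume "N \<in> parts"
  then obtain D where N: "N = part D" "part D \<noteq> {\<zero>}" by (auto simp: parts_def)
  then show "submodule N I_n M" "absolutely_prime I_n (sub_module M N)"
    "generalized_weight (sub_module M N)"
    using submodule_part absolutely_prime_part generalized_weight_part[OF assms] by auto
next
  show "internal_direct_sum M parts (\<lambda>N. N)" by (rule direct_sum_parts_set)
  show "inj_on (\<lambda>N. ann I_n (sub_module M N)) parts"
  proof (rule inj_onI)
    fix N N' assume a: "N \<in> parts" "N' \<in> parts" "ann I_n (sub_module M N) = ann I_n (sub_module M N')"
    then obtain D E where N: "N = part D" "part D \<noteq> {\<zero>}" "N' = part E" "part E \<noteq> {\<zero>}"
      by (auto simp: parts_def)
    interpret S: I_module "sub_module M (part D)" by (rule I_module_sub_module[OF submodule_part])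
    have "D = E"
      by (rule S.type_unique_of_ann[OF of_type_part _ I_module_sub_module[OF submodule_part] of_type_part])
        (use N a in auto)
    then show "N = N'" using N by simp
  qed
qed

section \<open>Uniqueness of the decomposition\<close>

lemma of_type_subset_part:
  assumes N: "submodule N I_n M" and ty: "of_type (sub_module M N) D"
  shows "N \<subseteq> part D"
proof
  fix m assume m: "m \<in> N"
  then have mc: "m \<in> carrier M" using submodule_subset[OF N] by auto
  have "m \<in> cond D i" for i
  proof (cases "i \<in> D")
    case True
    then show ?thesis using ty m mc by (auto simp: of_type_def cond_def nil_def)
  next
    case False
    have "m \<in> dvs i"
    proof (rule dvsI[OF mc])
      fix k
      have "(op_D i ^^ k) \<odot> m \<in> N" by (rule submodule_smult[OF N I_n_funpow[OF I_n_op(2)] m])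
      then show "op_J i \<odot> (op_D i \<odot> ((op_D i ^^ k) \<odot> m)) = (op_D i ^^ k) \<odot> m"
        using ty False by (simp add: of_type_def)
    qed
    then show ?thesis using False by (simp add: cond_def)
  qed
  then show "m \<in> part D" by (simp add: part_def)
qed

text \<open>The submodule is split into its own parts. Two nonzero parts would both have the
  annihilator of the whole, hence the same type; so exactly one part is nonzero and it is
  everything.\<close>

lemma absolutely_prime_type:
  assumes N: "submodule N I_n M" and ap: "absolutely_prime I_n (sub_module M N)"
  obtains D where "of_type (sub_module M N) D"
proof -
  interpret N: H_module "sub_module M N" C
    unfolding H_module_def H_module_axioms_def
    using I_module_sub_module[OF N] H_finite_sub_module[OF H_finite N] by simp
  have nz: "carrier (sub_module M N) \<noteq> {\<zero>\<^bsub>sub_module M N\<^esub>}"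
    using ap by (auto simp: absolutely_prime_def)
  let ?P = "\<lambda>D. sub_module (sub_module M N) (N.part D)"
  have annP: "ann I_n (?P D) = ann I_n (sub_module M N)" if "N.part D \<noteq> {\<zero>}" for D
    by (rule N.absolutely_prime_ann_submodule[OF ap N.submodule_part]) (use that in simp)
  have IP: "I_module (?P D)" for D by (rule N.I_module_sub_module[OF N.submodule_part])
  have "\<exists>D. N.part D \<noteq> {\<zero>}"
  proof (rule ccontr)
    assume "\<not> ?thesis"
    then have z: "N.part D = {\<zero>\<^bsub>sub_module M N\<^esub>}" for D by simp
    have "m = \<zero>\<^bsub>sub_module M N\<^esub>" if m: "m \<in> carrier (sub_module M N)" for m
      using N.parts_decompose[OF m, of "{}"] z by simp
    then show False using nz N.M.zero_closed by blast
  qed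
  then obtain D where D: "N.part D \<noteq> {\<zero>}" by blast
  have other: "N.part E = {\<zero>\<^bsub>sub_module M N\<^esub>}" if "E \<notin> {D}" for E
  proof (rule ccontr)
    assume E: "N.part E \<noteq> {\<zero>\<^bsub>sub_module M N\<^esub>}"
    then have "ann I_n (?P D) = ann I_n (?P E)" using annP[OF D] annP[of E] by simp
    then have "D = E"
      using I_module.type_unique_of_ann[OF IP N.of_type_part _ IP N.of_type_part] D E by simp
    then show False using that by simp
  qed
  have "N.part D = N"
  proof
    show "N.part D \<subseteq> N" using N.part_closed by auto
    show "N \<subseteq> N.part D"
    proof
      fix m assume "m \<in> N"
      then have m: "m \<in> carrier (sub_module M N)" by simp
      have "m = finsum (sub_module M N) (\<lambda>D. N.comp idx D m) {D}"
        by (rule N.parts_decompose[OF m other])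
      also have "\<dots> = N.comp idx D m"
        using N.comp_closed[OF m] subsetD[OF submodule_subset[OF N], of "N.comp idx D m"]
        by (simp add: N.M.finsum_insert)
      finally show "m \<in> N.part D" using N.comp_in_part[OF m] by metis
    qed
  qed
  then have "of_type (sub_module M N) D" using N.of_type_part[of D] by simp
  then show ?thesis by (rule that)
qed

text \<open>Every summand has a type, and different summands have different types since their
  annihilators differ. A summand of type \<open>D\<close> lies in \<open>part D\<close>, and as the
  only one of its type it has to fill this part.\<close>

lemma abs_prime_decomposition_unique:
  assumes S: "abs_prime_decomposition M S"
  shows "S = parts"
proof -
  have N: "submodule N I_n M" "absolutely_prime I_n (sub_module M N)" if "N \<in> S" for N
    using S that by (auto simp: abs_prime_decomposition_def)
  have ids: "internal_direct_sum M S (\<lambda>N. N)" using S by (simp add: abs_prime_decomposition_def)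
  have inj: "inj_on (\<lambda>N. ann I_n (sub_module M N)) S" using S by (simp add: abs_prime_decomposition_def)
  have nz: "N \<noteq> {\<zero>}" if "N \<in> S" for N
    using N[OF that] by (auto simp: absolutely_prime_def)
  have "\<exists>D. of_type (sub_module M N) D" if "N \<in> S" for N
    using absolutely_prime_type[OF N[OF that]] by blast
  then obtain ty where ty: "\<And>N. N \<in> S \<Longrightarrow> of_type (sub_module M N) (ty N)" by metis
  have sub: "N \<subseteq> part (ty N)" if "N \<in> S" for N
    by (rule of_type_subset_part[OF N(1)[OF that] ty[OF that]])
  have ann: "ann I_n (sub_module M N) = eventual_ann (ty N)" if "N \<in> S" for N
  proof -
    interpret N: I_module "sub_module M N" by (rule I_module_sub_module[OF N(1)[OF that]])
    show ?thesis
      by (rule N.ann_eq_eventual_ann[OF ty[OF that] H_finite_sub_module[OF H_finite N(1)[OF that]]])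
        (use nz[OF that] in simp)
  qed
  have ty_inj: "N = N'" if "N \<in> S" "N' \<in> S" "ty N = ty N'" for N N'
    using inj_onD[OF inj _ that(1,2)] ann that by simp
  \<comment> \<open>Projection to type \<open>D\<close> kills the components of all other types. As
    at most one summand has type \<open>D\<close>, a nonzero element of the part equals its
    component in that summand.\<close>
  have key: "\<exists>N\<in>S. ty N = D \<and> m \<in> N" if m: "m \<in> part D" "m \<noteq> \<zero>" for m D
  proof -
    have mc: "m \<in> carrier M" using m part_closed by auto
    obtain J f where J: "finite J" "J \<subseteq> S" "\<And>N. N \<in> S \<Longrightarrow> f N \<in> N" "m = finsum M f J"
      by (rule internal_direct_sum_decompose[OF ids mc]) blast
    have fp: "f N \<in> part (ty N)" if "N \<in> J" for N using sub J that by blast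
    have fc: "f \<in> J \<rightarrow> carrier M" using fp part_closed by blast
    have "comp idx D m = finsum M (\<lambda>N. comp idx D (f N)) J"
      unfolding J(4) by (rule M.finsum_hom[OF comp_hom comp_zero fc])
    then have eq: "m = finsum M (\<lambda>N. comp idx D (f N)) J"
      using comp_on_part[OF m(1)] by simp
    have "\<exists>N\<in>J. ty N = D"
    proof (rule ccontr)
      assume "\<not> ?thesis"
      then have "comp idx D (f N) = \<zero>" if "N \<in> J" for N
        using comp_on_other_part[OF fp[OF that], of D] that by auto
      then have "m = \<zero>" using eq by (simp cong: M.finsum_cong)
      then show False using m by simp
    qed
    then obtain N where N: "N \<in> J" "ty N = D" by blast
    have "(\<lambda>N. comp idx D (f N)) \<in> J \<rightarrow> carrier M" using fc by auto
    then have "m = finsum M (\<lambda>N'. if N = N' then f N' else \<zero>) J"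
    proof -
      have "comp idx D (f N') = (if N = N' then f N' else \<zero>)" if "N' \<in> J" for N'
      proof (cases "N = N'")
        case True
        then show ?thesis using comp_on_part[of "f N" D] fp[OF N(1)] N(2) by simp
      next
        case False
        then have "D \<noteq> ty N'" using ty_inj[of N N'] N J(2) that by auto
        then show ?thesis using comp_on_other_part[OF fp[OF that]] False by simp
      qed
      then have "finsum M (\<lambda>N. comp idx D (f N)) J = finsum M (\<lambda>N'. if N = N' then f N' else \<zero>) J"
        using fc by (intro M.finsum_cong') auto
      then show ?thesis using eq by simp
    qed
    also have "\<dots> = f N" using N(1) J(1) fc by (rule M.add.finprod_singleton)
    finally show ?thesis using N J by blast
  qed
  have eq: "N = part (ty N)" if "N \<in> S" for N
  proof
    show "N \<subseteq> part (ty N)" by (rule sub[OF that])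
    show "part (ty N) \<subseteq> N"
    proof
      fix m assume m: "m \<in> part (ty N)"
      show "m \<in> N"
      proof (cases "m = \<zero>")
        case True
        then show ?thesis using submodule_zero[OF N(1)[OF that]] by simp
      next
        case False
        then obtain N' where "N' \<in> S" "ty N' = ty N" "m \<in> N'" using key[OF m] by blast
        then show ?thesis using ty_inj that by metis
      qed
    qed
  qed
  show ?thesis
  proof
    show "S \<subseteq> parts"
    proof
      fix N assume "N \<in> S"
      then show "N \<in> parts" unfolding parts_def using eq[of N] nz[of N] by auto
    qed
    show "parts \<subseteq> S"
    proof
      fix P assume "P \<in> parts"
      then obtain D where D: "P = part D" "part D \<noteq> {\<zero>}" by (auto simp: parts_def)
      then obtain m where "m \<in> part D" "m \<noteq> \<zero>"
        using submodule_zero[OF submodule_part, of D] by blast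
      then obtain N where "N \<in> S" "ty N = D" using key by blast
      then show "P \<in> S" using eq[of N] D by simp
    qed
  qed
qed

lemma ex1_abs_prime_decomposition:
  "generalized_weight M \<Longrightarrow> \<exists>!S. abs_prime_decomposition M S"
  using abs_prime_decomposition_parts abs_prime_decomposition_unique by blast

end

section \<open>Tensor products\<close>

lemma op_H_single: "op_H i (Poly_Mapping.single \<alpha> 1) =
    pscale (of_nat (Poly_Mapping.lookup \<alpha> i) + 1) (Poly_Mapping.single \<alpha> 1)"
  by (simp add: op_H_def op_X_single op_D_single lookup_add add.commute)

text \<open>The polynomials are a faithful module, so the operator identity can be checked on
  monomials, which are eigenvectors of \<open>H\<close>.\<close>

lemma op_H_Jpow:
  "op_H i \<circ> Jpow i s = (\<lambda>p. Jpow i s (op_H i p) + pscale (of_int s) (Jpow i s p))"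
  for i :: "'n::finite"
proof (rule End_P_eqI)
  have J: "Jpow i s \<in> carrier End_P" by (rule subsetD[OF I_n_subset_End_P Jpow_I_n])
  show "op_H i \<circ> Jpow i s \<in> carrier End_P" by (rule comp_in_End_P[OF op_H_in_End_P J])
  show "(\<lambda>p. Jpow i s (op_H i p) + pscale (of_int s) (Jpow i s p)) \<in> carrier End_P"
    using add_in_End_P[OF comp_in_End_P[OF J op_H_in_End_P] comp_in_End_P[OF pscale_in_End_P J]]
    by simp
  fix \<alpha> :: "'n \<Rightarrow>\<^sub>0 nat"
  let ?p = "Poly_Mapping.single \<alpha> 1" and ?c = "of_nat (Poly_Mapping.lookup \<alpha> i) + 1"
  have "op_H i (Jpow i s ?p) = pscale (?c + of_int s) (Jpow i s ?p)"
    by (rule pol.H_Jpow[of ?p i ?c s, unfolded pol_module_simps, OF UNIV_I op_H_single])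
  then show "(op_H i \<circ> Jpow i s) ?p = Jpow i s (op_H i ?p) + pscale (of_int s) (Jpow i s ?p)"
    unfolding comp_apply op_H_single End_P_pscale[OF J] by (simp only: pscale.scale_left_distrib)
qed

lemma op_D_Jpow: "op_D i \<circ> Jpow i s = Jpow i (s - 1)" for i :: "'n::finite"
  using pol.D_Jpow[of _ i s] by (auto simp: fun_eq_iff)

lemma op_J_Jpow: "s \<ge> 0 \<Longrightarrow> op_J i \<circ> Jpow i s = Jpow i (s + 1)" for i :: "'n::finite"
  using pol.J_Jpow[of _ s i] by (auto simp: fun_eq_iff)

text \<open>The factor \<open>Ms i\<close> is cyclic, and \<open>cl i a\<close> is the product of \<open>a\<close> and its generator.\<close>

locale cyclic_tensor = I_module Q
  for Q :: "(('k::field_char_0, 'n::finite) endo, 'm) module" (structure) +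
  fixes Ms :: "'n \<Rightarrow> (('k, 'n) endo, 'y) module"
    and cl :: "'n \<Rightarrow> ('k, 'n) endo \<Rightarrow> 'y"
    and D :: "'n set" and lam :: "'n \<Rightarrow> 'k" and v :: 'm
  assumes car: "carrier (Ms i) = cl i ` carrier (I_1 i)"
    and cl_add: "\<lbrakk>a \<in> carrier (I_1 i); b \<in> carrier (I_1 i)\<rbrakk> \<Longrightarrow>
      cl i a \<oplus>\<^bsub>Ms i\<^esub> cl i b = cl i (\<lambda>p. a p + b p)"
    and cl_smult: "\<lbrakk>a \<in> carrier (I_1 i); b \<in> carrier (I_1 i)\<rbrakk> \<Longrightarrow>
      a \<odot>\<^bsub>Ms i\<^esub> cl i b = cl i (a \<circ> b)"
    and cl_act: "\<lbrakk>a \<in> carrier (I_1 i); b \<in> carrier (I_1 i); cl i a = cl i b\<rbrakk> \<Longrightarrow>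
      a \<odot> v = b \<odot> v"
    and cl_D: "i \<in> D \<Longrightarrow> cl i (op_D i) = cl i (\<lambda>p. 0)"
    and cl_J_D: "\<lbrakk>i \<notin> D; a \<in> carrier (I_1 i)\<rbrakk> \<Longrightarrow> cl i (op_J i \<circ> (op_D i \<circ> a)) = cl i a"
    and cl_H: "i \<notin> D \<Longrightarrow> cl i (op_H i) = cl i (pscale (lam i))"
    and base_v: "base D lam v" and v_nz: "v \<noteq> \<zero>"
    and full: "i \<notin> D \<Longrightarrow> full i"
    and simple: "submodule N I_n Q \<Longrightarrow> N = {\<zero>} \<or> N = carrier Q"
begin

lemma vc: "v \<in> carrier Q"
  using base_v by (simp add: base_def)

lemma cl_closed [simp, intro]: "a \<in> carrier (I_1 i) \<Longrightarrow> cl i a \<in> carrier (Ms i)"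
  by (simp add: car)

lemma Ms_add_closed: "\<lbrakk>x \<in> carrier (Ms i); y \<in> carrier (Ms i)\<rbrakk> \<Longrightarrow> x \<oplus>\<^bsub>Ms i\<^esub> y \<in> carrier (Ms i)"
  unfolding car by (auto simp: cl_add intro!: imageI I_1_add)

lemma Ms_smult_closed: "\<lbrakk>a \<in> carrier (I_1 i); x \<in> carrier (Ms i)\<rbrakk> \<Longrightarrow> a \<odot>\<^bsub>Ms i\<^esub> x \<in> carrier (Ms i)"
proof -
  assume a: "a \<in> carrier (I_1 i)" and "x \<in> carrier (Ms i)"
  then obtain b where b: "b \<in> carrier (I_1 i)" "x = cl i b" by (auto simp: car)
  show ?thesis unfolding b(2) cl_smult[OF a b(1)] by (rule cl_closed[OF I_1_comp[OF a b(1)]])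
qed

subsection \<open>A weight basis of the factors\<close>

text \<open>The positions at which the chain of \<open>v\<close> is nonzero: for
  \<open>i \<in> D\<close>, a negative position means a positive power of
  \<open>\<partial>_i\<close> applied to \<open>v\<close>.\<close>

definition adm :: "'n \<Rightarrow> int \<Rightarrow> bool" where
  "adm i s \<longleftrightarrow> (i \<in> D \<longrightarrow> s \<ge> 0)"

text \<open>The span of the classes of the admissible \<open>J^s\<close>. It is generated
  inductively through the rules for \<open>cl\<close>, since module axioms for the factor
  \<open>Ms i\<close> are not among the assumptions.\<close>

inductive_set Sp :: "'n \<Rightarrow> 'y set" for i where
  zero: "cl i (\<lambda>p. 0) \<in> Sp i"
| step: "\<lbrakk>adm i s; a \<in> carrier (I_1 i); cl i a \<in> Sp i\<rbrakk> \<Longrightarrow>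
    (pscale b \<odot>\<^bsub>Ms i\<^esub> cl i (Jpow i s)) \<oplus>\<^bsub>Ms i\<^esub> cl i a \<in> Sp i"

lemma Sp_carrier: "y \<in> Sp i \<Longrightarrow> y \<in> carrier (Ms i)"
  by (induction rule: Sp.induct) (auto intro!: Ms_add_closed Ms_smult_closed)

lemma cl_cong_comp:
  assumes "g \<in> carrier (I_1 i)" "a \<in> carrier (I_1 i)" "b \<in> carrier (I_1 i)" "cl i a = cl i b"
  shows "cl i (g \<circ> a) = cl i (g \<circ> b)"
  using cl_smult[OF assms(1,2)] cl_smult[OF assms(1,3)] assms(4) by simp

lemma I_1_comp_zero: "g \<in> carrier (I_1 i) \<Longrightarrow> g \<circ> (\<lambda>p. 0) = (\<lambda>p. 0)"
  using End_P_zero[OF subsetD[OF I_1_subset_End_P]] by (auto simp: fun_eq_iff)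

text \<open>For \<open>i \<in> D\<close> the class of \<open>\<partial>\<close> is zero, so
  \<open>H = 1 + x \<partial>\<close> has the class of \<open>1\<close>, in agreement with
  \<open>lam i = 1\<close>.\<close>

lemma cl_H_lam: "cl i (op_H i) = cl i (pscale (lam i))"
proof (cases "i \<in> D")
  case True
  then have lam: "lam i = 1" using base_v by (simp add: base_def)
  have "(op_H i :: ('k, 'n) endo) = (\<lambda>p. id p + (op_X i \<circ> op_D i) p)"
    unfolding op_H_def by (simp add: op_D_X)
  then have "cl i (op_H i) = cl i id \<oplus>\<^bsub>Ms i\<^esub> cl i (op_X i \<circ> op_D i)"
    using cl_add[OF I_1_id I_1_comp[OF I_1_op(1) I_1_op(2)], of i] by (simp only:)
  also have "cl i (op_X i \<circ> op_D i) = cl i (op_X i \<circ> (\<lambda>p. 0))"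
    by (rule cl_cong_comp[OF I_1_op(1) I_1_op(2) I_1_zero cl_D[OF True]])
  also have "\<dots> = cl i (\<lambda>p. 0)" by (simp only: I_1_comp_zero[OF I_1_op(1)])
  also have "cl i id \<oplus>\<^bsub>Ms i\<^esub> \<dots> = cl i (\<lambda>p. id p + 0)" by (rule cl_add[OF I_1_id I_1_zero])
  also have "(\<lambda>p. id p + 0) = pscale (lam i)" using lam by auto
  finally show ?thesis .
qed (rule cl_H)

lemma cl_J_Jpow:
  assumes "adm i s"
  shows "cl i (op_J i \<circ> Jpow i s) = cl i (Jpow i (s + 1))"
proof (cases "s \<ge> 0")
  case True
  then show ?thesis by (simp only: op_J_Jpow)
next
  case False
  then have "i \<notin> D" using assms by (simp add: adm_def)
  have "cl i (op_J i \<circ> (op_D i \<circ> Jpow i (s + 1))) = cl i (Jpow i (s + 1))"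
    by (rule cl_J_D[OF \<open>i \<notin> D\<close> Jpow_I_1])
  then show ?thesis by (simp only: op_D_Jpow add_diff_cancel_right')
qed

lemma cl_gen_Jpow:
  assumes g: "g \<in> {op_X i, op_D i, op_J i}" and s: "adm i s"
  shows "\<exists>t b. adm i t \<and> cl i (g \<circ> Jpow i s) = cl i (pscale b \<circ> Jpow i t)"
proof -
  have one: "pscale 1 \<circ> a = a" for a :: "('k, 'n) endo" by auto
  have s1: "adm i (s + 1)" using s by (auto simp: adm_def)
  have J: "cl i (op_J i \<circ> Jpow i s) = cl i (pscale 1 \<circ> Jpow i (s + 1))"
    unfolding one by (rule cl_J_Jpow[OF s])
  have D: "\<exists>t b. adm i t \<and> cl i (op_D i \<circ> Jpow i s) = cl i (pscale b \<circ> Jpow i t)"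
  \<comment> \<open>At the bottom of the chain \<open>\<partial>\<close> gives zero. It is written
    as the multiple \<open>0\<close> of the class at hand, because position \<open>s - 1\<close>
    would not be admissible.\<close>
  proof (cases "i \<in> D \<and> s = 0")
    case True
    have "Jpow i s = (id :: ('k, 'n) endo)" using True by (simp add: Jpow_def id_def[symmetric])
    then have "cl i (op_D i \<circ> Jpow i s) = cl i (\<lambda>p. 0)" using cl_D True by simp
    moreover have "(\<lambda>p :: ('k, 'n) pol. 0) = pscale 0 \<circ> Jpow i s" by auto
    ultimately have "cl i (op_D i \<circ> Jpow i s) = cl i (pscale 0 \<circ> Jpow i s)" by (simp only:)
    then show ?thesis using s by blast
  next
    case False
    then have "adm i (s - 1)" using s by (auto simp: adm_def)
    then show ?thesis unfolding op_D_Jpow using one by metis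
  qed
  have X: "cl i (op_X i \<circ> Jpow i s) = cl i (pscale (lam i + of_int s) \<circ> Jpow i (s + 1))"
  proof -
    let ?c = "lam i + of_int s"
    have H: "cl i (op_H i \<circ> Jpow i s) = cl i (pscale ?c \<circ> Jpow i s)"
    proof -
      have "(op_H i :: ('k, 'n) endo) \<circ> Jpow i s = (\<lambda>p. (Jpow i s \<circ> op_H i) p + (pscale (of_int s) \<circ> Jpow i s) p)"
        unfolding op_H_Jpow by simp
      then have "cl i (op_H i \<circ> Jpow i s)
          = cl i (Jpow i s \<circ> op_H i) \<oplus>\<^bsub>Ms i\<^esub> cl i (pscale (of_int s) \<circ> Jpow i s)"
        using cl_add[OF I_1_comp[OF Jpow_I_1 op_H_I_1] I_1_comp[OF I_1_pscale Jpow_I_1], of i s "of_int s" s]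
        by (simp only:)
      also have "cl i (Jpow i s \<circ> op_H i) = cl i (Jpow i s \<circ> pscale (lam i))"
        by (rule cl_cong_comp[OF Jpow_I_1 op_H_I_1 I_1_pscale cl_H_lam])
      also have "Jpow i s \<circ> pscale (lam i) = pscale (lam i) \<circ> Jpow i s"
        by (rule I_n_pscale_commute[OF Jpow_I_n])
      also have "cl i (pscale (lam i) \<circ> Jpow i s) \<oplus>\<^bsub>Ms i\<^esub> cl i (pscale (of_int s) \<circ> Jpow i s)
          = cl i (\<lambda>p. (pscale (lam i) \<circ> Jpow i s) p + (pscale (of_int s) \<circ> Jpow i s) p)"
        by (rule cl_add[OF I_1_comp[OF I_1_pscale Jpow_I_1] I_1_comp[OF I_1_pscale Jpow_I_1]])
      also have "(\<lambda>p. (pscale (lam i) \<circ> Jpow i s) p + (pscale (of_int s) \<circ> Jpow i s) p) = pscale ?c \<circ> Jpow i s"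
        by (auto simp: pscale.scale_left_distrib)
      finally show ?thesis .
    qed
    \<comment> \<open>\<open>x = J H\<close> reduces the case of \<open>x\<close> to those of
      \<open>H\<close> and \<open>J\<close>.\<close>
    have "(op_X i :: ('k, 'n) endo) \<circ> Jpow i s = op_J i \<circ> (op_H i \<circ> Jpow i s)"
      unfolding op_H_def by (simp only: comp_assoc[symmetric] op_J_D_X[unfolded comp_assoc[symmetric]])
    then have "cl i (op_X i \<circ> Jpow i s) = cl i (op_J i \<circ> (op_H i \<circ> Jpow i s))" by simp
    also have "\<dots> = cl i (op_J i \<circ> (pscale ?c \<circ> Jpow i s))"
      by (rule cl_cong_comp[OF I_1_op(3) I_1_comp[OF op_H_I_1 Jpow_I_1] I_1_comp[OF I_1_pscale Jpow_I_1] H])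
    also have "op_J i \<circ> (pscale ?c \<circ> Jpow i s) = pscale ?c \<circ> (op_J i \<circ> Jpow i s)"
      using I_n_pscale_commute[OF I_n_op(3), of i ?c] by (simp only: comp_assoc[symmetric])
    also have "cl i \<dots> = cl i (pscale ?c \<circ> Jpow i (s + 1))"
      by (rule cl_cong_comp[OF I_1_pscale I_1_comp[OF I_1_op(3) Jpow_I_1] Jpow_I_1 cl_J_Jpow[OF s]])
    finally show ?thesis .
  qed
  show ?thesis using g J D X s1 by blast
qed

lemma Sp_add: "\<lbrakk>x \<in> Sp i; y \<in> Sp i\<rbrakk> \<Longrightarrow> x \<oplus>\<^bsub>Ms i\<^esub> y \<in> Sp i"
proof (induction rule: Sp.induct)
  case zero
  obtain b where b: "b \<in> carrier (I_1 i)" "y = cl i b" using Sp_carrier[OF zero] by (auto simp: car)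
  have "cl i (\<lambda>p. 0) \<oplus>\<^bsub>Ms i\<^esub> y = y" unfolding b(2) cl_add[OF I_1_zero b(1)] by simp
  then show ?case using zero by simp
next
  case (step s a c)
  obtain b where b: "b \<in> carrier (I_1 i)" "y = cl i b" using Sp_carrier[OF step(5)] by (auto simp: car)
  let ?e = "pscale c \<circ> Jpow i s"
  have e: "?e \<in> carrier (I_1 i)" by (rule I_1_comp[OF I_1_pscale Jpow_I_1])
  have cle: "pscale c \<odot>\<^bsub>Ms i\<^esub> cl i (Jpow i s) = cl i ?e" by (rule cl_smult[OF I_1_pscale Jpow_I_1])
  have "cl i ?e \<oplus>\<^bsub>Ms i\<^esub> cl i a \<oplus>\<^bsub>Ms i\<^esub> y = cl i (\<lambda>p. (?e p + a p) + b p)"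
    unfolding b(2) cl_add[OF e step(2)] by (rule cl_add[OF I_1_add[OF e step(2)] b(1)])
  also have "(\<lambda>p. (?e p + a p) + b p) = (\<lambda>p. ?e p + (a p + b p))" by (simp add: add.assoc)
  also have "cl i \<dots> = cl i ?e \<oplus>\<^bsub>Ms i\<^esub> cl i (\<lambda>p. a p + b p)"
    by (rule cl_add[OF e I_1_add[OF step(2) b(1)], symmetric])
  finally have eq: "cl i ?e \<oplus>\<^bsub>Ms i\<^esub> cl i a \<oplus>\<^bsub>Ms i\<^esub> y = cl i ?e \<oplus>\<^bsub>Ms i\<^esub> cl i (\<lambda>p. a p + b p)" .
  have "cl i (\<lambda>p. a p + b p) \<in> Sp i"
    using step(4)[OF step(5)] unfolding b(2) cl_add[OF step(2) b(1)] .
  then show ?case unfolding cle eq using Sp.step[OF step(1) I_1_add[OF step(2) b(1)], of c]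
    unfolding cle by blast
qed

lemma Sp_scale_Jpow: "adm i s \<Longrightarrow> cl i (pscale c \<circ> Jpow i s) \<in> Sp i"
proof -
  assume s: "adm i s"
  let ?e = "pscale c \<circ> Jpow i s"
  have "pscale c \<odot>\<^bsub>Ms i\<^esub> cl i (Jpow i s) \<oplus>\<^bsub>Ms i\<^esub> cl i (\<lambda>p. 0) \<in> Sp i"
    by (rule Sp.step[OF s I_1_zero Sp.zero])
  also have "pscale c \<odot>\<^bsub>Ms i\<^esub> cl i (Jpow i s) = cl i ?e" by (rule cl_smult[OF I_1_pscale Jpow_I_1])
  also have "cl i ?e \<oplus>\<^bsub>Ms i\<^esub> cl i (\<lambda>p. 0) = cl i (\<lambda>p. ?e p + 0)"
    by (rule cl_add[OF I_1_comp[OF I_1_pscale Jpow_I_1] I_1_zero])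
  also have "(\<lambda>p. ?e p + 0) = ?e" by auto
  finally show ?thesis .
qed

lemma Sp_smult_step:
  assumes g: "g \<in> carrier (I_1 i)"
    and J: "\<And>s. adm i s \<Longrightarrow> \<exists>t b. adm i t \<and> cl i (g \<circ> Jpow i s) = cl i (pscale b \<circ> Jpow i t)"
    and y: "y \<in> Sp i"
  shows "g \<odot>\<^bsub>Ms i\<^esub> y \<in> Sp i"
  using y
proof (induction rule: Sp.induct)
  case zero
  have "g \<odot>\<^bsub>Ms i\<^esub> cl i (\<lambda>p. 0) = cl i (\<lambda>p. 0)"
    unfolding cl_smult[OF g I_1_zero] I_1_comp_zero[OF g] ..
  then show ?case using Sp.zero by simp
next
  case (step s a c)
  let ?e = "pscale c \<circ> Jpow i s"
  have e: "?e \<in> carrier (I_1 i)" by (rule I_1_comp[OF I_1_pscale Jpow_I_1])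
  obtain t b where t: "adm i t" "cl i (g \<circ> Jpow i s) = cl i (pscale b \<circ> Jpow i t)"
    using J[OF step(1)] by blast
  have "g \<odot>\<^bsub>Ms i\<^esub> (pscale c \<odot>\<^bsub>Ms i\<^esub> cl i (Jpow i s) \<oplus>\<^bsub>Ms i\<^esub> cl i a) = g \<odot>\<^bsub>Ms i\<^esub> cl i (\<lambda>p. ?e p + a p)"
    unfolding cl_smult[OF I_1_pscale Jpow_I_1] cl_add[OF e step(2)] ..
  also have "\<dots> = cl i (g \<circ> (\<lambda>p. ?e p + a p))" by (rule cl_smult[OF g I_1_add[OF e step(2)]])
  also have "g \<circ> (\<lambda>p. ?e p + a p) = (\<lambda>p. (g \<circ> ?e) p + (g \<circ> a) p)"
    using End_P_add[OF subsetD[OF I_1_subset_End_P g]] by (auto simp: fun_eq_iff)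
  also have "cl i \<dots> = cl i (g \<circ> ?e) \<oplus>\<^bsub>Ms i\<^esub> cl i (g \<circ> a)"
    by (rule cl_add[OF I_1_comp[OF g e] I_1_comp[OF g step(2)], symmetric])
  also have "g \<circ> ?e = pscale c \<circ> (g \<circ> Jpow i s)"
    using I_n_pscale_commute[OF I_1_subset_I_n[OF g], of c] by (simp only: comp_assoc[symmetric])
  also have "cl i \<dots> = cl i (pscale c \<circ> (pscale b \<circ> Jpow i t))"
    by (rule cl_cong_comp[OF I_1_pscale I_1_comp[OF g Jpow_I_1] I_1_comp[OF I_1_pscale Jpow_I_1] t(2)])
  also have "pscale c \<circ> (pscale b \<circ> Jpow i t) = pscale (c * b) \<circ> Jpow i t" by (auto simp: fun_eq_iff)
  also have "cl i (pscale (c * b) \<circ> Jpow i t) \<oplus>\<^bsub>Ms i\<^esub> cl i (g \<circ> a) \<in> Sp i"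
    using step(4) unfolding cl_smult[OF g step(2)] by (rule Sp_add[OF Sp_scale_Jpow[OF t(1)]])
  finally show ?case .
qed

lemma Sp_smult:
  assumes "g \<in> carrier (I_1 i)"
  shows "\<forall>y\<in>Sp i. g \<odot>\<^bsub>Ms i\<^esub> y \<in> Sp i"
  using assms
proof (induction rule: I_1_induct)
  case (pscale c)
  show ?case by (intro ballI Sp_smult_step) auto
next
  case (gen g)
  then have "g \<in> carrier (I_1 i)" by auto
  then show ?case using Sp_smult_step cl_gen_Jpow[OF gen] by blast
next
  case (add f g)
  show ?case
  proof
    fix y assume y: "y \<in> Sp i"
    obtain b where b: "b \<in> carrier (I_1 i)" "y = cl i b" using Sp_carrier[OF y] by (auto simp: car)
    have "(\<lambda>p. f p + g p) \<odot>\<^bsub>Ms i\<^esub> y = cl i ((\<lambda>p. f p + g p) \<circ> b)"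
      unfolding b(2) by (rule cl_smult[OF I_1_add[OF add(1,2)] b(1)])
    also have "(\<lambda>p. f p + g p) \<circ> b = (\<lambda>p. (f \<circ> b) p + (g \<circ> b) p)" by auto
    also have "cl i \<dots> = f \<odot>\<^bsub>Ms i\<^esub> y \<oplus>\<^bsub>Ms i\<^esub> g \<odot>\<^bsub>Ms i\<^esub> y"
      unfolding b(2) cl_smult[OF add(1) b(1)] cl_smult[OF add(2) b(1)]
      by (rule cl_add[OF I_1_comp[OF add(1) b(1)] I_1_comp[OF add(2) b(1)], symmetric])
    finally show "(\<lambda>p. f p + g p) \<odot>\<^bsub>Ms i\<^esub> y \<in> Sp i" using Sp_add add(3,4) y by simp
  qed
next
  case (comp f g)
  show ?case
  proof
    fix y assume y: "y \<in> Sp i"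
    obtain b where b: "b \<in> carrier (I_1 i)" "y = cl i b" using Sp_carrier[OF y] by (auto simp: car)
    have "(f \<circ> g) \<odot>\<^bsub>Ms i\<^esub> y = f \<odot>\<^bsub>Ms i\<^esub> (g \<odot>\<^bsub>Ms i\<^esub> y)"
      unfolding b(2) cl_smult[OF I_1_comp[OF comp(1,2)] b(1)] cl_smult[OF comp(2) b(1)]
        cl_smult[OF comp(1) I_1_comp[OF comp(2) b(1)]] comp_assoc ..
    then show "(f \<circ> g) \<odot>\<^bsub>Ms i\<^esub> y \<in> Sp i" using comp(3,4) y by simp
  qed
qed

text \<open>The class of \<open>id\<close> lies in the span and generates the factor, and the span
  is stable under \<open>I_1 i\<close>.\<close>

lemma Sp_all: "y \<in> carrier (Ms i) \<Longrightarrow> y \<in> Sp i"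
proof -
  assume "y \<in> carrier (Ms i)"
  then obtain a where a: "a \<in> carrier (I_1 i)" "y = cl i a" by (auto simp: car)
  have "adm i 0" by (simp add: adm_def)
  then have "cl i (pscale 1 \<circ> Jpow i 0) \<in> Sp i" by (rule Sp_scale_Jpow)
  also have "pscale 1 \<circ> Jpow i 0 = id" by (auto simp: Jpow_def)
  finally have "a \<odot>\<^bsub>Ms i\<^esub> cl i id \<in> Sp i" using Sp_smult[OF a(1)] by blast
  then show ?thesis unfolding cl_smult[OF a(1) I_1_id] a(2) by (simp only: comp_id)
qed

subsection \<open>The multilinear map\<close>

text \<open>A chosen operator representing an element of the factor. The default \<open>id\<close>
  outside the carrier makes the map below take values in \<open>Q\<close> on all tuples, as
  \<open>lincomb\<close> demands.\<close>

definition rp :: "'n \<Rightarrow> 'y \<Rightarrow> ('k, 'n) endo" where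
  "rp i y = (if y \<in> carrier (Ms i) then SOME a. a \<in> carrier (I_1 i) \<and> cl i a = y else id)"

lemma rp_I_1: "rp i y \<in> carrier (I_1 i)"
  and cl_rp: "y \<in> carrier (Ms i) \<Longrightarrow> cl i (rp i y) = y"
proof -
  have "rp i y \<in> carrier (I_1 i) \<and> cl i (rp i y) = y" if "y \<in> carrier (Ms i)"
  proof -
    have "\<exists>a. a \<in> carrier (I_1 i) \<and> cl i a = y" using that by (auto simp: car)
    then have "(SOME a. a \<in> carrier (I_1 i) \<and> cl i a = y) \<in> carrier (I_1 i)
        \<and> cl i (SOME a. a \<in> carrier (I_1 i) \<and> cl i a = y) = y" by (rule someI_ex)
    then show ?thesis using that by (simp add: rp_def)
  qed
  then show "rp i y \<in> carrier (I_1 i)" "y \<in> carrier (Ms i) \<Longrightarrow> cl i (rp i y) = y"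
    by (auto simp: rp_def)
qed

text \<open>The multilinear map \<open>(a_1 g_1, ..., a_n g_n) \<mapsto> a_1 ... a_n v\<close>,
  where \<open>g_i\<close> is the generator of the factor \<open>Ms i\<close>.\<close>

definition \<Phi> :: "('n \<Rightarrow> 'y) \<Rightarrow> 'm" where
  "\<Phi> u = pop idx (\<lambda>i. rp i (u i)) \<odot> v"

lemma \<Phi>_closed [simp, intro]: "\<Phi> u \<in> carrier Q"
  unfolding \<Phi>_def by (rule pop_act_closed[OF rp_I_1 vc])

text \<open>Independence of representatives: the operator of one variable commutes past the others
  until it meets \<open>v\<close>, where \<open>cl_act\<close> allows it to be exchanged.\<close>

lemma pop_cl_cong:
  assumes "\<And>i. a i \<in> carrier (I_1 i)" "\<And>i. b i \<in> carrier (I_1 i)" "\<And>i. cl i (a i) = cl i (b i)"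
    and "distinct xs"
  shows "pop xs a \<odot> v = pop xs b \<odot> v"
  using assms(4)
proof (induction xs)
  case (Cons i xs)
  have c: "c \<odot> (pop xs b \<odot> v) = pop xs b \<odot> (c \<odot> v)" if "c \<in> carrier (I_1 i)" for c
    by (rule pop_act_commute[OF assms(2) vc that]) (use Cons.prems in simp)
  have "pop (i # xs) a \<odot> v = a i \<odot> (pop xs b \<odot> v)"
    using Cons by (simp add: pop_act_Cons[OF assms(1) vc])
  also have "\<dots> = b i \<odot> (pop xs b \<odot> v)"
    unfolding c[OF assms(1)] c[OF assms(2)] cl_act[OF assms(1,2,3)] ..
  finally show ?case by (simp add: pop_act_Cons[OF assms(2) vc])
qed (simp add: pop_act_Nil[OF vc])

lemma \<Phi>_cl:
  assumes "\<And>i. a i \<in> carrier (I_1 i)" "\<And>i. u i = cl i (a i)"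
  shows "\<Phi> u = pop idx a \<odot> v"
  unfolding \<Phi>_def by (rule pop_cl_cong[OF rp_I_1 assms(1) _ idx(2)]) (use assms in \<open>simp add: cl_rp\<close>)

lemma \<Phi>_split:
  assumes "\<And>j. u j \<in> carrier (Ms j)"
  obtains r where "r \<in> carrier Q" "\<And>a. a \<in> carrier (I_1 i) \<Longrightarrow> \<Phi> (u(i := cl i a)) = a \<odot> r"
proof
  let ?a = "\<lambda>j. rp j (u j)"
  show "pop (remove1 i idx) ?a \<odot> v \<in> carrier Q" by (rule pop_act_closed[OF rp_I_1 vc])
  fix a :: "('k, 'n) endo" assume a: "a \<in> carrier (I_1 i)"
  have "\<Phi> (u(i := cl i a)) = pop idx (?a(i := a)) \<odot> v"
    by (rule \<Phi>_cl) (use a assms in \<open>auto simp: rp_I_1 cl_rp\<close>)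
  also have "\<dots> = a \<odot> (pop (remove1 i idx) ?a \<odot> v)"
    by (rule pop_act_update[OF rp_I_1 vc idx(2) _ a]) (simp add: idx)
  finally show "\<Phi> (u(i := cl i a)) = a \<odot> (pop (remove1 i idx) ?a \<odot> v)" .
qed

lemma \<Phi>_add:
  assumes "\<And>j. u j \<in> carrier (Ms j)" "x \<in> carrier (Ms i)" "y \<in> carrier (Ms i)"
  shows "\<Phi> (u(i := x \<oplus>\<^bsub>Ms i\<^esub> y)) = \<Phi> (u(i := x)) \<oplus> \<Phi> (u(i := y))"
proof -
  obtain a b where a: "a \<in> carrier (I_1 i)" "x = cl i a" and b: "b \<in> carrier (I_1 i)" "y = cl i b"
    using assms(2,3) by (auto simp: car)
  obtain r where r: "r \<in> carrier Q" "\<And>a. a \<in> carrier (I_1 i) \<Longrightarrow> \<Phi> (u(i := cl i a)) = a \<odot> r"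
    using \<Phi>_split[OF assms(1)] by blast
  show ?thesis
    unfolding a(2) b(2) cl_add[OF a(1) b(1)] r(2)[OF a(1)] r(2)[OF b(1)] r(2)[OF I_1_add[OF a(1) b(1)]]
    by (rule act_add[OF I_1_subset_I_n[OF a(1)] I_1_subset_I_n[OF b(1)] r(1)])
qed

lemma \<Phi>_smult:
  assumes "\<And>j. u j \<in> carrier (Ms j)" "a \<in> carrier (I_1 i)" "x \<in> carrier (Ms i)"
  shows "\<Phi> (u(i := a \<odot>\<^bsub>Ms i\<^esub> x)) = a \<odot> \<Phi> (u(i := x))"
proof -
  obtain b where b: "b \<in> carrier (I_1 i)" "x = cl i b" using assms(3) by (auto simp: car)
  obtain r where r: "r \<in> carrier Q" "\<And>a. a \<in> carrier (I_1 i) \<Longrightarrow> \<Phi> (u(i := cl i a)) = a \<odot> r"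
    using \<Phi>_split[OF assms(1)] by blast
  show ?thesis
    unfolding b(2) cl_smult[OF assms(2) b(1)] r(2)[OF b(1)] r(2)[OF I_1_comp[OF assms(2) b(1)]]
    by (rule act_comp[OF I_1_subset_I_n[OF assms(2)] I_1_subset_I_n[OF b(1)] r(1)])
qed

subsection \<open>The linear map on the tensor space\<close>

abbreviation "Fr \<equiv> free_module Ms"
abbreviation "Rel \<equiv> multilinear_relations Ms"

lemma Fr_simps [simp]: "zero Fr = 0" "add Fr = (+)"
  by (simp_all add: free_module_def)

lemma in_Fr_iff: "f \<in> carrier Fr \<longleftrightarrow> (\<forall>u\<in>Poly_Mapping.keys f. \<forall>i. u i \<in> carrier (Ms i))"
  by (simp add: free_module_def)

lemma single_in_Fr: "(\<And>i. u i \<in> carrier (Ms i)) \<Longrightarrow> Poly_Mapping.single u c \<in> carrier Fr"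
  by (simp add: in_Fr_iff)

lemma Fr_0: "0 \<in> carrier Fr"
  by (simp add: in_Fr_iff)

lemma Fr_add: "\<lbrakk>f \<in> carrier Fr; g \<in> carrier Fr\<rbrakk> \<Longrightarrow> f + g \<in> carrier Fr"
  using keys_add[of f g] unfolding in_Fr_iff by blast

lemma Fr_uminus: "f \<in> carrier Fr \<Longrightarrow> - f \<in> carrier Fr"
  by (simp add: in_Fr_iff in_keys_iff)

lemma Fr_diff: "\<lbrakk>f \<in> carrier Fr; g \<in> carrier Fr\<rbrakk> \<Longrightarrow> f - g \<in> carrier Fr"
  using Fr_add[OF _ Fr_uminus, of f g] by simp

lemma abelian_group_Fr: "abelian_group Fr"
proof (rule abelian_groupI)
  fix f assume "f \<in> carrier Fr"
  then show "\<exists>g\<in>carrier Fr. g \<oplus>\<^bsub>Fr\<^esub> f = \<zero>\<^bsub>Fr\<^esub>"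
    by (intro bexI[of _ "- f"] Fr_uminus) auto
qed (auto simp: Fr_add add.assoc add.commute Fr_0)

lemma Fr_a_inv: "f \<in> carrier Fr \<Longrightarrow> \<ominus>\<^bsub>Fr\<^esub> f = - f"
  using abelian_group.minus_equality[OF abelian_group_Fr, of "- f" f] Fr_uminus by simp

lemma Rel_subset: "Rel \<subseteq> carrier Fr"
proof
  fix f assume "f \<in> Rel"
  then show "f \<in> carrier Fr"
  proof (induction rule: multilinear_relations.induct)
    case (additive v x i y c)
    then show ?case by (intro Fr_diff single_in_Fr) (auto intro: Ms_add_closed)
  next
    case (scalar v x i b c)
    then show ?case by (intro Fr_diff single_in_Fr) (auto intro: Ms_smult_closed[OF I_1_pscale])
  qed (simp_all add: Fr_add Fr_0)
qed

text \<open>Closure under negatives is not a generating rule of the relations; it follows because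
  both kinds of relations admit the coefficient \<open>- c\<close>.\<close>

lemma Rel_uminus: "f \<in> Rel \<Longrightarrow> - f \<in> Rel"
proof (induction rule: multilinear_relations.induct)
  case (additive v x i y c)
  have "- (Poly_Mapping.single (v(i := x \<oplus>\<^bsub>Ms i\<^esub> y)) c - Poly_Mapping.single (v(i := x)) c
        - Poly_Mapping.single (v(i := y)) c)
      = Poly_Mapping.single (v(i := x \<oplus>\<^bsub>Ms i\<^esub> y)) (- c) - Poly_Mapping.single (v(i := x)) (- c)
        - Poly_Mapping.single (v(i := y)) (- c)"
    by (simp add: single_uminus)
  then show ?case using multilinear_relations.additive[OF additive, of "- c"] by (simp only:)
next
  case (scalar v x i b c)
  from multilinear_relations.scalar[OF scalar, of b "- c"] show ?case
    by (simp add: single_uminus)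
next
  case (plus f g)
  from multilinear_relations.plus[OF plus(3,4)] show ?case by simp
qed (simp add: multilinear_relations.zero)

lemma abelian_subgroup_Rel: "abelian_subgroup Rel Fr"
proof (rule abelian_subgroupI3)
  show "abelian_group Fr" by (rule abelian_group_Fr)
  show "additive_subgroup Rel Fr"
    unfolding additive_subgroup_def
  proof (rule subgroup.intro)
    show "inv\<^bsub>add_monoid Fr\<^esub> x \<in> Rel" if "x \<in> Rel" for x
      using Fr_a_inv[OF subsetD[OF Rel_subset that]] Rel_uminus[OF that] by (simp add: a_inv_def)
  qed (use Rel_subset in \<open>auto intro: multilinear_relations.plus multilinear_relations.zero\<close>)
qed

definition T :: "(('n \<Rightarrow> 'y) \<Rightarrow>\<^sub>0 'k) \<Rightarrow> 'm" where
  "T f = lincomb \<Phi> f"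

lemma T_closed [simp, intro]: "T f \<in> carrier Q"
  unfolding T_def by (rule lincomb_closed) auto

lemma T_add: "T (f + g) = T f \<oplus> T g"
  unfolding T_def by (rule lincomb_add) auto

lemma T_diff: "T (f - g) = T f \<ominus> T g"
  unfolding T_def by (rule lincomb_diff) auto

lemma T_zero [simp]: "T 0 = \<zero>"
  unfolding T_def by (rule lincomb_zero) auto

lemma T_single: "T (Poly_Mapping.single u c) = pscale c \<odot> \<Phi> u"
  unfolding T_def by (rule lincomb_single) auto

lemma T_Rel: "f \<in> Rel \<Longrightarrow> T f = \<zero>"
proof (induction rule: multilinear_relations.induct)
  case (additive u x i y c)
  have "\<Phi> (u(i := x \<oplus>\<^bsub>Ms i\<^esub> y)) = \<Phi> (u(i := x)) \<oplus> \<Phi> (u(i := y))"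
    by (rule \<Phi>_add) (use additive in auto)
  moreover have "(a \<oplus> b) \<ominus> a \<ominus> b = \<zero>" if "a \<in> carrier Q" "b \<in> carrier Q" for a b
  proof -
    have "a \<oplus> b \<ominus> a = b" using that by (simp add: M.a_comm[of a b] M.minus_eq M.a_assoc M.r_neg)
    then show ?thesis using that by (simp add: M.minus_eq M.r_neg)
  qed
  ultimately show ?case by (simp add: T_diff T_single smult_r_distr)
next
  case (scalar u x i b c)
  have "\<Phi> (u(i := pscale b \<odot>\<^bsub>Ms i\<^esub> x)) = pscale b \<odot> \<Phi> (u(i := x))"
    by (rule \<Phi>_smult) (use scalar in auto)
  then show ?case by (simp add: T_diff T_single act_pscale_mult M.minus_eq M.r_neg)
qed (simp_all add: T_add)

definition bvec :: "('n \<Rightarrow> int) \<Rightarrow> 'n \<Rightarrow> 'y" where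
  "bvec \<gamma> = (\<lambda>i. cl i (Jpow i (\<gamma> i)))"

lemma bvec_carrier: "bvec \<gamma> i \<in> carrier (Ms i)"
  by (simp add: bvec_def)

lemma \<Phi>_bvec: "\<Phi> (bvec \<gamma>) = chain v \<gamma>"
  unfolding chain_def by (rule \<Phi>_cl) (auto simp: bvec_def)

definition lift :: "(('n \<Rightarrow> int) \<Rightarrow>\<^sub>0 'k) \<Rightarrow> ('n \<Rightarrow> 'y) \<Rightarrow>\<^sub>0 'k" where
  "lift \<kappa> = (\<Sum>\<gamma>\<in>Poly_Mapping.keys \<kappa>. Poly_Mapping.single (bvec \<gamma>) (Poly_Mapping.lookup \<kappa> \<gamma>))"

lemma lift_add: "lift (\<kappa> + \<kappa>') = lift \<kappa> + lift \<kappa>'"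
  unfolding lift_def by (rule setsum_keys_plus_distrib) (simp_all add: single_add)

lemma lift_single: "lift (Poly_Mapping.single \<gamma> c) = Poly_Mapping.single (bvec \<gamma>) c"
  by (simp add: lift_def)

lemma lift_zero [simp]: "lift 0 = 0"
  by (simp add: lift_def)

lemma T_lift: "T (lift \<kappa>) = lincomb (chain v) \<kappa>"
proof (induction \<kappa> rule: poly_mapping_add_induct)
  case (add \<gamma> c \<kappa>)
  then show ?case using vc by (simp add: lift_add lift_single T_add T_single \<Phi>_bvec lincomb_add)
qed (use vc in \<open>simp add: lincomb_zero\<close>)

text \<open>
  Modulo the relations, every element of the free module is a combination of tensors \<open>bvec \<gamma>\<close>; as the map
  \<open>T\<close> sends these to linearly independent vectors, its kernel consists of the relations.
\<close>

definition reduced :: "(('n \<Rightarrow> 'y) \<Rightarrow>\<^sub>0 'k) set" where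
  "reduced = {f. \<exists>\<kappa>. (\<forall>\<gamma>\<in>Poly_Mapping.keys \<kappa>. \<forall>i. adm i (\<gamma> i)) \<and> f - lift \<kappa> \<in> Rel}"

lemma reduced_add: "\<lbrakk>f \<in> reduced; g \<in> reduced\<rbrakk> \<Longrightarrow> f + g \<in> reduced"
proof -
  assume "f \<in> reduced" "g \<in> reduced"
  then obtain \<kappa> \<kappa>' where k: "\<forall>\<gamma>\<in>Poly_Mapping.keys \<kappa>. \<forall>i. adm i (\<gamma> i)" "f - lift \<kappa> \<in> Rel"
    "\<forall>\<gamma>\<in>Poly_Mapping.keys \<kappa>'. \<forall>i. adm i (\<gamma> i)" "g - lift \<kappa>' \<in> Rel"
    by (auto simp: reduced_def)
  have "\<forall>\<gamma>\<in>Poly_Mapping.keys (\<kappa> + \<kappa>'). \<forall>i. adm i (\<gamma> i)"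
    using k keys_add[of \<kappa> \<kappa>'] by blast
  moreover have "(f + g) - lift (\<kappa> + \<kappa>') \<in> Rel"
    using multilinear_relations.plus[OF k(2,4)] by (simp add: lift_add algebra_simps)
  ultimately show ?thesis by (auto simp: reduced_def)
qed

lemma reduced_cong: "\<lbrakk>f - g \<in> Rel; g \<in> reduced\<rbrakk> \<Longrightarrow> f \<in> reduced"
proof -
  assume fg: "f - g \<in> Rel" and "g \<in> reduced"
  then obtain \<kappa> where k: "\<forall>\<gamma>\<in>Poly_Mapping.keys \<kappa>. \<forall>i. adm i (\<gamma> i)" "g - lift \<kappa> \<in> Rel"
    by (auto simp: reduced_def)
  have "f - lift \<kappa> \<in> Rel" using multilinear_relations.plus[OF fg k(2)] by simp
  then show ?thesis using k(1) by (auto simp: reduced_def)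
qed

lemma reduced_zero: "0 \<in> reduced"
  unfolding reduced_def by (auto intro!: exI[of _ 0] multilinear_relations.zero)

text \<open>\<open>A\<close> contains the slots whose entry is not yet a weight class. One slot is
  treated at a time: its entry lies in \<open>Sp i\<close>, and multilinearity expands the tensor
  along that expression.\<close>

lemma single_reduced:
  assumes "finite A" "\<And>j. u j \<in> carrier (Ms j)" "\<And>j. j \<notin> A \<Longrightarrow> \<exists>s. adm j s \<and> u j = cl j (Jpow j s)"
  shows "Poly_Mapping.single u c \<in> reduced"
  using assms
proof (induction A arbitrary: u c rule: finite_induct)
  case empty
  then obtain \<gamma> where g: "\<And>j. adm j (\<gamma> j)" "\<And>j. u j = cl j (Jpow j (\<gamma> j))" by (metis empty_iff)
  then have "u = bvec \<gamma>" by (auto simp: bvec_def)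
  then have "Poly_Mapping.single u c - lift (Poly_Mapping.single \<gamma> c) \<in> Rel"
    by (simp add: lift_single multilinear_relations.zero)
  then show ?case using g(1)
    by (auto simp: reduced_def intro!: exI[of _ "Poly_Mapping.single \<gamma> c"] split: if_splits)
next
  case (insert i A)
  have "Poly_Mapping.single (u(i := y)) c \<in> reduced" if "y \<in> Sp i" for y c
    using that
  proof (induction arbitrary: c rule: Sp.induct)
    case zero
    \<comment> \<open>A tensor with a zero entry is itself a relation: the scalar \<open>0\<close>
      is pulled out of the slot.\<close>
    have z: "pscale 0 \<odot>\<^bsub>Ms i\<^esub> cl i (\<lambda>p. 0) = cl i (\<lambda>p. 0)"
      unfolding cl_smult[OF I_1_pscale I_1_zero] I_1_comp_zero[OF I_1_pscale] ..
    have "Poly_Mapping.single (u(i := pscale 0 \<odot>\<^bsub>Ms i\<^esub> cl i (\<lambda>p. 0))) c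
        - Poly_Mapping.single (u(i := cl i (\<lambda>p. 0))) (c * 0) \<in> Rel"
      by (rule multilinear_relations.scalar) (use insert.prems in auto)
    then have "Poly_Mapping.single (u(i := cl i (\<lambda>p. 0))) c - 0 \<in> Rel" unfolding z by simp
    then show ?case by (rule reduced_cong[OF _ reduced_zero])
  next
    case (step s a b)
    let ?e = "cl i (Jpow i s)"
    let ?be = "pscale b \<odot>\<^bsub>Ms i\<^esub> ?e"
    have be: "?be \<in> carrier (Ms i)" by (intro Ms_smult_closed) auto
    have "Poly_Mapping.single (u(i := ?e)) (c * b) \<in> reduced"
    proof (rule insert.IH)
      show "(u(i := ?e)) j \<in> carrier (Ms j)" for j using insert.prems by auto
      fix j assume j: "j \<notin> A"
      show "\<exists>s. adm j s \<and> (u(i := ?e)) j = cl j (Jpow j s)"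
        using insert.prems(2)[of j] j step(1) by (cases "j = i") auto
    qed
    moreover have "Poly_Mapping.single (u(i := ?be)) c - Poly_Mapping.single (u(i := ?e)) (c * b) \<in> Rel"
      by (rule multilinear_relations.scalar) (use insert.prems in auto)
    ultimately have "Poly_Mapping.single (u(i := ?be)) c \<in> reduced" by (rule reduced_cong[rotated])
    then have sum: "Poly_Mapping.single (u(i := ?be)) c + Poly_Mapping.single (u(i := cl i a)) c \<in> reduced"
      using step.IH by (rule reduced_add)
    have "Poly_Mapping.single (u(i := ?be \<oplus>\<^bsub>Ms i\<^esub> cl i a)) c
        - Poly_Mapping.single (u(i := ?be)) c - Poly_Mapping.single (u(i := cl i a)) c \<in> Rel"
      by (rule multilinear_relations.additive) (use insert.prems be step in auto)
    then show ?case unfolding diff_diff_eq by (rule reduced_cong[OF _ sum])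
  qed
  from this[OF Sp_all[OF insert.prems(1)[of i]], of c] show ?case by simp
qed

lemma Fr_reduced: "f \<in> carrier Fr \<Longrightarrow> f \<in> reduced"
proof (induction f rule: poly_mapping_add_induct)
  case (add u c f)
  have k: "Poly_Mapping.keys (Poly_Mapping.single u c + f) = insert u (Poly_Mapping.keys f)"
    using add.hyps by (auto simp: in_keys_iff lookup_add lookup_single when_def split: if_splits)
  then have "f \<in> carrier Fr" "\<And>i. u i \<in> carrier (Ms i)" using add.prems by (auto simp: in_Fr_iff)
  then show ?case using add.IH single_reduced[of UNIV u c] by (intro reduced_add) auto
qed (rule reduced_zero)

lemma T_eq_0:
  assumes "f \<in> carrier Fr" "T f = \<zero>"
  shows "f \<in> Rel"
proof -
  obtain \<kappa> where k: "\<forall>\<gamma>\<in>Poly_Mapping.keys \<kappa>. \<forall>i. adm i (\<gamma> i)" "f - lift \<kappa> \<in> Rel"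
    using Fr_reduced[OF assms(1)] by (auto simp: reduced_def)
  have "T f \<ominus> T (lift \<kappa>) = \<zero>" using T_Rel[OF k(2)] by (simp add: T_diff)
  then have "T (lift \<kappa>) = \<zero>" using assms(2) M.diff_eq_zero_iff[of "T f" "T (lift \<kappa>)"] by simp
  then have "\<kappa> = 0"
    using chain_independent[OF base_v v_nz full, of \<kappa>] k(1) by (auto simp: T_lift adm_def)
  then show ?thesis using k(2) by simp
qed

lemma T_single_pure:
  assumes "\<And>j. u j \<in> carrier (Ms j)"
  shows "\<exists>w. (\<forall>j. w j \<in> carrier (Ms j)) \<and> pscale c \<odot> \<Phi> u = \<Phi> w"
proof -
  \<comment> \<open>Types are nonempty, so there is a slot that can absorb the scalar.\<close>
  obtain i :: 'n where "True" by simp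
  let ?w = "u(i := pscale c \<odot>\<^bsub>Ms i\<^esub> u i)"
  have "\<Phi> ?w = pscale c \<odot> \<Phi> (u(i := u i))"
    by (rule \<Phi>_smult[OF assms I_1_pscale assms])
  moreover have "\<forall>j. ?w j \<in> carrier (Ms j)" using assms by (auto intro: Ms_smult_closed)
  ultimately show ?thesis by (intro exI[of _ ?w]) simp
qed

lemma T_Fr_induct [consumes 1, case_names zero add]:
  assumes f: "f \<in> carrier Fr" and "P \<zero>"
    and add: "\<And>u q. \<lbrakk>\<And>j. u j \<in> carrier (Ms j); q \<in> T ` carrier Fr; P q\<rbrakk> \<Longrightarrow> P (\<Phi> u \<oplus> q)"
  shows "P (T f)"
  using f
proof (induction f rule: poly_mapping_add_induct)
  case zero
  then show ?case using assms(2) by simp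
next
  case (add u c f)
  have k: "Poly_Mapping.keys (Poly_Mapping.single u c + f) = insert u (Poly_Mapping.keys f)"
    using add.hyps by (auto simp: in_keys_iff lookup_add lookup_single when_def split: if_splits)
  then have f: "f \<in> carrier Fr" and u: "\<And>i. u i \<in> carrier (Ms i)" using add.prems by (auto simp: in_Fr_iff)
  obtain w where w: "\<And>j. w j \<in> carrier (Ms j)" "pscale c \<odot> \<Phi> u = \<Phi> w"
    using T_single_pure[OF u, of c] by blast
  have "P (\<Phi> w \<oplus> T f)" by (rule assms(3)[OF w(1) imageI[OF f] add.IH[OF f]])
  then show ?case by (simp add: T_add T_single w(2))
qed

text \<open>The image is stable under every \<open>I_1 i\<close>, hence a submodule, and it contains
  \<open>v\<close>. Simplicity of \<open>Q\<close> makes it everything.\<close>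

lemma T_surj: "T ` carrier Fr = carrier Q"
proof -
  have act: "a \<odot> q \<in> T ` carrier Fr" if a: "a \<in> carrier (I_1 i)" and q: "q \<in> T ` carrier Fr" for a i q
  proof -
    obtain f where f: "f \<in> carrier Fr" "q = T f" using q by auto
    have "a \<odot> T f \<in> T ` carrier Fr"
      using f(1)
    proof (induction rule: T_Fr_induct)
      case zero
      have "T 0 \<in> T ` carrier Fr" by (rule imageI) (simp add: in_Fr_iff)
      then show ?case using I_1_subset_I_n[OF a] by simp
    next
      case (add u q)
      let ?w = "u(i := a \<odot>\<^bsub>Ms i\<^esub> u i)"
      have w: "?w j \<in> carrier (Ms j)" for j using add(1) Ms_smult_closed[OF a] by simp
      obtain g where g: "g \<in> carrier Fr" "a \<odot> q = T g" using add(3) by blast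
      have qc: "q \<in> carrier Q" using add(2) by auto
      have "\<Phi> ?w = a \<odot> \<Phi> (u(i := u i))" by (rule \<Phi>_smult[OF add(1) a add(1)])
      then have "a \<odot> (\<Phi> u \<oplus> q) = T (Poly_Mapping.single ?w 1 + g)"
        using I_1_subset_I_n[OF a] qc g(2) by (simp add: smult_r_distr T_add T_single)
      moreover have "Poly_Mapping.single ?w 1 + g \<in> carrier Fr"
        by (intro Fr_add single_in_Fr w g(1))
      ultimately show ?case by (simp only: imageI)
    qed
    then show ?thesis using f(2) by simp
  qed
  have "submodule (T ` carrier Fr) I_n Q"
  proof (rule submodule_generatorsI)
    show "\<zero> \<in> T ` carrier Fr" by (rule image_eqI[of _ _ 0]) (simp_all add: in_Fr_iff)
    show "x \<oplus> y \<in> T ` carrier Fr" if xy: "x \<in> T ` carrier Fr" "y \<in> T ` carrier Fr" for x y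
    proof -
      obtain f g where "f \<in> carrier Fr" "x = T f" "g \<in> carrier Fr" "y = T g" using xy by auto
      then show ?thesis by (intro image_eqI[of _ _ "f + g"]) (simp_all add: T_add Fr_add)
    qed
    show "pscale c \<odot> x \<in> T ` carrier Fr" if "x \<in> T ` carrier Fr" for c x
      by (rule act[OF I_1_pscale that])
    show "g \<odot> x \<in> T ` carrier Fr"
      if g: "g \<in> {op_X i, op_D i, op_J i}" and x: "x \<in> T ` carrier Fr" for g i x
      by (rule act[of g i]) (use g x in auto)
  qed auto
  moreover have "T ` carrier Fr \<noteq> {\<zero>}"
  proof -
    have "T (Poly_Mapping.single (bvec (\<lambda>i. 0)) 1) = v"
      using chain_zero[OF vc] vc by (simp add: T_single \<Phi>_bvec)
    then have "v \<in> T ` carrier Fr" by (intro image_eqI[OF sym]) (auto intro: single_in_Fr bvec_carrier)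
    then show ?thesis using v_nz by auto
  qed
  ultimately show ?thesis using simple by blast
qed

subsection \<open>The isomorphism\<close>

interpretation Rel: abelian_subgroup Rel Fr by (rule abelian_subgroup_Rel)

text \<open>The inverse of the map induced by \<open>T\<close> on cosets. The choice of a preimage
  is harmless because the kernel of \<open>T\<close> on the free module is
  \<open>Rel\<close>.\<close>

definition G :: "'m \<Rightarrow> (('n \<Rightarrow> 'y) \<Rightarrow>\<^sub>0 'k) set" where
  "G q = Rel +>\<^bsub>Fr\<^esub> (SOME f. f \<in> carrier Fr \<and> T f = q)"

lemma coset_eq_T_iff:
  assumes "f \<in> carrier Fr" "g \<in> carrier Fr"
  shows "Rel +>\<^bsub>Fr\<^esub> f = Rel +>\<^bsub>Fr\<^esub> g \<longleftrightarrow> T f = T g"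
proof -
  have "f \<ominus>\<^bsub>Fr\<^esub> g = f - g" using assms by (simp add: Rel.minus_eq Fr_a_inv)
  then have "Rel +>\<^bsub>Fr\<^esub> f = Rel +>\<^bsub>Fr\<^esub> g \<longleftrightarrow> f - g \<in> Rel"
    using Rel.coset_eq_iff[OF assms] by simp
  also have "\<dots> \<longleftrightarrow> T (f - g) = \<zero>" using T_Rel T_eq_0[OF Fr_diff[OF assms]] by blast
  also have "\<dots> \<longleftrightarrow> T f = T g" by (simp add: T_diff M.diff_eq_zero_iff)
  finally show ?thesis .
qed

lemma G_T: "f \<in> carrier Fr \<Longrightarrow> G (T f) = Rel +>\<^bsub>Fr\<^esub> f"
proof -
  assume f: "f \<in> carrier Fr"
  let ?g = "SOME g. g \<in> carrier Fr \<and> T g = T f"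
  have "\<exists>g. g \<in> carrier Fr \<and> T g = T f" using f by blast
  then have "?g \<in> carrier Fr \<and> T ?g = T f" by (rule someI_ex)
  then show ?thesis unfolding G_def using coset_eq_T_iff[of ?g f] f by blast
qed

lemma tensor_space_simps:
  "carrier (tensor_space Ms) = a_rcosets\<^bsub>Fr\<^esub> Rel" "zero (tensor_space Ms) = Rel"
  "add (tensor_space Ms) = set_add Fr"
  by (simp_all add: tensor_space_def)

lemma G_surj: "X \<in> carrier (tensor_space Ms) \<Longrightarrow> \<exists>q\<in>carrier Q. X = G q"
proof -
  assume "X \<in> carrier (tensor_space Ms)"
  then obtain f where f: "f \<in> carrier Fr" "X = Rel +>\<^bsub>Fr\<^esub> f"
    unfolding tensor_space_simps by (rule Rel.rcosetsE)
  show ?thesis unfolding f(2) G_T[OF f(1), symmetric] by (rule bexI[OF refl T_closed])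
qed

lemma T_surjE:
  assumes "q \<in> carrier Q"
  obtains f where "f \<in> carrier Fr" "q = T f"
  using assms T_surj by blast

lemma G_closed: "q \<in> carrier Q \<Longrightarrow> G q \<in> carrier (tensor_space Ms)"
proof -
  assume "q \<in> carrier Q"
  then obtain f where f: "f \<in> carrier Fr" "q = T f" by (rule T_surjE)
  show ?thesis unfolding f(2) G_T[OF f(1)] tensor_space_simps by (rule Rel.coset_in_rcosets[OF f(1)])
qed

lemma G_inj: "inj_on G (carrier Q)"
proof (rule inj_onI)
  fix p q assume "p \<in> carrier Q" "q \<in> carrier Q" and eq: "G p = G q"
  then obtain f g where f: "f \<in> carrier Fr" "p = T f" and g: "g \<in> carrier Fr" "q = T g"
    by (metis T_surjE)
  show "p = q" using eq unfolding f(2) g(2) G_T[OF f(1)] G_T[OF g(1)] coset_eq_T_iff[OF f(1) g(1)] .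
qed

lemma bij_G: "bij_betw G (carrier Q) (carrier (tensor_space Ms))"
  unfolding bij_betw_def using G_inj G_closed G_surj by auto

lemma G_add: "\<lbrakk>p \<in> carrier Q; q \<in> carrier Q\<rbrakk> \<Longrightarrow> G (p \<oplus> q) = G p \<oplus>\<^bsub>tensor_space Ms\<^esub> G q"
proof -
  assume "p \<in> carrier Q" "q \<in> carrier Q"
  then obtain f g where f: "f \<in> carrier Fr" "p = T f" and g: "g \<in> carrier Fr" "q = T g"
    by (metis T_surjE)
  then show ?thesis
    by (simp add: T_add[symmetric] G_T Fr_add tensor_space_simps Rel.a_rcos_sum)
qed

lemma pure_tensor_G: "(\<And>j. u j \<in> carrier (Ms j)) \<Longrightarrow> pure_tensor Ms u = G (\<Phi> u)"
  using G_T[of "Poly_Mapping.single u 1"] by (simp add: single_in_Fr T_single pure_tensor_def)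

definition \<rho>0 where
  "\<rho>0 a X = G (a \<odot> inv_into (carrier Q) G X)"

lemma \<rho>0_G: "q \<in> carrier Q \<Longrightarrow> \<rho>0 a (G q) = G (a \<odot> q)"
  by (simp add: \<rho>0_def G_inj)

lemma tensor_with_action_simps [simp]:
  "carrier (tensor_with_action Ms \<rho>) = carrier (tensor_space Ms)"
  "zero (tensor_with_action Ms \<rho>) = zero (tensor_space Ms)"
  "add (tensor_with_action Ms \<rho>) = add (tensor_space Ms)"
  "module.smult (tensor_with_action Ms \<rho>) = \<rho>"
  by (simp_all add: tensor_with_action_def)

text \<open>A tensor action exists: the action on \<open>Q\<close> is carried over along
  \<open>G\<close>. In slot \<open>i\<close> it is the action of the factor, because
  \<open>\<Phi>\<close> is linear over \<open>I_1 i\<close> in that slot.\<close>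

lemma is_tensor_action_\<rho>0: "is_tensor_action Ms \<rho>0"
  unfolding is_tensor_action_def
proof (intro conjI allI ballI impI)
  have ab: "abelian_group (tensor_with_action Ms \<rho>0)"
    by (rule Rel.abelian_group_rcosets) (simp_all add: tensor_space_simps)
  show "left_module I_n (tensor_with_action Ms \<rho>0)"
  proof (intro left_module.intro ring_I_n ab left_module_axioms.intro; unfold tensor_with_action_simps)
    fix a b :: "('k, 'n) endo" and X Y
    assume a: "a \<in> carrier I_n"
    {
      assume "X \<in> carrier (tensor_space Ms)"
      then obtain q where q: "q \<in> carrier Q" "X = G q" using G_surj by blast
      then show "\<rho>0 a X \<in> carrier (tensor_space Ms)" using a by (simp add: \<rho>0_G G_closed)
      assume b: "b \<in> carrier I_n"
      show "\<rho>0 (a \<oplus>\<^bsub>I_n\<^esub> b) X = \<rho>0 a X \<oplus>\<^bsub>tensor_space Ms\<^esub> \<rho>0 b X"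
        using a b q by (simp add: \<rho>0_G act_add G_add)
      have "\<rho>0 (a \<circ> b) X = \<rho>0 a (\<rho>0 b X)"
        unfolding q(2) using q(1) a b by (simp only: \<rho>0_G act_comp smult_closed)
      then show "\<rho>0 (a \<otimes>\<^bsub>I_n\<^esub> b) X = \<rho>0 a (\<rho>0 b X)" by (simp only: I_n_simps)
    }
    assume "X \<in> carrier (tensor_space Ms)" "Y \<in> carrier (tensor_space Ms)"
    then obtain p q where "p \<in> carrier Q" "X = G p" "q \<in> carrier Q" "Y = G q" using G_surj by metis
    then show "\<rho>0 a (X \<oplus>\<^bsub>tensor_space Ms\<^esub> Y) = \<rho>0 a X \<oplus>\<^bsub>tensor_space Ms\<^esub> \<rho>0 a Y"
      using a by (simp add: \<rho>0_G G_add[symmetric] smult_r_distr)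
  next
    fix X assume "X \<in> carrier (tensor_space Ms)"
    then obtain q where "q \<in> carrier Q" "X = G q" using G_surj by blast
    then show "\<rho>0 \<one>\<^bsub>I_n\<^esub> X = X" by (simp add: \<rho>0_G)
  qed
next
  fix i u and a :: "('k, 'n) endo" assume a: "a \<in> carrier (I_1 i)" and "\<forall>j. u j \<in> carrier (Ms j)"
  then have u: "\<And>j. u j \<in> carrier (Ms j)" by simp
  have "\<rho>0 a (pure_tensor Ms u) = G (a \<odot> \<Phi> u)"
    by (simp add: pure_tensor_G[OF u] \<rho>0_G)
  also have "a \<odot> \<Phi> u = \<Phi> (u(i := a \<odot>\<^bsub>Ms i\<^esub> u i))"
    using \<Phi>_smult[OF u a u[of i]] by simp
  also have "G \<dots> = pure_tensor Ms (u(i := a \<odot>\<^bsub>Ms i\<^esub> u i))"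
    by (rule pure_tensor_G[symmetric]) (use u Ms_smult_closed[OF a] in simp)
  finally show "\<rho>0 a (pure_tensor Ms u) = pure_tensor Ms (u(i := a \<odot>\<^bsub>Ms i\<^esub> u i))" .
qed

text \<open>The action of \<open>tensor_module\<close> is picked by \<open>SOME\<close>, so an
  arbitrary tensor action has to be treated. Pure tensors span and the \<open>I_1 i\<close> generate
  the algebra, which leaves only one possibility.\<close>

lemma G_act:
  assumes \<rho>: "is_tensor_action Ms \<rho>" and a: "a \<in> carrier I_n"
  shows "\<forall>q\<in>carrier Q. G (a \<odot> q) = \<rho> a (G q)"
proof -
  interpret L: left_module I_n "tensor_with_action Ms \<rho>"
    using \<rho> by (simp add: is_tensor_action_def)
  have I1: "G (a \<odot> q) = \<rho> a (G q)" if a: "a \<in> carrier (I_1 i)" and q: "q \<in> carrier Q" for a i q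
  proof -
    have an: "a \<in> carrier I_n" by (rule I_1_subset_I_n[OF a])
    obtain f where f: "f \<in> carrier Fr" "q = T f" by (rule T_surjE[OF q])
    have "G (a \<odot> T f) = \<rho> a (G (T f))"
      using f(1)
    proof (induction rule: T_Fr_induct)
      case zero
      have "G \<zero> = \<zero>\<^bsub>tensor_space Ms\<^esub>"
        using G_T[of 0] Rel.a_rcos_const[OF multilinear_relations.zero]
        by (simp add: in_Fr_iff tensor_space_simps)
      then show ?case using an L.smult_r_null[OF an] by simp
    next
      case (add u q)
      have qc: "q \<in> carrier Q" using add(2) by auto
      have "\<rho> a (pure_tensor Ms u) = pure_tensor Ms (u(i := a \<odot>\<^bsub>Ms i\<^esub> u i))"
        using \<rho> a add(1) by (simp add: is_tensor_action_def)
      also have "\<dots> = G (\<Phi> (u(i := a \<odot>\<^bsub>Ms i\<^esub> u i)))"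
        by (rule pure_tensor_G) (use add(1) Ms_smult_closed[OF a] in simp)
      also have "\<Phi> (u(i := a \<odot>\<^bsub>Ms i\<^esub> u i)) = a \<odot> \<Phi> u"
        using \<Phi>_smult[OF add(1) a add(1)[of i]] by simp
      finally have "\<rho> a (G (\<Phi> u)) = G (a \<odot> \<Phi> u)" by (simp add: pure_tensor_G[OF add(1)])
      then show ?case
        using L.smult_r_distr[OF an, of "G (\<Phi> u)" "G q"] add(3) an qc
        by (simp add: G_add G_closed smult_r_distr)
    qed
    then show ?thesis using f(2) by simp
  qed
  from a show ?thesis
  proof (induction rule: I_n_induct)
    case (pscale c)
    show ?case using I1[OF I_1_pscale] by blast
  next
    case (gen g)
    then obtain i where "g \<in> carrier (I_1 i)" by auto
    then show ?case using I1 by blast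
  next
    case (add f g)
    show ?case
    proof
      fix q assume q: "q \<in> carrier Q"
      have "\<rho> (\<lambda>p. f p + g p) (G q) = \<rho> f (G q) \<oplus>\<^bsub>tensor_space Ms\<^esub> \<rho> g (G q)"
        using L.smult_l_distr[OF add(1,2), of "G q"] G_closed[OF q] by simp
      then show "G ((\<lambda>p. f p + g p) \<odot> q) = \<rho> (\<lambda>p. f p + g p) (G q)"
        using add q by (simp add: act_add G_add)
    qed
  next
    case (comp f g)
    show ?case
    proof
      fix q assume q: "q \<in> carrier Q"
      have "\<rho> (f \<circ> g) (G q) = \<rho> f (\<rho> g (G q))"
        using L.smult_assoc1[OF comp(1,2), of "G q"] G_closed[OF q] by simp
      then show "G ((f \<circ> g) \<odot> q) = \<rho> (f \<circ> g) (G q)"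
        unfolding act_comp[OF comp(1,2) q] using comp q by simp
    qed
  qed
qed

lemma tensor_isomorphic: "module_isomorphic I_n Q (tensor_module Ms)"
proof -
  define \<rho> where "\<rho> = (SOME \<rho>. is_tensor_action Ms \<rho>)"
  have \<rho>: "is_tensor_action Ms \<rho>" unfolding \<rho>_def by (rule someI[where P = "is_tensor_action Ms", OF is_tensor_action_\<rho>0])
  show ?thesis
    unfolding module_isomorphic_def tensor_module_def \<rho>_def[symmetric]
    using bij_G G_add G_act[OF \<rho>] by (intro exI[of _ G]) simp
qed

end

section \<open>The simple modules\<close>

subsection \<open>The ideal spanned by the matrix units\<close>

lemma End_P_diff: "f \<in> carrier End_P \<Longrightarrow> f (p - q) = f p - f q"
  using End_P_add[of f "p - q" q] by (simp add: algebra_simps)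

lemma op_D_J_apply [simp]: "op_D i (op_J i p) = p"
  using fun_cong[OF op_D_J, of i p] by simp

lemma funpow_op_J_diff: "(op_J i ^^ k) (p - q) = (op_J i ^^ k) p - (op_J i ^^ k) q"
  by (induction k) (simp_all add: End_P_diff[OF op_J_in_End_P])

lemma matrix_unit_I_1: "matrix_unit i s t \<in> carrier (I_1 i)"
proof -
  have "matrix_unit i s t = (\<lambda>p. ((op_J i ^^ s) \<circ> (op_D i ^^ t)) p - ((op_J i ^^ (s + 1)) \<circ> (op_D i ^^ (t + 1))) p)"
    by (simp add: matrix_unit_def fun_eq_iff)
  also have "\<dots> \<in> carrier (I_1 i)"
    by (rule I_1_diff[OF I_1_comp[OF I_1_funpow[OF I_1_op(3)] I_1_funpow[OF I_1_op(2)]]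
      I_1_comp[OF I_1_funpow[OF I_1_op(3)] I_1_funpow[OF I_1_op(2)]]])
  finally show ?thesis .
qed

lemma op_J_matrix_unit: "op_J i (matrix_unit i s t p) = matrix_unit i (Suc s) t p"
  by (simp add: matrix_unit_def End_P_diff[OF op_J_in_End_P])

lemma op_D_matrix_unit_0: "op_D i (matrix_unit i 0 t p) = 0"
  by (simp add: matrix_unit_def End_P_diff[OF op_D_in_End_P])

lemma op_D_matrix_unit_Suc: "op_D i (matrix_unit i (Suc s) t p) = matrix_unit i s t p"
  by (simp add: op_J_matrix_unit[symmetric])

lemma op_J_D_X_apply: "op_J i (op_D i (op_X i p)) = op_X i p"
  using fun_cong[OF op_J_D_X, of i p] by simp

lemma op_D_X_apply: "op_D i (op_X i p) = p + op_X i (op_D i p)"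
  using fun_cong[OF op_D_X, of i p] by simp

text \<open>In the variable \<open>x_i\<close> the matrix units refer to the basis
  \<open>x^s / s!\<close>, and \<open>x\<close> times this vector is \<open>s + 1\<close> times the
  next one. The induction uses \<open>x = J (1 + x \<partial>)\<close>.\<close>

lemma op_X_matrix_unit: "op_X i (matrix_unit i s t p) = pscale (of_nat (Suc s)) (matrix_unit i (Suc s) t p)"
proof (induction s)
  case 0
  let ?y = "matrix_unit i 0 t p"
  have "op_X i ?y = op_J i (?y + op_X i (op_D i ?y))"
    using op_J_D_X_apply[of i ?y] by (simp only: op_D_X_apply)
  then show ?case by (simp add: op_D_matrix_unit_0 End_P_zero[OF op_X_in_End_P] op_J_matrix_unit)
next
  case (Suc s)
  let ?y = "matrix_unit i s t p"
  have "op_X i (op_J i ?y) = op_J i (op_J i ?y + op_X i (op_D i (op_J i ?y)))"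
    using op_J_D_X_apply[of i "op_J i ?y"] by (simp only: op_D_X_apply)
  also have "\<dots> = matrix_unit i (Suc (Suc s)) t p + pscale (of_nat (Suc s)) (matrix_unit i (Suc (Suc s)) t p)"
    unfolding op_D_J_apply Suc
    by (simp add: End_P_add[OF op_J_in_End_P] End_P_pscale[OF op_J_in_End_P] op_J_matrix_unit)
  also have "\<dots> = pscale (1 + of_nat (Suc s)) (matrix_unit i (Suc (Suc s)) t p)"
    by (simp only: pscale.scale_left_distrib pscale.scale_one)
  finally show ?case by (simp add: op_J_matrix_unit)
qed

lemma matrix_unit_op_D: "matrix_unit i s t (op_D i p) = matrix_unit i s (Suc t) p"
  by (simp add: matrix_unit_def funpow_swap1)

lemma matrix_unit_op_J_0: "matrix_unit i s 0 (op_J i p) = 0"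
  by (simp add: matrix_unit_def funpow_swap1)

lemma matrix_unit_op_J_Suc: "matrix_unit i s (Suc t) (op_J i p) = matrix_unit i s t p"
  by (simp add: matrix_unit_op_D[symmetric])

text \<open>The dual computation: \<open>x\<close> sends \<open>x^(t-1) / (t-1)!\<close> to
  \<open>t\<close> times \<open>x^t / t!\<close>. For \<open>t = 0\<close> the truncated index
  carries the coefficient \<open>0\<close>.\<close>

lemma matrix_unit_op_X: "matrix_unit i s t (op_X i p) = pscale (of_nat t) (matrix_unit i s (t - 1) p)"
proof (induction t arbitrary: p)
  case 0
  have "matrix_unit i s 0 (op_X i p) = (op_J i ^^ s) (op_X i p - op_J i (op_D i (op_X i p)))"
    by (simp add: matrix_unit_def funpow_op_J_diff funpow_swap1)
  then show ?case using funpow_op_J_diff[of s i 0 0] by (simp add: op_J_D_X_apply)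
next
  case (Suc t)
  have e: "matrix_unit i s t \<in> carrier End_P" by (rule subsetD[OF I_1_subset_End_P matrix_unit_I_1])
  have "matrix_unit i s (Suc t) (op_X i p) = matrix_unit i s t (op_D i (op_X i p))"
    by (simp add: matrix_unit_op_D)
  also have "\<dots> = matrix_unit i s t p + matrix_unit i s t (op_X i (op_D i p))"
    by (simp add: op_D_X_apply End_P_add[OF e])
  also have "matrix_unit i s t (op_X i (op_D i p)) = pscale (of_nat t) (matrix_unit i s t p)"
    unfolding Suc by (cases t) (simp_all add: matrix_unit_op_D)
  finally show ?case by (simp add: pscale.scale_left_distrib)
qed

text \<open>Products with generators are multiples of matrix units again, with \<open>b = 0\<close>
  where the product vanishes. This makes the span stable under left multiplication.\<close>

lemma gen_matrix_unit:
  assumes "g \<in> {op_X i, op_D i, op_J i}"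
  shows "\<exists>b s' t'. \<forall>p. g (matrix_unit i s t p) = pscale b (matrix_unit i s' t' p)"
proof -
  have X: "\<exists>b s' t'. \<forall>p. op_X i (matrix_unit i s t p) = pscale b (matrix_unit i s' t' p)"
    by (rule exI, rule exI, rule exI, rule allI, rule op_X_matrix_unit)
  have "\<forall>p. op_J i (matrix_unit i s t p) = pscale 1 (matrix_unit i (Suc s) t p)"
    by (simp add: op_J_matrix_unit)
  then have J: "\<exists>b s' t'. \<forall>p. op_J i (matrix_unit i s t p) = pscale b (matrix_unit i s' t' p)" by blast
  have D: "\<exists>b s' t'. \<forall>p. op_D i (matrix_unit i s t p) = pscale b (matrix_unit i s' t' p)"
  proof (cases s)
    case 0
    then have "\<forall>p. op_D i (matrix_unit i s t p) = pscale 0 (matrix_unit i s t p)"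
      by (simp add: op_D_matrix_unit_0)
    then show ?thesis by blast
  next
    case (Suc s')
    then have "\<forall>p. op_D i (matrix_unit i s t p) = pscale 1 (matrix_unit i s' t p)"
      by (simp add: op_D_matrix_unit_Suc)
    then show ?thesis by blast
  qed
  show ?thesis using assms X J D by auto
qed

lemma matrix_unit_gen:
  assumes "g \<in> {op_X i, op_D i, op_J i}"
  shows "\<exists>b s' t'. \<forall>p. matrix_unit i s t (g p) = pscale b (matrix_unit i s' t' p)"
proof -
  have X: "\<exists>b s' t'. \<forall>p. matrix_unit i s t (op_X i p) = pscale b (matrix_unit i s' t' p)"
    by (rule exI, rule exI, rule exI, rule allI, rule matrix_unit_op_X)
  have "\<forall>p. matrix_unit i s t (op_D i p) = pscale 1 (matrix_unit i s (Suc t) p)"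
    by (simp add: matrix_unit_op_D)
  then have D: "\<exists>b s' t'. \<forall>p. matrix_unit i s t (op_D i p) = pscale b (matrix_unit i s' t' p)" by blast
  have J: "\<exists>b s' t'. \<forall>p. matrix_unit i s t (op_J i p) = pscale b (matrix_unit i s' t' p)"
  proof (cases t)
    case 0
    then have "\<forall>p. matrix_unit i s t (op_J i p) = pscale 0 (matrix_unit i s t p)"
      by (simp add: matrix_unit_op_J_0)
    then show ?thesis by blast
  next
    case (Suc t')
    then have "\<forall>p. matrix_unit i s t (op_J i p) = pscale 1 (matrix_unit i s t' p)"
      by (simp add: matrix_unit_op_J_Suc)
    then show ?thesis by blast
  qed
  show ?thesis using assms X J D by auto
qed

lemma F_ideal_zero: "(\<lambda>p. 0) \<in> F_ideal i"
  unfolding F_ideal_def by (rule CollectI, rule exI[of _ "{}"]) simp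

lemma F_ideal_step:
  assumes "f \<in> F_ideal i"
  shows "(\<lambda>p. pscale b (matrix_unit i s t p) + f p) \<in> F_ideal i"
proof -
  obtain A c where A: "finite A" "f = (\<lambda>p. \<Sum>(s, t)\<in>A. pscale (c s t) (matrix_unit i s t p))"
    using assms by (auto simp: F_ideal_def)
  let ?A = "insert (s, t) A"
  \<comment> \<open>The index \<open>(s, t)\<close> may already occur in \<open>A\<close>; in that
    case the coefficients add up.\<close>
  let ?c = "\<lambda>s' t'. (if (s', t') \<in> A then c s' t' else 0) + (if (s', t') = (s, t) then b else 0)"
  have "pscale b (matrix_unit i s t p) + f p
      = (\<Sum>(s', t')\<in>?A. pscale (?c s' t') (matrix_unit i s' t' p))" for p
  proof -
    have "(\<Sum>(s', t')\<in>?A. pscale (?c s' t') (matrix_unit i s' t' p))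
        = (\<Sum>x\<in>?A. (if x \<in> A then pscale (c (fst x) (snd x)) (matrix_unit i (fst x) (snd x) p) else 0)
          + (if x = (s, t) then pscale b (matrix_unit i s t p) else 0))"
      by (rule sum.cong) (auto simp: pscale.scale_left_distrib split: if_splits)
    also have "\<dots> = (\<Sum>x\<in>?A. if x \<in> A then pscale (c (fst x) (snd x)) (matrix_unit i (fst x) (snd x) p) else 0)
        + (\<Sum>x\<in>?A. if x = (s, t) then pscale b (matrix_unit i s t p) else 0)"
      by (rule sum.distrib)
    also have "(\<Sum>x\<in>?A. if x \<in> A then pscale (c (fst x) (snd x)) (matrix_unit i (fst x) (snd x) p) else 0)
        = (\<Sum>x\<in>A. pscale (c (fst x) (snd x)) (matrix_unit i (fst x) (snd x) p))"
      using A(1) by (intro sum.mono_neutral_cong_right) auto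
    also have "(\<Sum>x\<in>?A. if x = (s, t) then pscale b (matrix_unit i s t p) else 0)
        = pscale b (matrix_unit i s t p)"
      using A(1) by (simp add: sum.delta)
    finally show ?thesis by (simp add: A(2) case_prod_unfold add.commute)
  qed
  then show ?thesis unfolding F_ideal_def using A(1)
    by (intro CollectI exI[of _ ?A] exI[of _ ?c]) (auto simp: fun_eq_iff)
qed

lemma F_ideal_induct [consumes 1, case_names zero step]:
  assumes "f \<in> F_ideal i" and "P (\<lambda>p. 0)"
    and "\<And>b s t f. \<lbrakk>f \<in> F_ideal i; P f\<rbrakk> \<Longrightarrow> P (\<lambda>p. pscale b (matrix_unit i s t p) + f p)"
  shows "P f"
proof -
  obtain A c where A: "finite A" "f = (\<lambda>p. \<Sum>(s, t)\<in>A. pscale (c s t) (matrix_unit i s t p))"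
    using assms by (auto simp: F_ideal_def)
  have "P (\<lambda>p. \<Sum>(s, t)\<in>A. pscale (c s t) (matrix_unit i s t p)) \<and>
      (\<lambda>p. \<Sum>(s, t)\<in>A. pscale (c s t) (matrix_unit i s t p)) \<in> F_ideal i"
    using A(1)
  proof (induction A rule: finite_induct)
    case empty
    then show ?case using assms(2) F_ideal_zero by simp
  next
    case (insert x A)
    obtain s t where x: "x = (s, t)" by (cases x)
    have "(\<lambda>p. \<Sum>(s, t)\<in>insert x A. pscale (c s t) (matrix_unit i s t p))
        = (\<lambda>p. pscale (c s t) (matrix_unit i s t p) + (\<Sum>(s, t)\<in>A. pscale (c s t) (matrix_unit i s t p)))"
      using insert.hyps by (simp add: x)
    moreover have "P (\<lambda>p. \<Sum>(s, t)\<in>A. pscale (c s t) (matrix_unit i s t p))"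
      "(\<lambda>p. \<Sum>(s, t)\<in>A. pscale (c s t) (matrix_unit i s t p)) \<in> F_ideal i"
      using insert.IH by blast+
    ultimately show ?case
      using assms(3)[of "\<lambda>p. \<Sum>(s, t)\<in>A. pscale (c s t) (matrix_unit i s t p)" "c s t" s t]
        F_ideal_step[of "\<lambda>p. \<Sum>(s, t)\<in>A. pscale (c s t) (matrix_unit i s t p)" i "c s t" s t]
      by (simp only: simp_thms)
  qed
  then show ?thesis using A(2) by simp
qed

lemma F_ideal_add:
  assumes "f \<in> F_ideal i" "g \<in> F_ideal i"
  shows "(\<lambda>p. f p + g p) \<in> F_ideal i"
  using assms(1)
proof (induction rule: F_ideal_induct)
  case zero
  then show ?case using assms(2) by simp
next
  case (step b s t f)
  from F_ideal_step[OF step(2), of b s t] show ?case by (simp only: add.assoc)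
qed

lemma F_ideal_I_1: "f \<in> F_ideal i \<Longrightarrow> f \<in> carrier (I_1 i)"
proof (induction rule: F_ideal_induct)
  case (step b s t f)
  have "(\<lambda>p. (pscale b \<circ> matrix_unit i s t) p + f p) \<in> carrier (I_1 i)"
    by (rule I_1_add[OF I_1_comp[OF I_1_pscale matrix_unit_I_1] step(2)])
  then show ?case by simp
qed simp

lemma F_ideal_comp_left_step:
  fixes g :: "('k::field_char_0, 'n) endo"
  assumes g: "g \<in> carrier (I_1 i)"
    and mu: "\<And>s t. \<exists>b s' t'. \<forall>p. g (matrix_unit i s t p) = pscale b (matrix_unit i s' t' p)"
    and f: "f \<in> F_ideal i"
  shows "g \<circ> f \<in> F_ideal i"
  using f
proof (induction rule: F_ideal_induct)
  case zero
  have "g \<circ> (\<lambda>p :: ('k, 'n) pol. 0) = (\<lambda>p. 0)" using End_P_zero[OF subsetD[OF I_1_subset_End_P g]] by auto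
  then show ?case using F_ideal_zero by (simp only:)
next
  case (step b s t f)
  note e = subsetD[OF I_1_subset_End_P g]
  obtain d s' t' where "\<And>p. g (matrix_unit i s t p) = pscale d (matrix_unit i s' t' p)" using mu by blast
  then have "g \<circ> (\<lambda>p. pscale b (matrix_unit i s t p) + f p)
      = (\<lambda>p. pscale (b * d) (matrix_unit i s' t' p) + (g \<circ> f) p)"
    by (simp add: fun_eq_iff End_P_add[OF e] End_P_pscale[OF e])
  then show ?case using F_ideal_step[OF step(2)] by (simp only:)
qed

lemma F_ideal_comp_left:
  fixes a :: "('k::field_char_0, 'n) endo"
  assumes "a \<in> carrier (I_1 i)"
  shows "\<forall>f\<in>F_ideal i. a \<circ> f \<in> F_ideal i"
  using assms
proof (induction rule: I_1_induct)
  case (pscale c)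
  show ?case by (intro ballI F_ideal_comp_left_step) auto
next
  case (gen g)
  have "g \<in> carrier (I_1 i)" using gen by auto
  then show ?case by (intro ballI F_ideal_comp_left_step gen_matrix_unit[OF gen])
next
  case (add a b)
  show ?case
  proof
    fix f :: "('k, 'n) endo" assume "f \<in> F_ideal i"
    then have "(\<lambda>p. (a \<circ> f) p + (b \<circ> f) p) \<in> F_ideal i"
      by (intro F_ideal_add bspec[OF add(3)] bspec[OF add(4)])
    then show "(\<lambda>p. a p + b p) \<circ> f \<in> F_ideal i" by (simp add: comp_def)
  qed
next
  case (comp a b)
  show ?case
  proof
    fix f :: "('k, 'n) endo" assume "f \<in> F_ideal i"
    then have "a \<circ> (b \<circ> f) \<in> F_ideal i" by (rule bspec[OF comp(3) bspec[OF comp(4)]])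
    then show "(a \<circ> b) \<circ> f \<in> F_ideal i" unfolding comp_assoc .
  qed
qed

lemma F_ideal_comp_right:
  fixes a :: "('k::field_char_0, 'n) endo"
  assumes "a \<in> carrier (I_1 i)"
  shows "\<forall>f\<in>F_ideal i. f \<circ> a \<in> F_ideal i"
  using assms
proof (induction rule: I_1_induct)
  case (pscale c)
  show ?case
  proof
    fix f :: "('k, 'n) endo" assume f: "f \<in> F_ideal i"
    have "f \<circ> pscale c = pscale c \<circ> f" by (rule I_n_pscale_commute[OF I_1_subset_I_n[OF F_ideal_I_1[OF f]]])
    moreover have "pscale c \<circ> f \<in> F_ideal i" by (rule bspec[OF F_ideal_comp_left[OF I_1_pscale] f])
    ultimately show "f \<circ> pscale c \<in> F_ideal i" by (simp only:)
  qed
next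
  case (gen g)
  show ?case
  proof
    fix f :: "('k, 'n) endo" assume "f \<in> F_ideal i"
    then show "f \<circ> g \<in> F_ideal i"
    proof (induction rule: F_ideal_induct)
      case zero
      have "(\<lambda>p :: ('k, 'n) pol. 0 :: ('k, 'n) pol) \<circ> g = (\<lambda>p. 0)" by auto
      then show ?case using F_ideal_zero by (simp only:)
    next
      case (step b s t f)
      obtain d s' t' where "\<And>p. matrix_unit i s t (g p) = pscale d (matrix_unit i s' t' p)"
        using matrix_unit_gen[OF gen] by blast
      then have "(\<lambda>p. pscale b (matrix_unit i s t p) + f p) \<circ> g
          = (\<lambda>p. pscale (b * d) (matrix_unit i s' t' p) + (f \<circ> g) p)"
        by (simp add: fun_eq_iff)
      then show ?case using F_ideal_step[OF step(2)] by (simp only:)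
    qed
  qed
next
  case (add a b)
  show ?case
  proof
    fix f :: "('k, 'n) endo" assume f: "f \<in> F_ideal i"
    have e: "f \<in> carrier End_P" by (rule subsetD[OF I_1_subset_End_P F_ideal_I_1[OF f]])
    have "(\<lambda>p. (f \<circ> a) p + (f \<circ> b) p) \<in> F_ideal i"
      by (intro F_ideal_add bspec[OF add(3) f] bspec[OF add(4) f])
    also have "(\<lambda>p. (f \<circ> a) p + (f \<circ> b) p) = f \<circ> (\<lambda>p. a p + b p)"
      by (auto simp: End_P_add[OF e])
    finally show "f \<circ> (\<lambda>p. a p + b p) \<in> F_ideal i" .
  qed
next
  case (comp a b)
  show ?case
  proof
    fix f :: "('k, 'n) endo" assume "f \<in> F_ideal i"
    then have "(f \<circ> a) \<circ> b \<in> F_ideal i" by (rule bspec[OF comp(4) bspec[OF comp(3)]])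
    then show "f \<circ> (a \<circ> b) \<in> F_ideal i" unfolding comp_assoc .
  qed
qed

lemma ideal_F_ideal: "ideal (F_ideal i :: ('k::field_char_0, 'n) endo set) (I_1 i)"
proof (rule idealI)
  interpret R: ring "I_1 i :: ('k, 'n) endo ring" by (rule ring_I_1)
  show "ring (I_1 i :: ('k, 'n) endo ring)" by (rule ring_I_1)
  show "subgroup (F_ideal i) (add_monoid (I_1 i :: ('k, 'n) endo ring))"
  proof (rule subgroup.intro)
    show "F_ideal i \<subseteq> carrier (add_monoid (I_1 i))" using F_ideal_I_1 by auto
    show "x \<otimes>\<^bsub>add_monoid (I_1 i)\<^esub> y \<in> F_ideal i" if "x \<in> F_ideal i" "y \<in> F_ideal i" for x y
      using F_ideal_add[OF that] by simp
    show "\<one>\<^bsub>add_monoid (I_1 i)\<^esub> \<in> F_ideal i" using F_ideal_zero by simp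
    fix f :: "('k, 'n) endo" assume f: "f \<in> F_ideal i"
    have m: "pscale (-1) \<circ> f \<in> F_ideal i" by (rule bspec[OF F_ideal_comp_left[OF I_1_pscale] f])
    have "\<ominus>\<^bsub>I_1 i\<^esub> f = pscale (-1) \<circ> f"
    proof (rule R.minus_equality)
      show "(pscale (-1) \<circ> f) \<oplus>\<^bsub>I_1 i\<^esub> f = \<zero>\<^bsub>I_1 i\<^esub>" by simp
    qed (rule F_ideal_I_1[OF f] F_ideal_I_1[OF m])+
    then show "inv\<^bsub>add_monoid (I_1 i)\<^esub> f \<in> F_ideal i" using m by (simp add: a_inv_def)
  qed
  show "x \<otimes>\<^bsub>I_1 i\<^esub> a \<in> F_ideal i" if "a \<in> F_ideal i" "x \<in> carrier (I_1 i)" for a x :: "('k, 'n) endo"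
    unfolding I_1_simps by (rule bspec[OF F_ideal_comp_left[OF that(2)] that(1)])
  show "a \<otimes>\<^bsub>I_1 i\<^esub> x \<in> F_ideal i" if "a \<in> F_ideal i" "x \<in> carrier (I_1 i)" for a x :: "('k, 'n) endo"
    unfolding I_1_simps by (rule bspec[OF F_ideal_comp_right[OF that(2)] that(1)])
qed

text \<open>When \<open>J \<partial> = 1\<close>, the two terms of the matrix unit cancel, as the
  second one is \<open>J^s (J \<partial>) \<partial>^t\<close>. The module is then a module over
  \<open>B_1 i\<close>.\<close>

lemma (in I_module) F_ideal_act:
  assumes "full i" "f \<in> F_ideal i" "m \<in> carrier M"
  shows "f \<odot> m = \<zero>"
  using assms(2)
proof (induction rule: F_ideal_induct)
  case zero
  then show ?case using assms(3) by simp
next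
  case (step b s t f)
  let ?D = "op_D i ^^ t" and ?J = "op_J i ^^ s"
  have "(matrix_unit i s t :: ('k, 'n) endo) = (\<lambda>p. (?J \<circ> ?D) p + (pscale (-1) \<circ> (?J \<circ> (op_J i \<circ> (op_D i \<circ> ?D)))) p)"
    by (simp add: matrix_unit_def fun_eq_iff funpow_swap1)
  moreover have "\<dots> \<odot> m = (?J \<circ> ?D) \<odot> m \<oplus> (pscale (-1) \<circ> (?J \<circ> (op_J i \<circ> (op_D i \<circ> ?D)))) \<odot> m"
    by (rule act_add) (intro I_n_comp I_n_funpow I_n_op I_n_pscale assms(3))+
  moreover have "(?J \<circ> ?D) \<odot> m = ?J \<odot> (?D \<odot> m)"
    by (rule act_comp) (intro I_n_funpow I_n_op assms(3))+
  moreover have "(pscale (-1) \<circ> (?J \<circ> (op_J i \<circ> (op_D i \<circ> ?D)))) \<odot> m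
      = \<ominus> (?J \<odot> (op_J i \<odot> (op_D i \<odot> (?D \<odot> m))))"
    using assms(3) by (simp only: act_comp I_n_comp I_n_funpow I_n_op I_n_pscale smult_closed act_pscale_minus_1)
  moreover have "op_J i \<odot> (op_D i \<odot> (?D \<odot> m)) = ?D \<odot> m"
    using assms(1,3) by (simp add: full_def)
  ultimately have mu: "matrix_unit i s t \<odot> m = \<zero>" using assms(3) by (simp add: M.r_neg)
  have "(\<lambda>p. (pscale b \<circ> matrix_unit i s t) p + f p) \<odot> m
      = (pscale b \<circ> matrix_unit i s t) \<odot> m \<oplus> f \<odot> m"
    by (rule act_add[OF I_n_comp[OF I_n_pscale I_1_subset_I_n[OF matrix_unit_I_1]]
      I_1_subset_I_n[OF F_ideal_I_1[OF step(1)]] assms(3)])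
  also have "(pscale b \<circ> matrix_unit i s t) \<odot> m = pscale b \<odot> (matrix_unit i s t \<odot> m)"
    by (rule act_comp[OF I_n_pscale I_1_subset_I_n[OF matrix_unit_I_1] assms(3)])
  finally show ?case using step(2) by (simp add: mu)
qed

subsection \<open>The module \<open>M_1\<close>\<close>

lemma left_module_regular_module:
  fixes R :: "'r ring"
  assumes "ring R"
  shows "left_module R (regular_module R)"
proof -
  interpret R: ring R by fact
  have "abelian_group (regular_module R)"
  proof (rule abelian_groupI)
    fix x assume "x \<in> carrier (regular_module R)"
    then show "\<exists>y\<in>carrier (regular_module R). y \<oplus>\<^bsub>regular_module R\<^esub> x = \<zero>\<^bsub>regular_module R\<^esub>"
      by (intro bexI[of _ "\<ominus>\<^bsub>R\<^esub> x"]) (auto simp: regular_module_def R.l_neg)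
  qed (auto simp: regular_module_def R.a_ac)
  then show ?thesis
    by (intro left_module.intro left_module_axioms.intro R.ring_axioms)
      (auto simp: regular_module_def R.l_distr R.r_distr R.m_assoc)
qed

lemma regular_module_simps [simp]:
  "carrier (regular_module R) = carrier R" "zero (regular_module R) = zero R"
  "add (regular_module R) = add R" "a \<odot>\<^bsub>regular_module R\<^esub> b = a \<otimes>\<^bsub>R\<^esub> b"
  by (simp_all add: regular_module_def)

definition F_class :: "'n \<Rightarrow> ('k::field_char_0, 'n) endo \<Rightarrow> ('k, 'n) endo set" where
  "F_class i a = F_ideal i +>\<^bsub>I_1 i\<^esub> a"

lemma ring_B_1: "ring (B_1 i)"
  unfolding B_1_def by (rule ideal.quotient_is_ring[OF ideal_F_ideal])

lemma carrier_B_1: "carrier (B_1 i) = F_class i ` carrier (I_1 i)"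
  by (auto simp: B_1_def FactRing_def A_RCOSETS_def' F_class_def)

lemma F_class_add:
  assumes "a \<in> carrier (I_1 i)" "b \<in> carrier (I_1 i)"
  shows "F_class i a \<oplus>\<^bsub>B_1 i\<^esub> F_class i b = F_class i (\<lambda>p. a p + b p)"
proof -
  interpret F: ideal "F_ideal i" "I_1 i" by (rule ideal_F_ideal)
  show ?thesis using F.a_rcos_sum[OF assms] by (simp add: B_1_def FactRing_def F_class_def)
qed

lemma F_class_mult:
  assumes "a \<in> carrier (I_1 i)" "b \<in> carrier (I_1 i)"
  shows "F_class i a \<otimes>\<^bsub>B_1 i\<^esub> F_class i b = F_class i (a \<circ> b)"
proof -
  interpret F: ideal "F_ideal i" "I_1 i" by (rule ideal_F_ideal)
  show ?thesis using F.rcoset_mult_add[OF assms] by (simp add: B_1_def FactRing_def F_class_def)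
qed

lemma F_class_eqD:
  assumes "a \<in> carrier (I_1 i)" "F_class i a = F_class i b"
  shows "\<exists>f\<in>F_ideal i. a = (\<lambda>p. f p + b p)"
proof -
  interpret F: ideal "F_ideal i" "I_1 i" by (rule ideal_F_ideal)
  have "a \<in> F_class i b" using F.a_rcos_self[OF assms(1)] assms(2) by (simp add: F_class_def)
  then show ?thesis by (auto simp: F_class_def a_r_coset_def')
qed

lemma F_class_absorb:
  assumes "f \<in> F_ideal i" "a \<in> carrier (I_1 i)"
  shows "F_class i (\<lambda>p. f p + a p) = F_class i a"
proof -
  interpret F: ideal "F_ideal i" "I_1 i" by (rule ideal_F_ideal)
  have "(\<lambda>p. f p + a p) \<in> F_ideal i +>\<^bsub>I_1 i\<^esub> a" using assms(1) by (auto simp: a_r_coset_def')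
  then show ?thesis unfolding F_class_def using F.a_repr_independence'[OF _ assms(2)] by metis
qed

definition H_left_ideal :: "'n \<Rightarrow> 'k \<Rightarrow> ('k::field_char_0, 'n) endo set set" where
  "H_left_ideal i c = {b \<otimes>\<^bsub>B_1 i\<^esub> F_class i (H_minus i c) | b. b \<in> carrier (B_1 i)}"

lemma in_H_left_ideal_iff:
  "X \<in> H_left_ideal i c \<longleftrightarrow> (\<exists>b\<in>carrier (I_1 i). X = F_class i (b \<circ> H_minus i c))"
proof -
  have "X \<in> H_left_ideal i c \<longleftrightarrow>
      (\<exists>b\<in>carrier (I_1 i). X = F_class i b \<otimes>\<^bsub>B_1 i\<^esub> F_class i (H_minus i c))"
    unfolding H_left_ideal_def carrier_B_1 by blast
  also have "\<dots> \<longleftrightarrow> (\<exists>b\<in>carrier (I_1 i). X = F_class i (b \<circ> H_minus i c))"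
    by (rule bex_cong[OF refl]) (simp only: F_class_mult[OF _ H_minus_I_1])
  finally show ?thesis .
qed

lemma submodule_H_left_ideal: "submodule (H_left_ideal i c) (B_1 i) (regular_module (B_1 i))"
proof -
  interpret B: left_module "B_1 i" "regular_module (B_1 i)"
    by (rule left_module_regular_module[OF ring_B_1])
  note R = ring.ring_simprules[OF ring_B_1]
  have h: "F_class i (H_minus i c) \<in> carrier (B_1 i)" unfolding carrier_B_1 by (rule imageI) simp
  show ?thesis
  proof (rule B.submoduleI)
    show "H_left_ideal i c \<subseteq> carrier (regular_module (B_1 i))"
      using h by (auto simp: H_left_ideal_def)
    have "\<zero>\<^bsub>B_1 i\<^esub> = \<zero>\<^bsub>B_1 i\<^esub> \<otimes>\<^bsub>B_1 i\<^esub> F_class i (H_minus i c)" using h by simp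
    then show "\<zero>\<^bsub>regular_module (B_1 i)\<^esub> \<in> H_left_ideal i c"
      unfolding H_left_ideal_def regular_module_simps by blast
    show "x \<oplus>\<^bsub>regular_module (B_1 i)\<^esub> y \<in> H_left_ideal i c"
      if xy: "x \<in> H_left_ideal i c" "y \<in> H_left_ideal i c" for x y
    proof -
      obtain a b where "a \<in> carrier (B_1 i)" "x = a \<otimes>\<^bsub>B_1 i\<^esub> F_class i (H_minus i c)"
        "b \<in> carrier (B_1 i)" "y = b \<otimes>\<^bsub>B_1 i\<^esub> F_class i (H_minus i c)"
        using xy by (auto simp: H_left_ideal_def)
      then show ?thesis unfolding H_left_ideal_def
        by (intro CollectI exI[of _ "a \<oplus>\<^bsub>B_1 i\<^esub> b"]) (simp add: R(13) h)
    qed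
    show "a \<odot>\<^bsub>regular_module (B_1 i)\<^esub> x \<in> H_left_ideal i c"
      if a: "a \<in> carrier (B_1 i)" and x: "x \<in> H_left_ideal i c" for a x
    proof -
      obtain b where "b \<in> carrier (B_1 i)" "x = b \<otimes>\<^bsub>B_1 i\<^esub> F_class i (H_minus i c)"
        using x by (auto simp: H_left_ideal_def)
      then show ?thesis unfolding H_left_ideal_def
        by (intro CollectI exI[of _ "a \<otimes>\<^bsub>B_1 i\<^esub> b"]) (simp add: R h a)
    qed
  qed
qed

definition M_1_class :: "'n \<Rightarrow> 'k \<Rightarrow> ('k::field_char_0, 'n) endo \<Rightarrow> ('k, 'n) endo set set" where
  "M_1_class i c a = H_left_ideal i c +>\<^bsub>regular_module (B_1 i)\<^esub> F_class i a"

lemma M_1_eq: "M_1 i c = restrict_scalars (F_class i) (quot_module (regular_module (B_1 i)) (H_left_ideal i c))"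
  by (simp add: M_1_def H_left_ideal_def F_class_def[abs_def])

lemma abelian_subgroup_H_left_ideal: "abelian_subgroup (H_left_ideal i c) (regular_module (B_1 i))"
  by (rule left_module.submodule_abelian_subgroup[OF left_module_regular_module[OF ring_B_1] submodule_H_left_ideal])

lemma carrier_M_1: "carrier (M_1 i c) = M_1_class i c ` carrier (I_1 i)"
proof -
  have "carrier (M_1 i c) = (\<lambda>X. H_left_ideal i c +>\<^bsub>regular_module (B_1 i)\<^esub> X) ` carrier (B_1 i)"
    by (auto simp: M_1_eq restrict_scalars_def A_RCOSETS_def')
  then show ?thesis by (simp add: carrier_B_1 image_image M_1_class_def)
qed

lemma F_class_carrier: "a \<in> carrier (I_1 i) \<Longrightarrow> F_class i a \<in> carrier (B_1 i)"
  by (simp add: carrier_B_1)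

lemma M_1_class_add:
  assumes "a \<in> carrier (I_1 i)" "b \<in> carrier (I_1 i)"
  shows "M_1_class i c a \<oplus>\<^bsub>M_1 i c\<^esub> M_1_class i c b = M_1_class i c (\<lambda>p. a p + b p)"
proof -
  interpret N: abelian_subgroup "H_left_ideal i c" "regular_module (B_1 i)"
    by (rule abelian_subgroup_H_left_ideal)
  have "M_1_class i c a \<oplus>\<^bsub>M_1 i c\<^esub> M_1_class i c b
      = H_left_ideal i c +>\<^bsub>regular_module (B_1 i)\<^esub> (F_class i a \<oplus>\<^bsub>B_1 i\<^esub> F_class i b)"
    using N.a_rcos_sum[of "F_class i a" "F_class i b"] assms
    by (simp add: M_1_eq restrict_scalars_def M_1_class_def F_class_carrier)
  then show ?thesis by (simp add: F_class_add[OF assms] M_1_class_def)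
qed

lemma M_1_class_smult:
  assumes "a \<in> carrier (I_1 i)" "b \<in> carrier (I_1 i)"
  shows "a \<odot>\<^bsub>M_1 i c\<^esub> M_1_class i c b = M_1_class i c (a \<circ> b)"
proof -
  interpret B: left_module "B_1 i" "regular_module (B_1 i)"
    by (rule left_module_regular_module[OF ring_B_1])
  have "a \<odot>\<^bsub>M_1 i c\<^esub> M_1_class i c b
      = H_left_ideal i c +>\<^bsub>regular_module (B_1 i)\<^esub> (F_class i a \<otimes>\<^bsub>B_1 i\<^esub> F_class i b)"
    using B.smult_quot_module[OF submodule_H_left_ideal, of "F_class i a" "F_class i b" c] assms
    by (simp add: M_1_eq restrict_scalars_def M_1_class_def F_class_carrier)
  then show ?thesis by (simp add: F_class_mult[OF assms] M_1_class_def)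
qed

text \<open>Unwinds both quotients: equality of classes means that \<open>a - b\<close> lies in
  \<open>F + I_1 (H - c)\<close>.\<close>

lemma M_1_class_eqD:
  assumes "a \<in> carrier (I_1 i)" "b \<in> carrier (I_1 i)" "M_1_class i c a = M_1_class i c b"
  shows "\<exists>f\<in>F_ideal i. \<exists>d\<in>carrier (I_1 i). a = (\<lambda>p. f p + ((d \<circ> H_minus i c) p + b p))"
proof -
  interpret N: abelian_subgroup "H_left_ideal i c" "regular_module (B_1 i)"
    by (rule abelian_subgroup_H_left_ideal)
  have "F_class i a \<in> M_1_class i c b"
    using N.a_rcos_self[of "F_class i a"] assms(1,3) by (simp add: M_1_class_def F_class_carrier)
  then obtain X where X: "X \<in> H_left_ideal i c" "F_class i a = X \<oplus>\<^bsub>B_1 i\<^esub> F_class i b"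
    by (auto simp: M_1_class_def a_r_coset_def')
  then obtain d where d: "d \<in> carrier (I_1 i)" "X = F_class i (d \<circ> H_minus i c)"
    by (auto simp: in_H_left_ideal_iff)
  have "F_class i a = F_class i (\<lambda>p. (d \<circ> H_minus i c) p + b p)"
    unfolding X(2) d(2) by (rule F_class_add[OF I_1_comp[OF d(1) H_minus_I_1] assms(2)])
  from F_class_eqD[OF assms(1) this] d(1) show ?thesis by blast
qed

text \<open>The difference \<open>a - J \<partial> a\<close> is the matrix unit of index
  \<open>(0, 0)\<close> times \<open>a\<close>, hence an element of \<open>F\<close>.\<close>

lemma M_1_class_J_D:
  assumes "a \<in> carrier (I_1 i)"
  shows "M_1_class i c (op_J i \<circ> (op_D i \<circ> a)) = M_1_class i c a"
proof -
  have "(\<lambda>p. pscale 1 (matrix_unit i 0 0 p) + 0) \<in> F_ideal i" by (rule F_ideal_step[OF F_ideal_zero])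
  then have "matrix_unit i 0 0 \<in> F_ideal i" by simp
  then have m: "matrix_unit i 0 0 \<circ> a \<in> F_ideal i" using F_ideal_comp_right[OF assms] by blast
  have "a = (\<lambda>p. (matrix_unit i 0 0 \<circ> a) p + (op_J i \<circ> (op_D i \<circ> a)) p)"
    by (simp add: matrix_unit_def fun_eq_iff)
  then have "F_class i a = F_class i (op_J i \<circ> (op_D i \<circ> a))"
    using F_class_absorb[OF m I_1_comp[OF I_1_op(3) I_1_comp[OF I_1_op(2) assms]]] by simp
  then show ?thesis by (simp add: M_1_class_def)
qed

lemma M_1_class_H: "M_1_class i c (op_H i) = M_1_class i c (pscale c)"
proof -
  interpret N: abelian_subgroup "H_left_ideal i c" "regular_module (B_1 i)"
    by (rule abelian_subgroup_H_left_ideal)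
  have "F_class i (op_H i) = F_class i (H_minus i c) \<oplus>\<^bsub>B_1 i\<^esub> F_class i (pscale c)"
    unfolding F_class_add[OF H_minus_I_1 I_1_pscale] by (simp add: H_minus_def)
  moreover have "F_class i (H_minus i c) \<in> H_left_ideal i c"
    unfolding in_H_left_ideal_iff by (rule bexI[of _ id]) auto
  ultimately have "F_class i (op_H i) \<in> M_1_class i c (pscale c)"
    by (auto simp: M_1_class_def a_r_coset_def')
  moreover have "F_class i (pscale c) \<in> carrier (regular_module (B_1 i))"
    using F_class_carrier[OF I_1_pscale, of i c] by simp
  ultimately show ?thesis unfolding M_1_class_def by (rule N.a_repr_independence'[symmetric])
qed

subsection \<open>Polynomials in one variable\<close>

text \<open>Operators in the variable \<open>x_i\<close> are linear over the polynomials in the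
  other variables; for the generators this is a computation with exponents.\<close>

lemma I_1_mult_other:
  fixes a :: "('k::field_char_0, 'n) endo"
  assumes "a \<in> carrier (I_1 i)" "Poly_Mapping.lookup \<alpha> i = 0"
  shows "a (Poly_Mapping.single \<alpha> 1 * p) = Poly_Mapping.single \<alpha> 1 * a p"
proof -
  let ?m = "\<lambda>p :: ('k, 'n) pol. Poly_Mapping.single \<alpha> 1 * p"
  have m: "?m \<in> carrier End_P"
  proof -
    have "pscale c p = Poly_Mapping.single 0 c * p" for c :: 'k and p :: "('k, 'n) pol"
      by (simp add: pscale_def Poly_Mapping.mult_map_scale_conv_mult)
    then show ?thesis by (auto simp: in_End_P_iff algebra_simps)
  qed
  have "a \<circ> ?m = ?m \<circ> a"
    using assms(1)
  proof (induction rule: I_1_induct)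
    case (pscale c)
    show ?case using m by (auto simp: in_End_P_iff fun_eq_iff)
  next
    case (gen g)
    show ?case
    proof (rule End_P_eqI)
      have gE: "g \<in> carrier End_P" using gen by (auto intro: op_in_End_P)
      show "g \<circ> ?m \<in> carrier End_P" by (rule comp_in_End_P[OF gE m])
      show "?m \<circ> g \<in> carrier End_P" by (rule comp_in_End_P[OF m gE])
      fix \<beta> :: "'n \<Rightarrow>\<^sub>0 nat"
      have "Poly_Mapping.lookup \<beta> i \<noteq> 0 \<Longrightarrow>
          \<alpha> + \<beta> - Poly_Mapping.single i 1 = \<alpha> + (\<beta> - Poly_Mapping.single i 1)"
        by (rule poly_mapping_eqI) (auto simp: lookup_add lookup_minus lookup_single when_def)
      then show "(g \<circ> ?m) (Poly_Mapping.single \<beta> 1) = (?m \<circ> g) (Poly_Mapping.single \<beta> 1)"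
        using gen assms(2)
        by (cases "Poly_Mapping.lookup \<beta> i = 0")
          (auto simp: op_X_single op_D_single op_J_single mult_single lookup_add add.assoc)
    qed
  next
    case (add f g)
    then show ?case by (auto simp: fun_eq_iff algebra_simps)
  next
    case (comp f g)
    then show ?case by (simp add: fun_eq_iff)
  qed
  then show ?thesis by (simp add: fun_eq_iff)
qed

text \<open>The kernel of \<open>a \<mapsto> a 1\<close> consists of multiples of
  \<open>\<partial>\<close>, which presents \<open>K[x_i]\<close> as
  \<open>I_1 / I_1 \<partial>\<close>. An operator killing \<open>1\<close> kills all monomials
  without \<open>x_i\<close>, and on the remaining ones \<open>J \<partial>\<close> is the
  identity.\<close>

lemma I_1_kill_one:
  fixes a :: "('k::field_char_0, 'n) endo"
  assumes "a \<in> carrier (I_1 i)" "a 1 = 0"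
  shows "a = a \<circ> (op_J i \<circ> op_D i)"
proof (rule End_P_eqI)
  have aE: "a \<in> carrier End_P" by (rule subsetD[OF I_1_subset_End_P assms(1)])
  show "a \<in> carrier End_P" by fact
  show "a \<circ> (op_J i \<circ> op_D i) \<in> carrier End_P" by (intro comp_in_End_P aE op_in_End_P)
  fix \<alpha>
  show "a (Poly_Mapping.single \<alpha> 1) = (a \<circ> (op_J i \<circ> op_D i)) (Poly_Mapping.single \<alpha> 1)"
  proof (cases "Poly_Mapping.lookup \<alpha> i = 0")
    case True
    have "a (Poly_Mapping.single \<alpha> 1) = 0"
      using I_1_mult_other[OF assms(1) True, of 1] assms(2) by simp
    then show ?thesis using True by (simp add: op_D_single End_P_zero[OF aE] End_P_zero[OF op_J_in_End_P])
  next
    case False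
    then have "op_J i (op_D i (Poly_Mapping.single \<alpha> 1)) = (Poly_Mapping.single \<alpha> 1 :: ('k, 'n) pol)"
      using exp_diff_add[OF False]
      by (simp add: op_D_single op_J_single lookup_minus of_nat_diff)
    then show ?thesis by simp
  qed
qed

lemma carrier_poly_module:
  "(carrier (poly_module i) :: ('k::field_char_0, 'n) pol set) = (\<lambda>a. a 1) ` carrier (I_1 i)"
proof
  let ?P = "carrier (poly_module i) :: ('k, 'n) pol set"
  have P: "p \<in> ?P \<longleftrightarrow> (\<forall>\<alpha>\<in>Poly_Mapping.keys p. Poly_Mapping.keys \<alpha> \<subseteq> {i})" for p
    by (simp add: poly_module_def)
  have P0: "0 \<in> ?P" and P1: "1 \<in> ?P" by (simp_all add: P)
  have Padd: "p + q \<in> ?P" if "p \<in> ?P" "q \<in> ?P" for p q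
    using that keys_add[of p q] unfolding P by blast
  have Psingle: "Poly_Mapping.single \<alpha> c \<in> ?P" if "Poly_Mapping.keys \<alpha> \<subseteq> {i}" for \<alpha> and c :: 'k
    using that by (simp add: P)
  have gen: "g p \<in> ?P" if g: "g \<in> {op_X i, op_D i, op_J i}" and p: "p \<in> ?P" for g p
    using p
  proof (induction p rule: poly_mapping_add_induct)
    case zero
    have "g \<in> carrier End_P" using g by (auto intro: op_in_End_P)
    then show ?case using P0 by (simp add: End_P_zero)
  next
    case (add \<alpha> c p)
    have gE: "g \<in> carrier End_P" using g by (auto intro: op_in_End_P)
    have k: "Poly_Mapping.keys (Poly_Mapping.single \<alpha> c + p) = insert \<alpha> (Poly_Mapping.keys p)"
      using add.hyps by (auto simp: in_keys_iff lookup_add lookup_single when_def split: if_splits)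
    then have \<alpha>: "Poly_Mapping.keys \<alpha> \<subseteq> {i}" and p: "p \<in> ?P" using add.prems by (auto simp: P)
    have "Poly_Mapping.keys (\<alpha> + Poly_Mapping.single i 1) \<subseteq> {i}"
      using \<alpha> keys_add[of \<alpha> "Poly_Mapping.single i 1"] by auto
    moreover have "Poly_Mapping.keys (\<alpha> - Poly_Mapping.single i 1) \<subseteq> {i}"
    proof
      fix x assume "x \<in> Poly_Mapping.keys (\<alpha> - Poly_Mapping.single i 1)"
      then have "x \<in> Poly_Mapping.keys \<alpha>" unfolding in_keys_iff lookup_minus by linarith
      then show "x \<in> {i}" by (rule subsetD[OF \<alpha>])
    qed
    ultimately have "g (Poly_Mapping.single \<alpha> c) \<in> ?P"
      using g by (auto simp: op_X_single op_D_single op_J_single intro: Psingle)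
    then show ?case using Padd add.IH[OF p] by (simp add: End_P_add[OF gE])
  qed
  show "(\<lambda>a. a 1) ` carrier (I_1 i) \<subseteq> ?P"
  proof (rule image_subsetI)
    fix a :: "('k, 'n) endo" assume "a \<in> carrier (I_1 i)"
    then have "\<forall>p\<in>?P. a p \<in> ?P"
    proof (induction rule: I_1_induct)
      case (pscale c)
      have "pscale c p \<in> ?P" if p: "p \<in> ?P" for p :: "('k, 'n) pol"
      proof -
        have "Poly_Mapping.keys (pscale c p) \<subseteq> Poly_Mapping.keys p" by (auto simp: in_keys_iff)
        then show ?thesis using p unfolding P by (meson subsetD)
      qed
      then show ?case by blast
    next
      case (comp f g)
      then show ?case by simp
    qed (use gen Padd in auto)
    then show "a 1 \<in> ?P" using P1 by blast
  qed
  show "?P \<subseteq> (\<lambda>a. a 1) ` carrier (I_1 i)"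
  proof
    fix p assume "p \<in> ?P"
    then show "p \<in> (\<lambda>a. a 1) ` carrier (I_1 i)"
    proof (induction p rule: poly_mapping_add_induct)
      case zero
      show ?case by (rule image_eqI[OF _ I_1_zero]) simp
    next
      case (add \<alpha> c p)
      have k: "Poly_Mapping.keys (Poly_Mapping.single \<alpha> c + p) = insert \<alpha> (Poly_Mapping.keys p)"
        using add.hyps by (auto simp: in_keys_iff lookup_add lookup_single when_def split: if_splits)
      then have \<alpha>: "Poly_Mapping.keys \<alpha> \<subseteq> {i}" and p: "p \<in> ?P" using add.prems by (auto simp: P)
      obtain b where b: "b \<in> carrier (I_1 i)" "p = b 1" using add.IH[OF p] by auto
      let ?k = "Poly_Mapping.lookup \<alpha> i"
      have "(op_X i ^^ k) 1 = (Poly_Mapping.single (Poly_Mapping.single i k) 1 :: ('k, 'n) pol)" for k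
      proof (induction k)
        case (Suc k)
        then show ?case by (simp add: op_X_single single_add[symmetric])
      qed simp
      moreover have "\<alpha> = Poly_Mapping.single i ?k"
        using \<alpha> by (intro poly_mapping_eqI) (auto simp: lookup_single when_def in_keys_iff)
      ultimately have "Poly_Mapping.single \<alpha> c = (pscale c \<circ> op_X i ^^ ?k) (1 :: ('k, 'n) pol)"
        by (metis comp_apply mult.right_neutral pscale_single)
      then have eq: "Poly_Mapping.single \<alpha> c + p = (pscale c \<circ> op_X i ^^ ?k) 1 + b 1"
        using b(2) by simp
      show ?case unfolding eq
        by (rule imageI[OF I_1_add[OF I_1_comp[OF I_1_pscale I_1_funpow[OF I_1_op(1)]] b(1)]])
    qed
  qed
qed

lemma transport_module_simps:
  assumes "inj f"
  shows "carrier (transport_module f N) = f ` carrier N"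
    and "\<lbrakk>x \<in> carrier N; y \<in> carrier N\<rbrakk> \<Longrightarrow> f x \<oplus>\<^bsub>transport_module f N\<^esub> f y = f (x \<oplus>\<^bsub>N\<^esub> y)"
    and "x \<in> carrier N \<Longrightarrow> a \<odot>\<^bsub>transport_module f N\<^esub> f x = f (a \<odot>\<^bsub>N\<^esub> x)"
  using inj_on_subset[OF assms subset_UNIV] by (auto simp: transport_module_def inv_into_f_f)

subsection \<open>Simple modules of a given type\<close>

text \<open>The given simple module takes the place of \<open>Q\<close> in
  \<open>cyclic_tensor\<close>. An eigenvector is moved along its chain until its weight is the
  chosen representative outside \<open>D\<close>, so that it satisfies the defining relations of all
  factors.\<close>

lemma (in I_module) simple_isomorphic:
  assumes simple: "simple_module I_n M" and ty: "of_type M D" and hf: "H_finite M C"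
    and C: "\<And>i c. \<lbrakk>i \<notin> D; c \<in> C i\<rbrakk> \<Longrightarrow> \<exists>z. rep (orbit_factor Orb i) = c + of_int z"
  shows "module_isomorphic I_n M (M_simple rep Orb D)"
proof -
  have nz: "carrier M \<noteq> {\<zero>}" and sim: "\<And>N. submodule N I_n M \<Longrightarrow> N = {\<zero>} \<or> N = carrier M"
    using simple by (auto simp: simple_module_def)
  have full: "full i" if "i \<notin> D" for i using ty that by (auto simp: full_def of_type_def)
  obtain lam w where w: "base D lam w" "w \<noteq> \<zero>" "\<And>i. i \<notin> D \<Longrightarrow> lam i \<in> C i"
    using exists_base[OF ty hf nz] by metis
  \<comment> \<open>The shift from the eigenvalue found to the representative of its coset; in the
    variables of \<open>D\<close> the eigenvalue is \<open>1\<close> and stays.\<close>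
  have "\<exists>z. if i \<in> D then z = 0 else rep (orbit_factor Orb i) = lam i + of_int z" for i
    using C[OF _ w(3)] by auto
  then obtain \<gamma> where \<gamma>: "\<And>i. if i \<in> D then \<gamma> i = 0 else rep (orbit_factor Orb i) = lam i + of_int (\<gamma> i)"
    by metis
  define v where "v = chain w \<gamma>"
  define mu where "mu i = lam i + of_int (\<gamma> i)" for i
  have wc: "w \<in> carrier M" using w(1) by (simp add: base_def)
  have v: "base D mu v"
    unfolding base_def v_def mu_def
  proof (intro conjI allI ballI)
    show "chain w \<gamma> \<in> carrier M" using wc by simp
    show "op_H i \<odot> chain w \<gamma> = pscale (lam i + of_int (\<gamma> i)) \<odot> chain w \<gamma>" for i
      by (rule chain_H[OF w(1)])
    fix i assume i: "i \<in> D"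
    then have g: "\<gamma> i = 0" using \<gamma>[of i] by simp
    show "op_D i \<odot> chain w \<gamma> = \<zero>" by (rule chain_D_zero[where \<gamma> = \<gamma> and i = i, OF w(1) i g])
    show "lam i + of_int (\<gamma> i) = 1" using w(1) i g by (simp add: base_def)
  qed
  have vc: "v \<in> carrier M" using wc by (simp add: v_def)
  have v_nz: "v \<noteq> \<zero>"
    unfolding v_def
  proof (rule chain_nonzero[OF wc w(2)])
    show "0 \<le> \<gamma> i \<or> full i" for i using \<gamma>[of i] full[of i] by (cases "i \<in> D") auto
  qed
  have mu: "mu i = rep (orbit_factor Orb i)" if "i \<notin> D" for i using \<gamma>[of i] that by (simp add: mu_def)
  \<comment> \<open>The generator of the factor is the polynomial \<open>1\<close> for
    \<open>i \<in> D\<close> and the class of \<open>id\<close> otherwise.\<close>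
  define cl where "cl i a = (if i \<in> D then Inl (a 1) else Inr (M_1_class i (mu i) a))"
    for i and a :: "('k, 'n) endo"
  have injl: "inj (Inl :: _ \<Rightarrow> ('k, 'n) pol + ('k, 'n) endo set set)"
    and injr: "inj (Inr :: _ \<Rightarrow> ('k, 'n) pol + ('k, 'n) endo set set)"
    by simp_all
  have fac: "factor rep Orb D i = (if i \<in> D then transport_module Inl (poly_module i)
      else transport_module Inr (M_1 i (mu i)))" for i
    by (simp add: factor_def mu)
  have pm: "a 1 \<in> carrier (poly_module i)" if "a \<in> carrier (I_1 i)" for a :: "('k, 'n) endo" and i
    using that unfolding carrier_poly_module by blast
  have mm: "M_1_class i (mu i) a \<in> carrier (M_1 i (mu i))" if "a \<in> carrier (I_1 i)" for a i
    using that unfolding carrier_M_1 by blast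
  interpret ct: cyclic_tensor M "factor rep Orb D" cl D mu v
  proof
    fix i
    show "carrier (factor rep Orb D i) = cl i ` carrier (I_1 i)"
      by (auto simp: fac cl_def transport_module_simps[OF injl] transport_module_simps[OF injr]
          carrier_poly_module carrier_M_1 image_image)
    {
      fix a b :: "('k, 'n) endo" assume a: "a \<in> carrier (I_1 i)" and b: "b \<in> carrier (I_1 i)"
      show "cl i a \<oplus>\<^bsub>factor rep Orb D i\<^esub> cl i b = cl i (\<lambda>p. a p + b p)"
        using transport_module_simps(2)[OF injl pm[OF a] pm[OF b]]
          transport_module_simps(2)[OF injr mm[OF a] mm[OF b]] M_1_class_add[OF a b, of "mu i"]
        by (simp add: fac cl_def poly_module_def)
      show "a \<odot>\<^bsub>factor rep Orb D i\<^esub> cl i b = cl i (a \<circ> b)"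
        using transport_module_simps(3)[OF injl pm[OF b], of a]
          transport_module_simps(3)[OF injr mm[OF b], of a] M_1_class_smult[OF a b, of "mu i"]
        by (simp add: fac cl_def poly_module_def)
      assume eq: "cl i a = cl i b"
      note an = I_1_subset_I_n[OF a] and bn = I_1_subset_I_n[OF b]
      show "a \<odot> v = b \<odot> v"
      proof (cases "i \<in> D")
        case True
        \<comment> \<open>The difference kills \<open>1\<close>, so it factors through
          \<open>\<partial>\<close>, and \<open>\<partial> v = 0\<close>.\<close>
        let ?d = "\<lambda>p. a p - b p"
        have d: "?d \<in> carrier (I_1 i)" by (rule I_1_diff[OF a b])
        have "?d 1 = 0" using eq True by (simp add: cl_def)
        then have "?d = ?d \<circ> (op_J i \<circ> op_D i)" by (rule I_1_kill_one[OF d])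
        then have "?d \<odot> v = (?d \<circ> (op_J i \<circ> op_D i)) \<odot> v" by (rule arg_cong)
        also have "\<dots> = ?d \<odot> ((op_J i \<circ> op_D i) \<odot> v)"
          by (rule act_comp[OF I_1_subset_I_n[OF d] I_n_comp[OF I_n_op(3) I_n_op(2)] vc])
        also have "(op_J i \<circ> op_D i) \<odot> v = op_J i \<odot> (op_D i \<odot> v)"
          by (rule act_comp[OF I_n_op(3) I_n_op(2) vc])
        also have "op_D i \<odot> v = \<zero>" using v True by (simp add: base_def)
        finally have dv: "?d \<odot> v = \<zero>" using I_1_subset_I_n[OF d] by simp
        have "a = (\<lambda>p. ?d p + b p)" by simp
        then have "a \<odot> v = (\<lambda>p. ?d p + b p) \<odot> v" by (rule arg_cong)
        also have "\<dots> = ?d \<odot> v \<oplus> b \<odot> v"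
          by (rule act_add[OF I_1_subset_I_n[OF d] bn vc])
        finally show ?thesis using dv bn vc by simp
      next
        case False
        then have "M_1_class i (mu i) a = M_1_class i (mu i) b" using eq by (simp add: cl_def)
        \<comment> \<open>The difference lies in \<open>F + I_1 (H - mu i)\<close>. Both summands
          kill \<open>v\<close>: the first because \<open>J \<partial> = 1\<close> on
          \<open>M\<close>, the second because of its weight.\<close>
        then obtain f d where f: "f \<in> F_ideal i" and d: "d \<in> carrier (I_1 i)"
          and a_eq: "a = (\<lambda>p. f p + ((d \<circ> H_minus i (mu i)) p + b p))"
          using M_1_class_eqD[OF a b] by blast
        have fn: "f \<in> carrier I_n" and dn: "d \<in> carrier I_n"
          using I_1_subset_I_n[OF F_ideal_I_1[OF f]] I_1_subset_I_n[OF d] .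
        have hn: "d \<circ> H_minus i (mu i) \<in> carrier I_n" by (rule I_n_comp[OF dn H_minus_I_n])
        have "a \<odot> v = f \<odot> v \<oplus> ((d \<circ> H_minus i (mu i)) \<odot> v \<oplus> b \<odot> v)"
          unfolding a_eq act_add[OF fn I_n_add[OF hn bn] vc] act_add[OF hn bn vc] ..
        also have "f \<odot> v = \<zero>" by (rule F_ideal_act[OF full[OF False] f vc])
        also have "(d \<circ> H_minus i (mu i)) \<odot> v = d \<odot> (H_minus i (mu i) \<odot> v)"
          by (rule act_comp[OF dn H_minus_I_n vc])
        also have "H_minus i (mu i) \<odot> v = \<zero>"
          using v vc by (simp add: H_minus_eq_0_iff base_def)
        finally show ?thesis using dn bn vc by simp
      qed
    }
    show "cl i (op_D i) = cl i (\<lambda>p. 0)" if "i \<in> D"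
      using that op_D_single[of i 0 "1 :: 'k"] by (simp add: cl_def)
    show "cl i (op_J i \<circ> (op_D i \<circ> a)) = cl i a" if "i \<notin> D" "a \<in> carrier (I_1 i)" for a
      using that M_1_class_J_D[OF that(2), of "mu i"] by (simp add: cl_def)
    show "cl i (op_H i) = cl i (pscale (mu i))" if "i \<notin> D"
      using that M_1_class_H[of i "mu i"] by (simp add: cl_def)
    show "full i" if "i \<notin> D" using full[OF that] .
  next
    show "N = {\<zero>} \<or> N = carrier M" if "submodule N I_n M" for N by (rule sim[OF that])
  qed (rule v v_nz)+
  show ?thesis unfolding M_simple_def by (rule ct.tensor_isomorphic)
qed

section \<open>Orbits, and the types that can occur in a given support\<close>

lemma orbit_factor_orbit:
  "orbit_factor (Z_orbit lam) i = {lam i + of_int z | z. True}"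
proof
  show "orbit_factor (Z_orbit lam) i \<subseteq> {lam i + of_int z | z. True}"
    by (auto simp: orbit_factor_def Z_orbit_def)
  show "{lam i + of_int z | z. True} \<subseteq> orbit_factor (Z_orbit lam) i"
  proof
    fix c assume "c \<in> {lam i + of_int z | z. True}"
    then obtain z where z: "c = lam i + of_int z" by blast
    \<comment> \<open>Any point of the orbit with this \<open>i\<close>-th coordinate will do; all
      coordinates are shifted by \<open>z\<close>.\<close>
    have "(\<lambda>j. lam j + of_int z) \<in> Z_orbit lam" by (auto simp: Z_orbit_def)
    then show "c \<in> orbit_factor (Z_orbit lam) i" unfolding orbit_factor_def z by (rule rev_image_eqI) simp
  qed
qed

lemma weight_component_sub_module:
  "N \<subseteq> carrier M \<Longrightarrow> weight_component (sub_module M N) lam = weight_component M lam \<inter> N"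
  by (auto simp: weight_component_def)

context H_module
begin

lemma one_in_C:
  assumes "part D \<noteq> {\<zero>}" "i \<in> D"
  shows "1 \<in> C i"
proof -
  interpret S: I_module "sub_module M (part D)" by (rule I_module_sub_module[OF submodule_part])
  have hf: "H_finite (sub_module M (part D)) C" by (rule H_finite_sub_module[OF H_finite submodule_part])
  obtain lam v where v: "S.base D lam v" "v \<noteq> \<zero>\<^bsub>sub_module M (part D)\<^esub>"
    by (rule S.exists_base[OF of_type_part hf]) (use assms(1) in simp)
  then have vc: "v \<in> carrier (sub_module M (part D))" and "lam i = 1"
    and "op_H i \<odot>\<^bsub>sub_module M (part D)\<^esub> v = pscale (lam i) \<odot>\<^bsub>sub_module M (part D)\<^esub> v"
    using assms(2) by (auto simp: S.base_def)
  then have H: "op_H i \<odot> v = pscale 1 \<odot> v" and vM: "v \<in> carrier M"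
    using part_closed by auto
  have Hc: "H_minus i c \<odot> v = pscale (1 - c) \<odot> v" for c
  proof -
    let ?p = "pscale (1 - c) \<odot> v" and ?q = "pscale c \<odot> v"
    have e: "v = ?p \<oplus> ?q" using act_pscale_add[OF vM, of "1 - c" c] vM by simp
    have "H_minus i c \<odot> v = v \<ominus> ?q" using H vM by (simp add: H_minus_act)
    also have "\<dots> = (?p \<oplus> ?q) \<ominus> ?q" by (rule arg_cong[OF e, of "\<lambda>x. x \<ominus> ?q"])
    also have "\<dots> = ?p" using vM by (simp add: M.minus_eq M.a_assoc M.r_neg)
    finally show ?thesis .
  qed
  obtain cs where cs: "set cs \<subseteq> C i" "H_prod i cs v = \<zero>" by (rule H_finiteE[OF H_finite vM])
  have "H_prod i cs v = pscale (prod_list (map (\<lambda>c. 1 - c) cs)) \<odot> v"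
  proof (induction cs)
    case Nil
    then show ?case using vM by simp
  next
    case (Cons c cs)
    let ?p = "prod_list (map (\<lambda>c. 1 - c) cs)"
    have "H_prod i (c # cs) v = pscale ?p \<odot> (H_minus i c \<odot> v)"
      unfolding H_prod_simps Cons by (rule act_pscale_commute[OF H_minus_I_n vM])
    also have "\<dots> = pscale (?p * (1 - c)) \<odot> v"
      unfolding Hc by (rule act_pscale_mult[OF vM, symmetric])
    finally show ?case by (simp add: mult.commute)
  qed
  then have "prod_list (map (\<lambda>c. 1 - c) cs) = 0"
    using cs(2) v(2) act_pscale_eq_0_iff[OF vM, of "prod_list (map (\<lambda>c. 1 - c) cs)"] by simp
  then have "1 \<in> set cs" by (auto simp: prod_list_zero_iff)
  then show ?thesis using cs(1) by auto
qed

end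

text \<open>The family \<open>MD\<close> is \<open>part\<close>. Zero members stay in the indexed
  direct sum, while the absolutely prime decomposition consists of the nonzero ones.\<close>

theorem corollary3p4:
  fixes rep :: "'k::field_char_0 set \<Rightarrow> 'k"
  assumes "\<forall>C\<in>Z_cosets. rep C \<in> C" and "rep \<int> = 0"
  shows
    "(\<forall>Orb \<in> (Z_orbits :: ('n::finite \<Rightarrow> 'k) set set). \<forall>M :: (('k, 'n) endo, 'm) module.
        GW Orb M \<longrightarrow>
        (\<exists>!S. abs_prime_decomposition M S) \<and>
        (\<exists>MD. (\<forall>D\<in>Pow (D_set Orb). submodule (MD D) I_n M \<and> GW_D rep Orb D (sub_module M (MD D))) \<and>
              internal_direct_sum M (Pow (D_set Orb)) MD \<and>
              abs_prime_decomposition M {MD D | D. D \<in> Pow (D_set Orb) \<and> MD D \<noteq> {\<zero>\<^bsub>M\<^esub>}}))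
     \<and> (\<forall>M :: (('k, 'n) endo, 'm) module.
        generalized_weight M \<longrightarrow> (\<exists>!S. abs_prime_decomposition M S))"
proof (intro conjI ballI allI impI)
  fix M :: "(('k, 'n) endo, 'm) module"
  assume gw: "generalized_weight M"
  then interpret I_module M by (simp add: I_module_def generalized_weight_def)
  interpret H_module M "\<lambda>_. UNIV"
    by unfold_locales (rule generalized_weight_H_finite[OF gw], simp)
  show "\<exists>!S. abs_prime_decomposition M S" by (rule ex1_abs_prime_decomposition[OF gw])
next
  fix Orb :: "('n \<Rightarrow> 'k) set" and M :: "(('k, 'n) endo, 'm) module"
  assume Orb: "Orb \<in> Z_orbits" and GW: "GW Orb M"
  from GW have gw: "generalized_weight M" and supp: "Supp M \<subseteq> Orb" by (auto simp: GW_def)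
  interpret I_module M using gw by (simp add: I_module_def generalized_weight_def)
  \<comment> \<open>All weights lie in the orbit, so the eigenvalues of \<open>H_i\<close> are
    confined to its \<open>i\<close>-th factor.\<close>
  define C where "C = orbit_factor Orb"
  interpret H_module M C
    by unfold_locales
      (rule generalized_weight_H_finite[OF gw], use supp in \<open>auto simp: C_def orbit_factor_def\<close>)
  show "\<exists>!S. abs_prime_decomposition M S" by (rule ex1_abs_prime_decomposition[OF gw])
  obtain lam where lam: "Orb = Z_orbit lam" using Orb by (auto simp: Z_orbits_def)
  have C: "C i = {lam i + of_int z | z. True}" for i by (simp add: C_def lam orbit_factor_orbit)
  \<comment> \<open>A coset of \<open>\<int>\<close> that contains \<open>1\<close> is
    \<open>\<int>\<close> itself. With \<open>one_in_C\<close> this confines the types of nonzero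
    parts to subsets of \<open>D_set Orb\<close>.\<close>
  have D_set: "i \<in> D_set Orb" if "1 \<in> C i" for i
  proof -
    have "1 \<in> {lam i + of_int z | z. True}" using that unfolding C .
    then obtain z where z: "1 = lam i + of_int z" by blast
    then have "lam i = of_int (1 - z)" by (simp add: algebra_simps)
    then have "C i = {of_int (1 - z) + of_int w | w. True}" by (simp add: C)
    also have "\<dots> = \<int>"
    proof
      show "{of_int (1 - z) + of_int w | w. True} \<subseteq> (\<int> :: 'k set)"
        by (auto simp only: of_int_add[symmetric] Ints_of_int)
      show "(\<int> :: 'k set) \<subseteq> {of_int (1 - z) + of_int w | w. True}"
      proof
        fix x :: 'k assume "x \<in> \<int>"
        then obtain y where "x = of_int y" by (rule Ints_cases)
        then have "x = of_int (1 - z) + of_int (y - (1 - z))" by simp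
        then show "x \<in> {of_int (1 - z) + of_int w | w. True}" by blast
      qed
    qed
    finally show ?thesis by (simp add: D_set_def C_def)
  qed
  have trivial: "part D = {\<zero>\<^bsub>M\<^esub>}" if "D \<notin> Pow (D_set Orb)" for D
  proof (rule ccontr)
    assume "part D \<noteq> {\<zero>\<^bsub>M\<^esub>}"
    then have "D \<subseteq> D_set Orb" using one_in_C D_set by blast
    then show False using that by simp
  qed
  have GW_part: "GW Orb (sub_module M (part D))" for D
    unfolding GW_def
  proof
    show "generalized_weight (sub_module M (part D))" by (rule generalized_weight_part[OF gw])
    have "weight_component (sub_module M (part D)) mu = {\<zero>\<^bsub>M\<^esub>}" if "mu \<notin> Supp M" for mu
      using that submodule_zero[OF submodule_part, of D]
      by (simp add: weight_component_sub_module[OF part_closed] Supp_def)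
    then show "Supp (sub_module M (part D)) \<subseteq> Orb" using supp by (auto simp: Supp_def)
  qed
  have GW_D_part: "GW_D rep Orb D (sub_module M (part D))" for D
    unfolding GW_D_def
  proof (intro conjI allI impI)
    show "GW Orb (sub_module M (part D))" by (rule GW_part)
    let ?S = "sub_module M (part D)"
    fix M1 M2
    assume M1: "submodule M1 I_n ?S" and M2: "submodule M2 I_n ?S" and sub: "M1 \<subseteq> M2"
      and simple: "simple_module I_n (quot_module (sub_module ?S M2) M1)"
    interpret S: I_module ?S by (rule I_module_sub_module[OF submodule_part])
    interpret S2: I_module "sub_module ?S M2" by (rule S.I_module_sub_module[OF M2])
    have M12: "submodule M1 I_n (sub_module ?S M2)"
      unfolding S.submodule_sub_module_iff[OF M2] using M1 sub by simp
    interpret Q: I_module "quot_module (sub_module ?S M2) M1" by (rule S2.I_module_quot_module[OF M12])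
    show "module_isomorphic I_n (quot_module (sub_module ?S M2) M1) (M_simple rep Orb D)"
    proof (rule Q.simple_isomorphic[OF simple])
      show "of_type (quot_module (sub_module ?S M2) M1) D"
        by (rule S2.of_type_quot_module[OF S.of_type_sub_module[OF of_type_part M2] M12])
      show "H_finite (quot_module (sub_module ?S M2) M1) C"
        by (rule S2.H_finite_quot_module[OF S.H_finite_sub_module[OF
          H_finite_sub_module[OF H_finite submodule_part] M2] M12])
      fix i c assume "c \<in> C i"
      then obtain z where z: "c = lam i + of_int z" by (auto simp: C)
      have "C i \<in> Z_cosets" by (auto simp: C Z_cosets_def)
      then have "rep (C i) \<in> C i" using assms(1) by blast
      then obtain w where "rep (C i) = lam i + of_int w" by (auto simp: C)
      then have "rep (orbit_factor Orb i) = c + of_int (w - z)" by (simp add: C_def z)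
      then show "\<exists>z. rep (orbit_factor Orb i) = c + of_int z" by blast
    qed
  qed
  \<comment> \<open>The restriction to subsets of \<open>D_set Orb\<close> loses nothing, because
    all other parts are zero.\<close>
  have "{part D | D. D \<in> Pow (D_set Orb) \<and> part D \<noteq> {\<zero>\<^bsub>M\<^esub>}} = parts"
    unfolding parts_def using trivial by blast
  then have dec: "abs_prime_decomposition M {part D | D. D \<in> Pow (D_set Orb) \<and> part D \<noteq> {\<zero>\<^bsub>M\<^esub>}}"
    using abs_prime_decomposition_parts[OF gw] by (simp only:)
  have sum: "internal_direct_sum M (Pow (D_set Orb)) part" by (rule direct_sum_parts) (rule trivial)
  show "\<exists>MD. (\<forall>D\<in>Pow (D_set Orb). submodule (MD D) I_n M \<and> GW_D rep Orb D (sub_module M (MD D))) \<and>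
      internal_direct_sum M (Pow (D_set Orb)) MD \<and>
      abs_prime_decomposition M {MD D | D. D \<in> Pow (D_set Orb) \<and> MD D \<noteq> {\<zero>\<^bsub>M\<^esub>}}"
    by (intro exI[of _ part] conjI ballI submodule_part GW_D_part sum dec)
qed

end
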